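(* Let $K$ be a global field of characteristic different from $2$ (that is, a finite extension of $\mathbb{Q}$ or of $\mathbb{F}_p(T)$ with $p \neq 2$). Then there exists a smooth plane quartic $C \subset \mathbb{P}^2$ over $K$ such that - $C$ has a bitangent over $K_v$ for every place $v$ of $K$ (including the infinite places when $K$ is a number field), but - $C$ does not have a bitangent over $K$.
   Context: A smooth plane quartic over a field $k$ is a smooth curve $C = \{[X:Y:Z] \in \mathbb{P}^2 \mid f(X,Y,Z) = 0\}$ where $f$ is a homogeneous polynomial of degree $4$ with coefficients in $k$. Let $k$ have characteristic different from $2$. A line $L \subset \mathbb{P}^2$ is a bitangent of $C$ if (over an algebraic closure of $k$) either $L$ is tangent to $C$ at two distinct points, or $L$ meets $C$ at a single point with multiplicity $4$. Over an algebraic closure there are exactly $28$ bitangents. For a field $k' \supseteq k$, "$C$ has a bitangent over $k'$" means that there is a line defined over $k'$ (i.e. given by a linear form with coefficients in $k'$) which is a bitangent of $C$. $K_v$ denotes the completion of $K$ at the place $v$. *)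

theory Defs
  imports "HOL-Algebra.Algebraic_Closure_Type" "HOL-Number_Theory.Residues"
begin

section \<open>Global fields\<close>

text \<open>A finite extension of a field \<open>F\<close> is a field \<open>K\<close> with a homomorphism \<open>F \<rightarrow> K\<close> over whose image
  \<open>K\<close> is finite-dimensional. There is no HOL-Algebra ring of rational functions, so an
  embedding of \<open>F\<^sub>p(T)\<close> is given by an injective homomorphism \<open>h\<close> from the polynomial ring \<open>F\<^sub>p[T]\<close>;
  its image is then the set of quotients \<open>h a / h b\<close>.\<close>

definition number_field :: "('a, 'm) ring_scheme \<Rightarrow> bool" where
  "number_field K \<longleftrightarrow> field K \<and>
     (\<exists>h \<in> ring_hom (ring_of_type_algebra :: rat ring) K.
        ring.finite_dimension K (range h) (carrier K))"

definition global_function_field :: "nat \<Rightarrow> ('a, 'm) ring_scheme \<Rightarrow> bool" where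
  "global_function_field p K \<longleftrightarrow> field K \<and>
     (\<exists>h \<in> ring_hom (poly_ring (residue_ring (int p))) K.
        inj_on h (carrier (poly_ring (residue_ring (int p)))) \<and>
        ring.finite_dimension K
          {h a \<otimes>\<^bsub>K\<^esub> inv\<^bsub>K\<^esub> (h b) | a b.
             a \<in> carrier (poly_ring (residue_ring (int p))) \<and>
             b \<in> carrier (poly_ring (residue_ring (int p))) - {\<zero>\<^bsub>poly_ring (residue_ring (int p))\<^esub>}}
          (carrier K))"

definition global_field :: "('a, 'm) ring_scheme \<Rightarrow> bool" where
  "global_field K \<longleftrightarrow> number_field K \<or> (\<exists>p. Factorial_Ring.prime p \<and> global_function_field p K)"


section \<open>Places and completions\<close>

text \<open>Absolute values are functions on the whole type; only their values on the carrier matter.\<close>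

definition nontrivial_abs :: "('a, 'm) ring_scheme \<Rightarrow> ('a \<Rightarrow> real) \<Rightarrow> bool" where
  "nontrivial_abs K a \<longleftrightarrow>
     (\<forall>x\<in>carrier K. a x \<ge> 0 \<and> (a x = 0 \<longleftrightarrow> x = \<zero>\<^bsub>K\<^esub>)) \<and>
     (\<forall>x\<in>carrier K. \<forall>y\<in>carrier K. a (x \<otimes>\<^bsub>K\<^esub> y) = a x * a y) \<and>
     (\<forall>x\<in>carrier K. \<forall>y\<in>carrier K. a (x \<oplus>\<^bsub>K\<^esub> y) \<le> a x + a y) \<and>
     (\<exists>x\<in>carrier K - {\<zero>\<^bsub>K\<^esub>}. a x \<noteq> 1)"

definition abs_equiv :: "('a, 'm) ring_scheme \<Rightarrow> (('a \<Rightarrow> real) \<times> ('a \<Rightarrow> real)) set" where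
  "abs_equiv K = {(a, b). nontrivial_abs K a \<and> nontrivial_abs K b \<and>
     (\<exists>s>0. \<forall>x\<in>carrier K. b x = a x powr s)}"

definition places :: "('a, 'm) ring_scheme \<Rightarrow> ('a \<Rightarrow> real) set set" where
  "places K = {a. nontrivial_abs K a} // abs_equiv K"

text \<open>The completion at a place is the ring of Cauchy sequences modulo the null sequences. Both
  notions are the same for all absolute values in the place.\<close>

definition cauchy_ring :: "('a, 'm) ring_scheme \<Rightarrow> ('a \<Rightarrow> real) set \<Rightarrow> (nat \<Rightarrow> 'a) ring" where
  "cauchy_ring K v =
     \<lparr> carrier = {s. range s \<subseteq> carrier K \<and>
         (\<forall>a\<in>v. \<forall>e>0. \<exists>N. \<forall>m\<ge>N. \<forall>n\<ge>N. a (s m \<ominus>\<^bsub>K\<^esub> s n) < e)},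
       monoid.mult = (\<lambda>s t n. s n \<otimes>\<^bsub>K\<^esub> t n), one = (\<lambda>_. \<one>\<^bsub>K\<^esub>),
       zero = (\<lambda>_. \<zero>\<^bsub>K\<^esub>), add = (\<lambda>s t n. s n \<oplus>\<^bsub>K\<^esub> t n) \<rparr>"

definition null_sequences :: "('a, 'm) ring_scheme \<Rightarrow> ('a \<Rightarrow> real) set \<Rightarrow> (nat \<Rightarrow> 'a) set" where
  "null_sequences K v = {s. range s \<subseteq> carrier K \<and> (\<forall>a\<in>v. (\<lambda>n. a (s n)) \<longlonglongrightarrow> 0)}"

definition completion :: "('a, 'm) ring_scheme \<Rightarrow> ('a \<Rightarrow> real) set \<Rightarrow> (nat \<Rightarrow> 'a) set ring" where
  "completion K v = cauchy_ring K v Quot null_sequences K v"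

definition to_completion ::
    "('a, 'm) ring_scheme \<Rightarrow> ('a \<Rightarrow> real) set \<Rightarrow> 'a \<Rightarrow> (nat \<Rightarrow> 'a) set" where
  "to_completion K v x = null_sequences K v +>\<^bsub>cauchy_ring K v\<^esub> (\<lambda>_. x)"


section \<open>Plane quartics and bitangents\<close>

text \<open>Ternary forms are indexed polynomials in the variables with index \<open>0\<close>, \<open>1\<close>, \<open>2\<close>: functions
  from monomials (multisets of indices) to coefficients. If \<open>h : R \<rightarrow> S\<close> is a homomorphism, then
  \<open>h \<circ> f\<close> is the form \<open>f\<close> with its coefficients taken in \<open>S\<close>.\<close>

definition quartic_form :: "('a, 'm) ring_scheme \<Rightarrow> (nat multiset \<Rightarrow> 'a) \<Rightarrow> bool" where
  "quartic_form R f \<longleftrightarrow> f \<in> ring.indexed_pset R {..<3} (carrier R) \<and>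
     (\<forall>m. f m \<noteq> \<zero>\<^bsub>R\<^esub> \<longrightarrow> size m = 4)"

definition eval_form :: "('a, 'm) ring_scheme \<Rightarrow> (nat multiset \<Rightarrow> 'a) \<Rightarrow> (nat \<Rightarrow> 'a) \<Rightarrow> 'a" where
  "eval_form R f x =
     (\<Oplus>\<^bsub>R\<^esub> m \<in> {m. f m \<noteq> \<zero>\<^bsub>R\<^esub>}. f m \<otimes>\<^bsub>R\<^esub> (\<Otimes>\<^bsub>R\<^esub> i \<in> {..<3}. x i [^]\<^bsub>R\<^esub> count m i))"

definition partial_deriv ::
    "('a, 'm) ring_scheme \<Rightarrow> nat \<Rightarrow> (nat multiset \<Rightarrow> 'a) \<Rightarrow> nat multiset \<Rightarrow> 'a" where
  "partial_deriv R i f = (\<lambda>m. [Suc (count m i)] \<cdot>\<^bsub>R\<^esub> f (add_mset i m))"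

text \<open>Homogeneous coordinates, up to \<open>proportional\<close>, both for points of the projective plane and
  for lines (the line \<open>l\<close> being given by \<open>l 0 * X + l 1 * Y + l 2 * Z = 0\<close>).\<close>

definition hom_coords :: "('a, 'm) ring_scheme \<Rightarrow> (nat \<Rightarrow> 'a) set" where
  "hom_coords R = {x. (\<forall>i<3. x i \<in> carrier R) \<and> (\<exists>i<3. x i \<noteq> \<zero>\<^bsub>R\<^esub>)}"

definition proportional :: "('a, 'm) ring_scheme \<Rightarrow> (nat \<Rightarrow> 'a) \<Rightarrow> (nat \<Rightarrow> 'a) \<Rightarrow> bool" where
  "proportional R x y \<longleftrightarrow> (\<exists>c \<in> carrier R - {\<zero>\<^bsub>R\<^esub>}. \<forall>i<3. y i = c \<otimes>\<^bsub>R\<^esub> x i)"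

definition on_line :: "('a, 'm) ring_scheme \<Rightarrow> (nat \<Rightarrow> 'a) \<Rightarrow> (nat \<Rightarrow> 'a) \<Rightarrow> bool" where
  "on_line R l P \<longleftrightarrow> (\<Oplus>\<^bsub>R\<^esub> i \<in> {..<3}. l i \<otimes>\<^bsub>R\<^esub> P i) = \<zero>\<^bsub>R\<^esub>"

definition on_curve :: "('a, 'm) ring_scheme \<Rightarrow> (nat multiset \<Rightarrow> 'a) \<Rightarrow> (nat \<Rightarrow> 'a) \<Rightarrow> bool" where
  "on_curve R f P \<longleftrightarrow> eval_form R f P = \<zero>\<^bsub>R\<^esub>"

text \<open>Smoothness is the Jacobian criterion at all points over an algebraic closure, into which
  \<open>indexed_const\<close> is the embedding.\<close>

definition smooth_plane_quartic :: "('a, 'm) ring_scheme \<Rightarrow> (nat multiset \<Rightarrow> 'a) \<Rightarrow> bool" where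
  "smooth_plane_quartic R f \<longleftrightarrow> quartic_form R f \<and>
     (let F = field.alg_closure R; g = ring.indexed_const R \<circ> f in
      \<forall>P \<in> hom_coords F. on_curve F g P \<longrightarrow>
        (\<exists>i<3. eval_form F (partial_deriv F i g) P \<noteq> \<zero>\<^bsub>F\<^esub>))"

text \<open>The tangent line at \<open>P\<close> has the gradient at \<open>P\<close> as its coordinates.\<close>

definition tangent_at ::
    "('a, 'm) ring_scheme \<Rightarrow> (nat multiset \<Rightarrow> 'a) \<Rightarrow> (nat \<Rightarrow> 'a) \<Rightarrow> (nat \<Rightarrow> 'a) \<Rightarrow> bool" where
  "tangent_at F f l P \<longleftrightarrow> on_curve F f P \<and>
     proportional F (\<lambda>i. eval_form F (partial_deriv F i f) P) l"

text \<open>The polynomial \<open>f(P + X Q)\<close> in one variable \<open>X\<close>.\<close>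

definition restrict_form :: "('a, 'm) ring_scheme \<Rightarrow> (nat multiset \<Rightarrow> 'a) \<Rightarrow>
    (nat \<Rightarrow> 'a) \<Rightarrow> (nat \<Rightarrow> 'a) \<Rightarrow> 'a list" where
  "restrict_form F f P Q = eval_form (poly_ring F) (ring.poly_of_const F \<circ> f)
     (\<lambda>i. ring.poly_of_const F (P i) \<oplus>\<^bsub>poly_ring F\<^esub>
          X\<^bsub>F\<^esub> \<otimes>\<^bsub>poly_ring F\<^esub> ring.poly_of_const F (Q i))"

text \<open>A line \<open>l\<close> not contained in the curve meets it at a point \<open>P\<close> with multiplicity the order of
  vanishing at \<open>P\<close> of the restriction of \<open>f\<close> to \<open>l\<close>. With \<open>P + X Q\<close> as local parametrization, this
  does not depend on the choice of the second point \<open>Q\<close> of \<open>l\<close>.\<close>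

definition meets_with_mult :: "('a, 'm) ring_scheme \<Rightarrow> (nat multiset \<Rightarrow> 'a) \<Rightarrow>
    (nat \<Rightarrow> 'a) \<Rightarrow> (nat \<Rightarrow> 'a) \<Rightarrow> nat \<Rightarrow> bool" where
  "meets_with_mult F f l P n \<longleftrightarrow> on_line F l P \<and>
     (\<exists>Q \<in> hom_coords F. on_line F l Q \<and> \<not> proportional F P Q \<and>
        restrict_form F f P Q \<noteq> \<zero>\<^bsub>poly_ring F\<^esub> \<and>
        ring.alg_mult F (restrict_form F f P Q) \<zero>\<^bsub>F\<^esub> = n)"

text \<open>For \<open>F\<close> algebraically closed:\<close>

definition bitangent :: "('a, 'm) ring_scheme \<Rightarrow> (nat multiset \<Rightarrow> 'a) \<Rightarrow> (nat \<Rightarrow> 'a) \<Rightarrow> bool" where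
  "bitangent F f l \<longleftrightarrow>
     (\<exists>P \<in> hom_coords F. \<exists>Q \<in> hom_coords F.
        \<not> proportional F P Q \<and> tangent_at F f l P \<and> tangent_at F f l Q) \<or>
     (\<exists>P \<in> hom_coords F. on_line F l P \<and> on_curve F f P \<and>
        (\<forall>Q \<in> hom_coords F. on_line F l Q \<and> on_curve F f Q \<longrightarrow> proportional F P Q) \<and>
        meets_with_mult F f l P 4)"

definition has_bitangent :: "('a, 'm) ring_scheme \<Rightarrow> (nat multiset \<Rightarrow> 'a) \<Rightarrow> bool" where
  "has_bitangent R f \<longleftrightarrow> (\<exists>l \<in> hom_coords R.
     bitangent (field.alg_closure R) (ring.indexed_const R \<circ> f) (ring.indexed_const R \<circ> l))"

end

theory Submission imports Defs "HOL-Decision_Procs.Commutative_Ring"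
begin

text \<open>The curve is the diagonal quartic \<open>X^4 = b^2 Y^4 + c^2 Z^4\<close> with \<open>b = 1 + 16 t^2\<close>, \<open>c = 2 t\<close>, where
  \<open>t\<close> is an element of the base ring \<open>\<int>\<close> or \<open>F\<^sub>p[T]\<close> of \<open>K\<close>.

  The bitangents of a diagonal quartic \<open>c\<^sub>0 X^4 + c\<^sub>1 Y^4 + c\<^sub>2 Z^4\<close> are known: twelve lines through the
  vertices of the coordinate triangle, which meet the curve in one point only, and sixteen lines
  with all coordinates nonzero. One of the twelve is rational if and only if some \<open>- c\<^sub>j / c\<^sub>i\<close> is a
  fourth power, one of the sixteen if and only if \<open>c\<^sub>i / c\<^sub>k\<close> and \<open>c\<^sub>j / c\<^sub>k\<close> are fourth powers
  (\<open>has_bitangent_diag_hyperflex\<close>, \<open>has_bitangent_diag_two_contacts\<close>, \<open>has_bitangent_diagD\<close>). For the curve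
  above, and \<open>i\<close> a square root of \<open>-1\<close>, the factorizations \<open>x^4 - u^2 = (x^2 - u) (x^2 + u)\<close> and
  \<open>(1 + i)^2 = 2 i\<close> turn this into statements about squares: a bitangent over \<open>K\<close> makes one of \<open>b\<close>, \<open>-b\<close>,
  \<open>2 b\<close>, \<open>2 t\<close>, \<open>-2 t\<close>, \<open>b t\<close> a square in \<open>K\<close> (\<open>square_if_has_bitangent\<close>). Conversely a bitangent exists over a
  field in which one of \<open>b\<close>, \<open>-b\<close>, \<open>c\<close>, \<open>-c\<close> is a square, or which contains \<open>i\<close> and in which either
  \<open>2 b c\<close> is a square, or \<open>2 b\<close> and \<open>2 c\<close> are squares and \<open>3 \<noteq> 0\<close>.

  Every completion of \<open>K\<close> satisfies this (\<open>approx_sqrt_cases\<close>). At an archimedean place \<open>b\<close> is a positive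
  integer, hence a square. At a place above \<open>2\<close> the element \<open>b = 1 + 4 (2 t)^2\<close> is a square by Hensel
  lifting. At any other place, if \<open>t\<close> is not a unit then \<open>b\<close> is close to \<open>1\<close> or to \<open>(4 t)^2\<close>, and if \<open>b\<close> is
  not a unit then \<open>8 t = (1 + 4 t)^2 - b\<close> is close to a square, so that \<open>2 t\<close> is a square. There remains the
  case that \<open>2\<close>, \<open>b\<close>, \<open>c\<close> are units. The residue field is finite, so that its group of square classes
  has at most two elements. If \<open>-1\<close> is not a square, then \<open>b\<close> or \<open>-b\<close> is one. If \<open>-1\<close> is a square and
  neither \<open>b\<close> nor \<open>c\<close> is, then \<open>b c\<close> is a square; if \<open>2\<close> is a square then so is \<open>2 b c\<close>, and otherwise
  \<open>2 b\<close> and \<open>2 c\<close> are squares, and \<open>3 = 0\<close> is impossible because it would make \<open>2 = -1\<close> a square.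

  It remains to choose \<open>t\<close> such that the six elements are not squares in \<open>K\<close>. If \<open>k\<close> is the fraction
  field of the base ring, then only finitely many classes of \<open>k\<close> modulo squares become trivial in
  the finite extension \<open>K\<close> (\<open>finite_square_classes\<close>). Let \<open>M\<close> be a multiple of twice representatives
  of them, and \<open>t = \<tau> M^2\<close> with \<open>\<tau>\<close> prime to \<open>M\<close>. If for example \<open>b t\<close> is a square in \<open>K\<close>, then
  \<open>b \<tau> r\<close> is a square in \<open>k\<close> for one of the representatives \<open>r\<close>; as \<open>b\<close> is prime to \<open>\<tau> r\<close>, it is a unit
  times a square in the base ring (\<open>exists_parameter\<close>). So it is enough that neither \<open>b\<close> nor \<open>\<tau>\<close> is a unit
  times a square. In \<open>\<int>\<close> one can take \<open>\<tau> = 4 M^2 - 1\<close>, and in \<open>F\<^sub>p[T]\<close> some \<open>\<tau> = 1 + M Y\<close> of odd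
  degree.\<close>

section \<open>Identities in commutative rings\<close>

context cring
begin

text \<open>Both sides of an identity are reified as polynomial expressions in a list \<open>ls\<close> of ring elements.
  Resolution with \<open>reify\<close> finds the expressions, and rewriting compares their normal forms.\<close>

lemma ring_identity: "s = Ipolex ls A \<Longrightarrow> t = Ipolex ls B \<Longrightarrow> in_carrier ls \<Longrightarrow> norm A = norm B \<Longrightarrow> s = t"
  by (simp add: norm_ci)

lemma reify:
  "x = Ipolex ls A \<Longrightarrow> y = Ipolex ls B \<Longrightarrow> x \<oplus> y = Ipolex ls (Add A B)"
  "x = Ipolex ls A \<Longrightarrow> y = Ipolex ls B \<Longrightarrow> x \<ominus> y = Ipolex ls (Sub A B)"
  "x = Ipolex ls A \<Longrightarrow> y = Ipolex ls B \<Longrightarrow> x \<otimes> y = Ipolex ls (Mul A B)"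
  "x = Ipolex ls A \<Longrightarrow> x [^] n = Ipolex ls (Pow A n)"
  "x = Ipolex ls A \<Longrightarrow> \<ominus> x = Ipolex ls (Neg A)"
  "\<zero> = Ipolex ls (Const 0)"
  "\<one> = Ipolex ls (Const 1)"
  "\<guillemotleft>c\<guillemotright> = Ipolex ls (Const c)"
  "x1 = Ipolex (x1#ls) (Var 0)"
  "x2 = Ipolex (x1#x2#ls) (Var 1)"
  "x3 = Ipolex (x1#x2#x3#ls) (Var 2)"
  "x4 = Ipolex (x1#x2#x3#x4#ls) (Var 3)"
  "x5 = Ipolex (x1#x2#x3#x4#x5#ls) (Var 4)"
  "x6 = Ipolex (x1#x2#x3#x4#x5#x6#ls) (Var 5)"
  "x7 = Ipolex (x1#x2#x3#x4#x5#x6#x7#ls) (Var 6)"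
  "x8 = Ipolex (x1#x2#x3#x4#x5#x6#x7#x8#ls) (Var 7)"
  "x9 = Ipolex (x1#x2#x3#x4#x5#x6#x7#x8#x9#ls) (Var 8)"
  by (simp_all add: numeral_eq_Suc)
end
lemma (in ring_hom_cring) hom_of_int: "h \<guillemotleft>n\<guillemotright> = \<guillemotleft>n\<guillemotright>\<^bsub>S\<^esub>"
proof -
  have nat: "h \<guillemotleft>int m\<guillemotright> = \<guillemotleft>int m\<guillemotright>\<^bsub>S\<^esub>" for m
    by (induction m) simp_all
  obtain m where "n = int m \<or> n = - int m" by (metis int_cases2)
  then show ?thesis using nat[of m] by auto
qed

section \<open>Diagonal forms\<close>

definition diag_form :: "('a, 'm) ring_scheme \<Rightarrow> nat \<Rightarrow> (nat \<Rightarrow> 'a) \<Rightarrow> nat multiset \<Rightarrow> 'a" where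
  "diag_form R n c m =
     (if m = replicate_mset n 0 then c 0 else if m = replicate_mset n 1 then c 1
      else if m = replicate_mset n 2 then c 2 else \<zero>\<^bsub>R\<^esub>)"

lemma diag_form_comp: "h \<zero>\<^bsub>R\<^esub> = \<zero>\<^bsub>S\<^esub> \<Longrightarrow> h \<circ> diag_form R n c = diag_form S n (h \<circ> c)"
  by (auto simp: diag_form_def fun_eq_iff)

lemma lessThan_3_cases: "(i::nat) < 3 \<longleftrightarrow> i = 0 \<or> i = 1 \<or> i = 2"
  by auto

lemma perm_3_distinct:
  assumes "{i, j, k} = {..<3::nat}"
  shows "i \<noteq> j" "i \<noteq> k" "j \<noteq> k" "i < 3" "j < 3" "k < 3"
proof -
  have "card {i, j, k} = 3" using assms by simp
  then show "i \<noteq> j" "i \<noteq> k" "j \<noteq> k" by (auto simp: card_insert_if split: if_splits)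
  show "i < 3" "j < 3" "k < 3" using assms by auto
qed

lemma perm_3_all: "{i, j, k} = {..<3::nat} \<Longrightarrow> (\<forall>m<3. P m) \<longleftrightarrow> P i \<and> P j \<and> P k"
  by (metis (no_types, lifting) insert_iff lessThan_iff singletonD)

lemma diag_form_replicate:
  assumes "0 < n" "i < 3"
  shows "diag_form R n c (replicate_mset n i) = c i"
proof -
  have "replicate_mset n i = replicate_mset n j \<longleftrightarrow> i = j" for j
    using assms(1) by (metis count_replicate_mset less_numeral_extra(3))
  then show ?thesis using assms by (auto simp: diag_form_def lessThan_3_cases)
qed

lemma (in abelian_monoid) finsum_perm_3:
  assumes "{i, j, k} = {..<3::nat}" "\<And>m. m < 3 \<Longrightarrow> f m \<in> carrier G"
  shows "finsum G f {..<3} = f i \<oplus> (f j \<oplus> f k)"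
  unfolding assms(1)[symmetric] using perm_3_distinct[OF assms(1)] assms(2)
  by (subst finsum_insert; auto)+

context cring
begin

lemma eval_diag_form:
  assumes "0 < n" "\<And>i. i < 3 \<Longrightarrow> c i \<in> carrier R" "\<And>i. i < 3 \<Longrightarrow> x i \<in> carrier R"
  shows "eval_form R (diag_form R n c) x = (\<Oplus>i\<in>{..<3}. c i \<otimes> x i [^] n)"
proof -
  let ?f = "diag_form R n c"
  let ?g = "\<lambda>m. ?f m \<otimes> (\<Otimes>i\<in>{..<3}. x i [^] count m i)"
  have cl: "?f m \<in> carrier R" for m using assms(2) by (auto simp: diag_form_def)
  have ne: "replicate_mset n i = replicate_mset n j \<longleftrightarrow> i = j" for i j :: nat
    using assms(1) by (metis count_replicate_mset less_numeral_extra(3))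
  have "eval_form R ?f x = finsum R ?g (replicate_mset n ` {..<3})"
    unfolding eval_form_def
  proof (rule add.finprod_mono_neutral_cong_left)
    show "{m. ?f m \<noteq> \<zero>} \<subseteq> replicate_mset n ` {..<3}"
      by (auto simp: diag_form_def split: if_splits)
  qed (use cl assms(3) in \<open>auto intro!: finprod_closed\<close>)
  also have "\<dots> = (\<Oplus>i\<in>{..<3}. ?g (replicate_mset n i))"
    by (rule add.finprod_reindex) (use cl assms(3) ne in \<open>auto intro!: finprod_closed simp: inj_on_def\<close>)
  also have "\<dots> = (\<Oplus>i\<in>{..<3}. c i \<otimes> x i [^] n)"
  proof (rule add.finprod_cong')
    fix i :: nat assume i: "i \<in> {..<3}"
    have "(\<Otimes>j\<in>{..<3}. x j [^] count (replicate_mset n i) j) = (\<Otimes>j\<in>{..<3}. if i = j then x j [^] n else \<one>)"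
      by (rule finprod_cong') (use assms(3) in auto)
    also have "\<dots> = x i [^] n"
      using finprod_singleton[of i "{..<3}" "\<lambda>j. x j [^] n"] i assms(3) by simp
    finally show "?g (replicate_mset n i) = c i \<otimes> x i [^] n"
      using i by (auto simp: diag_form_def ne lessThan_3_cases)
  qed (use assms in auto)
  finally show ?thesis .
qed

lemma quartic_form_diag:
  assumes "\<And>i. i < 3 \<Longrightarrow> c i \<in> carrier R"
  shows "quartic_form R (diag_form R 4 c)"
  unfolding quartic_form_def
proof
  have "\<exists>Q\<in>indexed_pset {..<3} (carrier R). \<forall>m. Q m = (if m = replicate_mset n i then c i else \<zero>)"
    if i: "i < 3" for n i
  proof (induction n)
    case 0
    show ?case
      by (rule bexI[OF _ indexed_pset.indexed_const[OF assms[OF i]]]) (simp add: indexed_const_def)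
  next
    case (Suc n)
    then obtain Q where Q: "Q \<in> indexed_pset {..<3} (carrier R)"
      "\<And>m. Q m = (if m = replicate_mset n i then c i else \<zero>)" by blast
    have "indexed_pmult Q i m = (if m = replicate_mset (Suc n) i then c i else \<zero>)" for m
    proof (cases "i \<in># m")
      case True
      then have "m - {#i#} = replicate_mset n i \<longleftrightarrow> m = replicate_mset (Suc n) i"
        by (metis add_mset_remove_trivial insert_DiffM replicate_mset_Suc)
      with True show ?thesis by (simp add: indexed_pmult_def Q(2))
    next
      case False
      then show ?thesis by (auto simp: indexed_pmult_def)
    qed
    then show ?case using indexed_pset.indexed_pmult[OF Q(1), of i] i by blast
  qed
  then have "\<forall>i. \<exists>Q. i < 3 \<longrightarrow> Q \<in> indexed_pset {..<3} (carrier R) \<and>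
      (\<forall>m. Q m = (if m = replicate_mset 4 i then c i else \<zero>))"
    by blast
  from choice[OF this] obtain M where M': "\<forall>i. i < 3 \<longrightarrow> M i \<in> indexed_pset {..<3} (carrier R) \<and>
      (\<forall>m. M i m = (if m = replicate_mset 4 i then c i else \<zero>))" ..
  have M: "M i \<in> indexed_pset {..<3} (carrier R)"
    "M i m = (if m = replicate_mset 4 i then c i else \<zero>)" if "i < 3" for i m
    using M' that by blast+
  have ne: "replicate_mset 4 i = replicate_mset 4 j \<longleftrightarrow> i = j" for i j :: nat
    by (metis count_replicate_mset zero_neq_numeral)
  have "diag_form R 4 c = indexed_padd (indexed_padd (M 0) (M 1)) (M 2)"
    using assms by (simp add: fun_eq_iff indexed_padd_def M(2) diag_form_def ne)
  moreover have "M i \<in> indexed_pset {..<3} (carrier R)" if "i < 3" for i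
    using M(1) that by blast
  ultimately show "diag_form R 4 c \<in> indexed_pset {..<3} (carrier R)"
    by (auto intro!: indexed_padd)
  show "\<forall>m. diag_form R 4 c m \<noteq> \<zero> \<longrightarrow> size m = 4"
    by (auto simp: diag_form_def)
qed

lemma add_pow_eq_of_int: "x \<in> carrier R \<Longrightarrow> [n] \<cdot>\<^bsub>R\<^esub> x = \<guillemotleft>int n\<guillemotright> \<otimes> x"
  for n :: nat
  by (induction n) (auto simp: l_distr a_comm)

lemma partial_deriv_diag:
  assumes "\<And>i. i < 3 \<Longrightarrow> c i \<in> carrier R" "i < 3"
  shows "partial_deriv R i (diag_form R 4 c) = diag_form R 3 (\<lambda>j. if j = i then \<guillemotleft>4\<guillemotright> \<otimes> c i else \<zero>)"
proof
  fix m
  have "add_mset i m = replicate_mset 4 j \<Longrightarrow> i = j" for j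
    by (metis in_replicate_mset union_single_eq_member)
  then have eq4: "add_mset i m = replicate_mset 4 j \<longleftrightarrow> j = i \<and> m = replicate_mset 3 i" for j
    by (auto simp: numeral_eq_Suc)
  show "partial_deriv R i (diag_form R 4 c) m = diag_form R 3 (\<lambda>j. if j = i then \<guillemotleft>4\<guillemotright> \<otimes> c i else \<zero>) m"
  proof (cases "m = replicate_mset 3 i")
    case True
    then have "add_mset i m = replicate_mset 4 i" using eq4 by blast
    moreover have "Suc (count m i) = 4" using True by simp
    ultimately have "partial_deriv R i (diag_form R 4 c) m = [(4::nat)] \<cdot>\<^bsub>R\<^esub> c i"
      using assms(2) by (simp only: partial_deriv_def diag_form_replicate zero_less_numeral)
    then show ?thesis
      using assms add_pow_eq_of_int[of "c i" 4] True by (simp add: diag_form_replicate)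
  next
    case False
    then have "diag_form R 4 c (add_mset i m) = \<zero>"
      using eq4 by (simp add: diag_form_def)
    moreover have "diag_form R 3 (\<lambda>j. if j = i then \<guillemotleft>4\<guillemotright> \<otimes> c i else \<zero>) m = \<zero>"
    proof (cases "\<exists>j<3. m = replicate_mset 3 j")
      case True
      then obtain j where j: "j < 3" "m = replicate_mset 3 j" by blast
      with False have "j \<noteq> i" by blast
      with j show ?thesis by (simp only: diag_form_replicate zero_less_numeral if_False)
    next
      case False
      then have "m \<noteq> replicate_mset 3 0" "m \<noteq> replicate_mset 3 1" "m \<noteq> replicate_mset 3 2"
        by (metis zero_less_numeral, metis one_less_numeral_iff semiring_norm(77), metis lessThan_3_cases)
      then show ?thesis by (simp only: diag_form_def if_False)
    qed
    ultimately show ?thesis by (simp add: partial_deriv_def add_pow_eq_of_int)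
  qed
qed

text \<open>The factor \<open>4\<close> is invertible, so up to proportionality the tangent line at \<open>P\<close> has the coordinates
  \<open>c i * P i ^ 3\<close>.\<close>

lemma gradient_diag:
  assumes "\<And>i. i < 3 \<Longrightarrow> c i \<in> carrier R" "\<And>i. i < 3 \<Longrightarrow> x i \<in> carrier R" "i < 3"
  shows "eval_form R (partial_deriv R i (diag_form R 4 c)) x = \<guillemotleft>4\<guillemotright> \<otimes> (c i \<otimes> x i [^] (3::nat))"
proof -
  have "eval_form R (partial_deriv R i (diag_form R 4 c)) x =
      (\<Oplus>j\<in>{..<3}. (if j = i then \<guillemotleft>4\<guillemotright> \<otimes> c i else \<zero>) \<otimes> x j [^] (3::nat))"
    by (subst partial_deriv_diag[where c=c], use assms in blast, fact,
        subst eval_diag_form) (use assms in auto)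
  also have "\<dots> = (\<Oplus>j\<in>{..<3}. if i = j then \<guillemotleft>4\<guillemotright> \<otimes> (c j \<otimes> x j [^] (3::nat)) else \<zero>)"
    by (rule add.finprod_cong') (use assms in \<open>auto simp: m_assoc\<close>)
  also have "\<dots> = \<guillemotleft>4\<guillemotright> \<otimes> (c i \<otimes> x i [^] (3::nat))"
    using add.finprod_singleton[of i "{..<3}" "\<lambda>j. \<guillemotleft>4\<guillemotright> \<otimes> (c j \<otimes> x j [^] (3::nat))"] assms by simp
  finally show ?thesis .
qed

end

lemma (in domain) nat_pow_ne_zero: "x \<in> carrier R \<Longrightarrow> x \<noteq> \<zero> \<Longrightarrow> x [^] (n::nat) \<noteq> \<zero>"
  by (induction n) (auto dest: integral)

context field
begin

lemma four_ne: "\<guillemotleft>2\<guillemotright> \<noteq> \<zero> \<Longrightarrow> \<guillemotleft>4\<guillemotright> \<noteq> \<zero>"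
  using of_int_mult[of 2 2] integral[of "\<guillemotleft>2\<guillemotright>" "\<guillemotleft>2\<guillemotright>"] by auto

text \<open>The restriction to a hyperflex line is \<open>a * X ^ 4\<close>, and the contact multiplicity there is read off
  from this.\<close>

lemma alg_mult_monomial:
  assumes "c \<in> carrier R" "c \<noteq> \<zero>"
  shows "alg_mult (X [^]\<^bsub>poly_ring R\<^esub> n \<otimes>\<^bsub>poly_ring R\<^esub> poly_of_const c) \<zero> = n"
proof -
  interpret P: domain "poly_ring R" using univ_poly_is_domain[OF carrier_is_subring] .
  have cc: "poly_of_const c \<in> carrier (poly_ring R)"
    using canonical_embedding_is_hom[OF carrier_is_subring] assms ring_hom_closed by fastforce
  have X: "X \<in> carrier (poly_ring R)" using var_closed(1)[OF carrier_is_subring] .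
  have X0: "X \<noteq> \<zero>\<^bsub>poly_ring R\<^esub>" by (simp add: var_def univ_poly_zero)
  let ?p = "X [^]\<^bsub>poly_ring R\<^esub> n \<otimes>\<^bsub>poly_ring R\<^esub> poly_of_const c"
  have p: "?p \<in> carrier (poly_ring R)" using cc X by simp
  have c0: "poly_of_const c \<noteq> \<zero>\<^bsub>poly_ring R\<^esub>" using assms by (simp add: poly_of_const_def univ_poly_zero)
  have Xn: "X [^]\<^bsub>poly_ring R\<^esub> n \<in> carrier (poly_ring R)" using X by simp
  have Xn0: "X [^]\<^bsub>poly_ring R\<^esub> n \<noteq> \<zero>\<^bsub>poly_ring R\<^esub>" by (rule P.nat_pow_ne_zero[OF X X0])
  have p0: "?p \<noteq> []"
    using P.integral_iff[OF Xn cc] Xn0 c0 by (simp add: univ_poly_zero)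
  have X': "[\<one>, \<ominus> \<zero>] = X" by (simp add: var_def)
  note E = alg_multE[OF zero_closed p p0, unfolded X']
  have "n \<le> alg_mult ?p \<zero>"
    by (rule E(2)) (use cc in \<open>unfold pdivides_def factor_def, blast\<close>)
  moreover have "\<not> Suc n \<le> alg_mult ?p \<zero>"
  proof
    assume "Suc n \<le> alg_mult ?p \<zero>"
    then have "X [^]\<^bsub>poly_ring R\<^esub> Suc n pdivides ?p"
      using le_alg_mult_imp_pdivides[OF zero_closed p, unfolded X'] by blast
    then obtain q where q: "q \<in> carrier (poly_ring R)" "?p = X [^]\<^bsub>poly_ring R\<^esub> Suc n \<otimes>\<^bsub>poly_ring R\<^esub> q"
      by (auto simp: pdivides_def factor_def)
    then have "X [^]\<^bsub>poly_ring R\<^esub> n \<otimes>\<^bsub>poly_ring R\<^esub> poly_of_const c = X [^]\<^bsub>poly_ring R\<^esub> n \<otimes>\<^bsub>poly_ring R\<^esub> (X \<otimes>\<^bsub>poly_ring R\<^esub> q)"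
      using P.m_assoc[OF Xn X q(1)] by simp
    then have "poly_of_const c = X \<otimes>\<^bsub>poly_ring R\<^esub> q"
      using P.m_lcancel[OF Xn0 Xn cc P.m_closed[OF X q(1)]] by blast
    then have "const_term (poly_of_const c) = const_term X \<otimes> const_term q"
      using const_term_simprules_shell(2)[OF carrier_is_subring X q(1)] by metis
    moreover have "const_term X = \<zero>" by (simp add: const_term_def eval_var)
    moreover have "const_term (poly_of_const c) = c"
      using assms by (simp add: const_term_def poly_of_const_def)
    moreover have "const_term q \<in> carrier R" using const_term_simprules_shell(1)[OF carrier_is_subring q(1)] .
    ultimately show False using assms by simp
  qed
  ultimately show ?thesis by auto
qed

end

section \<open>Restrictions of diagonal quartics that are squares\<close>

lemma (in ring) eq_imp_zero_eq_minus: "x = y \<Longrightarrow> x \<in> carrier R \<Longrightarrow> \<zero> = x \<ominus> y"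
  by (metis r_right_minus_eq)

context cring
begin

text \<open>The quartic \<open>m0 + 4 m1 x + 6 m2 x^2 + 4 m3 x^3 + m4 x^4\<close> is \<open>\<kappa> (p + q x + r x^2)^2\<close>; the equations \<open>e1\<close>
  and \<open>e3\<close> are divided by \<open>2\<close>. The two conclusions are relations between the coefficients of a square,
  with \<open>\<kappa>\<close>, \<open>p\<close>, \<open>q\<close>, \<open>r\<close> eliminated. The factor \<open>4\<close> makes them valid without division.\<close>

lemma quartic_of_square:
  assumes "\<kappa> \<in> carrier R" "p \<in> carrier R" "q \<in> carrier R" "r \<in> carrier R"
    "m0 \<in> carrier R" "m1 \<in> carrier R" "m2 \<in> carrier R" "m3 \<in> carrier R" "m4 \<in> carrier R"
   and e0: "m0 = \<kappa> \<otimes> p [^] (2::nat)" and e1: "\<guillemotleft>2\<guillemotright> \<otimes> m1 = \<kappa> \<otimes> p \<otimes> q"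
   and e2: "\<guillemotleft>6\<guillemotright> \<otimes> m2 = \<kappa> \<otimes> (q [^] (2::nat) \<oplus> \<guillemotleft>2\<guillemotright> \<otimes> p \<otimes> r)"
   and e3: "\<guillemotleft>2\<guillemotright> \<otimes> m3 = \<kappa> \<otimes> q \<otimes> r" and e4: "m4 = \<kappa> \<otimes> r [^] (2::nat)"
 shows "\<guillemotleft>4\<guillemotright> \<otimes> (m0 \<otimes> m3 [^] (2::nat)) = \<guillemotleft>4\<guillemotright> \<otimes> (m1 [^] (2::nat) \<otimes> m4)"
  and "\<guillemotleft>4\<guillemotright> \<otimes> (\<guillemotleft>2\<guillemotright> \<otimes> m1 [^] (3::nat) \<oplus> m0 [^] (2::nat) \<otimes> m3) = \<guillemotleft>4\<guillemotright> \<otimes> (\<guillemotleft>3\<guillemotright> \<otimes> m0 \<otimes> m1 \<otimes> m2)"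
proof -
  note cl = assms(1-9)
  have "\<guillemotleft>4\<guillemotright> \<otimes> (m0 \<otimes> m3 [^] (2::nat)) = m0 \<otimes> (\<guillemotleft>2\<guillemotright> \<otimes> m3) [^] (2::nat)"
    by (rule ring_identity[where ls="[m0, m3]"], (rule reify)+, simp add: in_carrier_def cl, code_simp)
  also have "\<dots> = (\<kappa> \<otimes> p \<otimes> q) [^] (2::nat) \<otimes> (\<kappa> \<otimes> r [^] (2::nat))"
    unfolding e3 e0
    by (rule ring_identity[where ls="[\<kappa>, p, q, r]"], (rule reify)+, simp add: in_carrier_def cl, code_simp)
  also have "\<dots> = \<guillemotleft>4\<guillemotright> \<otimes> (m1 [^] (2::nat) \<otimes> m4)"
    unfolding e1[symmetric] e4[symmetric]
    by (rule ring_identity[where ls="[m1, m4]"], (rule reify)+, simp add: in_carrier_def cl, code_simp)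
  finally show "\<guillemotleft>4\<guillemotright> \<otimes> (m0 \<otimes> m3 [^] (2::nat)) = \<guillemotleft>4\<guillemotright> \<otimes> (m1 [^] (2::nat) \<otimes> m4)" .
  have "\<guillemotleft>4\<guillemotright> \<otimes> (\<guillemotleft>2\<guillemotright> \<otimes> m1 [^] (3::nat) \<oplus> m0 [^] (2::nat) \<otimes> m3)
      = (\<guillemotleft>2\<guillemotright> \<otimes> m1) [^] (3::nat) \<oplus> \<guillemotleft>2\<guillemotright> \<otimes> m0 [^] (2::nat) \<otimes> (\<guillemotleft>2\<guillemotright> \<otimes> m3)"
    by (rule ring_identity[where ls="[m0, m1, m3]"], (rule reify)+, simp add: in_carrier_def cl, code_simp)
  also have "\<dots> = m0 \<otimes> (\<kappa> \<otimes> p \<otimes> q) \<otimes> (\<kappa> \<otimes> (q [^] (2::nat) \<oplus> \<guillemotleft>2\<guillemotright> \<otimes> p \<otimes> r))"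
    unfolding e1 e3 e0
    by (rule ring_identity[where ls="[\<kappa>, p, q, r]"], (rule reify)+, simp add: in_carrier_def cl, code_simp)
  also have "\<dots> = \<guillemotleft>4\<guillemotright> \<otimes> (\<guillemotleft>3\<guillemotright> \<otimes> m0 \<otimes> m1 \<otimes> m2)"
    unfolding e1[symmetric] e2[symmetric]
    by (rule ring_identity[where ls="[m0, m1, m2]"], (rule reify)+, simp add: in_carrier_def cl, code_simp)
  finally show "\<guillemotleft>4\<guillemotright> \<otimes> (\<guillemotleft>2\<guillemotright> \<otimes> m1 [^] (3::nat) \<oplus> m0 [^] (2::nat) \<otimes> m3) = \<guillemotleft>4\<guillemotright> \<otimes> (\<guillemotleft>3\<guillemotright> \<otimes> m0 \<otimes> m1 \<otimes> m2)" .
qed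

end

lemma (in domain) zero_eq_mult_cancel:
  "\<zero> = x \<otimes> y \<Longrightarrow> x \<noteq> \<zero> \<Longrightarrow> x \<in> carrier R \<Longrightarrow> y \<in> carrier R \<Longrightarrow> y = \<zero>"
  using integral by metis

context field
begin

lemma of_int_2_cancel:
  assumes "\<guillemotleft>2\<guillemotright> \<noteq> \<zero>" "x \<in> carrier R" "y \<in> carrier R" "\<guillemotleft>4\<guillemotright> \<otimes> x = \<guillemotleft>4\<guillemotright> \<otimes> y"
  shows "x = y"
  using m_lcancel[OF four_ne[OF assms(1)] of_int_closed assms(2,3)] assms(4) by blast

text \<open>Here \<open>(A, B, D)\<close> parametrizes a line: on it, \<open>z = (A x + B y) / D\<close>. For \<open>A B \<noteq> 0\<close> put
  \<open>u = ck A^4\<close>, \<open>v = ci D^4\<close>. As \<open>m1^2 m4 = m0 m3^2\<close> and \<open>2 m1^3 + m0^2 m3 = 3 m0 m1 m2\<close>, and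
  \<open>m1\<close>, \<open>m2\<close>, \<open>m3\<close> are monomials in \<open>A\<close> and \<open>B\<close>, the second relation becomes
  \<open>2 u^2 + (u + v)^2 = 3 u (u + v)\<close>, that is \<open>v (v - u) = 0\<close>. So \<open>v = u\<close>, and
  the first relation gives the corresponding equation for \<open>cj\<close>. If \<open>A = 0\<close> or \<open>B = 0\<close>, the form
  \<open>\<alpha> x^4 + \<beta> y^4\<close> is only a square if one of its coefficients vanishes.\<close>

lemma diag_restriction_square:
  assumes two: "\<guillemotleft>2\<guillemotright> \<noteq> \<zero>"
   and cl: "ci \<in> carrier R" "cj \<in> carrier R" "ck \<in> carrier R" "A \<in> carrier R" "B \<in> carrier R" "D \<in> carrier R"
   and ne: "ci \<noteq> \<zero>" "cj \<noteq> \<zero>" "ck \<noteq> \<zero>" "D \<noteq> \<zero>"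
   and cl': "\<kappa> \<in> carrier R" "p \<in> carrier R" "q \<in> carrier R" "r \<in> carrier R"
   and e0: "ci \<otimes> D [^] (4::nat) \<oplus> ck \<otimes> A [^] (4::nat) = \<kappa> \<otimes> p [^] (2::nat)"
   and e1: "\<guillemotleft>2\<guillemotright> \<otimes> (ck \<otimes> A [^] (3::nat) \<otimes> B) = \<kappa> \<otimes> p \<otimes> q"
   and e2: "\<guillemotleft>6\<guillemotright> \<otimes> (ck \<otimes> A [^] (2::nat) \<otimes> B [^] (2::nat)) = \<kappa> \<otimes> (q [^] (2::nat) \<oplus> \<guillemotleft>2\<guillemotright> \<otimes> p \<otimes> r)"
   and e3: "\<guillemotleft>2\<guillemotright> \<otimes> (ck \<otimes> A \<otimes> B [^] (3::nat)) = \<kappa> \<otimes> q \<otimes> r"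
   and e4: "cj \<otimes> D [^] (4::nat) \<oplus> ck \<otimes> B [^] (4::nat) = \<kappa> \<otimes> r [^] (2::nat)"
  shows "ci \<otimes> D [^] (4::nat) = ck \<otimes> A [^] (4::nat) \<and> cj \<otimes> D [^] (4::nat) = ck \<otimes> B [^] (4::nat)
    \<or> cj \<otimes> D [^] (4::nat) \<oplus> ck \<otimes> B [^] (4::nat) = \<zero>
    \<or> ci \<otimes> D [^] (4::nat) \<oplus> ck \<otimes> A [^] (4::nat) = \<zero>"
proof (cases "A = \<zero> \<or> B = \<zero>")
  case False
  let ?u = "ck \<otimes> A [^] (4::nat)" and ?v = "ci \<otimes> D [^] (4::nat)"
  have uv: "?u \<in> carrier R" "?v \<in> carrier R" using cl by auto
  have v0: "?v \<noteq> \<zero>" using cl ne nat_pow_ne_zero[of D 4] integral[of ci "D [^] (4::nat)"] by auto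
  have w0: "ck \<otimes> A \<otimes> B [^] (3::nat) \<noteq> \<zero>"
    using cl ne False nat_pow_ne_zero[of B 3] by (simp add: integral_iff)
  note sq = quartic_of_square[OF cl' _ _ _ _ _ e0 e1 e2 e3 e4]
  note sq1 = sq(1)[THEN of_int_2_cancel[OF two, rotated -1]]
  note sq2 = sq(2)[THEN of_int_2_cancel[OF two, rotated -1]]
  have "\<guillemotleft>2\<guillemotright> \<otimes> (ck \<otimes> A [^] (3::nat) \<otimes> B) [^] (3::nat) \<oplus> (?v \<oplus> ?u) [^] (2::nat) \<otimes> (ck \<otimes> A \<otimes> B [^] (3::nat))
     = \<guillemotleft>3\<guillemotright> \<otimes> (?v \<oplus> ?u) \<otimes> (ck \<otimes> A [^] (3::nat) \<otimes> B) \<otimes> (ck \<otimes> A [^] (2::nat) \<otimes> B [^] (2::nat))"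
    by (rule sq2) (use cl in simp_all)
  then have "\<zero> = \<guillemotleft>2\<guillemotright> \<otimes> (ck \<otimes> A [^] (3::nat) \<otimes> B) [^] (3::nat) \<oplus> (?v \<oplus> ?u) [^] (2::nat) \<otimes> (ck \<otimes> A \<otimes> B [^] (3::nat)) 
     \<ominus> \<guillemotleft>3\<guillemotright> \<otimes> (?v \<oplus> ?u) \<otimes> (ck \<otimes> A [^] (3::nat) \<otimes> B) \<otimes> (ck \<otimes> A [^] (2::nat) \<otimes> B [^] (2::nat))"
    by (rule eq_imp_zero_eq_minus) (use cl in simp_all)
  also have "\<dots> = (ck \<otimes> A \<otimes> B [^] (3::nat)) \<otimes> (?v \<otimes> (?v \<ominus> ?u))"
    by (rule ring_identity[where ls="[ci, ck, A, B, D]"], (rule reify)+, simp add: in_carrier_def cl, code_simp)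
  finally have "?v \<otimes> (?v \<ominus> ?u) = \<zero>"
    by (rule zero_eq_mult_cancel[OF _ w0]) (use cl in simp_all)
  then have "?v \<ominus> ?u = \<zero>"
    by (rule zero_eq_mult_cancel[OF sym v0]) (use uv in simp_all)
  then have vu: "?v = ?u" using uv by (simp add: r_right_minus_eq)
  have "(?v \<oplus> ?u) \<otimes> (ck \<otimes> A \<otimes> B [^] (3::nat)) [^] (2::nat) = (ck \<otimes> A [^] (3::nat) \<otimes> B) [^] (2::nat) \<otimes> (cj \<otimes> D [^] (4::nat) \<oplus> ck \<otimes> B [^] (4::nat))"
    by (rule sq1) (use cl in simp_all)
  then have "\<zero> = (?u \<oplus> ?u) \<otimes> (ck \<otimes> A \<otimes> B [^] (3::nat)) [^] (2::nat) \<ominus> (ck \<otimes> A [^] (3::nat) \<otimes> B) [^] (2::nat) \<otimes> (cj \<otimes> D [^] (4::nat) \<oplus> ck \<otimes> B [^] (4::nat))"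
    unfolding vu by (rule eq_imp_zero_eq_minus) (use cl in simp_all)
  also have "\<dots> = (ck \<otimes> A [^] (3::nat) \<otimes> B) [^] (2::nat) \<otimes> (ck \<otimes> B [^] (4::nat) \<ominus> cj \<otimes> D [^] (4::nat))"
    by (rule ring_identity[where ls="[cj, ck, A, B, D]"], (rule reify)+, simp add: in_carrier_def cl, code_simp)
  finally have "ck \<otimes> B [^] (4::nat) \<ominus> cj \<otimes> D [^] (4::nat) = \<zero>"
  proof (rule zero_eq_mult_cancel)
    show "(ck \<otimes> A [^] (3::nat) \<otimes> B) [^] (2::nat) \<noteq> \<zero>"
      by (rule nat_pow_ne_zero) (use cl ne False nat_pow_ne_zero[of A 3] in \<open>auto simp add: integral_iff\<close>)
  qed (use cl in simp_all)
  then show ?thesis using vu cl by (simp add: r_right_minus_eq)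
next
  case True
  have D0: "D [^] (4::nat) \<noteq> \<zero>" using cl ne nat_pow_ne_zero by blast
  have z: "\<zero> = \<kappa> \<otimes> p \<otimes> q" "\<zero> = \<kappa> \<otimes> (q [^] (2::nat) \<oplus> \<guillemotleft>2\<guillemotright> \<otimes> p \<otimes> r)" "\<zero> = \<kappa> \<otimes> q \<otimes> r"
    using True cl by (auto simp: e1[symmetric] e2[symmetric] e3[symmetric] nat_pow_zero)
  consider "\<kappa> = \<zero>" | "\<kappa> \<noteq> \<zero>" "q \<noteq> \<zero>" | "\<kappa> \<noteq> \<zero>" "q = \<zero>" by blast
  then have "\<kappa> = \<zero> \<or> p = \<zero> \<or> r = \<zero>"
  proof cases
    case 2
    then show ?thesis using z(1)[symmetric] cl' by (simp add: integral_iff)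
  next
    case 3
    then have "\<guillemotleft>2\<guillemotright> \<otimes> p \<otimes> r = \<zero>" using z(2)[symmetric] cl' by (simp add: nat_pow_zero integral_iff)
    then show ?thesis using two cl' by (simp add: integral_iff)
  qed auto
  then have "\<kappa> \<otimes> p [^] (2::nat) = \<zero> \<or> \<kappa> \<otimes> r [^] (2::nat) = \<zero>"
    using cl' by (auto simp: nat_pow_zero)
  then show ?thesis unfolding e0[symmetric] e4[symmetric] by blast
qed

end

context cring
begin

lemma finsum_lincomb5:
  assumes "finite I" "a \<in> I \<rightarrow> carrier R" "b \<in> I \<rightarrow> carrier R" "c \<in> I \<rightarrow> carrier R" "d \<in> I \<rightarrow> carrier R" "e \<in> I \<rightarrow> carrier R"
    "x1 \<in> carrier R" "x2 \<in> carrier R" "x3 \<in> carrier R" "x4 \<in> carrier R" "x5 \<in> carrier R"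
    "\<And>i. i \<in> I \<Longrightarrow> f i = x1 \<otimes> a i \<oplus> (x2 \<otimes> b i \<oplus> (x3 \<otimes> c i \<oplus> (x4 \<otimes> d i \<oplus> x5 \<otimes> e i)))"
  shows "finsum R f I = x1 \<otimes> finsum R a I \<oplus> (x2 \<otimes> finsum R b I \<oplus> (x3 \<otimes> finsum R c I \<oplus> (x4 \<otimes> finsum R d I \<oplus> x5 \<otimes> finsum R e I)))"
proof -
  have "finsum R f I = (\<Oplus>i\<in>I. x1 \<otimes> a i \<oplus> (x2 \<otimes> b i \<oplus> (x3 \<otimes> c i \<oplus> (x4 \<otimes> d i \<oplus> x5 \<otimes> e i))))"
    by (rule add.finprod_cong') (use assms in \<open>auto simp: Pi_iff\<close>)
  also have "\<dots> = (\<Oplus>i\<in>I. x1 \<otimes> a i) \<oplus> ((\<Oplus>i\<in>I. x2 \<otimes> b i) \<oplus> ((\<Oplus>i\<in>I. x3 \<otimes> c i) \<oplus> ((\<Oplus>i\<in>I. x4 \<otimes> d i) \<oplus> (\<Oplus>i\<in>I. x5 \<otimes> e i))))"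
    using assms(2-11) by (simp add: finsum_addf Pi_iff)
  also have "\<dots> = x1 \<otimes> finsum R a I \<oplus> (x2 \<otimes> finsum R b I \<oplus> (x3 \<otimes> finsum R c I \<oplus> (x4 \<otimes> finsum R d I \<oplus> x5 \<otimes> finsum R e I)))"
    using assms(1-11) by (simp add: finsum_rdistr)
  finally show ?thesis .
qed

text \<open>The form \<open>f(x P + y Q)\<close> equals \<open>6 M2 x^2 y^2 + M4 y^4\<close> by the hypotheses \<open>m0\<close>, \<open>m1\<close>, \<open>m3\<close>. The conclusions are
  its polarized values at other pairs of points of the line.\<close>

lemma quartic_sums:
  fixes c p q :: "nat \<Rightarrow> 'a"
  assumes c: "\<And>i. i < 3 \<Longrightarrow> c i \<in> carrier R" and p: "\<And>i. i < 3 \<Longrightarrow> p i \<in> carrier R" and q: "\<And>i. i < 3 \<Longrightarrow> q i \<in> carrier R"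
    and u: "u1 \<in> carrier R" "u2 \<in> carrier R" and w: "w1 \<in> carrier R" "w2 \<in> carrier R"
    and m0: "(\<Oplus>i\<in>{..<3}. c i \<otimes> p i [^] (4::nat)) = \<zero>"
    and m1: "(\<Oplus>i\<in>{..<3}. c i \<otimes> p i [^] (3::nat) \<otimes> q i) = \<zero>"
    and m2: "(\<Oplus>i\<in>{..<3}. c i \<otimes> p i [^] (2::nat) \<otimes> q i [^] (2::nat)) = M2"
    and m3: "(\<Oplus>i\<in>{..<3}. c i \<otimes> p i \<otimes> q i [^] (3::nat)) = \<zero>"
    and m4: "(\<Oplus>i\<in>{..<3}. c i \<otimes> q i [^] (4::nat)) = M4"
  shows "(\<Oplus>i\<in>{..<3}. c i \<otimes> (u1 \<otimes> p i \<oplus> u2 \<otimes> q i) [^] (4::nat)) =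
      \<guillemotleft>6\<guillemotright> \<otimes> u1 [^] (2::nat) \<otimes> u2 [^] (2::nat) \<otimes> M2 \<oplus> u2 [^] (4::nat) \<otimes> M4" (is ?s0)
    and "(\<Oplus>i\<in>{..<3}. c i \<otimes> (u1 \<otimes> p i \<oplus> u2 \<otimes> q i) [^] (3::nat) \<otimes> (w1 \<otimes> p i \<oplus> w2 \<otimes> q i)) =
      \<guillemotleft>3\<guillemotright> \<otimes> u1 \<otimes> u2 \<otimes> (u1 \<otimes> w2 \<oplus> u2 \<otimes> w1) \<otimes> M2 \<oplus> u2 [^] (3::nat) \<otimes> w2 \<otimes> M4" (is ?s1)
    and "(\<Oplus>i\<in>{..<3}. c i \<otimes> (u1 \<otimes> p i \<oplus> u2 \<otimes> q i) [^] (2::nat) \<otimes> (w1 \<otimes> p i \<oplus> w2 \<otimes> q i) [^] (2::nat)) =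
      (u1 [^] (2::nat) \<otimes> w2 [^] (2::nat) \<oplus> \<guillemotleft>4\<guillemotright> \<otimes> u1 \<otimes> u2 \<otimes> w1 \<otimes> w2 \<oplus> u2 [^] (2::nat) \<otimes> w1 [^] (2::nat)) \<otimes> M2
      \<oplus> u2 [^] (2::nat) \<otimes> w2 [^] (2::nat) \<otimes> M4" (is ?s2)
proof -
  have M: "M2 \<in> carrier R" "M4 \<in> carrier R"
    unfolding m2[symmetric] m4[symmetric] using c p q by (auto intro!: finsum_closed)
  note lin = finsum_lincomb5[where I="{..<3::nat}" and
     a="\<lambda>i. c i \<otimes> p i [^] (4::nat)" and b="\<lambda>i. c i \<otimes> p i [^] (3::nat) \<otimes> q i" and
     c="\<lambda>i. c i \<otimes> p i [^] (2::nat) \<otimes> q i [^] (2::nat)" and d="\<lambda>i. c i \<otimes> p i \<otimes> q i [^] (3::nat)" and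
     e="\<lambda>i. c i \<otimes> q i [^] (4::nat)", unfolded m0 m1 m2 m3 m4]
  have "(\<Oplus>i\<in>{..<3}. c i \<otimes> (u1 \<otimes> p i \<oplus> u2 \<otimes> q i) [^] (4::nat)) =
    u1 [^] (4::nat) \<otimes> \<zero> \<oplus> (\<guillemotleft>4\<guillemotright> \<otimes> u1 [^] (3::nat) \<otimes> u2 \<otimes> \<zero> \<oplus> (\<guillemotleft>6\<guillemotright> \<otimes> u1 [^] (2::nat) \<otimes> u2 [^] (2::nat) \<otimes> M2 \<oplus>
      (\<guillemotleft>4\<guillemotright> \<otimes> u1 \<otimes> u2 [^] (3::nat) \<otimes> \<zero> \<oplus> u2 [^] (4::nat) \<otimes> M4)))"
  proof (rule lin)
    fix i :: nat assume "i \<in> {..<3}"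
    then have cl: "c i \<in> carrier R" "p i \<in> carrier R" "q i \<in> carrier R" using c p q by auto
    show "c i \<otimes> (u1 \<otimes> p i \<oplus> u2 \<otimes> q i) [^] (4::nat) =
      u1 [^] (4::nat) \<otimes> (c i \<otimes> p i [^] (4::nat)) \<oplus> (\<guillemotleft>4\<guillemotright> \<otimes> u1 [^] (3::nat) \<otimes> u2 \<otimes> (c i \<otimes> p i [^] (3::nat) \<otimes> q i) \<oplus>
      (\<guillemotleft>6\<guillemotright> \<otimes> u1 [^] (2::nat) \<otimes> u2 [^] (2::nat) \<otimes> (c i \<otimes> p i [^] (2::nat) \<otimes> q i [^] (2::nat)) \<oplus>
      (\<guillemotleft>4\<guillemotright> \<otimes> u1 \<otimes> u2 [^] (3::nat) \<otimes> (c i \<otimes> p i \<otimes> q i [^] (3::nat)) \<oplus> u2 [^] (4::nat) \<otimes> (c i \<otimes> q i [^] (4::nat)))))"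
      by (rule ring_identity[where ls="[c i, p i, q i, u1, u2]"], (rule reify)+, simp add: in_carrier_def cl u, code_simp)
  qed (use c p q u in auto)
  then show ?s0 using u M by simp
  have "(\<Oplus>i\<in>{..<3}. c i \<otimes> (u1 \<otimes> p i \<oplus> u2 \<otimes> q i) [^] (3::nat) \<otimes> (w1 \<otimes> p i \<oplus> w2 \<otimes> q i)) =
    u1 [^] (3::nat) \<otimes> w1 \<otimes> \<zero> \<oplus> (u1 [^] (2::nat) \<otimes> (u1 \<otimes> w2 \<oplus> \<guillemotleft>3\<guillemotright> \<otimes> u2 \<otimes> w1) \<otimes> \<zero> \<oplus>
     (\<guillemotleft>3\<guillemotright> \<otimes> u1 \<otimes> u2 \<otimes> (u1 \<otimes> w2 \<oplus> u2 \<otimes> w1) \<otimes> M2 \<oplus>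
      (u2 [^] (2::nat) \<otimes> (\<guillemotleft>3\<guillemotright> \<otimes> u1 \<otimes> w2 \<oplus> u2 \<otimes> w1) \<otimes> \<zero> \<oplus> u2 [^] (3::nat) \<otimes> w2 \<otimes> M4)))"
  proof (rule lin)
    fix i :: nat assume "i \<in> {..<3}"
    then have cl: "c i \<in> carrier R" "p i \<in> carrier R" "q i \<in> carrier R" using c p q by auto
    show "c i \<otimes> (u1 \<otimes> p i \<oplus> u2 \<otimes> q i) [^] (3::nat) \<otimes> (w1 \<otimes> p i \<oplus> w2 \<otimes> q i) =
      u1 [^] (3::nat) \<otimes> w1 \<otimes> (c i \<otimes> p i [^] (4::nat)) \<oplus> (u1 [^] (2::nat) \<otimes> (u1 \<otimes> w2 \<oplus> \<guillemotleft>3\<guillemotright> \<otimes> u2 \<otimes> w1) \<otimes> (c i \<otimes> p i [^] (3::nat) \<otimes> q i) \<oplus>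
      (\<guillemotleft>3\<guillemotright> \<otimes> u1 \<otimes> u2 \<otimes> (u1 \<otimes> w2 \<oplus> u2 \<otimes> w1) \<otimes> (c i \<otimes> p i [^] (2::nat) \<otimes> q i [^] (2::nat)) \<oplus>
      (u2 [^] (2::nat) \<otimes> (\<guillemotleft>3\<guillemotright> \<otimes> u1 \<otimes> w2 \<oplus> u2 \<otimes> w1) \<otimes> (c i \<otimes> p i \<otimes> q i [^] (3::nat)) \<oplus> u2 [^] (3::nat) \<otimes> w2 \<otimes> (c i \<otimes> q i [^] (4::nat)))))"
      by (rule ring_identity[where ls="[c i, p i, q i, u1, u2, w1, w2]"], (rule reify)+, simp add: in_carrier_def cl u w, code_simp)
  qed (use c p q u w in auto)
  then show ?s1 using u w M by simp
  have "(\<Oplus>i\<in>{..<3}. c i \<otimes> (u1 \<otimes> p i \<oplus> u2 \<otimes> q i) [^] (2::nat) \<otimes> (w1 \<otimes> p i \<oplus> w2 \<otimes> q i) [^] (2::nat)) =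
    u1 [^] (2::nat) \<otimes> w1 [^] (2::nat) \<otimes> \<zero> \<oplus> (\<guillemotleft>2\<guillemotright> \<otimes> u1 \<otimes> w1 \<otimes> (u1 \<otimes> w2 \<oplus> u2 \<otimes> w1) \<otimes> \<zero> \<oplus>
     ((u1 [^] (2::nat) \<otimes> w2 [^] (2::nat) \<oplus> \<guillemotleft>4\<guillemotright> \<otimes> u1 \<otimes> u2 \<otimes> w1 \<otimes> w2 \<oplus> u2 [^] (2::nat) \<otimes> w1 [^] (2::nat)) \<otimes> M2 \<oplus>
      (\<guillemotleft>2\<guillemotright> \<otimes> u2 \<otimes> w2 \<otimes> (u1 \<otimes> w2 \<oplus> u2 \<otimes> w1) \<otimes> \<zero> \<oplus> u2 [^] (2::nat) \<otimes> w2 [^] (2::nat) \<otimes> M4)))"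
  proof (rule lin)
    fix i :: nat assume "i \<in> {..<3}"
    then have cl: "c i \<in> carrier R" "p i \<in> carrier R" "q i \<in> carrier R" using c p q by auto
    show "c i \<otimes> (u1 \<otimes> p i \<oplus> u2 \<otimes> q i) [^] (2::nat) \<otimes> (w1 \<otimes> p i \<oplus> w2 \<otimes> q i) [^] (2::nat) =
      u1 [^] (2::nat) \<otimes> w1 [^] (2::nat) \<otimes> (c i \<otimes> p i [^] (4::nat)) \<oplus> (\<guillemotleft>2\<guillemotright> \<otimes> u1 \<otimes> w1 \<otimes> (u1 \<otimes> w2 \<oplus> u2 \<otimes> w1) \<otimes> (c i \<otimes> p i [^] (3::nat) \<otimes> q i) \<oplus>
      ((u1 [^] (2::nat) \<otimes> w2 [^] (2::nat) \<oplus> \<guillemotleft>4\<guillemotright> \<otimes> u1 \<otimes> u2 \<otimes> w1 \<otimes> w2 \<oplus> u2 [^] (2::nat) \<otimes> w1 [^] (2::nat)) \<otimes> (c i \<otimes> p i [^] (2::nat) \<otimes> q i [^] (2::nat)) \<oplus>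
      (\<guillemotleft>2\<guillemotright> \<otimes> u2 \<otimes> w2 \<otimes> (u1 \<otimes> w2 \<oplus> u2 \<otimes> w1) \<otimes> (c i \<otimes> p i \<otimes> q i [^] (3::nat)) \<oplus> u2 [^] (2::nat) \<otimes> w2 [^] (2::nat) \<otimes> (c i \<otimes> q i [^] (4::nat)))))"
      by (rule ring_identity[where ls="[c i, p i, q i, u1, u2, w1, w2]"], (rule reify)+, simp add: in_carrier_def cl u w, code_simp)
  qed (use c p q u w in auto)
  then show ?s2 using u w M by simp
qed

end

lemma (in field) proportional_if_minors:
  assumes "P \<in> hom_coords R" "Q \<in> hom_coords R" "\<And>m n. m < 3 \<Longrightarrow> n < 3 \<Longrightarrow> P m \<otimes> Q n = P n \<otimes> Q m"
  shows "proportional R P Q"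
proof -
  obtain m where m: "m < 3" "P m \<noteq> \<zero>" using assms(1) by (auto simp: hom_coords_def)
  have cl: "P i \<in> carrier R" "Q i \<in> carrier R" if "i < 3" for i using assms(1,2) that by (auto simp: hom_coords_def)
  have Pm: "P m \<in> Units R" using m cl field_Units by auto
  have iv: "inv (P m) \<in> carrier R" "inv (P m) \<noteq> \<zero>"
    using Pm Units_inv_Units field_Units by auto
  have Q: "Q n = inv (P m) \<otimes> Q m \<otimes> P n" if "n < 3" for n
  proof -
    have "inv (P m) \<otimes> Q m \<otimes> P n = inv (P m) \<otimes> (P n \<otimes> Q m)"
      using that m cl iv by (simp add: m_ac)
    also have "\<dots> = inv (P m) \<otimes> (P m \<otimes> Q n)" using assms(3) m that by simp
    also have "\<dots> = Q n" using Pm cl that m iv by (simp add: m_assoc[symmetric])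
    finally show ?thesis by simp
  qed
  have "Q m \<noteq> \<zero>"
  proof
    assume "Q m = \<zero>"
    then have "\<forall>n<3. Q n = \<zero>" using Q iv cl by (metis r_null l_null)
    then show False using assms(2) by (auto simp: hom_coords_def)
  qed
  then have "inv (P m) \<otimes> Q m \<noteq> \<zero>" using iv cl m integral by blast
  moreover have "inv (P m) \<otimes> Q m \<in> carrier R" using iv cl m by blast
  ultimately show ?thesis unfolding proportional_def using Q by blast
qed

context field
begin

text \<open>The hypotheses say that the restriction of the form to the line through \<open>P\<close> and \<open>Q\<close> is
  \<open>6 M2 x^2 y^2\<close> or \<open>M4 y^4\<close>, a constant times a square in both cases. Changing to the coordinates \<open>i\<close>
  and \<open>j\<close> on the line, which is possible since \<open>l k \<noteq> 0\<close>, brings it into the form of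
  \<open>diag_restriction_square\<close>.\<close>

lemma diag_line_criterion:
  assumes two: "\<guillemotleft>2\<guillemotright> \<noteq> \<zero>" and ijk: "{i, j, k} = {..<3::nat}"
    and c: "\<And>i. i < 3 \<Longrightarrow> c i \<in> carrier R" "\<And>i. i < 3 \<Longrightarrow> c i \<noteq> \<zero>"
    and l: "\<And>i. i < 3 \<Longrightarrow> l i \<in> carrier R" "l k \<noteq> \<zero>"
    and PQ: "P \<in> hom_coords R" "Q \<in> hom_coords R" "\<not> proportional R P Q" "on_line R l P" "on_line R l Q"
    and m0: "(\<Oplus>i\<in>{..<3}. c i \<otimes> P i [^] (4::nat)) = \<zero>"
    and m1: "(\<Oplus>i\<in>{..<3}. c i \<otimes> P i [^] (3::nat) \<otimes> Q i) = \<zero>"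
    and m3: "(\<Oplus>i\<in>{..<3}. c i \<otimes> P i \<otimes> Q i [^] (3::nat)) = \<zero>"
    and m24: "\<guillemotleft>6\<guillemotright> \<otimes> (\<Oplus>i\<in>{..<3}. c i \<otimes> P i [^] (2::nat) \<otimes> Q i [^] (2::nat)) = \<zero> \<or> (\<Oplus>i\<in>{..<3}. c i \<otimes> Q i [^] (4::nat)) = \<zero>"
  shows "c i \<otimes> l k [^] (4::nat) = c k \<otimes> l i [^] (4::nat) \<and> c j \<otimes> l k [^] (4::nat) = c k \<otimes> l j [^] (4::nat)
    \<or> c j \<otimes> l k [^] (4::nat) \<oplus> c k \<otimes> l j [^] (4::nat) = \<zero>
    \<or> c i \<otimes> l k [^] (4::nat) \<oplus> c k \<otimes> l i [^] (4::nat) = \<zero>"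
proof -
  have lt: "i < 3" "j < 3" "k < 3" using perm_3_distinct[OF ijk] by auto
  have P: "P i \<in> carrier R" and Q: "Q i \<in> carrier R" if "i < 3" for i using PQ that by (auto simp: hom_coords_def)
  note cl = P[OF lt(1)] P[OF lt(2)] P[OF lt(3)] Q[OF lt(1)] Q[OF lt(2)] Q[OF lt(3)] c(1)[OF lt(1)] c(1)[OF lt(2)] c(1)[OF lt(3)]
    l(1)[OF lt(1)] l(1)[OF lt(2)] l(1)[OF lt(3)]
  define D where "D = Q j \<otimes> P i \<oplus> (\<ominus> P j) \<otimes> Q i"
  define A where "A = Q j \<otimes> P k \<oplus> (\<ominus> P j) \<otimes> Q k"
  define B where "B = (\<ominus> Q i) \<otimes> P k \<oplus> P i \<otimes> Q k"
  have DAB: "D \<in> carrier R" "A \<in> carrier R" "B \<in> carrier R" using cl by (auto simp: D_def A_def B_def)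
  have SP: "l i \<otimes> P i \<oplus> (l j \<otimes> P j \<oplus> l k \<otimes> P k) = \<zero>" and SQ: "l i \<otimes> Q i \<oplus> (l j \<otimes> Q j \<oplus> l k \<otimes> Q k) = \<zero>"
    using PQ(4,5) finsum_perm_3[OF ijk, of "\<lambda>i. l i \<otimes> P i"] finsum_perm_3[OF ijk, of "\<lambda>i. l i \<otimes> Q i"] l(1) P Q
    by (auto simp: on_line_def)
  have "l k \<otimes> A \<oplus> l i \<otimes> D = Q j \<otimes> (l i \<otimes> P i \<oplus> (l j \<otimes> P j \<oplus> l k \<otimes> P k)) \<ominus> P j \<otimes> (l i \<otimes> Q i \<oplus> (l j \<otimes> Q j \<oplus> l k \<otimes> Q k))"
    unfolding A_def D_def
    by (rule ring_identity[where ls="[P i, P j, P k, Q i, Q j, Q k, l i, l j, l k]"], (rule reify)+, simp add: in_carrier_def cl, code_simp)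
  also have "\<dots> = \<zero>" unfolding SP SQ using cl by (simp add: minus_eq)
  finally have kA: "l k \<otimes> A = \<ominus> (l i \<otimes> D)"
    by (rule minus_equality[symmetric]) (use cl DAB in simp_all)
  have "l k \<otimes> B \<oplus> l j \<otimes> D = P i \<otimes> (l i \<otimes> Q i \<oplus> (l j \<otimes> Q j \<oplus> l k \<otimes> Q k)) \<ominus> Q i \<otimes> (l i \<otimes> P i \<oplus> (l j \<otimes> P j \<oplus> l k \<otimes> P k))"
    unfolding B_def D_def
    by (rule ring_identity[where ls="[P i, P j, P k, Q i, Q j, Q k, l i, l j, l k]"], (rule reify)+, simp add: in_carrier_def cl, code_simp)
  also have "\<dots> = \<zero>" unfolding SP SQ using cl by (simp add: minus_eq)
  finally have kB: "l k \<otimes> B = \<ominus> (l j \<otimes> D)"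
    by (rule minus_equality[symmetric]) (use cl DAB in simp_all)
  have D0: "D \<noteq> \<zero>"
  proof
    assume "D = \<zero>"
    then have "l k \<otimes> A = \<zero>" "l k \<otimes> B = \<zero>" using kA kB cl by simp_all
    then have "A = \<zero>" "B = \<zero>" using l(2) cl DAB by (simp_all add: integral_iff)
    have min: "x \<otimes> y = z \<otimes> w" if "x \<otimes> y \<oplus> (\<ominus> z) \<otimes> w = \<zero>" "x \<in> carrier R" "y \<in> carrier R" "z \<in> carrier R" "w \<in> carrier R"
      for x y z w
      using that r_right_minus_eq[of "x \<otimes> y" "z \<otimes> w"] by (simp add: minus_eq l_minus)
    have "Q j \<otimes> P i = P j \<otimes> Q i" by (rule min[OF \<open>D = \<zero>\<close>[unfolded D_def]]) (use cl in simp_all)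
    then have f1: "P i \<otimes> Q j = P j \<otimes> Q i" using m_comm[of "P i" "Q j"] cl by simp
    have "Q j \<otimes> P k = P j \<otimes> Q k" by (rule min[OF \<open>A = \<zero>\<close>[unfolded A_def]]) (use cl in simp_all)
    then have f2: "P k \<otimes> Q j = P j \<otimes> Q k" using m_comm[of "P k" "Q j"] cl by simp
    have "P i \<otimes> Q k = Q i \<otimes> P k" 
    proof (rule min)
      have "P i \<otimes> Q k \<oplus> (\<ominus> Q i) \<otimes> P k = B" unfolding B_def using cl by (intro a_comm) simp_all
      then show "P i \<otimes> Q k \<oplus> (\<ominus> Q i) \<otimes> P k = \<zero>" using \<open>B = \<zero>\<close> by simp
    qed (use cl in simp_all)
    then have f3: "P i \<otimes> Q k = P k \<otimes> Q i" using m_comm[of "Q i" "P k"] cl by simp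
    have "P m \<otimes> Q n = P n \<otimes> Q m" if "m \<in> {i, j, k}" "n \<in> {i, j, k}" for m n
      using that f1 f2 f3 by (elim insertE emptyE) metis+
    then have "P m \<otimes> Q n = P n \<otimes> Q m" if "m < 3" "n < 3" for m n
      using that unfolding ijk by simp
    then show False using proportional_if_minors PQ by blast
  qed
  define M2 where "M2 = (\<Oplus>i\<in>{..<3}. c i \<otimes> P i [^] (2::nat) \<otimes> Q i [^] (2::nat))"
  define M4 where "M4 = (\<Oplus>i\<in>{..<3}. c i \<otimes> Q i [^] (4::nat))"
  have M: "M2 \<in> carrier R" "M4 \<in> carrier R" using c P Q by (auto simp: M2_def M4_def intro!: finsum_closed)
  define U where "U m = Q j \<otimes> P m \<oplus> (\<ominus> P j) \<otimes> Q m" for m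
  define W where "W m = (\<ominus> Q i) \<otimes> P m \<oplus> P i \<otimes> Q m" for m
  have UW: "U m \<in> carrier R" "W m \<in> carrier R" if "m < 3" for m using that P Q cl by (auto simp: U_def W_def)
  have U: "U i = D" "U k = A" and W: "W k = B" by (simp_all add: U_def W_def D_def A_def B_def)
  have Uj: "U j = \<zero>" unfolding U_def
    by (rule ring_identity[where ls="[P j, Q j]"], (rule reify)+, simp add: in_carrier_def cl, code_simp)
  have Wi: "W i = \<zero>" unfolding W_def
    by (rule ring_identity[where ls="[P i, Q i]"], (rule reify)+, simp add: in_carrier_def cl, code_simp)
  have Wj: "W j = D" unfolding W_def D_def
    by (rule ring_identity[where ls="[P i, P j, Q i, Q j]"], (rule reify)+, simp add: in_carrier_def cl, code_simp)
  note U = U Uj and W = W Wi Wj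
  note S = quartic_sums[OF c(1) P Q _ _ _ _ m0 m1 M2_def[symmetric] m3 M4_def[symmetric]]
  note SU = S[of "Q j" "\<ominus> P j" "\<ominus> Q i" "P i", folded U_def W_def]
  note SW = S[of "\<ominus> Q i" "P i" "Q j" "\<ominus> P j", folded U_def W_def]
  have sum: "(\<Oplus>m\<in>{..<3}. g m) = g i \<oplus> (g j \<oplus> g k)" if "\<And>m. m < 3 \<Longrightarrow> g m \<in> carrier R" for g
    using finsum_perm_3[OF ijk, of g] that by blast
  have E0: "c i \<otimes> D [^] (4::nat) \<oplus> c k \<otimes> A [^] (4::nat) = \<guillemotleft>6\<guillemotright> \<otimes> Q j [^] (2::nat) \<otimes> (\<ominus> P j) [^] (2::nat) \<otimes> M2 \<oplus> (\<ominus> P j) [^] (4::nat) \<otimes> M4"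
    using SU(1) sum[of "\<lambda>i. c i \<otimes> U i [^] (4::nat)"] c UW U cl DAB by (simp add: nat_pow_zero)
  have E4: "c j \<otimes> D [^] (4::nat) \<oplus> c k \<otimes> B [^] (4::nat) = \<guillemotleft>6\<guillemotright> \<otimes> (\<ominus> Q i) [^] (2::nat) \<otimes> P i [^] (2::nat) \<otimes> M2 \<oplus> P i [^] (4::nat) \<otimes> M4"
    using SW(1) sum[of "\<lambda>i. c i \<otimes> W i [^] (4::nat)"] c UW W cl DAB by (simp add: nat_pow_zero)
  have E1: "c k \<otimes> A [^] (3::nat) \<otimes> B = \<guillemotleft>3\<guillemotright> \<otimes> Q j \<otimes> (\<ominus> P j) \<otimes> (Q j \<otimes> P i \<oplus> (\<ominus> P j) \<otimes> (\<ominus> Q i)) \<otimes> M2 \<oplus> (\<ominus> P j) [^] (3::nat) \<otimes> P i \<otimes> M4"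
    using SU(2) sum[of "\<lambda>i. c i \<otimes> U i [^] (3::nat) \<otimes> W i"] c UW U W cl DAB by (simp add: nat_pow_zero)
  have E3: "c k \<otimes> B [^] (3::nat) \<otimes> A = \<guillemotleft>3\<guillemotright> \<otimes> (\<ominus> Q i) \<otimes> P i \<otimes> ((\<ominus> Q i) \<otimes> (\<ominus> P j) \<oplus> P i \<otimes> Q j) \<otimes> M2 \<oplus> P i [^] (3::nat) \<otimes> (\<ominus> P j) \<otimes> M4"
    using SW(2) sum[of "\<lambda>i. c i \<otimes> W i [^] (3::nat) \<otimes> U i"] c UW U W cl DAB by (simp add: nat_pow_zero)
  have E2: "c k \<otimes> A [^] (2::nat) \<otimes> B [^] (2::nat) = (Q j [^] (2::nat) \<otimes> P i [^] (2::nat) \<oplus> \<guillemotleft>4\<guillemotright> \<otimes> Q j \<otimes> (\<ominus> P j) \<otimes> (\<ominus> Q i) \<otimes> P i \<oplus> (\<ominus> P j) [^] (2::nat) \<otimes> (\<ominus> Q i) [^] (2::nat)) \<otimes> M2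
      \<oplus> (\<ominus> P j) [^] (2::nat) \<otimes> P i [^] (2::nat) \<otimes> M4"
    using SU(3) sum[of "\<lambda>i. c i \<otimes> U i [^] (2::nat) \<otimes> W i [^] (2::nat)"] c UW U W cl DAB by (simp add: nat_pow_zero)
  have E3': "c k \<otimes> A \<otimes> B [^] (3::nat) = c k \<otimes> B [^] (3::nat) \<otimes> A" using cl DAB by (simp add: m_ac)
  have "\<exists>\<kappa> p q r. \<kappa> \<in> carrier R \<and> p \<in> carrier R \<and> q \<in> carrier R \<and> r \<in> carrier R \<and>
     c i \<otimes> D [^] (4::nat) \<oplus> c k \<otimes> A [^] (4::nat) = \<kappa> \<otimes> p [^] (2::nat) \<and>
     \<guillemotleft>2\<guillemotright> \<otimes> (c k \<otimes> A [^] (3::nat) \<otimes> B) = \<kappa> \<otimes> p \<otimes> q \<and>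
     \<guillemotleft>6\<guillemotright> \<otimes> (c k \<otimes> A [^] (2::nat) \<otimes> B [^] (2::nat)) = \<kappa> \<otimes> (q [^] (2::nat) \<oplus> \<guillemotleft>2\<guillemotright> \<otimes> p \<otimes> r) \<and>
     \<guillemotleft>2\<guillemotright> \<otimes> (c k \<otimes> A \<otimes> B [^] (3::nat)) = \<kappa> \<otimes> q \<otimes> r \<and>
     c j \<otimes> D [^] (4::nat) \<oplus> c k \<otimes> B [^] (4::nat) = \<kappa> \<otimes> r [^] (2::nat)"
  proof (cases "M4 = \<zero>")
    case True
    show ?thesis
      unfolding E0 E1 E2 E3' E3 E4 True
      apply (rule exI[of _ "\<guillemotleft>6\<guillemotright> \<otimes> M2"], rule exI[of _ "Q j \<otimes> (\<ominus> P j)"], rule exI[of _ "Q j \<otimes> P i \<oplus> P j \<otimes> Q i"], rule exI[of _ "(\<ominus> Q i) \<otimes> P i"])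
      apply (intro conjI)
      using cl M apply simp_all[4]
      apply (rule ring_identity[where ls="[P i, P j, Q i, Q j, M2]"], (rule reify)+, simp add: in_carrier_def cl M, code_simp)+
      done
  next
    case False
    then have z: "\<guillemotleft>6\<guillemotright> \<otimes> M2 = \<zero>" using m24 by (simp add: M2_def M4_def)
    have z0: "c i \<otimes> D [^] (4::nat) \<oplus> c k \<otimes> A [^] (4::nat) = Q j [^] (2::nat) \<otimes> (\<ominus> P j) [^] (2::nat) \<otimes> (\<guillemotleft>6\<guillemotright> \<otimes> M2) \<oplus> (\<ominus> P j) [^] (4::nat) \<otimes> M4"
      unfolding E0 by (rule ring_identity[where ls="[P i, P j, Q i, Q j, M2, M4]"], (rule reify)+, simp add: in_carrier_def cl M, code_simp)
    have z1: "\<guillemotleft>2\<guillemotright> \<otimes> (c k \<otimes> A [^] (3::nat) \<otimes> B) = Q j \<otimes> (\<ominus> P j) \<otimes> (Q j \<otimes> P i \<oplus> (\<ominus> P j) \<otimes> (\<ominus> Q i)) \<otimes> (\<guillemotleft>6\<guillemotright> \<otimes> M2) \<oplus> \<guillemotleft>2\<guillemotright> \<otimes> (\<ominus> P j) [^] (3::nat) \<otimes> P i \<otimes> M4"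
      unfolding E1 by (rule ring_identity[where ls="[P i, P j, Q i, Q j, M2, M4]"], (rule reify)+, simp add: in_carrier_def cl M, code_simp)
    have z2: "\<guillemotleft>6\<guillemotright> \<otimes> (c k \<otimes> A [^] (2::nat) \<otimes> B [^] (2::nat)) = (Q j [^] (2::nat) \<otimes> P i [^] (2::nat) \<oplus> \<guillemotleft>4\<guillemotright> \<otimes> Q j \<otimes> (\<ominus> P j) \<otimes> (\<ominus> Q i) \<otimes> P i \<oplus> (\<ominus> P j) [^] (2::nat) \<otimes> (\<ominus> Q i) [^] (2::nat)) \<otimes> (\<guillemotleft>6\<guillemotright> \<otimes> M2)
      \<oplus> \<guillemotleft>6\<guillemotright> \<otimes> (\<ominus> P j) [^] (2::nat) \<otimes> P i [^] (2::nat) \<otimes> M4"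
      unfolding E2 by (rule ring_identity[where ls="[P i, P j, Q i, Q j, M2, M4]"], (rule reify)+, simp add: in_carrier_def cl M, code_simp)
    have z3: "\<guillemotleft>2\<guillemotright> \<otimes> (c k \<otimes> A \<otimes> B [^] (3::nat)) = (\<ominus> Q i) \<otimes> P i \<otimes> ((\<ominus> Q i) \<otimes> (\<ominus> P j) \<oplus> P i \<otimes> Q j) \<otimes> (\<guillemotleft>6\<guillemotright> \<otimes> M2) \<oplus> \<guillemotleft>2\<guillemotright> \<otimes> P i [^] (3::nat) \<otimes> (\<ominus> P j) \<otimes> M4"
      unfolding E3' E3 by (rule ring_identity[where ls="[P i, P j, Q i, Q j, M2, M4]"], (rule reify)+, simp add: in_carrier_def cl M, code_simp)
    have z4: "c j \<otimes> D [^] (4::nat) \<oplus> c k \<otimes> B [^] (4::nat) = (\<ominus> Q i) [^] (2::nat) \<otimes> P i [^] (2::nat) \<otimes> (\<guillemotleft>6\<guillemotright> \<otimes> M2) \<oplus> P i [^] (4::nat) \<otimes> M4"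
      unfolding E4 by (rule ring_identity[where ls="[P i, P j, Q i, Q j, M2, M4]"], (rule reify)+, simp add: in_carrier_def cl M, code_simp)
    show ?thesis
      unfolding z0 z1 z2 z3 z4 z
      apply (rule exI[of _ M4], rule exI[of _ "P j [^] (2::nat)"], rule exI[of _ "\<ominus> (\<guillemotleft>2\<guillemotright> \<otimes> P j \<otimes> P i)"], rule exI[of _ "P i [^] (2::nat)"])
      apply (intro conjI)
      using cl M apply simp_all[4]
      apply (rule ring_identity[where ls="[P i, P j, Q i, Q j, M4]"], (rule reify)+, simp add: in_carrier_def cl M, code_simp)+
      done
  qed
  then obtain \<kappa> p q r where sq: "\<kappa> \<in> carrier R" "p \<in> carrier R" "q \<in> carrier R" "r \<in> carrier R"
     "c i \<otimes> D [^] (4::nat) \<oplus> c k \<otimes> A [^] (4::nat) = \<kappa> \<otimes> p [^] (2::nat)"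
     "\<guillemotleft>2\<guillemotright> \<otimes> (c k \<otimes> A [^] (3::nat) \<otimes> B) = \<kappa> \<otimes> p \<otimes> q"
     "\<guillemotleft>6\<guillemotright> \<otimes> (c k \<otimes> A [^] (2::nat) \<otimes> B [^] (2::nat)) = \<kappa> \<otimes> (q [^] (2::nat) \<oplus> \<guillemotleft>2\<guillemotright> \<otimes> p \<otimes> r)"
     "\<guillemotleft>2\<guillemotright> \<otimes> (c k \<otimes> A \<otimes> B [^] (3::nat)) = \<kappa> \<otimes> q \<otimes> r"
     "c j \<otimes> D [^] (4::nat) \<oplus> c k \<otimes> B [^] (4::nat) = \<kappa> \<otimes> r [^] (2::nat)"
    by blast
  have fin: "c i \<otimes> D [^] (4::nat) = c k \<otimes> A [^] (4::nat) \<and> c j \<otimes> D [^] (4::nat) = c k \<otimes> B [^] (4::nat)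
    \<or> c j \<otimes> D [^] (4::nat) \<oplus> c k \<otimes> B [^] (4::nat) = \<zero>
    \<or> c i \<otimes> D [^] (4::nat) \<oplus> c k \<otimes> A [^] (4::nat) = \<zero>"
    by (rule diag_restriction_square[OF two cl(7,8,9) DAB(2,3,1) c(2)[OF lt(1)] c(2)[OF lt(2)] c(2)[OF lt(3)] D0 sq])
  \<comment> \<open>On the line, \<open>A / D = - l i / l k\<close> and \<open>B / D = - l j / l k\<close>.\<close>
  have D4: "D [^] (4::nat) \<noteq> \<zero>" "D [^] (4::nat) \<in> carrier R" using D0 DAB nat_pow_ne_zero by auto
  have kA4: "l k [^] (4::nat) \<otimes> A [^] (4::nat) = l i [^] (4::nat) \<otimes> D [^] (4::nat)"
  proof -
    have "l k [^] (4::nat) \<otimes> A [^] (4::nat) = (\<ominus> (l i \<otimes> D)) [^] (4::nat)"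
      using cl DAB by (simp add: kA[symmetric] nat_pow_distrib)
    also have "\<dots> = l i [^] (4::nat) \<otimes> D [^] (4::nat)"
      by (rule ring_identity[where ls="[l i, D]"], (rule reify)+, simp add: in_carrier_def cl DAB, code_simp)
    finally show ?thesis .
  qed
  have kB4: "l k [^] (4::nat) \<otimes> B [^] (4::nat) = l j [^] (4::nat) \<otimes> D [^] (4::nat)"
  proof -
    have "l k [^] (4::nat) \<otimes> B [^] (4::nat) = (\<ominus> (l j \<otimes> D)) [^] (4::nat)"
      using cl DAB by (simp add: kB[symmetric] nat_pow_distrib)
    also have "\<dots> = l j [^] (4::nat) \<otimes> D [^] (4::nat)"
      by (rule ring_identity[where ls="[l j, D]"], (rule reify)+, simp add: in_carrier_def cl DAB, code_simp)
    finally show ?thesis .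
  qed
  have tr_eq: "x \<otimes> lk = y \<otimes> z" if "x \<otimes> d = y \<otimes> a" "lk \<otimes> a = z \<otimes> d" "x \<in> carrier R" "y \<in> carrier R" "z \<in> carrier R"
     "lk \<in> carrier R" "a \<in> carrier R" "d \<in> carrier R" "d \<noteq> \<zero>" for x y z lk a d
  proof -
    have "d \<otimes> (x \<otimes> lk) = (x \<otimes> d) \<otimes> lk" using that(3-8) by (simp add: m_ac)
    also have "\<dots> = (y \<otimes> a) \<otimes> lk" by (simp only: that(1))
    also have "\<dots> = y \<otimes> (lk \<otimes> a)" using that(3-8) by (simp add: m_ac)
    also have "\<dots> = y \<otimes> (z \<otimes> d)" by (simp only: that(2))
    also have "\<dots> = d \<otimes> (y \<otimes> z)" using that(3-8) by (simp add: m_ac)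
    finally show ?thesis using that m_lcancel by simp
  qed
  have neg: "x \<oplus> y = \<zero> \<longleftrightarrow> x = \<ominus> y" if "x \<in> carrier R" "y \<in> carrier R" for x y
    using that minus_equality[of x y] l_neg[of y] by auto
  have tr_neg: "x \<otimes> lk \<oplus> y \<otimes> z = \<zero>" if "x \<otimes> d \<oplus> y \<otimes> a = \<zero>" "lk \<otimes> a = z \<otimes> d" "x \<in> carrier R" "y \<in> carrier R" "z \<in> carrier R"
     "lk \<in> carrier R" "a \<in> carrier R" "d \<in> carrier R" "d \<noteq> \<zero>" for x y z lk a d
  proof -
    have "x \<otimes> d = \<ominus> (y \<otimes> a)" using neg[of "x \<otimes> d" "y \<otimes> a"] that(1,3-8) by simp
    then have "x \<otimes> d = (\<ominus> y) \<otimes> a" using that(3-8) by (simp only: l_minus)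
    from tr_eq[OF this that(2) that(3) a_inv_closed[OF that(4)] that(5-9)]
    have "x \<otimes> lk = \<ominus> (y \<otimes> z)" using that(3-8) by (simp only: l_minus)
    then show ?thesis using neg[of "x \<otimes> lk" "y \<otimes> z"] that(3-8) by simp
  qed
  have pw: "l i [^] (4::nat) \<in> carrier R" "l j [^] (4::nat) \<in> carrier R" "l k [^] (4::nat) \<in> carrier R"
    "A [^] (4::nat) \<in> carrier R" "B [^] (4::nat) \<in> carrier R" using cl DAB by simp_all
  note r1 = tr_eq[OF _ kA4 cl(7,9) pw(1,3,4) D4(2,1)] and r2 = tr_eq[OF _ kB4 cl(8,9) pw(2,3,5) D4(2,1)]
    and r3 = tr_neg[OF _ kA4 cl(7,9) pw(1,3,4) D4(2,1)] and r4 = tr_neg[OF _ kB4 cl(8,9) pw(2,3,5) D4(2,1)]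
  show ?thesis using fin r1 r2 r3 r4 by blast
qed

end

section \<open>Tangency and intersection multiplicities\<close>

lemma (in ring_hom_cring) hom_nat_power: "x \<in> carrier R \<Longrightarrow> h (x [^] (n::nat)) = h x [^]\<^bsub>S\<^esub> n"
  by (induction n) simp_all

context field
begin

text \<open>The existential conclusion is the Euler relation in polarized form: the linear form of the tangent
  is a multiple of \<open>\<Sum> c i P i ^ 3 Y i\<close>, so it can be evaluated at any point \<open>Y\<close> of the line.\<close>

lemma tangent_diagD:
  assumes two: "\<guillemotleft>2\<guillemotright> \<noteq> \<zero>"
    and c: "\<And>i. i < 3 \<Longrightarrow> c i \<in> carrier R" and P: "P \<in> hom_coords R" and t: "tangent_at R (diag_form R 4 c) l P"
  shows "(\<Oplus>i\<in>{..<3}. c i \<otimes> P i [^] (4::nat)) = \<zero>"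
    and "\<exists>d\<in>carrier R. d \<noteq> \<zero> \<and> (\<forall>Y. (\<forall>i<3. Y i \<in> carrier R) \<longrightarrow>
      (\<Oplus>i\<in>{..<3}. l i \<otimes> Y i) = d \<otimes> (\<Oplus>i\<in>{..<3}. c i \<otimes> P i [^] (3::nat) \<otimes> Y i))"
proof -
  have Pc: "P i \<in> carrier R" if "i < 3" for i using P that by (auto simp: hom_coords_def)
  show "(\<Oplus>i\<in>{..<3}. c i \<otimes> P i [^] (4::nat)) = \<zero>"
    using t eval_diag_form[of 4 c P] c Pc by (simp add: tangent_at_def on_curve_def)
  obtain e where e: "e \<in> carrier R" "e \<noteq> \<zero>"
    "\<And>i. i < 3 \<Longrightarrow> l i = e \<otimes> eval_form R (partial_deriv R i (diag_form R 4 c)) P"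
    using t by (auto simp: tangent_at_def proportional_def)
  have li: "l i = (e \<otimes> \<guillemotleft>4\<guillemotright>) \<otimes> (c i \<otimes> P i [^] (3::nat))" if "i < 3" for i
    using e(1) e(3)[OF that] gradient_diag[of c P i] c Pc that by (simp add: m_assoc)
  have "e \<otimes> \<guillemotleft>4\<guillemotright> \<noteq> \<zero>" using e four_ne[OF two] by (simp add: integral_iff)
  moreover have "(\<Oplus>i\<in>{..<3}. l i \<otimes> Y i) = (e \<otimes> \<guillemotleft>4\<guillemotright>) \<otimes> (\<Oplus>i\<in>{..<3}. c i \<otimes> P i [^] (3::nat) \<otimes> Y i)"
    if Y: "\<forall>i<3. Y i \<in> carrier R" for Y
  proof -
    have "(\<Oplus>i\<in>{..<3}. l i \<otimes> Y i) = (\<Oplus>i\<in>{..<3}. (e \<otimes> \<guillemotleft>4\<guillemotright>) \<otimes> (c i \<otimes> P i [^] (3::nat) \<otimes> Y i))"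
    proof (rule add.finprod_cong')
      fix i :: nat assume "i \<in> {..<3}"
      then have i: "i < 3" by simp
      show "l i \<otimes> Y i = (e \<otimes> \<guillemotleft>4\<guillemotright>) \<otimes> (c i \<otimes> P i [^] (3::nat) \<otimes> Y i)"
        unfolding li[OF i] using e c[OF i] Pc[OF i] Y i by (simp add: m_assoc)
    qed (use e c Pc Y in auto)
    also have "\<dots> = (e \<otimes> \<guillemotleft>4\<guillemotright>) \<otimes> (\<Oplus>i\<in>{..<3}. c i \<otimes> P i [^] (3::nat) \<otimes> Y i)"
      by (rule finsum_rdistr[symmetric]) (use e c Pc Y in auto)
    finally show ?thesis .
  qed
  ultimately show "\<exists>d\<in>carrier R. d \<noteq> \<zero> \<and> (\<forall>Y. (\<forall>i<3. Y i \<in> carrier R) \<longrightarrow>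
      (\<Oplus>i\<in>{..<3}. l i \<otimes> Y i) = d \<otimes> (\<Oplus>i\<in>{..<3}. c i \<otimes> P i [^] (3::nat) \<otimes> Y i))"
    using e by (intro bexI[of _ "e \<otimes> \<guillemotleft>4\<guillemotright>"]) auto
qed

lemma poly_of_const_ring_hom_cring: "ring_hom_cring R (poly_ring R) poly_of_const"
  using canonical_embedding_ring_hom[OF carrier_is_subring] univ_poly_is_cring[OF carrier_is_subring] is_cring
  by (simp add: ring_hom_cring_def ring_hom_cring_axioms_def ring_hom_ring_def ring_hom_ring_axioms_def)

text \<open>Horner form of the binomial expansion, suited to reading off the order of vanishing at \<open>0\<close>.\<close>

lemma restrict_diag_form:
  assumes c: "\<And>i. i < 3 \<Longrightarrow> c i \<in> carrier R" and P: "\<And>i. i < 3 \<Longrightarrow> P i \<in> carrier R" and Q: "\<And>i. i < 3 \<Longrightarrow> Q i \<in> carrier R"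
  defines "m0 \<equiv> \<Oplus>i\<in>{..<3}. c i \<otimes> P i [^] (4::nat)"
    and "m1 \<equiv> \<Oplus>i\<in>{..<3}. c i \<otimes> P i [^] (3::nat) \<otimes> Q i"
    and "m2 \<equiv> \<Oplus>i\<in>{..<3}. c i \<otimes> P i [^] (2::nat) \<otimes> Q i [^] (2::nat)"
    and "m3 \<equiv> \<Oplus>i\<in>{..<3}. c i \<otimes> P i \<otimes> Q i [^] (3::nat)"
    and "m4 \<equiv> \<Oplus>i\<in>{..<3}. c i \<otimes> Q i [^] (4::nat)"
  shows "restrict_form R (diag_form R 4 c) P Q = poly_of_const m0 \<oplus>\<^bsub>poly_ring R\<^esub> X \<otimes>\<^bsub>poly_ring R\<^esub>
      (poly_of_const (\<guillemotleft>4\<guillemotright> \<otimes> m1) \<oplus>\<^bsub>poly_ring R\<^esub> X \<otimes>\<^bsub>poly_ring R\<^esub>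
      (poly_of_const (\<guillemotleft>6\<guillemotright> \<otimes> m2) \<oplus>\<^bsub>poly_ring R\<^esub> X \<otimes>\<^bsub>poly_ring R\<^esub>
      (poly_of_const (\<guillemotleft>4\<guillemotright> \<otimes> m3) \<oplus>\<^bsub>poly_ring R\<^esub> X \<otimes>\<^bsub>poly_ring R\<^esub> poly_of_const m4)))"
proof -
  interpret k: ring_hom_cring R "poly_ring R" poly_of_const by (rule poly_of_const_ring_hom_cring)
  let ?k = "poly_of_const" and ?P = "poly_ring R"
  have X: "X \<in> carrier ?P" using var_closed(1)[OF carrier_is_subring] .
  have M: "m0 \<in> carrier R" "m1 \<in> carrier R" "m2 \<in> carrier R" "m3 \<in> carrier R" "m4 \<in> carrier R"
    unfolding m0_def m1_def m2_def m3_def m4_def using c P Q by (auto intro!: finsum_closed)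
  have km: "?k m0 = finsum ?P (\<lambda>i. ?k (c i \<otimes> P i [^] (4::nat))) {..<3}"
     "?k m1 = finsum ?P (\<lambda>i. ?k (c i \<otimes> P i [^] (3::nat) \<otimes> Q i)) {..<3}"
     "?k m2 = finsum ?P (\<lambda>i. ?k (c i \<otimes> P i [^] (2::nat) \<otimes> Q i [^] (2::nat))) {..<3}"
     "?k m3 = finsum ?P (\<lambda>i. ?k (c i \<otimes> P i \<otimes> Q i [^] (3::nat))) {..<3}"
     "?k m4 = finsum ?P (\<lambda>i. ?k (c i \<otimes> Q i [^] (4::nat))) {..<3}"
    unfolding m0_def m1_def m2_def m3_def m4_def using c P Q
    by (subst k.hom_finsum; auto simp: comp_def)+
  have "restrict_form R (diag_form R 4 c) P Q =
     eval_form ?P (diag_form ?P 4 (?k \<circ> c)) (\<lambda>i. ?k (P i) \<oplus>\<^bsub>?P\<^esub> X \<otimes>\<^bsub>?P\<^esub> ?k (Q i))"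
    unfolding restrict_form_def by (subst diag_form_comp[where S = ?P]) auto
  also have "\<dots> = finsum ?P (\<lambda>i. ?k (c i) \<otimes>\<^bsub>?P\<^esub> (?k (P i) \<oplus>\<^bsub>?P\<^esub> X \<otimes>\<^bsub>?P\<^esub> ?k (Q i)) [^]\<^bsub>?P\<^esub> (4::nat)) {..<3}"
    by (subst k.S.eval_diag_form) (use c P Q X in auto)
  also have "\<dots> = \<one>\<^bsub>?P\<^esub> \<otimes>\<^bsub>?P\<^esub> finsum ?P (\<lambda>i. ?k (c i \<otimes> P i [^] (4::nat))) {..<3} \<oplus>\<^bsub>?P\<^esub>
     (\<guillemotleft>4\<guillemotright>\<^bsub>?P\<^esub> \<otimes>\<^bsub>?P\<^esub> X \<otimes>\<^bsub>?P\<^esub> finsum ?P (\<lambda>i. ?k (c i \<otimes> P i [^] (3::nat) \<otimes> Q i)) {..<3} \<oplus>\<^bsub>?P\<^esub>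
     (\<guillemotleft>6\<guillemotright>\<^bsub>?P\<^esub> \<otimes>\<^bsub>?P\<^esub> X [^]\<^bsub>?P\<^esub> (2::nat) \<otimes>\<^bsub>?P\<^esub> finsum ?P (\<lambda>i. ?k (c i \<otimes> P i [^] (2::nat) \<otimes> Q i [^] (2::nat))) {..<3} \<oplus>\<^bsub>?P\<^esub>
     (\<guillemotleft>4\<guillemotright>\<^bsub>?P\<^esub> \<otimes>\<^bsub>?P\<^esub> X [^]\<^bsub>?P\<^esub> (3::nat) \<otimes>\<^bsub>?P\<^esub> finsum ?P (\<lambda>i. ?k (c i \<otimes> P i \<otimes> Q i [^] (3::nat))) {..<3} \<oplus>\<^bsub>?P\<^esub>
     X [^]\<^bsub>?P\<^esub> (4::nat) \<otimes>\<^bsub>?P\<^esub> finsum ?P (\<lambda>i. ?k (c i \<otimes> Q i [^] (4::nat))) {..<3})))"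
  proof (rule k.S.finsum_lincomb5)
    fix i :: nat assume "i \<in> {..<3}"
    then have cl: "c i \<in> carrier R" "P i \<in> carrier R" "Q i \<in> carrier R" using c P Q by auto
    then have kcl: "?k (c i) \<in> carrier ?P" "?k (P i) \<in> carrier ?P" "?k (Q i) \<in> carrier ?P" by auto
    have "?k (c i) \<otimes>\<^bsub>?P\<^esub> (?k (P i) \<oplus>\<^bsub>?P\<^esub> X \<otimes>\<^bsub>?P\<^esub> ?k (Q i)) [^]\<^bsub>?P\<^esub> (4::nat) =
      \<one>\<^bsub>?P\<^esub> \<otimes>\<^bsub>?P\<^esub> (?k (c i) \<otimes>\<^bsub>?P\<^esub> ?k (P i) [^]\<^bsub>?P\<^esub> (4::nat)) \<oplus>\<^bsub>?P\<^esub>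
     (\<guillemotleft>4\<guillemotright>\<^bsub>?P\<^esub> \<otimes>\<^bsub>?P\<^esub> X \<otimes>\<^bsub>?P\<^esub> (?k (c i) \<otimes>\<^bsub>?P\<^esub> ?k (P i) [^]\<^bsub>?P\<^esub> (3::nat) \<otimes>\<^bsub>?P\<^esub> ?k (Q i)) \<oplus>\<^bsub>?P\<^esub>
     (\<guillemotleft>6\<guillemotright>\<^bsub>?P\<^esub> \<otimes>\<^bsub>?P\<^esub> X [^]\<^bsub>?P\<^esub> (2::nat) \<otimes>\<^bsub>?P\<^esub> (?k (c i) \<otimes>\<^bsub>?P\<^esub> ?k (P i) [^]\<^bsub>?P\<^esub> (2::nat) \<otimes>\<^bsub>?P\<^esub> ?k (Q i) [^]\<^bsub>?P\<^esub> (2::nat)) \<oplus>\<^bsub>?P\<^esub>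
     (\<guillemotleft>4\<guillemotright>\<^bsub>?P\<^esub> \<otimes>\<^bsub>?P\<^esub> X [^]\<^bsub>?P\<^esub> (3::nat) \<otimes>\<^bsub>?P\<^esub> (?k (c i) \<otimes>\<^bsub>?P\<^esub> ?k (P i) \<otimes>\<^bsub>?P\<^esub> ?k (Q i) [^]\<^bsub>?P\<^esub> (3::nat)) \<oplus>\<^bsub>?P\<^esub>
     X [^]\<^bsub>?P\<^esub> (4::nat) \<otimes>\<^bsub>?P\<^esub> (?k (c i) \<otimes>\<^bsub>?P\<^esub> ?k (Q i) [^]\<^bsub>?P\<^esub> (4::nat)))))"
      by (rule k.S.ring_identity[where ls="[?k (c i), ?k (P i), ?k (Q i), X]"], (rule k.S.reify)+, simp add: k.S.in_carrier_def kcl X, code_simp)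
    then show "?k (c i) \<otimes>\<^bsub>?P\<^esub> (?k (P i) \<oplus>\<^bsub>?P\<^esub> X \<otimes>\<^bsub>?P\<^esub> ?k (Q i)) [^]\<^bsub>?P\<^esub> (4::nat) =
      \<one>\<^bsub>?P\<^esub> \<otimes>\<^bsub>?P\<^esub> (?k (c i \<otimes> P i [^] (4::nat))) \<oplus>\<^bsub>?P\<^esub>
     (\<guillemotleft>4\<guillemotright>\<^bsub>?P\<^esub> \<otimes>\<^bsub>?P\<^esub> X \<otimes>\<^bsub>?P\<^esub> (?k (c i \<otimes> P i [^] (3::nat) \<otimes> Q i)) \<oplus>\<^bsub>?P\<^esub>
     (\<guillemotleft>6\<guillemotright>\<^bsub>?P\<^esub> \<otimes>\<^bsub>?P\<^esub> X [^]\<^bsub>?P\<^esub> (2::nat) \<otimes>\<^bsub>?P\<^esub> (?k (c i \<otimes> P i [^] (2::nat) \<otimes> Q i [^] (2::nat))) \<oplus>\<^bsub>?P\<^esub>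
     (\<guillemotleft>4\<guillemotright>\<^bsub>?P\<^esub> \<otimes>\<^bsub>?P\<^esub> X [^]\<^bsub>?P\<^esub> (3::nat) \<otimes>\<^bsub>?P\<^esub> (?k (c i \<otimes> P i \<otimes> Q i [^] (3::nat))) \<oplus>\<^bsub>?P\<^esub>
     X [^]\<^bsub>?P\<^esub> (4::nat) \<otimes>\<^bsub>?P\<^esub> (?k (c i \<otimes> Q i [^] (4::nat))))))"
      using cl by (simp only: k.hom_mult k.hom_nat_power m_closed nat_pow_closed)
  qed (use c P Q X in auto)
  also have "\<dots> = ?k m0 \<oplus>\<^bsub>?P\<^esub> X \<otimes>\<^bsub>?P\<^esub> (\<guillemotleft>4\<guillemotright>\<^bsub>?P\<^esub> \<otimes>\<^bsub>?P\<^esub> ?k m1 \<oplus>\<^bsub>?P\<^esub> X \<otimes>\<^bsub>?P\<^esub>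
      (\<guillemotleft>6\<guillemotright>\<^bsub>?P\<^esub> \<otimes>\<^bsub>?P\<^esub> ?k m2 \<oplus>\<^bsub>?P\<^esub> X \<otimes>\<^bsub>?P\<^esub>
      (\<guillemotleft>4\<guillemotright>\<^bsub>?P\<^esub> \<otimes>\<^bsub>?P\<^esub> ?k m3 \<oplus>\<^bsub>?P\<^esub> X \<otimes>\<^bsub>?P\<^esub> ?k m4)))"
    unfolding km[symmetric]
    by (rule k.S.ring_identity[where ls="[?k m0, ?k m1, ?k m2, ?k m3, ?k m4, X]"], (rule k.S.reify)+, simp add: k.S.in_carrier_def M X, code_simp)
  finally show ?thesis using M by (simp only: k.hom_mult k.hom_of_int of_int_closed)
qed

text \<open>The constant coefficient is split off in order to peel off the coefficients of a Horner form one by one.\<close>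

lemma var_pow_pdivides_horner:
  assumes a: "b \<in> carrier R" and t: "t \<in> carrier (poly_ring R)"
    and d: "X [^]\<^bsub>poly_ring R\<^esub> Suc n pdivides (poly_of_const b \<oplus>\<^bsub>poly_ring R\<^esub> X \<otimes>\<^bsub>poly_ring R\<^esub> t)"
  shows "b = \<zero>" "X [^]\<^bsub>poly_ring R\<^esub> n pdivides t"
proof -
  interpret P: domain "poly_ring R" using univ_poly_is_domain[OF carrier_is_subring] .
  interpret k: ring_hom_cring R "poly_ring R" poly_of_const by (rule poly_of_const_ring_hom_cring)
  have X: "X \<in> carrier (poly_ring R)" using var_closed(1)[OF carrier_is_subring] .
  have X0: "X \<noteq> \<zero>\<^bsub>poly_ring R\<^esub>" by (simp add: var_def univ_poly_zero)
  obtain q where q: "q \<in> carrier (poly_ring R)"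
     "poly_of_const b \<oplus>\<^bsub>poly_ring R\<^esub> X \<otimes>\<^bsub>poly_ring R\<^esub> t = X [^]\<^bsub>poly_ring R\<^esub> Suc n \<otimes>\<^bsub>poly_ring R\<^esub> q"
    using d by (auto simp: pdivides_def factor_def)
  have e: "X [^]\<^bsub>poly_ring R\<^esub> Suc n \<otimes>\<^bsub>poly_ring R\<^esub> q = X \<otimes>\<^bsub>poly_ring R\<^esub> (X [^]\<^bsub>poly_ring R\<^esub> n \<otimes>\<^bsub>poly_ring R\<^esub> q)"
    using X q by (simp add: P.m_ac)
  have r: "X [^]\<^bsub>poly_ring R\<^esub> n \<otimes>\<^bsub>poly_ring R\<^esub> q \<in> carrier (poly_ring R)" using X q by simp
  note ct = const_term_simprules_shell[OF carrier_is_subring]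
  have ctX: "const_term X = \<zero>" by (simp add: const_term_def eval_var)
  have "const_term (poly_of_const b) = b" using a by (simp add: const_term_def poly_of_const_def)
  moreover have "const_term (poly_of_const b \<oplus>\<^bsub>poly_ring R\<^esub> X \<otimes>\<^bsub>poly_ring R\<^esub> t) = const_term (poly_of_const b) \<oplus> const_term X \<otimes> const_term t"
    using a t X ct(2)[OF X t] ct(3)[of "poly_of_const b" "X \<otimes>\<^bsub>poly_ring R\<^esub> t"] by simp
  moreover have "const_term (X \<otimes>\<^bsub>poly_ring R\<^esub> (X [^]\<^bsub>poly_ring R\<^esub> n \<otimes>\<^bsub>poly_ring R\<^esub> q)) = const_term X \<otimes> const_term (X [^]\<^bsub>poly_ring R\<^esub> n \<otimes>\<^bsub>poly_ring R\<^esub> q)"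
    by (rule ct(2)[OF X r])
  ultimately show "b = \<zero>" using q(2) e ctX ct(1)[OF t] ct(1)[OF r] a by simp
  then have "X \<otimes>\<^bsub>poly_ring R\<^esub> t = X \<otimes>\<^bsub>poly_ring R\<^esub> (X [^]\<^bsub>poly_ring R\<^esub> n \<otimes>\<^bsub>poly_ring R\<^esub> q)"
    using q(2) X t unfolding e by simp
  then have "t = X [^]\<^bsub>poly_ring R\<^esub> n \<otimes>\<^bsub>poly_ring R\<^esub> q" using P.m_lcancel[OF X0 X t r] by blast
  then show "X [^]\<^bsub>poly_ring R\<^esub> n pdivides t" using q(1) unfolding pdivides_def factor_def by blast
qed

text \<open>Both kinds of bitangents yield points \<open>P\<close> and \<open>Q\<close> spanning the line on which the restricted form is
  \<open>6 M2 x^2 y^2\<close> (contact at \<open>P\<close> and at \<open>Q\<close>) or \<open>M4 y^4\<close> (fourfold contact at \<open>P\<close>).\<close>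

lemma bitangent_diag_data:
  assumes two: "\<guillemotleft>2\<guillemotright> \<noteq> \<zero>"
    and c: "\<And>i. i < 3 \<Longrightarrow> c i \<in> carrier R"
    and b: "bitangent R (diag_form R 4 c) l"
  shows "\<exists>P Q. P \<in> hom_coords R \<and> Q \<in> hom_coords R \<and> \<not> proportional R P Q \<and> on_line R l P \<and> on_line R l Q
    \<and> (\<Oplus>i\<in>{..<3}. c i \<otimes> P i [^] (4::nat)) = \<zero>
    \<and> (\<Oplus>i\<in>{..<3}. c i \<otimes> P i [^] (3::nat) \<otimes> Q i) = \<zero>
    \<and> (\<Oplus>i\<in>{..<3}. c i \<otimes> P i \<otimes> Q i [^] (3::nat)) = \<zero>
    \<and> (\<guillemotleft>6\<guillemotright> \<otimes> (\<Oplus>i\<in>{..<3}. c i \<otimes> P i [^] (2::nat) \<otimes> Q i [^] (2::nat)) = \<zero> \<or> (\<Oplus>i\<in>{..<3}. c i \<otimes> Q i [^] (4::nat)) = \<zero>)"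
  using b unfolding bitangent_def
proof (elim disjE bexE conjE)
  fix P Q assume P: "P \<in> hom_coords R" and Q: "Q \<in> hom_coords R" and PQ: "\<not> proportional R P Q"
    and tP: "tangent_at R (diag_form R 4 c) l P" and tQ: "tangent_at R (diag_form R 4 c) l Q"
  have Pc: "\<forall>i<3. P i \<in> carrier R" using P by (auto simp: hom_coords_def)
  have Qc: "\<forall>i<3. Q i \<in> carrier R" using Q by (auto simp: hom_coords_def)
  note P4 = tangent_diagD(1)[OF two c P tP] and Q4 = tangent_diagD(1)[OF two c Q tQ]
  obtain dP where dP: "dP \<in> carrier R" "dP \<noteq> \<zero>" "\<And>Y. \<forall>i<3. Y i \<in> carrier R \<Longrightarrow>
      (\<Oplus>i\<in>{..<3}. l i \<otimes> Y i) = dP \<otimes> (\<Oplus>i\<in>{..<3}. c i \<otimes> P i [^] (3::nat) \<otimes> Y i)"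
    using tangent_diagD(2)[OF two c P tP] by blast
  obtain dQ where dQ: "dQ \<in> carrier R" "dQ \<noteq> \<zero>" "\<And>Y. \<forall>i<3. Y i \<in> carrier R \<Longrightarrow>
      (\<Oplus>i\<in>{..<3}. l i \<otimes> Y i) = dQ \<otimes> (\<Oplus>i\<in>{..<3}. c i \<otimes> Q i [^] (3::nat) \<otimes> Y i)"
    using tangent_diagD(2)[OF two c Q tQ] by blast
  have four: "(\<Oplus>i\<in>{..<3}. c i \<otimes> Y i [^] (3::nat) \<otimes> Y i) = (\<Oplus>i\<in>{..<3}. c i \<otimes> Y i [^] (4::nat))" if "\<forall>i<3. Y i \<in> carrier R" for Y
    by (rule add.finprod_cong') (use c that in \<open>auto simp: m_assoc numeral_eq_Suc\<close>)
  have lP: "(\<Oplus>i\<in>{..<3}. l i \<otimes> P i) = \<zero>" using dP(1) dP(3)[OF Pc] four[OF Pc] P4 by simp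
  have lQ: "(\<Oplus>i\<in>{..<3}. l i \<otimes> Q i) = \<zero>" using dQ(1) dQ(3)[OF Qc] four[OF Qc] Q4 by simp
  have S1: "(\<Oplus>i\<in>{..<3}. c i \<otimes> P i [^] (3::nat) \<otimes> Q i) \<in> carrier R" using c Pc Qc by (auto intro!: finsum_closed)
  have S2: "(\<Oplus>i\<in>{..<3}. c i \<otimes> Q i [^] (3::nat) \<otimes> P i) \<in> carrier R" using c Pc Qc by (auto intro!: finsum_closed)
  have 1: "(\<Oplus>i\<in>{..<3}. c i \<otimes> P i [^] (3::nat) \<otimes> Q i) = \<zero>"
    using lQ dP(3)[OF Qc] zero_eq_mult_cancel[OF _ dP(2,1) S1] by simp
  have 2: "(\<Oplus>i\<in>{..<3}. c i \<otimes> Q i [^] (3::nat) \<otimes> P i) = \<zero>"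
    using lP dQ(3)[OF Pc] zero_eq_mult_cancel[OF _ dQ(2,1) S2] by simp
  have "(\<Oplus>i\<in>{..<3}. c i \<otimes> P i \<otimes> Q i [^] (3::nat)) = (\<Oplus>i\<in>{..<3}. c i \<otimes> Q i [^] (3::nat) \<otimes> P i)"
    by (rule add.finprod_cong') (use c Pc Qc in \<open>auto simp: m_ac\<close>)
  with P Q PQ lP lQ P4 Q4 1 2 show ?thesis
    by (intro exI[of _ P] exI[of _ Q]) (simp add: on_line_def)
next
  fix P assume P: "P \<in> hom_coords R" and lP: "on_line R l P" and cP: "on_curve R (diag_form R 4 c) P"
    and m: "meets_with_mult R (diag_form R 4 c) l P 4"
  obtain Q where Q: "Q \<in> hom_coords R" "on_line R l Q" "\<not> proportional R P Q"
    "restrict_form R (diag_form R 4 c) P Q \<noteq> \<zero>\<^bsub>poly_ring R\<^esub>"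
    "alg_mult (restrict_form R (diag_form R 4 c) P Q) \<zero> = 4"
    using m by (auto simp: meets_with_mult_def)
  have Pc: "P i \<in> carrier R" if "i < 3" for i using P that by (auto simp: hom_coords_def)
  have Qc: "Q i \<in> carrier R" if "i < 3" for i using Q that by (auto simp: hom_coords_def)
  interpret k: ring_hom_cring R "poly_ring R" poly_of_const by (rule poly_of_const_ring_hom_cring)
  have X: "X \<in> carrier (poly_ring R)" using var_closed(1)[OF carrier_is_subring] .
  let ?m0 = "\<Oplus>i\<in>{..<3}. c i \<otimes> P i [^] (4::nat)" let ?m1 = "\<Oplus>i\<in>{..<3}. c i \<otimes> P i [^] (3::nat) \<otimes> Q i"
  let ?m2 = "\<Oplus>i\<in>{..<3}. c i \<otimes> P i [^] (2::nat) \<otimes> Q i [^] (2::nat)" let ?m3 = "\<Oplus>i\<in>{..<3}. c i \<otimes> P i \<otimes> Q i [^] (3::nat)"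
  let ?m4 = "\<Oplus>i\<in>{..<3}. c i \<otimes> Q i [^] (4::nat)"
  have M: "?m0 \<in> carrier R" "?m1 \<in> carrier R" "?m2 \<in> carrier R" "?m3 \<in> carrier R" "?m4 \<in> carrier R"
    using c Pc Qc by (auto intro!: finsum_closed)
  have rf: "restrict_form R (diag_form R 4 c) P Q = poly_of_const ?m0 \<oplus>\<^bsub>poly_ring R\<^esub> X \<otimes>\<^bsub>poly_ring R\<^esub>
      (poly_of_const (\<guillemotleft>4\<guillemotright> \<otimes> ?m1) \<oplus>\<^bsub>poly_ring R\<^esub> X \<otimes>\<^bsub>poly_ring R\<^esub>
      (poly_of_const (\<guillemotleft>6\<guillemotright> \<otimes> ?m2) \<oplus>\<^bsub>poly_ring R\<^esub> X \<otimes>\<^bsub>poly_ring R\<^esub>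
      (poly_of_const (\<guillemotleft>4\<guillemotright> \<otimes> ?m3) \<oplus>\<^bsub>poly_ring R\<^esub> X \<otimes>\<^bsub>poly_ring R\<^esub> poly_of_const ?m4)))"
    by (rule restrict_diag_form) (use c Pc Qc in auto)
  have X': "[\<one>, \<ominus> \<zero>] = X" by (simp add: var_def)
  have rc: "restrict_form R (diag_form R 4 c) P Q \<in> carrier (poly_ring R)" by (subst rf) (use M X in simp)
  have "X [^]\<^bsub>poly_ring R\<^esub> (4::nat) pdivides restrict_form R (diag_form R 4 c) P Q"
    using alg_multE(1)[OF zero_closed rc, unfolded X' Q(5)] Q(4) by (simp add: univ_poly_zero)
  then have d4: "X [^]\<^bsub>poly_ring R\<^esub> Suc 3 pdivides restrict_form R (diag_form R 4 c) P Q" by simp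
  note v0 = var_pow_pdivides_horner[OF _ _ d4[unfolded rf]]
  have d3: "X [^]\<^bsub>poly_ring R\<^esub> Suc 2 pdivides (poly_of_const (\<guillemotleft>4\<guillemotright> \<otimes> ?m1) \<oplus>\<^bsub>poly_ring R\<^esub> X \<otimes>\<^bsub>poly_ring R\<^esub>
      (poly_of_const (\<guillemotleft>6\<guillemotright> \<otimes> ?m2) \<oplus>\<^bsub>poly_ring R\<^esub> X \<otimes>\<^bsub>poly_ring R\<^esub>
      (poly_of_const (\<guillemotleft>4\<guillemotright> \<otimes> ?m3) \<oplus>\<^bsub>poly_ring R\<^esub> X \<otimes>\<^bsub>poly_ring R\<^esub> poly_of_const ?m4)))"
    using v0(2) M X by simp
  note v1 = var_pow_pdivides_horner[OF _ _ d3]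
  have d2: "X [^]\<^bsub>poly_ring R\<^esub> Suc 1 pdivides (poly_of_const (\<guillemotleft>6\<guillemotright> \<otimes> ?m2) \<oplus>\<^bsub>poly_ring R\<^esub> X \<otimes>\<^bsub>poly_ring R\<^esub>
      (poly_of_const (\<guillemotleft>4\<guillemotright> \<otimes> ?m3) \<oplus>\<^bsub>poly_ring R\<^esub> X \<otimes>\<^bsub>poly_ring R\<^esub> poly_of_const ?m4))"
    using v1(2) M X by (simp add: numeral_2_eq_2)
  note v2 = var_pow_pdivides_horner[OF _ _ d2]
  have d1: "X [^]\<^bsub>poly_ring R\<^esub> Suc 0 pdivides (poly_of_const (\<guillemotleft>4\<guillemotright> \<otimes> ?m3) \<oplus>\<^bsub>poly_ring R\<^esub> X \<otimes>\<^bsub>poly_ring R\<^esub> poly_of_const ?m4)"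
    using v2(2) M X by simp
  note v3 = var_pow_pdivides_horner[OF _ _ d1]
  have "?m0 = \<zero>" using v0(1) M X by simp
  moreover have "\<guillemotleft>4\<guillemotright> \<otimes> ?m1 = \<zero>" using v1(1) M X by simp
  then have "?m1 = \<zero>" using four_ne[OF two] M by (simp add: integral_iff)
  moreover have "\<guillemotleft>6\<guillemotright> \<otimes> ?m2 = \<zero>" using v2(1) M X by simp
  moreover have "\<guillemotleft>4\<guillemotright> \<otimes> ?m3 = \<zero>" using v3(1) M X by simp
  then have "?m3 = \<zero>" using four_ne[OF two] M by (simp add: integral_iff)
  ultimately show ?thesis using P lP Q by blast
qed

end

section \<open>Bitangents of diagonal quartics\<close>

context field
begin

text \<open>On the line \<open>X i = e X j\<close> the form is \<open>c k X k ^ 4\<close>, which vanishes only at \<open>(e : 1 : 0)\<close>, to the order four.\<close>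

lemma hyperflex_bitangent:
  assumes ijk: "{i, j, k} = {..<3::nat}"
    and c: "\<And>i. i < 3 \<Longrightarrow> c i \<in> carrier R" "\<And>i. i < 3 \<Longrightarrow> c i \<noteq> \<zero>"
    and e: "e \<in> carrier R" "c j \<oplus> c i \<otimes> e [^] (4::nat) = \<zero>"
  shows "bitangent R (diag_form R 4 c) (\<lambda>m. if m = i then \<one> else if m = j then \<ominus> e else \<zero>)" (is "bitangent R _ ?l")
proof -
  note d = perm_3_distinct[OF ijk]
  note cl = c(1)[OF d(4)] c(1)[OF d(5)] c(1)[OF d(6)]
  define P where "P m = (if m = i then e else if m = j then \<one> else \<zero>)" for m
  define Q where "Q m = (if m = k then \<one> else \<zero>)" for m
  have P: "P i = e" "P j = \<one>" "P k = \<zero>" and Q: "Q i = \<zero>" "Q j = \<zero>" "Q k = \<one>"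
    using d by (auto simp: P_def Q_def)
  have l: "?l i = \<one>" "?l j = \<ominus> e" "?l k = \<zero>" using d by auto
  have Pc: "P m \<in> carrier R" and Qc: "Q m \<in> carrier R" and lc: "?l m \<in> carrier R" for m using e by (auto simp: P_def Q_def)
  have sum: "(\<Oplus>m\<in>{..<3}. g m) = g i \<oplus> (g j \<oplus> g k)" if "\<And>m. m < 3 \<Longrightarrow> g m \<in> carrier R" for g
    using finsum_perm_3[OF ijk, of g] that by blast
  have hP: "P \<in> hom_coords R" using Pc P(2) d(5) one_not_zero unfolding hom_coords_def by (auto intro!: exI[of _ j])
  have hQ: "Q \<in> hom_coords R" using Qc Q(3) d(6) one_not_zero unfolding hom_coords_def by (auto intro!: exI[of _ k])
  have lP: "on_line R ?l P" unfolding on_line_def using sum[of "\<lambda>m. ?l m \<otimes> P m"] lc Pc l P e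
    by (simp add: r_neg)
  have lQ: "on_line R ?l Q" unfolding on_line_def using sum[of "\<lambda>m. ?l m \<otimes> Q m"] lc Qc l Q e by simp
  have ev: "eval_form R (diag_form R 4 c) Y = c i \<otimes> Y i [^] (4::nat) \<oplus> (c j \<otimes> Y j [^] (4::nat) \<oplus> c k \<otimes> Y k [^] (4::nat))"
    if "\<And>m. m < 3 \<Longrightarrow> Y m \<in> carrier R" for Y
    using eval_diag_form[of 4 c Y] sum[of "\<lambda>m. c m \<otimes> Y m [^] (4::nat)"] that c by simp
  have cP: "on_curve R (diag_form R 4 c) P"
    unfolding on_curve_def using ev[of P] Pc P e cl by (simp add: nat_pow_zero a_comm)
  have uniq: "proportional R P Y" if Y: "Y \<in> hom_coords R" and lY: "on_line R ?l Y" and cY: "on_curve R (diag_form R 4 c) Y" for Y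
  proof -
    have Yc: "Y m \<in> carrier R" if "m < 3" for m using Y that by (auto simp: hom_coords_def)
    note Ycl = Yc[OF d(4)] Yc[OF d(5)] Yc[OF d(6)]
    have "Y i \<oplus> (\<ominus> e) \<otimes> Y j = \<zero>"
      using lY sum[of "\<lambda>m. ?l m \<otimes> Y m"] lc Yc l e Ycl unfolding on_line_def by simp
    then have "Y i \<ominus> e \<otimes> Y j = \<zero>" using e Ycl by (simp add: l_minus minus_eq)
    then have Yi: "Y i = e \<otimes> Y j" using e Ycl by (simp add: r_right_minus_eq)
    have "\<zero> = c i \<otimes> (e \<otimes> Y j) [^] (4::nat) \<oplus> (c j \<otimes> Y j [^] (4::nat) \<oplus> c k \<otimes> Y k [^] (4::nat))"
      using cY ev[OF Yc] by (simp add: on_curve_def Yi)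
    also have "\<dots> = (c j \<oplus> c i \<otimes> e [^] (4::nat)) \<otimes> Y j [^] (4::nat) \<oplus> c k \<otimes> Y k [^] (4::nat)"
      by (rule ring_identity[where ls="[c i, c j, c k, e, Y j, Y k]"], (rule reify)+, simp add: in_carrier_def cl e Ycl, code_simp)
    also have "\<dots> = c k \<otimes> Y k [^] (4::nat)" using e(2) cl Ycl by simp
    finally have "Y k [^] (4::nat) = \<zero>" by (rule zero_eq_mult_cancel) (use c(2)[OF d(6)] cl Ycl in auto)
    then have Yk: "Y k = \<zero>" using nat_pow_ne_zero[of "Y k" 4] Ycl by blast
    have "Y j \<noteq> \<zero>"
    proof
      assume "Y j = \<zero>"
      then have "\<forall>m<3. Y m = \<zero>" unfolding perm_3_all[OF ijk] using Yi Yk e by simp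
      then show False using Y by (auto simp: hom_coords_def)
    qed
    moreover have "\<forall>m<3. Y m = Y j \<otimes> P m" unfolding perm_3_all[OF ijk] using Yi Yk P Ycl e by (simp add: m_comm)
    ultimately show ?thesis unfolding proportional_def using Ycl by blast
  qed
  have np: "\<not> proportional R P Q"
  proof
    assume "proportional R P Q"
    then obtain x where "x \<in> carrier R" "Q k = x \<otimes> P k" using d(6) by (auto simp: proportional_def)
    then show False using P Q one_not_zero by simp
  qed
  interpret k: ring_hom_cring R "poly_ring R" poly_of_const by (rule poly_of_const_ring_hom_cring)
  have X: "X \<in> carrier (poly_ring R)" using var_closed(1)[OF carrier_is_subring] .
  have M: "(\<Oplus>i\<in>{..<3}. c i \<otimes> P i [^] (4::nat)) = \<zero>" "(\<Oplus>i\<in>{..<3}. c i \<otimes> P i [^] (3::nat) \<otimes> Q i) = \<zero>"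
    "(\<Oplus>i\<in>{..<3}. c i \<otimes> P i [^] (2::nat) \<otimes> Q i [^] (2::nat)) = \<zero>" "(\<Oplus>i\<in>{..<3}. c i \<otimes> P i \<otimes> Q i [^] (3::nat)) = \<zero>"
    "(\<Oplus>i\<in>{..<3}. c i \<otimes> Q i [^] (4::nat)) = c k"
    using cP eval_diag_form[of 4 c P] c Pc apply (simp add: on_curve_def)
    using sum[of "\<lambda>i. c i \<otimes> P i [^] (3::nat) \<otimes> Q i"] c Pc Qc P Q cl e apply (simp add: nat_pow_zero)
    using sum[of "\<lambda>i. c i \<otimes> P i [^] (2::nat) \<otimes> Q i [^] (2::nat)"] c Pc Qc P Q cl e apply (simp add: nat_pow_zero)
    using sum[of "\<lambda>i. c i \<otimes> P i \<otimes> Q i [^] (3::nat)"] c Pc Qc P Q cl e apply (simp add: nat_pow_zero)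
    using sum[of "\<lambda>i. c i \<otimes> Q i [^] (4::nat)"] c Qc Q cl e apply (simp add: nat_pow_zero)
    done
  have "restrict_form R (diag_form R 4 c) P Q = poly_of_const \<zero> \<oplus>\<^bsub>poly_ring R\<^esub> X \<otimes>\<^bsub>poly_ring R\<^esub>
      (poly_of_const (\<guillemotleft>4\<guillemotright> \<otimes> \<zero>) \<oplus>\<^bsub>poly_ring R\<^esub> X \<otimes>\<^bsub>poly_ring R\<^esub>
      (poly_of_const (\<guillemotleft>6\<guillemotright> \<otimes> \<zero>) \<oplus>\<^bsub>poly_ring R\<^esub> X \<otimes>\<^bsub>poly_ring R\<^esub>
      (poly_of_const (\<guillemotleft>4\<guillemotright> \<otimes> \<zero>) \<oplus>\<^bsub>poly_ring R\<^esub> X \<otimes>\<^bsub>poly_ring R\<^esub> poly_of_const (c k))))"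
    by (subst restrict_diag_form) (use c Pc Qc M in simp_all)
  also have "\<dots> = X \<otimes>\<^bsub>poly_ring R\<^esub> (X \<otimes>\<^bsub>poly_ring R\<^esub> (X \<otimes>\<^bsub>poly_ring R\<^esub> (X \<otimes>\<^bsub>poly_ring R\<^esub> poly_of_const (c k))))"
    using X cl by simp
  also have "\<dots> = X [^]\<^bsub>poly_ring R\<^esub> (4::nat) \<otimes>\<^bsub>poly_ring R\<^esub> poly_of_const (c k)"
    by (rule k.S.ring_identity[where ls="[X, poly_of_const (c k)]"], (rule k.S.reify)+, simp add: k.S.in_carrier_def X cl, code_simp)
  finally have rf: "restrict_form R (diag_form R 4 c) P Q = X [^]\<^bsub>poly_ring R\<^esub> (4::nat) \<otimes>\<^bsub>poly_ring R\<^esub> poly_of_const (c k)" .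
  have am: "alg_mult (restrict_form R (diag_form R 4 c) P Q) \<zero> = 4"
    unfolding rf by (rule alg_mult_monomial[OF cl(3) c(2)[OF d(6)]])
  moreover have "restrict_form R (diag_form R 4 c) P Q \<noteq> \<zero>\<^bsub>poly_ring R\<^esub>"
  proof
    assume "restrict_form R (diag_form R 4 c) P Q = \<zero>\<^bsub>poly_ring R\<^esub>"
    then have "alg_mult (restrict_form R (diag_form R 4 c) P Q) \<zero> = 0"
      by (simp add: univ_poly_zero alg_mult_def)
    with am show False by simp
  qed
  ultimately have "meets_with_mult R (diag_form R 4 c) ?l P 4"
    unfolding meets_with_mult_def using lP hQ lQ np by blast
  then show ?thesis unfolding bitangent_def using hP lP cP uniq by blast
qed

text \<open>For the Fermat quartic the line \<open>X + Y + Z = 0\<close> touches at \<open>(\<omega> : \<omega>^2 : 1)\<close> with \<open>\<omega>\<close> a primitive third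
  root of unity. The general case follows by scaling with \<open>\<alpha>\<close> and \<open>\<beta>\<close>; the point is multiplied by
  \<open>\<alpha> \<beta>\<close> to avoid denominators.\<close>

lemma cube_root_tangent:
  assumes two: "\<guillemotleft>2\<guillemotright> \<noteq> \<zero>" and ijk: "{i, j, k} = {..<3::nat}"
    and c: "\<And>i. i < 3 \<Longrightarrow> c i \<in> carrier R" "c k \<noteq> \<zero>"
    and al: "\<alpha> \<in> carrier R" "\<alpha> \<noteq> \<zero>" "\<beta> \<in> carrier R" "\<beta> \<noteq> \<zero>"
    and eq: "c i = c k \<otimes> \<alpha> [^] (4::nat)" "c j = c k \<otimes> \<beta> [^] (4::nat)"
    and w: "\<omega> \<in> carrier R" "\<omega> [^] (2::nat) \<oplus> \<omega> \<oplus> \<one> = \<zero>"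
  shows "tangent_at R (diag_form R 4 c) (\<lambda>m. if m = i then \<alpha> else if m = j then \<beta> else \<one>)
      (\<lambda>m. if m = i then \<omega> \<otimes> \<beta> else if m = j then \<omega> [^] (2::nat) \<otimes> \<alpha> else \<alpha> \<otimes> \<beta>)" (is "tangent_at R _ ?l ?P")
proof -
  note d = perm_3_distinct[OF ijk]
  note cl = c(1)[OF d(4)] c(1)[OF d(5)] c(1)[OF d(6)]
  have P: "?P i = \<omega> \<otimes> \<beta>" "?P j = \<omega> [^] (2::nat) \<otimes> \<alpha>" "?P k = \<alpha> \<otimes> \<beta>" and l: "?l i = \<alpha>" "?l j = \<beta>" "?l k = \<one>"
    using d by auto
  have Pc: "?P m \<in> carrier R" for m using al w by auto
  have w3: "\<omega> [^] (3::nat) = \<one>"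
  proof -
    have "\<omega> [^] (3::nat) = (\<omega> \<ominus> \<one>) \<otimes> (\<omega> [^] (2::nat) \<oplus> \<omega> \<oplus> \<one>) \<oplus> \<one>"
      by (rule ring_identity[where ls="[\<omega>]"], (rule reify)+, simp add: in_carrier_def w, code_simp)
    then show ?thesis using w by simp
  qed
  have "eval_form R (diag_form R 4 c) ?P = (c k \<otimes> \<alpha> [^] (4::nat)) \<otimes> (\<omega> \<otimes> \<beta>) [^] (4::nat) \<oplus>
      ((c k \<otimes> \<beta> [^] (4::nat)) \<otimes> (\<omega> [^] (2::nat) \<otimes> \<alpha>) [^] (4::nat) \<oplus> c k \<otimes> (\<alpha> \<otimes> \<beta>) [^] (4::nat))"
    using eval_diag_form[of 4 c ?P] finsum_perm_3[OF ijk, of "\<lambda>m. c m \<otimes> ?P m [^] (4::nat)"] c Pc d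
    by (simp add: eq[symmetric])
  also have "\<dots> = (c k \<otimes> \<alpha> [^] (4::nat) \<otimes> \<beta> [^] (4::nat)) \<otimes> ((\<omega> [^] (4::nat) \<ominus> \<omega> [^] (2::nat) \<oplus> \<one>) \<otimes> (\<omega> [^] (2::nat) \<ominus> \<omega> \<oplus> \<one>)) \<otimes> (\<omega> [^] (2::nat) \<oplus> \<omega> \<oplus> \<one>)"
    by (rule ring_identity[where ls="[c k, \<alpha>, \<beta>, \<omega>]"], (rule reify)+, simp add: in_carrier_def w cl al, code_simp)
  also have "\<dots> = \<zero>" using w cl al by simp
  finally have "on_curve R (diag_form R 4 c) ?P" by (simp add: on_curve_def)
  moreover have "proportional R (\<lambda>m. eval_form R (partial_deriv R m (diag_form R 4 c)) ?P) ?l"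
  proof -
    define g where "g = \<guillemotleft>4\<guillemotright> \<otimes> (c k \<otimes> \<alpha> [^] (3::nat) \<otimes> \<beta> [^] (3::nat))"
    have g: "g \<in> carrier R" "g \<noteq> \<zero>"
      using cl al four_ne[OF two] c(2) nat_pow_ne_zero[OF al(1,2), of 3] nat_pow_ne_zero[OF al(3,4), of 3]
      by (auto simp: g_def integral_iff)
    have gi: "inv g \<in> carrier R" "inv g \<noteq> \<zero>" "inv g \<otimes> g = \<one>"
      using g field_Units Units_inv_Units[of g] Units_l_inv[of g] by auto
    have gr: "eval_form R (partial_deriv R m (diag_form R 4 c)) ?P = \<guillemotleft>4\<guillemotright> \<otimes> (c m \<otimes> ?P m [^] (3::nat))" if "m < 3" for m
      by (rule gradient_diag) (use c Pc that in auto)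
    have gr_i: "eval_form R (partial_deriv R i (diag_form R 4 c)) ?P = g \<otimes> ?l i"
    proof -
      have "\<guillemotleft>4\<guillemotright> \<otimes> ((c k \<otimes> \<alpha> [^] (4::nat)) \<otimes> (\<omega> \<otimes> \<beta>) [^] (3::nat)) = g \<otimes> \<alpha> \<otimes> \<omega> [^] (3::nat)" unfolding g_def
        by (rule ring_identity[where ls="[c k, \<alpha>, \<beta>, \<omega>]"], (rule reify)+, simp add: in_carrier_def w cl al, code_simp)
      then show ?thesis using gr[OF d(4)] g al by (simp add: eq[symmetric] w3)
    qed
    have gr_j: "eval_form R (partial_deriv R j (diag_form R 4 c)) ?P = g \<otimes> ?l j"
    proof -
      have "\<guillemotleft>4\<guillemotright> \<otimes> ((c k \<otimes> \<beta> [^] (4::nat)) \<otimes> (\<omega> [^] (2::nat) \<otimes> \<alpha>) [^] (3::nat)) = g \<otimes> \<beta> \<otimes> (\<omega> [^] (3::nat)) [^] (2::nat)" unfolding g_def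
        by (rule ring_identity[where ls="[c k, \<alpha>, \<beta>, \<omega>]"], (rule reify)+, simp add: in_carrier_def w cl al, code_simp)
      then show ?thesis using gr[OF d(5)] g al d by (simp add: eq[symmetric] w3)
    qed
    have gr_k: "eval_form R (partial_deriv R k (diag_form R 4 c)) ?P = g \<otimes> ?l k"
    proof -
      have "\<guillemotleft>4\<guillemotright> \<otimes> (c k \<otimes> (\<alpha> \<otimes> \<beta>) [^] (3::nat)) = g" unfolding g_def
        by (rule ring_identity[where ls="[c k, \<alpha>, \<beta>]"], (rule reify)+, simp add: in_carrier_def cl al, code_simp)
      then show ?thesis using gr[OF d(6)] g al d by simp
    qed
    have cancel: "x = inv g \<otimes> (g \<otimes> x)" if "x \<in> carrier R" for x
      using gi g that by (simp add: m_assoc[symmetric])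
    have "\<forall>m<3. ?l m = inv g \<otimes> eval_form R (partial_deriv R m (diag_form R 4 c)) ?P"
      unfolding perm_3_all[OF ijk] gr_i gr_j gr_k by (intro conjI cancel) (use al in auto)
    then show ?thesis unfolding proportional_def using gi by blast
  qed
  ultimately show ?thesis by (simp add: tangent_at_def)
qed

text \<open>The second point of contact belongs to the other root \<open>\<omega>^2\<close>. In characteristic \<open>3\<close> there is only one root,
  hence the hypothesis.\<close>

lemma cube_root_bitangent:
  assumes two: "\<guillemotleft>2\<guillemotright> \<noteq> \<zero>" and three: "\<guillemotleft>3\<guillemotright> \<noteq> \<zero>" and ijk: "{i, j, k} = {..<3::nat}"
    and c: "\<And>i. i < 3 \<Longrightarrow> c i \<in> carrier R" "c k \<noteq> \<zero>"
    and al: "\<alpha> \<in> carrier R" "\<alpha> \<noteq> \<zero>" "\<beta> \<in> carrier R" "\<beta> \<noteq> \<zero>"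
    and eq: "c i = c k \<otimes> \<alpha> [^] (4::nat)" "c j = c k \<otimes> \<beta> [^] (4::nat)"
    and w: "\<omega> \<in> carrier R" "\<omega> [^] (2::nat) \<oplus> \<omega> \<oplus> \<one> = \<zero>"
  shows "bitangent R (diag_form R 4 c) (\<lambda>m. if m = i then \<alpha> else if m = j then \<beta> else \<one>)"
proof -
  note d = perm_3_distinct[OF ijk]
  define P where "P w = (\<lambda>m. if m = i then w \<otimes> \<beta> else if m = j then w [^] (2::nat) \<otimes> \<alpha> else \<alpha> \<otimes> \<beta>)" for w
  have ww: "\<omega> [^] (2::nat) \<in> carrier R" "(\<omega> [^] (2::nat)) [^] (2::nat) \<oplus> \<omega> [^] (2::nat) \<oplus> \<one> = \<zero>"
  proof -
    have "(\<omega> [^] (2::nat)) [^] (2::nat) \<oplus> \<omega> [^] (2::nat) \<oplus> \<one> = (\<omega> [^] (2::nat) \<ominus> \<omega> \<oplus> \<one>) \<otimes> (\<omega> [^] (2::nat) \<oplus> \<omega> \<oplus> \<one>)"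
      by (rule ring_identity[where ls="[\<omega>]"], (rule reify)+, simp add: in_carrier_def w, code_simp)
    then show "(\<omega> [^] (2::nat)) [^] (2::nat) \<oplus> \<omega> [^] (2::nat) \<oplus> \<one> = \<zero>" using w by simp
  qed (use w in simp)
  have t1: "tangent_at R (diag_form R 4 c) (\<lambda>m. if m = i then \<alpha> else if m = j then \<beta> else \<one>) (P \<omega>)"
    unfolding P_def by (rule cube_root_tangent[OF two ijk c al eq w])
  have t2: "tangent_at R (diag_form R 4 c) (\<lambda>m. if m = i then \<alpha> else if m = j then \<beta> else \<one>) (P (\<omega> [^] (2::nat)))"
    unfolding P_def by (rule cube_root_tangent[OF two ijk c al eq ww])
  have h: "P w \<in> hom_coords R" if "w \<in> carrier R" for w
    using that al d integral[of \<alpha> \<beta>] unfolding hom_coords_def P_def by (auto intro!: exI[of _ k])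
  have "\<not> proportional R (P \<omega>) (P (\<omega> [^] (2::nat)))"
  proof
    assume "proportional R (P \<omega>) (P (\<omega> [^] (2::nat)))"
    then obtain x where x: "x \<in> carrier R" "\<And>m. m < 3 \<Longrightarrow> P (\<omega> [^] (2::nat)) m = x \<otimes> P \<omega> m"
      by (auto simp: proportional_def)
    have ab: "\<alpha> \<otimes> \<beta> \<in> carrier R" "\<alpha> \<otimes> \<beta> \<noteq> \<zero>" using al by (auto simp: integral_iff)
    have "\<one> \<otimes> (\<alpha> \<otimes> \<beta>) = x \<otimes> (\<alpha> \<otimes> \<beta>)" using x(2)[OF d(6)] d al by (simp add: P_def)
    then have "x = \<one>" using m_rcancel[OF ab(2,1) one_closed x(1)] by simp
    then have "\<omega> [^] (2::nat) \<otimes> \<beta> = \<omega> \<otimes> \<beta>" using x(2)[OF d(4)] d al w by (simp add: P_def)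
    then have e: "\<omega> [^] (2::nat) = \<omega>" using m_rcancel[OF al(4,3) ww(1) w(1)] by simp
    have "\<guillemotleft>3\<guillemotright> = \<guillemotleft>2\<guillemotright> \<otimes> (\<omega> [^] (2::nat) \<oplus> \<omega> \<oplus> \<one>) \<otimes> (\<one> \<ominus> \<omega>) \<oplus> \<one> \<oplus> \<guillemotleft>2\<guillemotright> \<otimes> (\<omega> [^] (2::nat) \<otimes> \<omega>)"
      by (rule ring_identity[where ls="[\<omega>]"], (rule reify)+, simp add: in_carrier_def w, code_simp)
    also have "\<dots> = \<one> \<oplus> \<guillemotleft>2\<guillemotright> \<otimes> \<omega>" using w e by (simp add: numeral_2_eq_2)
    also have "\<dots> = \<omega> [^] (2::nat) \<oplus> \<omega> \<oplus> \<one>" unfolding e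
      by (rule ring_identity[where ls="[\<omega>]"], (rule reify)+, simp add: in_carrier_def w, code_simp)
    finally show False using w three by simp
  qed
  with t1 t2 h[OF w(1)] h[OF ww(1)] show ?thesis unfolding bitangent_def by blast
qed

end

lemma (in algebraically_closed) exists_primitive_cube_root:
  "\<exists>\<omega>\<in>carrier L. \<omega> [^] (2::nat) \<oplus> \<omega> \<oplus> \<one> = \<zero>"
proof -
  let ?p = "[\<one>, \<one>, \<one>]"
  have p: "?p \<in> carrier (poly_ring L)" by (simp add: univ_poly_carrier[symmetric] polynomial_def)
  have "size (roots ?p) = 2" using roots_over_carrier[OF p] by (simp add: splitted_def)
  then obtain w where "w \<in># roots ?p" by (metis size_eq_0_iff_empty multiset_nonemptyE zero_neq_numeral)
  then have "is_root ?p w" using roots_mem_iff_is_root[OF p] by blast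
  then have "w \<in> carrier L" "eval ?p w = \<zero>" by (auto simp: is_root_def)
  then show ?thesis by (intro bexI[of _ w]) (auto simp: a_assoc numeral_2_eq_2)
qed

context field
begin

lemma alg_closure_hom:
  shows "algebraically_closed alg_closure" "field alg_closure" "ring_hom_cring R alg_closure indexed_const"
proof -
  interpret L: algebraic_closure alg_closure "indexed_const ` carrier R" by (rule alg_closureE(1))
  show "algebraically_closed alg_closure" by (rule L.algebraically_closed_axioms)
  show "field alg_closure" by (rule L.field_axioms)
  show "ring_hom_cring R alg_closure indexed_const"
    using alg_closureE(2) is_cring L.is_cring by (simp add: ring_hom_cring_def ring_hom_cring_axioms_def)
qed

lemma diag_form_closure:
  "indexed_const \<circ> diag_form R n c = diag_form alg_closure n (indexed_const \<circ> c)"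
proof -
  interpret h: ring_hom_cring R alg_closure indexed_const by (rule alg_closure_hom)
  show ?thesis by (rule diag_form_comp) simp
qed

lemma indexed_const_eq_iff: "indexed_const x = indexed_const y \<longleftrightarrow> x = y"
  using indexed_const_is_inj by (auto dest: injD)

lemma indexed_const_eq_zero_iff: "indexed_const x = \<zero>\<^bsub>alg_closure\<^esub> \<longleftrightarrow> x = \<zero>"
proof -
  interpret h: ring_hom_cring R alg_closure indexed_const by (rule alg_closure_hom)
  show ?thesis unfolding h.hom_zero[symmetric] by (rule indexed_const_eq_iff)
qed

text \<open>All three partial derivatives \<open>4 c i P i ^ 3\<close> vanish only if \<open>P = 0\<close>.\<close>

lemma smooth_diag:
  assumes two: "\<guillemotleft>2\<guillemotright> \<noteq> \<zero>"
    and c: "\<And>i. i < 3 \<Longrightarrow> c i \<in> carrier R" "\<And>i. i < 3 \<Longrightarrow> c i \<noteq> \<zero>"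
  shows "smooth_plane_quartic R (diag_form R 4 c)"
proof -
  let ?F = alg_closure
  interpret h: ring_hom_cring R ?F indexed_const by (rule alg_closure_hom)
  interpret F: field ?F by (rule alg_closure_hom)
  have hc: "(indexed_const \<circ> c) i \<in> carrier ?F" "(indexed_const \<circ> c) i \<noteq> \<zero>\<^bsub>?F\<^esub>" if "i < 3" for i
    using c[OF that] indexed_const_eq_zero_iff[of "c i"] by auto
  have two': "\<guillemotleft>2\<guillemotright>\<^bsub>?F\<^esub> \<noteq> \<zero>\<^bsub>?F\<^esub>" using two indexed_const_eq_zero_iff[of "\<guillemotleft>2\<guillemotright>"] h.hom_of_int[of 2] by auto
  have "\<exists>i<3. eval_form ?F (partial_deriv ?F i (diag_form ?F 4 (indexed_const \<circ> c))) P \<noteq> \<zero>\<^bsub>?F\<^esub>"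
    if P: "P \<in> hom_coords ?F" for P
  proof -
    obtain i where i: "i < 3" "P i \<noteq> \<zero>\<^bsub>?F\<^esub>" using P by (auto simp: hom_coords_def)
    have Pc: "P i \<in> carrier ?F" if "i < 3" for i using P that by (auto simp: hom_coords_def)
    have "eval_form ?F (partial_deriv ?F i (diag_form ?F 4 (indexed_const \<circ> c))) P =
       \<guillemotleft>4\<guillemotright>\<^bsub>?F\<^esub> \<otimes>\<^bsub>?F\<^esub> ((indexed_const \<circ> c) i \<otimes>\<^bsub>?F\<^esub> P i [^]\<^bsub>?F\<^esub> (3::nat))"
      by (rule h.S.gradient_diag) (use hc Pc i in auto)
    moreover have "\<dots> \<noteq> \<zero>\<^bsub>?F\<^esub>"
      using F.four_ne[OF two'] hc[OF i(1)] F.nat_pow_ne_zero[OF Pc[OF i(1)] i(2), of 3] Pc[OF i(1)]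
      by (simp add: F.integral_iff)
    ultimately show ?thesis using i(1) by auto
  qed
  then show ?thesis
    unfolding smooth_plane_quartic_def Let_def diag_form_closure using quartic_form_diag c by blast
qed

lemma has_bitangent_diag_hyperflex:
  assumes ijk: "{i, j, k} = {..<3::nat}"
    and c: "\<And>i. i < 3 \<Longrightarrow> c i \<in> carrier R" "\<And>i. i < 3 \<Longrightarrow> c i \<noteq> \<zero>"
    and e: "e \<in> carrier R" "c j \<oplus> c i \<otimes> e [^] (4::nat) = \<zero>"
  shows "has_bitangent R (diag_form R 4 c)"
proof -
  let ?F = alg_closure and ?l = "\<lambda>m. if m = i then \<one> else if m = j then \<ominus> e else \<zero>"
  interpret h: ring_hom_cring R ?F indexed_const by (rule alg_closure_hom)
  interpret F: field ?F by (rule alg_closure_hom)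
  note d = perm_3_distinct[OF ijk]
  have hc: "(indexed_const \<circ> c) i \<in> carrier ?F" "(indexed_const \<circ> c) i \<noteq> \<zero>\<^bsub>?F\<^esub>" if "i < 3" for i
    using c[OF that] indexed_const_eq_zero_iff[of "c i"] by auto
  have "(indexed_const \<circ> c) j \<oplus>\<^bsub>?F\<^esub> (indexed_const \<circ> c) i \<otimes>\<^bsub>?F\<^esub> indexed_const e [^]\<^bsub>?F\<^esub> (4::nat) = indexed_const (c j \<oplus> c i \<otimes> e [^] (4::nat))"
    using c(1)[OF d(4)] c(1)[OF d(5)] e(1) by (simp add: h.hom_nat_power)
  also have "\<dots> = \<zero>\<^bsub>?F\<^esub>" using e(2) by simp
  finally have "bitangent ?F (diag_form ?F 4 (indexed_const \<circ> c))
      (\<lambda>m. if m = i then \<one>\<^bsub>?F\<^esub> else if m = j then \<ominus>\<^bsub>?F\<^esub> indexed_const e else \<zero>\<^bsub>?F\<^esub>)"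
    by (intro F.hyperflex_bitangent[OF ijk]) (use hc e in auto)
  moreover have "indexed_const \<circ> ?l = (\<lambda>m. if m = i then \<one>\<^bsub>?F\<^esub> else if m = j then \<ominus>\<^bsub>?F\<^esub> indexed_const e else \<zero>\<^bsub>?F\<^esub>)"
    using e by auto
  moreover have "?l \<in> hom_coords R" using e d(4) one_not_zero by (auto simp: hom_coords_def intro!: exI[of _ i])
  ultimately show ?thesis unfolding has_bitangent_def diag_form_closure by (intro bexI[of _ ?l]) auto
qed

lemma has_bitangent_diag_two_contacts:
  assumes two: "\<guillemotleft>2\<guillemotright> \<noteq> \<zero>" and three: "\<guillemotleft>3\<guillemotright> \<noteq> \<zero>" and ijk: "{i, j, k} = {..<3::nat}"
    and c: "\<And>i. i < 3 \<Longrightarrow> c i \<in> carrier R" "\<And>i. i < 3 \<Longrightarrow> c i \<noteq> \<zero>"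
    and al: "\<alpha> \<in> carrier R" "\<beta> \<in> carrier R"
    and eq: "c i = c k \<otimes> \<alpha> [^] (4::nat)" "c j = c k \<otimes> \<beta> [^] (4::nat)"
  shows "has_bitangent R (diag_form R 4 c)"
proof -
  let ?F = alg_closure and ?l = "\<lambda>m. if m = i then \<alpha> else if m = j then \<beta> else \<one>"
  interpret h: ring_hom_cring R ?F indexed_const by (rule alg_closure_hom)
  interpret F: field ?F by (rule alg_closure_hom)
  note d = perm_3_distinct[OF ijk]
  have hc: "(indexed_const \<circ> c) i \<in> carrier ?F" "(indexed_const \<circ> c) i \<noteq> \<zero>\<^bsub>?F\<^esub>" if "i < 3" for i
    using c[OF that] indexed_const_eq_zero_iff[of "c i"] by auto
  have two': "\<guillemotleft>2\<guillemotright>\<^bsub>?F\<^esub> \<noteq> \<zero>\<^bsub>?F\<^esub>" using two indexed_const_eq_zero_iff[of "\<guillemotleft>2\<guillemotright>"] h.hom_of_int[of 2] by auto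
  have three': "\<guillemotleft>3\<guillemotright>\<^bsub>?F\<^esub> \<noteq> \<zero>\<^bsub>?F\<^esub>" using three indexed_const_eq_zero_iff[of "\<guillemotleft>3\<guillemotright>"] h.hom_of_int[of 3] by auto
  have "\<alpha> \<noteq> \<zero>" "\<beta> \<noteq> \<zero>" using eq c(1)[OF d(6)] c(2)[OF d(4)] c(2)[OF d(5)] by (auto simp: nat_pow_zero)
  then have ab: "indexed_const \<alpha> \<noteq> \<zero>\<^bsub>?F\<^esub>" "indexed_const \<beta> \<noteq> \<zero>\<^bsub>?F\<^esub>"
    using indexed_const_eq_zero_iff[of \<alpha>] indexed_const_eq_zero_iff[of \<beta>] by auto
  have eq': "(indexed_const \<circ> c) i = (indexed_const \<circ> c) k \<otimes>\<^bsub>?F\<^esub> indexed_const \<alpha> [^]\<^bsub>?F\<^esub> (4::nat)"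
     "(indexed_const \<circ> c) j = (indexed_const \<circ> c) k \<otimes>\<^bsub>?F\<^esub> indexed_const \<beta> [^]\<^bsub>?F\<^esub> (4::nat)"
    using c(1)[OF d(6)] al by (simp_all add: eq h.hom_nat_power)
  obtain w where w: "w \<in> carrier ?F" "w [^]\<^bsub>?F\<^esub> (2::nat) \<oplus>\<^bsub>?F\<^esub> w \<oplus>\<^bsub>?F\<^esub> \<one>\<^bsub>?F\<^esub> = \<zero>\<^bsub>?F\<^esub>"
    using algebraically_closed.exists_primitive_cube_root[OF alg_closure_hom(1)] by blast
  have "bitangent ?F (diag_form ?F 4 (indexed_const \<circ> c))
      (\<lambda>m. if m = i then indexed_const \<alpha> else if m = j then indexed_const \<beta> else \<one>\<^bsub>?F\<^esub>)"
    by (rule F.cube_root_bitangent[OF two' three' ijk _ _ _ ab(1) _ ab(2) eq' w]) (use hc d al in auto)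
  moreover have "indexed_const \<circ> ?l = (\<lambda>m. if m = i then indexed_const \<alpha> else if m = j then indexed_const \<beta> else \<one>\<^bsub>?F\<^esub>)"
    by auto
  moreover have "?l \<in> hom_coords R" using al d one_not_zero by (auto simp: hom_coords_def intro!: exI[of _ k])
  ultimately show ?thesis unfolding has_bitangent_def diag_form_closure by (intro bexI[of _ ?l]) auto
qed

text \<open>The line has coefficients in the field, but its points of contact only lie in the algebraic closure. So
  \<open>diag_line_criterion\<close> is applied there, with some \<open>k\<close> such that \<open>l k \<noteq> 0\<close>, and its conclusion, which
  mentions the line only, descends.\<close>

lemma has_bitangent_diagD:
  assumes two: "\<guillemotleft>2\<guillemotright> \<noteq> \<zero>"
    and c: "\<And>i. i < 3 \<Longrightarrow> c i \<in> carrier R" "\<And>i. i < 3 \<Longrightarrow> c i \<noteq> \<zero>"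
    and bit: "has_bitangent R (diag_form R 4 c)"
  obtains i j k x y where "{i, j, k} = {..<3::nat}" "x \<in> carrier R" "y \<in> carrier R" "y \<noteq> \<zero>"
      "c i \<otimes> y [^] (4::nat) \<oplus> c j \<otimes> x [^] (4::nat) = \<zero>"
    | i j k x y z where "{i, j, k} = {..<3::nat}" "x \<in> carrier R" "y \<in> carrier R" "z \<in> carrier R" "z \<noteq> \<zero>"
      "c i \<otimes> z [^] (4::nat) = c k \<otimes> x [^] (4::nat)" "c j \<otimes> z [^] (4::nat) = c k \<otimes> y [^] (4::nat)"
proof -
  let ?F = alg_closure
  interpret h: ring_hom_cring R ?F indexed_const by (rule alg_closure_hom)
  interpret F: field ?F by (rule alg_closure_hom)
  have hc: "(indexed_const \<circ> c) i \<in> carrier ?F" "(indexed_const \<circ> c) i \<noteq> \<zero>\<^bsub>?F\<^esub>" if "i < 3" for i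
    using c[OF that] indexed_const_eq_zero_iff[of "c i"] by auto
  have two': "\<guillemotleft>2\<guillemotright>\<^bsub>?F\<^esub> \<noteq> \<zero>\<^bsub>?F\<^esub>" using two indexed_const_eq_zero_iff[of "\<guillemotleft>2\<guillemotright>"] h.hom_of_int[of 2] by auto
  obtain l where l: "l \<in> hom_coords R" "bitangent ?F (diag_form ?F 4 (indexed_const \<circ> c)) (indexed_const \<circ> l)"
    using bit by (auto simp: has_bitangent_def diag_form_closure)
  obtain P Q where PQ: "P \<in> hom_coords ?F" "Q \<in> hom_coords ?F" "\<not> proportional ?F P Q"
      "on_line ?F (indexed_const \<circ> l) P" "on_line ?F (indexed_const \<circ> l) Q"
    "(\<Oplus>\<^bsub>?F\<^esub>i\<in>{..<3}. (indexed_const \<circ> c) i \<otimes>\<^bsub>?F\<^esub> P i [^]\<^bsub>?F\<^esub> (4::nat)) = \<zero>\<^bsub>?F\<^esub>"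
    "(\<Oplus>\<^bsub>?F\<^esub>i\<in>{..<3}. (indexed_const \<circ> c) i \<otimes>\<^bsub>?F\<^esub> P i [^]\<^bsub>?F\<^esub> (3::nat) \<otimes>\<^bsub>?F\<^esub> Q i) = \<zero>\<^bsub>?F\<^esub>"
    "(\<Oplus>\<^bsub>?F\<^esub>i\<in>{..<3}. (indexed_const \<circ> c) i \<otimes>\<^bsub>?F\<^esub> P i \<otimes>\<^bsub>?F\<^esub> Q i [^]\<^bsub>?F\<^esub> (3::nat)) = \<zero>\<^bsub>?F\<^esub>"
    "\<guillemotleft>6\<guillemotright>\<^bsub>?F\<^esub> \<otimes>\<^bsub>?F\<^esub> (\<Oplus>\<^bsub>?F\<^esub>i\<in>{..<3}. (indexed_const \<circ> c) i \<otimes>\<^bsub>?F\<^esub> P i [^]\<^bsub>?F\<^esub> (2::nat) \<otimes>\<^bsub>?F\<^esub> Q i [^]\<^bsub>?F\<^esub> (2::nat)) = \<zero>\<^bsub>?F\<^esub>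
      \<or> (\<Oplus>\<^bsub>?F\<^esub>i\<in>{..<3}. (indexed_const \<circ> c) i \<otimes>\<^bsub>?F\<^esub> Q i [^]\<^bsub>?F\<^esub> (4::nat)) = \<zero>\<^bsub>?F\<^esub>"
    using F.bitangent_diag_data[OF two' hc(1) l(2)] by blast
  obtain k where k: "k < 3" "l k \<noteq> \<zero>" using l by (auto simp: hom_coords_def)
  have lc: "l m \<in> carrier R" if "m < 3" for m using l that by (auto simp: hom_coords_def)
  have "\<exists>i j. {i, j, k} = {..<3::nat}"
  proof -
    have "{1, 2, 0} = {..<3::nat}" "{0, 2, 1} = {..<3::nat}" "{0, 1, 2} = {..<3::nat}" by auto
    then show ?thesis using k(1) unfolding lessThan_3_cases by blast
  qed
  then obtain i j where ijk: "{i, j, k} = {..<3::nat}" by blast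
  note d = perm_3_distinct[OF ijk]
  note cl = c(1)[OF d(4)] c(1)[OF d(5)] c(1)[OF d(6)] lc[OF d(4)] lc[OF d(5)] lc[OF d(6)]
  have hl: "(indexed_const \<circ> l) m \<in> carrier ?F" if "m < 3" for m using lc[OF that] by simp
  have hk: "(indexed_const \<circ> l) k \<noteq> \<zero>\<^bsub>?F\<^esub>" using k indexed_const_eq_zero_iff[of "l k"] by simp
  note F.diag_line_criterion[OF two' ijk hc hl hk PQ]
  moreover have "(indexed_const \<circ> c) a \<otimes>\<^bsub>?F\<^esub> (indexed_const \<circ> l) b [^]\<^bsub>?F\<^esub> (4::nat) = indexed_const (c a \<otimes> l b [^] (4::nat))"
    if "a < 3" "b < 3" for a b using c(1)[OF that(1)] lc[OF that(2)] by (simp add: h.hom_nat_power)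
  ultimately have "indexed_const (c i \<otimes> l k [^] (4::nat)) = indexed_const (c k \<otimes> l i [^] (4::nat)) \<and>
      indexed_const (c j \<otimes> l k [^] (4::nat)) = indexed_const (c k \<otimes> l j [^] (4::nat))
    \<or> indexed_const (c j \<otimes> l k [^] (4::nat)) \<oplus>\<^bsub>?F\<^esub> indexed_const (c k \<otimes> l j [^] (4::nat)) = \<zero>\<^bsub>?F\<^esub>
    \<or> indexed_const (c i \<otimes> l k [^] (4::nat)) \<oplus>\<^bsub>?F\<^esub> indexed_const (c k \<otimes> l i [^] (4::nat)) = \<zero>\<^bsub>?F\<^esub>"
    using d by simp
  moreover have "indexed_const x \<oplus>\<^bsub>?F\<^esub> indexed_const y = \<zero>\<^bsub>?F\<^esub> \<longleftrightarrow> x \<oplus> y = \<zero>" if "x \<in> carrier R" "y \<in> carrier R" for x y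
    using that indexed_const_eq_zero_iff[of "x \<oplus> y"] by simp
  ultimately consider "c i \<otimes> l k [^] (4::nat) = c k \<otimes> l i [^] (4::nat)" "c j \<otimes> l k [^] (4::nat) = c k \<otimes> l j [^] (4::nat)"
    | "c j \<otimes> l k [^] (4::nat) \<oplus> c k \<otimes> l j [^] (4::nat) = \<zero>"
    | "c i \<otimes> l k [^] (4::nat) \<oplus> c k \<otimes> l i [^] (4::nat) = \<zero>"
    unfolding indexed_const_eq_iff using cl by (metis m_closed nat_pow_closed)
  then show thesis
  proof cases
    case 1
    then show ?thesis using that(2)[OF ijk] cl k by blast
  next
    case 2
    moreover have "{j, k, i} = {..<3::nat}" using ijk by blast
    ultimately show ?thesis using that(1)[of j k i "l j" "l k"] cl k by blast
  next
    case 3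
    moreover have "{i, k, j} = {..<3::nat}" using ijk by blast
    ultimately show ?thesis using that(1)[of i k j "l i" "l k"] cl k by blast
  qed
qed

end

section \<open>Absolute values on the natural numbers\<close>

text \<open>Exponential growth beats linear growth; used below in the form that an estimate with a constant factor
  improves to one without, by passing to powers.\<close>

lemma le_one_if_powers_linearly_bounded:
  fixes x a b :: real
  assumes "\<And>j::nat. x ^ j \<le> a * real j + b"
  shows "x \<le> 1"
proof (rule ccontr)
  assume "\<not> x \<le> 1"
  then have x: "x > 1" by simp
  then have "\<bar>inverse x\<bar> < 1" by (simp add: inverse_less_1_iff)
  then have "(\<lambda>j. real j * inverse x ^ j) \<longlonglongrightarrow> 0"
    by (rule powser_times_n_limit_0[of "inverse x", unfolded real_norm_def])
  moreover have "(\<lambda>j. inverse x ^ j) \<longlonglongrightarrow> 0"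
    using \<open>\<bar>inverse x\<bar> < 1\<close> by (rule LIMSEQ_power_zero[of "inverse x", unfolded real_norm_def])
  ultimately have "(\<lambda>j. a * (real j * inverse x ^ j) + b * inverse x ^ j) \<longlonglongrightarrow> a * 0 + b * 0"
    by (intro tendsto_add tendsto_mult_left)
  moreover have "1 \<le> a * (real j * inverse x ^ j) + b * inverse x ^ j" for j
  proof -
    have "1 = x ^ j * inverse x ^ j" using x by (simp add: power_mult_distrib[symmetric])
    also have "\<dots> \<le> (a * real j + b) * inverse x ^ j" using x by (intro mult_right_mono assms) auto
    finally show ?thesis by (simp add: algebra_simps)
  qed
  ultimately have "1 \<le> a * 0 + b * 0" by (intro LIMSEQ_le_const) auto
  then show False by simp
qed

context
  fixes \<alpha> :: "nat \<Rightarrow> real"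
  assumes \<alpha>0: "\<alpha> 0 = 0" and \<alpha>1: "\<alpha> 1 = 1" and nonneg: "\<alpha> n \<ge> 0"
    and mult: "\<alpha> (m * n) = \<alpha> m * \<alpha> n" and add: "\<alpha> (m + n) \<le> \<alpha> m + \<alpha> n"
begin

lemma ostrowski_le_nat: "\<alpha> n \<le> real n"
proof (induction n)
  case (Suc n)
  then show ?case using add[of n 1] \<alpha>1 by simp
qed (simp add: \<alpha>0)

lemma ostrowski_power: "\<alpha> (n ^ j) = \<alpha> n ^ j"
  by (induction j) (simp_all add: mult \<alpha>1[simplified])

text \<open>Expansion of \<open>n\<close> to the base \<open>m\<close>: there are \<open>k\<close> digits, each contributing at most \<open>m\<close> times a
  power of \<open>\<alpha> m\<close>.\<close>

lemma ostrowski_digits: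
  assumes "m \<ge> 2" "n < m ^ k"
  shows "\<alpha> n \<le> real k * real m * max 1 (\<alpha> m) ^ k"
  using assms(2)
proof (induction k arbitrary: n)
  case 0
  then show ?case by (simp add: \<alpha>0)
next
  case (Suc k)
  let ?M = "max 1 (\<alpha> m)"
  have M1: "1 \<le> ?M" by simp
  have q: "n div m < m ^ k" using Suc.prems assms(1) by (simp add: less_mult_imp_div_less mult.commute)
  have "\<alpha> n = \<alpha> (m * (n div m) + n mod m)" by simp
  also have "\<dots> \<le> \<alpha> m * \<alpha> (n div m) + \<alpha> (n mod m)" using add mult by metis
  also have "\<dots> \<le> ?M * (real k * real m * ?M ^ k) + real m * ?M ^ Suc k"
  proof (rule add_mono)
    show "\<alpha> m * \<alpha> (n div m) \<le> ?M * (real k * real m * ?M ^ k)"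
      by (rule mult_mono) (use Suc.IH[OF q] nonneg in auto)
    have "\<alpha> (n mod m) \<le> real m * 1"
      using ostrowski_le_nat[of "n mod m"] assms(1) by (simp add: order_trans[OF _ of_nat_mono])
    also have "\<dots> \<le> real m * ?M ^ Suc k" using one_le_power[OF M1, of "Suc k"] by (intro mult_left_mono) auto
    finally show "\<alpha> (n mod m) \<le> real m * ?M ^ Suc k" .
  qed
  also have "\<dots> = real (Suc k) * real m * ?M ^ Suc k" by (simp add: algebra_simps)
  finally show ?case .
qed

text \<open>Apply \<open>ostrowski_digits\<close> to \<open>N ^ j\<close>, which has about \<open>j * log m N\<close> digits, and take \<open>j\<close>-th roots.\<close>

lemma ostrowski_le_powr:
  assumes "m \<ge> 2" "N \<ge> 1"
  shows "\<alpha> N \<le> max 1 (\<alpha> m) powr log m N"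
proof -
  let ?M = "max 1 (\<alpha> m)" and ?L = "log m N"
  have M1: "1 \<le> ?M" by simp
  have L0: "0 \<le> ?L" using assms by simp
  have "(\<alpha> N / ?M powr ?L) ^ j \<le> (?L * m * ?M) * real j + m * ?M" for j
  proof -
    define k where "k = nat \<lfloor>real j * ?L\<rfloor> + 1"
    have k: "real j * ?L < real k" "real k \<le> real j * ?L + 1"
      using L0 by (auto simp: k_def) linarith+
    have "real (N ^ j) = (real m powr ?L) powr real j"
      using assms by (simp add: powr_realpow)
    also have "\<dots> = real m powr (real j * ?L)" by (simp only: powr_powr mult.commute)
    also have "\<dots> < real m powr real k" using k assms by (intro powr_less_mono) auto
    also have "\<dots> = real (m ^ k)" using assms by (simp add: powr_realpow)
    finally have "N ^ j < m ^ k" by linarith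
    from ostrowski_digits[OF assms(1) this]
    have "\<alpha> N ^ j \<le> real k * real m * ?M powr real k"
      using M1 by (simp add: ostrowski_power powr_realpow)
    also have "\<dots> \<le> (real j * ?L + 1) * real m * ?M powr (real j * ?L + 1)"
      using k L0 by (intro mult_mono powr_mono) auto
    also have "?M powr (real j * ?L + 1) = (?M powr ?L) powr real j * ?M"
      using M1 by (simp only: powr_add powr_powr mult.commute) simp
    also have "(?M powr ?L) powr real j = (?M powr ?L) ^ j"
      using M1 by (intro powr_realpow) simp
    finally have "\<alpha> N ^ j \<le> ((?L * m * ?M) * real j + m * ?M) * (?M powr ?L) ^ j"
      by (simp add: algebra_simps)
    moreover have "(?M powr ?L) ^ j > 0" using M1 by simp
    ultimately show ?thesis by (simp add: power_divide divide_le_eq)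
  qed
  then have "\<alpha> N / ?M powr ?L \<le> 1" by (rule le_one_if_powers_linearly_bounded)
  moreover have "?M powr ?L > 0" using M1 by simp
  ultimately show ?thesis by (simp add: divide_le_eq)
qed

text \<open>Ostrowski's theorem for the archimedean case. If \<open>\<alpha> > 1\<close> somewhere then \<open>\<alpha> m > 1\<close> for all \<open>m \<ge> 2\<close>, and
  \<open>ostrowski_le_powr\<close>, used for \<open>(m, N)\<close> and \<open>(N, m)\<close>, shows that \<open>ln (\<alpha> m) / ln m\<close> does not depend on \<open>m\<close>.\<close>

theorem ostrowski_nat:
  "(\<forall>n. \<alpha> n \<le> 1) \<or> (\<exists>s>0. \<forall>n\<ge>1. \<alpha> n = real n powr s)"
proof (cases "\<forall>n. \<alpha> n \<le> 1")
  case False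
  then obtain n0 where n0: "\<alpha> n0 > 1" by (auto simp: not_le)
  then have n02: "n0 \<ge> 2" using \<alpha>0 \<alpha>1 by (cases n0; cases "n0 - 1") auto
  have gt1: "\<alpha> m > 1" if "m \<ge> 2" for m
  proof (rule ccontr)
    assume "\<not> \<alpha> m > 1"
    then have "\<alpha> n0 \<le> 1" using ostrowski_le_powr[OF that, of n0] n02 by (simp add: max_absorb1)
    with n0 show False by simp
  qed
  have le: "ln (\<alpha> N) * ln m \<le> ln (\<alpha> m) * ln N" if "m \<ge> 2" "N \<ge> 2" for m N :: nat
  proof -
    have "\<alpha> N \<le> \<alpha> m powr log m N" using ostrowski_le_powr[OF that(1), of N] gt1[OF that(1)] that by (simp add: max_absorb2)
    then have "ln (\<alpha> N) \<le> ln (\<alpha> m powr log m N)" using gt1[OF that(2)] gt1[OF that(1)] by (subst ln_le_cancel_iff) auto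
    also have "\<dots> = log m N * ln (\<alpha> m)" using gt1[OF that(1)] by (simp add: ln_powr)
    finally have "ln (\<alpha> N) * ln m \<le> log m N * ln (\<alpha> m) * ln m" using that by (intro mult_right_mono) auto
    also have "\<dots> = ln (\<alpha> m) * ln N" using that by (simp add: log_def)
    finally show ?thesis .
  qed
  define s where "s = ln (\<alpha> 2) / ln 2"
  have "s > 0" using gt1[of 2] by (simp add: s_def)
  moreover have "\<alpha> n = real n powr s" if "n \<ge> 1" for n
  proof (cases "n = 1")
    case False
    then have n: "n \<ge> 2" using that by simp
    have "ln (\<alpha> n) * ln 2 = ln (\<alpha> 2) * ln n"
      using le[OF n order.refl] le[OF order.refl n] by (intro antisym) (auto simp: mult.commute)
    then have "ln (\<alpha> n) = s * ln n" by (simp add: s_def field_simps)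
    then have "exp (ln (\<alpha> n)) = exp (s * ln n)" by simp
    then show ?thesis using gt1[OF n] n by (simp add: powr_def)
  qed (use \<alpha>1 in simp)
  ultimately show ?thesis by blast
qed simp

end

section \<open>Fields with an absolute value\<close>

locale valued_field = field K for K :: "('a, 'm) ring_scheme" (structure) +
  fixes a :: "'a \<Rightarrow> real"
  assumes nontrivial: "nontrivial_abs K a"
begin

lemma abs_nonneg [simp]: "x \<in> carrier K \<Longrightarrow> 0 \<le> a x"
  and abs_eq_0 [simp]: "x \<in> carrier K \<Longrightarrow> a x = 0 \<longleftrightarrow> x = \<zero>"
  and abs_mult [simp]: "x \<in> carrier K \<Longrightarrow> y \<in> carrier K \<Longrightarrow> a (x \<otimes> y) = a x * a y"
  and abs_triangle: "x \<in> carrier K \<Longrightarrow> y \<in> carrier K \<Longrightarrow> a (x \<oplus> y) \<le> a x + a y"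
  using nontrivial by (auto simp: nontrivial_abs_def)

lemma abs_zero [simp]: "a \<zero> = 0" by simp

lemma abs_pos [simp]: "x \<in> carrier K \<Longrightarrow> 0 < a x \<longleftrightarrow> x \<noteq> \<zero>"
  using abs_nonneg[of x] abs_eq_0[of x] by linarith

lemma abs_one [simp]: "a \<one> = 1"
  using abs_mult[of \<one> \<one>] abs_eq_0[of \<one>] one_not_zero by simp

lemma abs_power [simp]: "x \<in> carrier K \<Longrightarrow> a (x [^] (n::nat)) = a x ^ n"
  by (induction n) auto

lemma abs_minus [simp]: "x \<in> carrier K \<Longrightarrow> a (\<ominus> x) = a x"
proof -
  assume x: "x \<in> carrier K"
  have "a (\<ominus> x) * a (\<ominus> x) = a x * a x"
    using x abs_mult[of "\<ominus> x" "\<ominus> x"] abs_mult[of x x] by (simp add: l_minus r_minus)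
  then show ?thesis using x abs_nonneg[of x] abs_nonneg[of "\<ominus> x"]
    by (simp only: a_inv_closed) (metis abs_of_nonneg real_sqrt_abs2)
qed

lemma abs_diff: "x \<in> carrier K \<Longrightarrow> y \<in> carrier K \<Longrightarrow> a (x \<ominus> y) \<le> a x + a y"
  using abs_triangle[of x "\<ominus> y"] by (simp add: minus_eq)

lemma abs_diff_commute: "x \<in> carrier K \<Longrightarrow> y \<in> carrier K \<Longrightarrow> a (x \<ominus> y) = a (y \<ominus> x)"
proof -
  assume xy: "x \<in> carrier K" "y \<in> carrier K"
  have "x \<ominus> y = \<ominus> (y \<ominus> x)"
    by (rule ring_identity[where ls="[x, y]"], (rule reify)+, simp add: in_carrier_def xy, code_simp)
  then show ?thesis using xy by simp
qed

lemma abs_diff_triangle: "x \<in> carrier K \<Longrightarrow> y \<in> carrier K \<Longrightarrow> z \<in> carrier K \<Longrightarrow> a (x \<ominus> z) \<le> a (x \<ominus> y) + a (y \<ominus> z)"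
proof -
  assume xy: "x \<in> carrier K" "y \<in> carrier K" "z \<in> carrier K"
  have "x \<ominus> z = (x \<ominus> y) \<oplus> (y \<ominus> z)"
    by (rule ring_identity[where ls="[x, y, z]"], (rule reify)+, simp add: in_carrier_def xy, code_simp)
  then show ?thesis using xy abs_triangle[of "x \<ominus> y" "y \<ominus> z"] by simp
qed

lemma abs_diff_ge: "x \<in> carrier K \<Longrightarrow> y \<in> carrier K \<Longrightarrow> a x - a y \<le> a (x \<ominus> y)"
  using abs_diff_triangle[of x y \<zero>] by (simp add: minus_eq)

lemma inv_in_carrier [simp]: "x \<in> carrier K \<Longrightarrow> x \<noteq> \<zero> \<Longrightarrow> inv x \<in> carrier K"
  and r_inv_ne [simp]: "x \<in> carrier K \<Longrightarrow> x \<noteq> \<zero> \<Longrightarrow> x \<otimes> inv x = \<one>"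
  and l_inv_ne [simp]: "x \<in> carrier K \<Longrightarrow> x \<noteq> \<zero> \<Longrightarrow> inv x \<otimes> x = \<one>"
  using field_Units by auto

lemma abs_inv [simp]: "x \<in> carrier K \<Longrightarrow> x \<noteq> \<zero> \<Longrightarrow> a (inv x) = inverse (a x)"
  using abs_mult[of x "inv x"] abs_eq_0[of x] by (simp add: field_simps)

lemma abs_of_int_cases:
  "(\<forall>n. a \<guillemotleft>int n\<guillemotright> \<le> 1) \<or> (\<exists>s>0. \<forall>n\<ge>1. a \<guillemotleft>int n\<guillemotright> = real n powr s)"
  by (rule ostrowski_nat) (auto simp: abs_triangle)

lemma exists_abs_gt_1: "\<exists>x\<in>carrier K. 1 < a x"
proof -
  obtain x where x: "x \<in> carrier K" "x \<noteq> \<zero>" "a x \<noteq> 1"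
    using nontrivial by (auto simp: nontrivial_abs_def)
  show ?thesis
  proof (cases "a x > 1")
    case False
    then have "a (inv x) > 1" using x by (simp add: one_less_inverse_iff)
    then show ?thesis using x by (intro bexI[of _ "inv x"]) auto
  qed (use x in auto)
qed

lemma abs_finsum_le:
  assumes "finite I" "f \<in> I \<rightarrow> carrier K" "\<And>i. i \<in> I \<Longrightarrow> a (f i) \<le> B"
  shows "a (finsum K f I) \<le> real (card I) * B"
  using assms
proof (induction I rule: finite_induct)
  case (insert i I)
  then have "a (finsum K f (insert i I)) \<le> a (f i) + a (finsum K f I)"
    by (subst finsum_insert) (auto intro!: abs_triangle finsum_closed simp: Pi_iff)
  also have "\<dots> \<le> B + real (card I) * B" using insert by (intro add_mono) (auto simp: Pi_iff)
  finally show ?case using insert by (simp add: algebra_simps)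
qed simp

text \<open>Only the integrality of the binomial coefficients matters.\<close>

lemma one_plus_power_expand:
  assumes u: "u \<in> carrier K"
  shows "\<exists>c. (\<one> \<oplus> u) [^] (n::nat) = (\<Oplus>k\<in>{..n}. \<guillemotleft>int (c k)\<guillemotright> \<otimes> u [^] k)"
proof (induction n)
  case 0
  show ?case by (rule exI[of _ "\<lambda>_. 1"]) simp
next
  case (Suc n)
  then obtain c where c: "(\<one> \<oplus> u) [^] n = (\<Oplus>k\<in>{..n}. \<guillemotleft>int (c k)\<guillemotright> \<otimes> u [^] k)" by blast
  define c1 where "c1 k = (if k \<le> n then c k else 0)" for k
  define c2 where "c2 k = (if k = 0 then 0 else c (k - 1))" for k
  have "(\<one> \<oplus> u) [^] Suc n = (\<one> \<oplus> u) [^] n \<oplus> u \<otimes> (\<one> \<oplus> u) [^] n"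
    using u m_comm[of u "(\<one> \<oplus> u) [^] n"] by (simp add: r_distr)
  also have "(\<one> \<oplus> u) [^] n = (\<Oplus>k\<in>{..Suc n}. \<guillemotleft>int (c1 k)\<guillemotright> \<otimes> u [^] k)"
  proof -
    have "(\<Oplus>k\<in>{..Suc n}. \<guillemotleft>int (c1 k)\<guillemotright> \<otimes> u [^] k) = (\<Oplus>k\<in>{..n}. \<guillemotleft>int (c1 k)\<guillemotright> \<otimes> u [^] k)"
      using u by (subst finsum_Suc) (auto simp: c1_def)
    also have "\<dots> = (\<Oplus>k\<in>{..n}. \<guillemotleft>int (c k)\<guillemotright> \<otimes> u [^] k)"
      by (rule add.finprod_cong') (use u in \<open>auto simp: c1_def\<close>)
    finally show ?thesis using c by simp
  qed
  also have "u \<otimes> (\<Oplus>k\<in>{..Suc n}. \<guillemotleft>int (c1 k)\<guillemotright> \<otimes> u [^] k) = (\<Oplus>k\<in>{..Suc n}. \<guillemotleft>int (c2 k)\<guillemotright> \<otimes> u [^] k)"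
  proof -
    have "(\<Oplus>k\<in>{..Suc n}. \<guillemotleft>int (c2 k)\<guillemotright> \<otimes> u [^] k) = (\<Oplus>k\<in>{..n}. \<guillemotleft>int (c2 (Suc k))\<guillemotright> \<otimes> u [^] Suc k)"
      using u by (subst finsum_Suc2) (auto simp: c2_def)
    also have "\<dots> = (\<Oplus>k\<in>{..n}. u \<otimes> (\<guillemotleft>int (c k)\<guillemotright> \<otimes> u [^] k))"
      by (rule add.finprod_cong') (use u in \<open>auto simp: c2_def m_ac\<close>)
    also have "\<dots> = u \<otimes> (\<Oplus>k\<in>{..n}. \<guillemotleft>int (c k)\<guillemotright> \<otimes> u [^] k)"
      using u by (subst finsum_rdistr) auto
    also have "(\<Oplus>k\<in>{..n}. \<guillemotleft>int (c k)\<guillemotright> \<otimes> u [^] k) = (\<Oplus>k\<in>{..Suc n}. \<guillemotleft>int (c1 k)\<guillemotright> \<otimes> u [^] k)"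
      using calculation c \<open>(\<one> \<oplus> u) [^] n = (\<Oplus>k\<in>{..Suc n}. \<guillemotleft>int (c1 k)\<guillemotright> \<otimes> u [^] k)\<close> by simp
    finally show ?thesis by simp
  qed
  also have "(\<Oplus>k\<in>{..Suc n}. \<guillemotleft>int (c1 k)\<guillemotright> \<otimes> u [^] k) \<oplus> (\<Oplus>k\<in>{..Suc n}. \<guillemotleft>int (c2 k)\<guillemotright> \<otimes> u [^] k) =
      (\<Oplus>k\<in>{..Suc n}. \<guillemotleft>int (c1 k)\<guillemotright> \<otimes> u [^] k \<oplus> \<guillemotleft>int (c2 k)\<guillemotright> \<otimes> u [^] k)"
    using u by (subst finsum_addf) auto
  also have "\<dots> = (\<Oplus>k\<in>{..Suc n}. \<guillemotleft>int (c1 k + c2 k)\<guillemotright> \<otimes> u [^] k)"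
    by (rule add.finprod_cong') (use u in \<open>auto simp: l_distr\<close>)
  finally show ?case by (intro exI[of _ "\<lambda>k. c1 k + c2 k"])
qed

text \<open>The binomial expansion of \<open>(1 + u) ^ n\<close> has \<open>n + 1\<close> terms of absolute value at most one, so
  \<open>a (1 + u) ^ n \<le> n + 1\<close>.\<close>

lemma ultrametric_if_bounded_on_nat:
  assumes bd: "\<forall>n. a \<guillemotleft>int n\<guillemotright> \<le> 1" and xy: "x \<in> carrier K" "y \<in> carrier K"
  shows "a (x \<oplus> y) \<le> max (a x) (a y)"
proof -
  have one: "a (\<one> \<oplus> u) \<le> 1" if u: "u \<in> carrier K" "a u \<le> 1" for u
  proof (rule le_one_if_powers_linearly_bounded[where a=1 and b=1])
    fix n :: nat
    obtain c where c: "(\<one> \<oplus> u) [^] n = (\<Oplus>k\<in>{..n}. \<guillemotleft>int (c k)\<guillemotright> \<otimes> u [^] k)"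
      using one_plus_power_expand[OF u(1), of n] by blast
    have "a (\<one> \<oplus> u) ^ n = a ((\<one> \<oplus> u) [^] n)" using u by simp
    also have "\<dots> \<le> real (card {..n}) * 1" unfolding c
    proof (rule abs_finsum_le)
      fix k
      have "a (\<guillemotleft>int (c k)\<guillemotright> \<otimes> u [^] k) = a \<guillemotleft>int (c k)\<guillemotright> * a u ^ k" using u by simp
      also have "\<dots> \<le> 1 * 1" using bd u by (intro mult_mono power_le_one) auto
      finally show "a (\<guillemotleft>int (c k)\<guillemotright> \<otimes> u [^] k) \<le> 1" by simp
    qed (use u in auto)
    finally show "a (\<one> \<oplus> u) ^ n \<le> 1 * real n + 1" by simp
  qed
  have *: "a (x \<oplus> y) \<le> a y" if "x \<in> carrier K" "y \<in> carrier K" "a x \<le> a y" for x y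
  proof (cases "y = \<zero>")
    case True
    then have "a x \<le> 0" using that(3) abs_zero by simp
    then have "a x = 0" using abs_nonneg[OF that(1)] by simp
    then have "x = \<zero>" using that by simp
    then show ?thesis using True by simp
  next
    case False
    then have ay: "a y > 0" using that by simp
    have "x \<oplus> y = y \<otimes> (\<one> \<oplus> x \<otimes> inv y)"
    proof -
      have "y \<otimes> (\<one> \<oplus> x \<otimes> inv y) = y \<oplus> x \<otimes> (y \<otimes> inv y)"
        by (rule ring_identity[where ls="[x, y, inv y]"], (rule reify)+, simp add: in_carrier_def that False, code_simp)
      then show ?thesis using that False by (simp add: a_comm)
    qed
    moreover have "a (\<one> \<oplus> x \<otimes> inv y) \<le> 1"
      by (rule one) (use that False ay in \<open>auto simp: field_simps\<close>)
    ultimately show ?thesis using that False ay by (simp add: mult_left_le)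
  qed
  show ?thesis using *[OF xy] *[OF xy(2,1)] xy by (cases "a x \<le> a y") (auto simp: a_comm max_def)
qed

end

section \<open>The completion at a place\<close>

locale valued_place = valued_field +
  fixes v :: "('a \<Rightarrow> real) set"
  assumes place: "v = abs_equiv K `` {a}"

text \<open>A place is an equivalence class; all further work is done with one absolute value representing it.\<close>

lemma places_cases:
  assumes "field K" "v \<in> places K"
  obtains a where "valued_place K a v"
  using assms unfolding places_def
  by (elim quotientE) (auto simp: valued_place_def valued_field_def valued_field_axioms_def valued_place_axioms_def)

context valued_field
begin

text \<open>Cauchy and null sequences for one absolute value; \<open>carrier_C\<close> and \<open>null_sequences\<close> show that
  equivalent absolute values lead to the same sequences.\<close>

definition cauchy :: "(nat \<Rightarrow> 'a) \<Rightarrow> bool" where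
  "cauchy s \<longleftrightarrow> range s \<subseteq> carrier K \<and> (\<forall>e>0. \<exists>N. \<forall>m\<ge>N. \<forall>n\<ge>N. a (s m \<ominus> s n) < e)"

definition null :: "(nat \<Rightarrow> 'a) \<Rightarrow> bool" where
  "null s \<longleftrightarrow> range s \<subseteq> carrier K \<and> (\<lambda>n. a (s n)) \<longlonglongrightarrow> 0"

lemma cauchy_closed: "cauchy s \<Longrightarrow> s n \<in> carrier K"
  by (auto simp: cauchy_def)

lemma null_closed: "null s \<Longrightarrow> s n \<in> carrier K"
  by (auto simp: null_def)

lemma nullD: "null s \<Longrightarrow> 0 < e \<Longrightarrow> \<exists>N. \<forall>n\<ge>N. a (s n) < e"
  using LIMSEQ_D[of "\<lambda>n. a (s n)" 0 e] by (auto simp: null_def range_subsetD)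

lemma nullI:
  assumes "\<And>n. s n \<in> carrier K" "\<And>e. 0 < e \<Longrightarrow> \<exists>N. \<forall>n\<ge>N. a (s n) < e"
  shows "null s"
  using assms unfolding null_def by (auto intro!: LIMSEQ_I)

lemma cauchy_bounded:
  assumes "cauchy s"
  shows "\<exists>B>0. \<forall>n. a (s n) \<le> B"
proof -
  note cl = cauchy_closed[OF assms]
  obtain N where N: "\<And>m n. m \<ge> N \<Longrightarrow> n \<ge> N \<Longrightarrow> a (s m \<ominus> s n) < 1"
    using assms unfolding cauchy_def by (meson zero_less_one)
  define B where "B = (\<Sum>n\<le>N. a (s n)) + 1"
  have le: "a (s n) \<le> (\<Sum>n\<le>N. a (s n))" if "n \<le> N" for n
    by (rule member_le_sum) (use that cl in auto)
  have "a (s n) \<le> B" for n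
  proof (cases "n \<le> N")
    case False
    then have "a (s n) - a (s N) \<le> a (s n \<ominus> s N)" "a (s n \<ominus> s N) < 1" using N[of n N] abs_diff_ge cl by auto
    then show ?thesis using le[of N] by (simp add: B_def)
  next
    case True
    then show ?thesis using le[of n] by (simp add: B_def)
  qed
  moreover have "B > 0" using sum_nonneg[of "{..N}" "\<lambda>n. a (s n)"] cl by (simp add: B_def)
  ultimately show ?thesis by blast
qed

lemma cauchy_const: "x \<in> carrier K \<Longrightarrow> cauchy (\<lambda>_. x)"
  by (auto simp: cauchy_def minus_eq r_neg)

lemma cauchy_add:
  assumes "cauchy s" "cauchy t"
  shows "cauchy (\<lambda>n. s n \<oplus> t n)"
  unfolding cauchy_def
proof (intro conjI allI impI)
  note cl = cauchy_closed[OF assms(1)] cauchy_closed[OF assms(2)]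
  show "range (\<lambda>n. s n \<oplus> t n) \<subseteq> carrier K" using cl by auto
  fix e :: real assume "e > 0"
  then have e: "e / 2 > 0" by simp
  obtain N1 where N1: "\<forall>m\<ge>N1. \<forall>n\<ge>N1. a (s m \<ominus> s n) < e / 2" using assms(1) e unfolding cauchy_def by blast
  obtain N2 where N2: "\<forall>m\<ge>N2. \<forall>n\<ge>N2. a (t m \<ominus> t n) < e / 2" using assms(2) e unfolding cauchy_def by blast
  have "a ((s m \<oplus> t m) \<ominus> (s n \<oplus> t n)) < e" if "m \<ge> max N1 N2" "n \<ge> max N1 N2" for m n
  proof -
    have "(s m \<oplus> t m) \<ominus> (s n \<oplus> t n) = (s m \<ominus> s n) \<oplus> (t m \<ominus> t n)"
      by (rule ring_identity[where ls="[s m, s n, t m, t n]"], (rule reify)+, simp add: in_carrier_def cl, code_simp)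
    then have "a ((s m \<oplus> t m) \<ominus> (s n \<oplus> t n)) \<le> a (s m \<ominus> s n) + a (t m \<ominus> t n)" using cl by (simp add: abs_triangle)
    moreover have "a (s m \<ominus> s n) < e / 2" "a (t m \<ominus> t n) < e / 2" using N1 N2 that by auto
    ultimately show ?thesis by simp
  qed
  then show "\<exists>N. \<forall>m\<ge>N. \<forall>n\<ge>N. a ((s m \<oplus> t m) \<ominus> (s n \<oplus> t n)) < e" by blast
qed

lemma cauchy_mult:
  assumes "cauchy s" "cauchy t"
  shows "cauchy (\<lambda>n. s n \<otimes> t n)"
  unfolding cauchy_def
proof (intro conjI allI impI)
  note cl = cauchy_closed[OF assms(1)] cauchy_closed[OF assms(2)]
  show "range (\<lambda>n. s n \<otimes> t n) \<subseteq> carrier K" using cl by auto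
  obtain B1 where B1: "B1 > 0" "\<And>n. a (s n) \<le> B1" using cauchy_bounded[OF assms(1)] by blast
  obtain B2 where B2: "B2 > 0" "\<And>n. a (t n) \<le> B2" using cauchy_bounded[OF assms(2)] by blast
  fix e :: real assume "e > 0"
  then have e: "e / (2 * B2) > 0" "e / (2 * B1) > 0" using B1 B2 by auto
  obtain N1 where N1: "\<forall>m\<ge>N1. \<forall>n\<ge>N1. a (s m \<ominus> s n) < e / (2 * B2)" using assms(1) e(1) unfolding cauchy_def by blast
  obtain N2 where N2: "\<forall>m\<ge>N2. \<forall>n\<ge>N2. a (t m \<ominus> t n) < e / (2 * B1)" using assms(2) e(2) unfolding cauchy_def by blast
  have "a ((s m \<otimes> t m) \<ominus> (s n \<otimes> t n)) < e" if mn: "m \<ge> max N1 N2" "n \<ge> max N1 N2" for m n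
  proof -
    have "(s m \<otimes> t m) \<ominus> (s n \<otimes> t n) = (s m \<ominus> s n) \<otimes> t m \<oplus> s n \<otimes> (t m \<ominus> t n)"
      by (rule ring_identity[where ls="[s m, s n, t m, t n]"], (rule reify)+, simp add: in_carrier_def cl, code_simp)
    then have "a ((s m \<otimes> t m) \<ominus> (s n \<otimes> t n)) \<le> a (s m \<ominus> s n) * a (t m) + a (s n) * a (t m \<ominus> t n)"
      using cl abs_triangle[of "(s m \<ominus> s n) \<otimes> t m" "s n \<otimes> (t m \<ominus> t n)"] by simp
    also have "\<dots> \<le> a (s m \<ominus> s n) * B2 + B1 * a (t m \<ominus> t n)"
      using B1 B2 cl by (intro add_mono mult_left_mono mult_right_mono) auto
    also have "\<dots> < e / (2 * B2) * B2 + B1 * (e / (2 * B1))"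
      using N1 N2 mn B1 B2 by (intro add_strict_mono mult_strict_left_mono mult_strict_right_mono) auto
    also have "\<dots> = e" using B1 B2 by simp
    finally show ?thesis .
  qed
  then show "\<exists>N. \<forall>m\<ge>N. \<forall>n\<ge>N. a ((s m \<otimes> t m) \<ominus> (s n \<otimes> t n)) < e" by blast
qed

lemma cauchy_minus: "cauchy s \<Longrightarrow> cauchy (\<lambda>n. \<ominus> s n)"
  using cauchy_mult[OF cauchy_const[of "\<ominus> \<one>"], of s] cauchy_closed[of s] by (simp add: l_minus)

lemma null_imp_cauchy:
  assumes "null s" shows "cauchy s"
  unfolding cauchy_def
proof (intro conjI allI impI)
  show "range s \<subseteq> carrier K" using assms by (simp add: null_def)
  fix e :: real assume "e > 0"
  then obtain N where N: "\<forall>n\<ge>N. a (s n) < e / 2" using nullD[OF assms, of "e / 2"] by auto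
  have "a (s m \<ominus> s n) < e" if "m \<ge> N" "n \<ge> N" for m n
    using abs_diff[of "s m" "s n"] null_closed[OF assms] N that by (smt (verit) field_sum_of_halves)
  then show "\<exists>N. \<forall>m\<ge>N. \<forall>n\<ge>N. a (s m \<ominus> s n) < e" by blast
qed

lemma null_add:
  assumes "null s" "null t" shows "null (\<lambda>n. s n \<oplus> t n)"
proof (rule nullI)
  fix e :: real assume "e > 0"
  then obtain N1 N2 where N: "\<forall>n\<ge>N1. a (s n) < e / 2" "\<forall>n\<ge>N2. a (t n) < e / 2"
    using nullD[OF assms(1), of "e / 2"] nullD[OF assms(2), of "e / 2"] by auto
  have "a (s n \<oplus> t n) < e" if "n \<ge> max N1 N2" for n
    using abs_triangle[of "s n" "t n"] null_closed[OF assms(1)] null_closed[OF assms(2)] N that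
    by (smt (verit) field_sum_of_halves max.boundedE)
  then show "\<exists>N. \<forall>n\<ge>N. a (s n \<oplus> t n) < e" by blast
qed (use null_closed[OF assms(1)] null_closed[OF assms(2)] in auto)

lemma null_mult:
  assumes "null s" "cauchy t" shows "null (\<lambda>n. t n \<otimes> s n)"
proof (rule nullI)
  note cl = null_closed[OF assms(1)] cauchy_closed[OF assms(2)]
  obtain B where B: "B > 0" "\<And>n. a (t n) \<le> B" using cauchy_bounded[OF assms(2)] by blast
  fix e :: real assume "e > 0"
  then obtain N where N: "\<forall>n\<ge>N. a (s n) < e / B" using nullD[OF assms(1), of "e / B"] B by auto
  have "a (t n \<otimes> s n) < e" if "n \<ge> N" for n
  proof -
    have "a (t n \<otimes> s n) \<le> B * a (s n)" using cl B by (simp add: mult_right_mono)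
    also have "\<dots> < B * (e / B)" using N that B by (intro mult_strict_left_mono) auto
    finally show ?thesis using B by simp
  qed
  then show "\<exists>N. \<forall>n\<ge>N. a (t n \<otimes> s n) < e" by blast
qed (use null_closed[OF assms(1)] cauchy_closed[OF assms(2)] in auto)

lemma cauchy_not_null_bounded_below:
  assumes "cauchy s" "\<not> null s"
  shows "\<exists>d>0. \<exists>N. \<forall>n\<ge>N. d \<le> a (s n)"
proof -
  note cl = cauchy_closed[OF assms(1)]
  obtain e where e: "e > 0" "\<forall>N. \<exists>n\<ge>N. e \<le> a (s n)"
    using assms(2) nullI[of s] cl by (meson not_le)
  obtain N where N: "\<forall>m\<ge>N. \<forall>n\<ge>N. a (s m \<ominus> s n) < e / 2"
    using assms(1) e(1) unfolding cauchy_def by (meson half_gt_zero)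
  obtain m where m: "m \<ge> N" "e \<le> a (s m)" using e(2) by blast
  have "e / 2 \<le> a (s n)" if "n \<ge> N" for n
    using abs_diff_ge[of "s m" "s n"] cl m N that by (smt (verit) field_sum_of_halves)
  then show ?thesis using e(1) by (intro exI[of _ "e / 2"]) auto
qed

text \<open>A Cauchy sequence that is not null is bounded away from zero from some index on. Inverting it there, and
  replacing the other terms by a default value, gives an inverse modulo null sequences.\<close>

lemma cauchy_eventual_inverse:
  assumes "cauchy s" "\<not> null s"
  shows "\<exists>t N. cauchy t \<and> (\<forall>n\<ge>N. t n \<otimes> s n = \<one>)"
proof -
  note cl = cauchy_closed[OF assms(1)]
  obtain d N where d: "d > 0" "\<And>n. n \<ge> N \<Longrightarrow> d \<le> a (s n)" using cauchy_not_null_bounded_below[OF assms] by blast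
  define t where "t n = (if n \<ge> N then inv (s n) else \<zero>)" for n
  have ne: "s n \<noteq> \<zero>" if "n \<ge> N" for n using d(1) d(2)[OF that] abs_zero by auto
  have tc: "t n \<in> carrier K" for n using ne cl by (auto simp: t_def)
  have "cauchy t" unfolding cauchy_def
  proof (intro conjI allI impI)
    show "range t \<subseteq> carrier K" using tc by auto
    fix e :: real assume "e > 0"
    then have "e * (d * d) > 0" using d by simp
    then obtain N1 where N1: "\<forall>m\<ge>N1. \<forall>n\<ge>N1. a (s m \<ominus> s n) < e * (d * d)" using assms(1) unfolding cauchy_def by blast
    have "a (t m \<ominus> t n) < e" if mn: "m \<ge> max N N1" "n \<ge> max N N1" for m n
    proof -
      have c: "s m \<in> carrier K" "s n \<in> carrier K" "inv (s m) \<in> carrier K" "inv (s n) \<in> carrier K" using cl ne mn by auto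
      have t: "t m = inv (s m)" "t n = inv (s n)" using mn by (auto simp: t_def)
      have "t m \<ominus> t n = inv (s m) \<otimes> (s n \<otimes> inv (s n)) \<ominus> inv (s n) \<otimes> (s m \<otimes> inv (s m))"
        using c ne mn by (simp add: t)
      also have "\<dots> = (inv (s m) \<otimes> inv (s n)) \<otimes> (s n \<ominus> s m)"
        by (rule ring_identity[where ls="[s m, s n, inv (s m), inv (s n)]"], (rule reify)+, simp add: in_carrier_def c, code_simp)
      finally have "a (t m \<ominus> t n) = inverse (a (s m)) * inverse (a (s n)) * a (s n \<ominus> s m)"
        using c ne mn by simp
      also have "\<dots> \<le> inverse d * inverse d * a (s n \<ominus> s m)"
        using d mn c ne by (intro mult_right_mono mult_mono le_imp_inverse_le) auto
      also have "\<dots> < inverse d * inverse d * (e * (d * d))"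
        using N1 mn d by (intro mult_strict_left_mono) auto
      also have "\<dots> = e" using d by (simp add: field_simps)
      finally show ?thesis .
    qed
    then show "\<exists>N. \<forall>m\<ge>N. \<forall>n\<ge>N. a (t m \<ominus> t n) < e" by blast
  qed
  moreover have "\<forall>n\<ge>N. t n \<otimes> s n = \<one>" using ne cl by (simp add: t_def)
  ultimately show ?thesis by blast
qed

text \<open>The elements that become squares in the completion, in terms of sequences in the field itself; see
  \<open>completion_square\<close>.\<close>

definition approx_sqrt :: "'a \<Rightarrow> bool" where
  "approx_sqrt b \<longleftrightarrow> (\<exists>z. cauchy z \<and> null (\<lambda>n. z n \<otimes> z n \<ominus> b))"

end

context valued_place
begin

lemma a_in_v: "a \<in> v"
  using nontrivial by (auto simp: place abs_equiv_def intro!: exI[of _ 1])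

lemma v_powr: "b \<in> v \<Longrightarrow> \<exists>s>0. \<forall>x\<in>carrier K. b x = a x powr s"
  by (auto simp: place abs_equiv_def)

lemma v_small:
  assumes "b \<in> v" "e > 0"
  shows "\<exists>d>0. \<forall>x\<in>carrier K. a x < d \<longrightarrow> b x < e"
proof -
  obtain s where s: "s > 0" "\<And>x. x \<in> carrier K \<Longrightarrow> b x = a x powr s" using v_powr[OF assms(1)] by blast
  have "b x < e" if "x \<in> carrier K" "a x < e powr (1 / s)" for x
  proof -
    have "b x < (e powr (1 / s)) powr s" unfolding s(2)[OF that(1)] using that s(1) by (intro powr_less_mono2) auto
    also have "\<dots> = e" using s(1) assms(2) by (simp add: powr_powr)
    finally show ?thesis .
  qed
  then show ?thesis using assms(2) by (intro exI[of _ "e powr (1 / s)"]) auto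
qed

lemma v_nonneg: "b \<in> v \<Longrightarrow> x \<in> carrier K \<Longrightarrow> 0 \<le> b x"
  using v_powr by fastforce

abbreviation C where "C \<equiv> cauchy_ring K v"

lemma carrier_C: "carrier C = {s. cauchy s}"
proof -
  have "(\<forall>b\<in>v. \<forall>e>0. \<exists>N. \<forall>m\<ge>N. \<forall>n\<ge>N. b (s m \<ominus> s n) < e) \<longleftrightarrow> (\<forall>e>0. \<exists>N. \<forall>m\<ge>N. \<forall>n\<ge>N. a (s m \<ominus> s n) < e)"
    if s: "range s \<subseteq> carrier K" for s :: "nat \<Rightarrow> 'a"
  proof (intro iffI ballI allI impI)
    fix b e assume h: "\<forall>e>0. \<exists>N. \<forall>m\<ge>N. \<forall>n\<ge>N. a (s m \<ominus> s n) < e" and b: "b \<in> v" and e: "e > (0::real)"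
    obtain d where d: "d > 0" "\<forall>x\<in>carrier K. a x < d \<longrightarrow> b x < e" using v_small[OF b e] by blast
    obtain N where "\<forall>m\<ge>N. \<forall>n\<ge>N. a (s m \<ominus> s n) < d" using h d(1) by blast
    moreover have "s m \<ominus> s n \<in> carrier K" for m n using s by auto
    ultimately show "\<exists>N. \<forall>m\<ge>N. \<forall>n\<ge>N. b (s m \<ominus> s n) < e" using d(2) by blast
  qed (use a_in_v in blast)
  then show ?thesis by (auto simp: cauchy_ring_def cauchy_def)
qed

lemma null_sequences: "null_sequences K v = {s. null s}"
proof -
  have "(\<forall>b\<in>v. (\<lambda>n. b (s n)) \<longlonglongrightarrow> 0) \<longleftrightarrow> (\<lambda>n. a (s n)) \<longlonglongrightarrow> 0" if s: "range s \<subseteq> carrier K" for s :: "nat \<Rightarrow> 'a"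
  proof (intro iffI ballI)
    fix b assume h: "(\<lambda>n. a (s n)) \<longlonglongrightarrow> 0" and b: "b \<in> v"
    show "(\<lambda>n. b (s n)) \<longlonglongrightarrow> 0"
    proof (rule LIMSEQ_I)
      fix e :: real assume e: "e > 0"
      obtain d where d: "d > 0" "\<forall>x\<in>carrier K. a x < d \<longrightarrow> b x < e" using v_small[OF b e] by blast
      have "null s" using s h by (simp add: null_def)
      then obtain N where N: "\<forall>n\<ge>N. a (s n) < d" using nullD d(1) by blast
      have "b (s n) < e \<and> 0 \<le> b (s n)" if "n \<ge> N" for n using N d(2) that s v_nonneg[OF b] by (auto simp: range_subsetD)
      then show "\<exists>no. \<forall>n\<ge>no. norm_class.norm (b (s n) - 0) < e" by (intro exI[of _ N]) auto
    qed
  qed (use a_in_v in blast)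
  then show ?thesis by (auto simp: null_sequences_def null_def)
qed

lemma C_simps: "s \<otimes>\<^bsub>C\<^esub> t = (\<lambda>n. s n \<otimes> t n)" "s \<oplus>\<^bsub>C\<^esub> t = (\<lambda>n. s n \<oplus> t n)" "\<one>\<^bsub>C\<^esub> = (\<lambda>_. \<one>)" "\<zero>\<^bsub>C\<^esub> = (\<lambda>_. \<zero>)"
  by (simp_all add: cauchy_ring_def)

lemma cring_C: "cring C"
proof (rule cringI)
  show "abelian_group C"
  proof (rule abelian_groupI)
    fix s assume "s \<in> carrier C"
    then show "\<exists>t\<in>carrier C. t \<oplus>\<^bsub>C\<^esub> s = \<zero>\<^bsub>C\<^esub>"
      by (intro bexI[of _ "\<lambda>n. \<ominus> s n"]) (auto simp: carrier_C C_simps cauchy_minus cauchy_closed l_neg)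
  qed (auto simp: carrier_C C_simps cauchy_add cauchy_const cauchy_closed a_ac)
  show "comm_monoid C"
    by (rule comm_monoidI) (auto simp: carrier_C C_simps cauchy_mult cauchy_const cauchy_closed m_ac)
qed (auto simp: carrier_C C_simps cauchy_closed l_distr)

sublocale C: cring C by (rule cring_C)

lemma C_minus: "cauchy s \<Longrightarrow> cauchy t \<Longrightarrow> s \<ominus>\<^bsub>C\<^esub> t = (\<lambda>n. s n \<ominus> t n)"
proof -
  assume s: "cauchy s" and t: "cauchy t"
  have "\<ominus>\<^bsub>C\<^esub> t = (\<lambda>n. \<ominus> t n)"
    by (rule C.minus_equality) (use t in \<open>auto simp: carrier_C C_simps cauchy_minus cauchy_closed l_neg\<close>)
  then show ?thesis by (simp add: C.minus_eq C_simps minus_eq)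
qed

lemma ideal_null: "ideal (null_sequences K v) C"
proof (rule idealI)
  show "subgroup (null_sequences K v) (add_monoid C)"
  proof (rule C.add.subgroupI)
    show "null_sequences K v \<subseteq> carrier C" by (auto simp: null_sequences carrier_C null_imp_cauchy)
    have "null (\<lambda>_. \<zero>)" by (auto simp: null_def)
    then show "null_sequences K v \<noteq> {}" by (auto simp: null_sequences)
    fix s assume s: "s \<in> null_sequences K v"
    then have "\<ominus>\<^bsub>C\<^esub> s = (\<lambda>n. (\<ominus> \<one>) \<otimes> s n)"
      by (intro C.minus_equality)
         (auto simp: null_sequences carrier_C C_simps null_imp_cauchy null_closed l_neg l_minus cauchy_minus)
    then show "\<ominus>\<^bsub>C\<^esub> s \<in> null_sequences K v"
      using s null_mult[of s "\<lambda>_. \<ominus> \<one>"] by (simp add: null_sequences cauchy_const)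
    fix t assume "t \<in> null_sequences K v"
    then show "s \<oplus>\<^bsub>C\<^esub> t \<in> null_sequences K v" using s by (simp add: null_sequences C_simps null_add)
  qed
  fix s x assume sx: "s \<in> null_sequences K v" "x \<in> carrier C"
  then show "x \<otimes>\<^bsub>C\<^esub> s \<in> null_sequences K v"
    by (simp add: null_sequences carrier_C C_simps null_mult)
  then show "s \<otimes>\<^bsub>C\<^esub> x \<in> null_sequences K v"
    using sx by (subst C.m_comm) (auto simp: null_sequences carrier_C null_imp_cauchy)
qed (rule C.ring_axioms)

text \<open>An ideal that contains a sequence which is not null contains a sequence that is eventually \<open>1\<close>, by
  \<open>cauchy_eventual_inverse\<close>, and this differs from \<open>1\<close> by a null sequence.\<close>

lemma maximalideal_null: "maximalideal (null_sequences K v) C"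
proof (rule maximalidealI)
  show "ideal (null_sequences K v) C" by (rule ideal_null)
  have "\<not> null (\<lambda>_. \<one>)"
  proof
    assume "null (\<lambda>_. \<one>)"
    then obtain N :: nat where "\<forall>n\<ge>N. a \<one> < 1" using nullD[of "\<lambda>_. \<one>" 1] zero_less_one by blast
    then have "a \<one> < 1" using order.refl[of N] by blast
    then show False by simp
  qed
  then show "carrier C \<noteq> null_sequences K v" by (auto simp: carrier_C null_sequences cauchy_const)
  fix J assume J: "ideal J C" "null_sequences K v \<subseteq> J" "J \<subseteq> carrier C"
  show "J = null_sequences K v \<or> J = carrier C"
  proof (rule disjCI)
    assume "J \<noteq> carrier C"
    show "J = null_sequences K v"
    proof (rule ccontr)
      assume "J \<noteq> null_sequences K v"
      then obtain s where s: "s \<in> J" "\<not> null s" "cauchy s" using J(2,3) by (auto simp: null_sequences carrier_C)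
      obtain t N where t: "cauchy t" "\<forall>n\<ge>N. t n \<otimes> s n = \<one>" using cauchy_eventual_inverse[OF s(3,2)] by blast
      have ts: "t \<otimes>\<^bsub>C\<^esub> s \<in> J" using ideal.I_l_closed[OF J(1) s(1)] t by (simp add: carrier_C)
      have "null (\<lambda>n. \<one> \<ominus> t n \<otimes> s n)"
      proof (rule nullI)
        fix e :: real assume "e > 0"
        then show "\<exists>N. \<forall>n\<ge>N. a (\<one> \<ominus> t n \<otimes> s n) < e"
          using t(2) by (intro exI[of _ N]) (auto simp: minus_eq r_neg)
      qed (use cauchy_closed t s in auto)
      then have "\<one>\<^bsub>C\<^esub> \<ominus>\<^bsub>C\<^esub> t \<otimes>\<^bsub>C\<^esub> s \<in> J"
        using J(2) by (subst C_minus) (auto simp: C_simps null_sequences cauchy_const cauchy_mult t s)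
      then have "(\<one>\<^bsub>C\<^esub> \<ominus>\<^bsub>C\<^esub> t \<otimes>\<^bsub>C\<^esub> s) \<oplus>\<^bsub>C\<^esub> t \<otimes>\<^bsub>C\<^esub> s \<in> J" using ts J(1) by (simp add: additive_subgroup.a_closed ideal.axioms(1))
      moreover have "(\<one>\<^bsub>C\<^esub> \<ominus>\<^bsub>C\<^esub> t \<otimes>\<^bsub>C\<^esub> s) \<oplus>\<^bsub>C\<^esub> t \<otimes>\<^bsub>C\<^esub> s = \<one>\<^bsub>C\<^esub>"
        using ts J(3) by (simp add: C.minus_eq C.a_assoc C.l_neg subset_iff)
      ultimately have "J = carrier C" using ideal.one_imp_carrier[OF J(1)] by simp
      with \<open>J \<noteq> carrier C\<close> show False by simp
    qed
  qed
qed

lemma field_completion: "field (completion K v)"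
  unfolding completion_def by (rule maximalideal.quotient_is_field[OF maximalideal_null cring_C])

lemma to_completion_hom: "to_completion K v \<in> ring_hom K (completion K v)"
proof -
  note h = ideal.rcos_ring_hom[OF ideal_null]
  have c: "(\<lambda>_. x) \<in> carrier C" if "x \<in> carrier K" for x using that by (simp add: carrier_C cauchy_const)
  show ?thesis
    unfolding to_completion_def completion_def
    using ring_hom_closed[OF h c] ring_hom_mult[OF h c c] ring_hom_add[OF h c c] ring_hom_one[OF h]
    by (intro ring_hom_memI) (simp_all add: C_simps)
qed

lemma completion_square:
  assumes "approx_sqrt b" "b \<in> carrier K"
  shows "\<exists>w\<in>carrier (completion K v). w \<otimes>\<^bsub>completion K v\<^esub> w = to_completion K v b"
proof -
  obtain z where z: "cauchy z" "null (\<lambda>n. z n \<otimes> z n \<ominus> b)" using assms by (auto simp: approx_sqrt_def)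
  note h = ideal.rcos_ring_hom[OF ideal_null]
  have zc: "z \<in> carrier C" using z by (simp add: carrier_C)
  have bc: "(\<lambda>_. b) \<in> carrier C" using assms(2) by (simp add: carrier_C cauchy_const)
  let ?w = "null_sequences K v +>\<^bsub>C\<^esub> z"
  have "?w \<otimes>\<^bsub>completion K v\<^esub> ?w = null_sequences K v +>\<^bsub>C\<^esub> (z \<otimes>\<^bsub>C\<^esub> z)"
    unfolding completion_def using ring_hom_mult[OF h zc zc] by simp
  also have "\<dots> = null_sequences K v +>\<^bsub>C\<^esub> (\<lambda>_. b)"
  proof (subst C.quotient_eq_iff_same_a_r_cos[OF ideal_null, symmetric])
    show "z \<otimes>\<^bsub>C\<^esub> z \<ominus>\<^bsub>C\<^esub> (\<lambda>_. b) \<in> null_sequences K v"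
      using z assms(2) by (subst C_minus) (auto simp: C_simps cauchy_mult cauchy_const null_sequences)
  qed (use zc bc in auto)
  finally show ?thesis using ring_hom_closed[OF h zc] unfolding to_completion_def completion_def by blast
qed

end

section \<open>Square roots in completions\<close>

lemma (in cring) fraction_minus:
  assumes "p \<in> carrier R" "p' \<in> carrier R" "q \<in> carrier R" "q' \<in> carrier R" "i \<in> carrier R" "i' \<in> carrier R"
  shows "p \<otimes> i \<otimes> (q' \<otimes> i') \<ominus> p' \<otimes> i' \<otimes> (q \<otimes> i) = (p \<otimes> q' \<ominus> p' \<otimes> q) \<otimes> (i \<otimes> i')"
  by (rule ring_identity[where ls="[p, p', q, q', i, i']"], (rule reify)+, simp add: in_carrier_def assms, code_simp)

lemma (in cring) fraction_square_minus:
  assumes "p \<in> carrier R" "m \<in> carrier R" "q \<in> carrier R" "i \<in> carrier R"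
  shows "(p \<otimes> i) \<otimes> (p \<otimes> i) \<ominus> m \<otimes> (q \<otimes> i) \<otimes> (q \<otimes> i) = (p \<otimes> p \<ominus> m \<otimes> (q \<otimes> q)) \<otimes> (i \<otimes> i)"
  by (rule ring_identity[where ls="[p, m, q, i]"], (rule reify)+, simp add: in_carrier_def assms, code_simp)

context valued_field
begin

lemma approx_sqrt_mult_square:
  assumes "approx_sqrt b" "b \<in> carrier K" "w \<in> carrier K"
  shows "approx_sqrt (w \<otimes> w \<otimes> b)"
proof -
  obtain z where z: "cauchy z" "null (\<lambda>n. z n \<otimes> z n \<ominus> b)" using assms(1) by (auto simp: approx_sqrt_def)
  have zc: "z n \<in> carrier K" for n using cauchy_closed[OF z(1)] .
  have "(w \<otimes> z n) \<otimes> (w \<otimes> z n) \<ominus> w \<otimes> w \<otimes> b = (w \<otimes> w) \<otimes> (z n \<otimes> z n \<ominus> b)" for n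
    by (rule ring_identity[where ls="[w, z n, b]"], (rule reify)+, simp add: in_carrier_def zc assms, code_simp)
  then have "null (\<lambda>n. (w \<otimes> z n) \<otimes> (w \<otimes> z n) \<ominus> w \<otimes> w \<otimes> b)"
    using null_mult[OF z(2) cauchy_const[of "w \<otimes> w"]] assms by simp
  moreover have "cauchy (\<lambda>n. w \<otimes> z n)" using cauchy_mult[OF cauchy_const[OF assms(3)] z(1)] .
  ultimately show ?thesis unfolding approx_sqrt_def by blast
qed

text \<open>The root of \<open>m\<close> is approximated by the rationals \<open>\<lfloor>(n + 1) sqrt m\<rfloor> / (n + 1)\<close>. On rationals
  the absolute value is \<open>\<bar>x\<bar> powr s\<close>, so real convergence is convergence for \<open>a\<close>.\<close>

lemma approx_sqrt_archimedean:
  assumes s: "s > 0" and arch: "\<And>n. n \<ge> 1 \<Longrightarrow> a \<guillemotleft>int n\<guillemotright> = real n powr s" 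
  shows "approx_sqrt \<guillemotleft>int m\<guillemotright>"
proof -
  have int: "a \<guillemotleft>i\<guillemotright> = \<bar>real_of_int i\<bar> powr s" for i
  proof -
    obtain n where n: "i = int n \<or> i = - int n" by (metis int_cases2)
    have "a \<guillemotleft>int n\<guillemotright> = real n powr s" using arch[of n] s by (cases "n = 0") auto
    then show ?thesis using n by auto
  qed
  have ne: "\<guillemotleft>i\<guillemotright> \<noteq> \<zero>" if "i \<noteq> 0" for i
    using int[of i] that abs_zero by (auto simp: powr_eq_0_iff)
  define p where "p n = \<lfloor>real (Suc n) * sqrt m\<rfloor>" for n
  define r where "r n = real_of_int (p n) / real (Suc n)" for n
  define q where "q n = int (Suc n)" for n
  define z where "z n = \<guillemotleft>p n\<guillemotright> \<otimes> inv \<guillemotleft>q n\<guillemotright>" for n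
  have q: "\<guillemotleft>q n\<guillemotright> \<noteq> \<zero>" for n by (rule ne) (simp add: q_def)
  have qr: "\<bar>real_of_int (q n)\<bar> = real (Suc n)" for n by (simp add: q_def)
  have qi: "inv \<guillemotleft>q n\<guillemotright> \<in> carrier K" for n using q by simp
  have zc: "z n \<in> carrier K" for n using qi by (simp add: z_def)
  have r: "r \<longlonglongrightarrow> sqrt m"
  proof (rule tendsto_sandwich[of "\<lambda>n. sqrt m - inverse (real (Suc n))" _ _ "\<lambda>_. sqrt m"])
    show "\<forall>\<^sub>F n in sequentially. sqrt m - inverse (real (Suc n)) \<le> r n"
    proof (intro always_eventually allI)
      fix n
      have "real (Suc n) * sqrt m - 1 \<le> p n" unfolding p_def by linarith
      then have "(real (Suc n) * sqrt m - 1) / real (Suc n) \<le> r n" unfolding r_def by (intro divide_right_mono) auto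
      then show "sqrt m - inverse (real (Suc n)) \<le> r n" by (simp add: diff_divide_distrib inverse_eq_divide)
    qed
    show "\<forall>\<^sub>F n in sequentially. r n \<le> sqrt m"
    proof (intro always_eventually allI)
      fix n
      have "p n \<le> real (Suc n) * sqrt m" unfolding p_def by linarith
      then have "r n \<le> (real (Suc n) * sqrt m) / real (Suc n)" unfolding r_def by (intro divide_right_mono) auto
      then show "r n \<le> sqrt m" by simp
    qed
    show "(\<lambda>n. sqrt m - inverse (real (Suc n))) \<longlonglongrightarrow> sqrt m"
      using tendsto_diff[OF tendsto_const LIMSEQ_inverse_real_of_nat, of "sqrt m"] by simp
  qed simp
  have cross: "a (z k \<ominus> z n) = \<bar>r k - r n\<bar> powr s" for k n
  proof -
    have "z k \<ominus> z n = \<guillemotleft>p k\<guillemotright> \<otimes> inv \<guillemotleft>q k\<guillemotright> \<otimes> (\<guillemotleft>q n\<guillemotright> \<otimes> inv \<guillemotleft>q n\<guillemotright>) \<ominus> \<guillemotleft>p n\<guillemotright> \<otimes> inv \<guillemotleft>q n\<guillemotright> \<otimes> (\<guillemotleft>q k\<guillemotright> \<otimes> inv \<guillemotleft>q k\<guillemotright>)"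
      using q[of k] q[of n] qi by (simp add: z_def)
    also have "\<dots> = (\<guillemotleft>p k\<guillemotright> \<otimes> \<guillemotleft>q n\<guillemotright> \<ominus> \<guillemotleft>p n\<guillemotright> \<otimes> \<guillemotleft>q k\<guillemotright>) \<otimes> (inv \<guillemotleft>q k\<guillemotright> \<otimes> inv \<guillemotleft>q n\<guillemotright>)"
      by (rule fraction_minus) (use qi in auto)
    also have "\<guillemotleft>p k\<guillemotright> \<otimes> \<guillemotleft>q n\<guillemotright> \<ominus> \<guillemotleft>p n\<guillemotright> \<otimes> \<guillemotleft>q k\<guillemotright> = \<guillemotleft>p k * q n - p n * q k\<guillemotright>"
      by (simp only: of_int_diff of_int_mult)
    finally have "a (z k \<ominus> z n) = a \<guillemotleft>p k * q n - p n * q k\<guillemotright> * (inverse (a \<guillemotleft>q k\<guillemotright>) * inverse (a \<guillemotleft>q n\<guillemotright>))"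
      using q[of k] q[of n] qi by (simp del: of_int_diff of_int_mult)
    also have "\<dots> = (\<bar>real_of_int (p k * q n - p n * q k)\<bar> / (\<bar>real_of_int (q k)\<bar> * \<bar>real_of_int (q n)\<bar>)) powr s"
      unfolding int by (simp add: qr powr_divide powr_mult inverse_eq_divide del: of_nat_Suc)
    also have "\<bar>real_of_int (p k * q n - p n * q k)\<bar> / (\<bar>real_of_int (q k)\<bar> * \<bar>real_of_int (q n)\<bar>) = \<bar>r k - r n\<bar>"
    proof -
      have "r k - r n = real_of_int (p k * q n - p n * q k) / (real_of_int (q k) * real_of_int (q n))"
        by (simp add: r_def q_def field_simps)
      then show ?thesis by (simp add: Fields.abs_divide Rings.abs_mult)
    qed
    finally show ?thesis .
  qed
  have sq: "a (z n \<otimes> z n \<ominus> \<guillemotleft>int m\<guillemotright>) = \<bar>r n * r n - m\<bar> powr s" for n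
  proof -
    have "z n \<otimes> z n \<ominus> \<guillemotleft>int m\<guillemotright> = (\<guillemotleft>p n\<guillemotright> \<otimes> inv \<guillemotleft>q n\<guillemotright>) \<otimes> (\<guillemotleft>p n\<guillemotright> \<otimes> inv \<guillemotleft>q n\<guillemotright>) \<ominus> \<guillemotleft>int m\<guillemotright> \<otimes> (\<guillemotleft>q n\<guillemotright> \<otimes> inv \<guillemotleft>q n\<guillemotright>) \<otimes> (\<guillemotleft>q n\<guillemotright> \<otimes> inv \<guillemotleft>q n\<guillemotright>)"
      using q[of n] qi by (simp add: z_def)
    also have "\<dots> = (\<guillemotleft>p n\<guillemotright> \<otimes> \<guillemotleft>p n\<guillemotright> \<ominus> \<guillemotleft>int m\<guillemotright> \<otimes> (\<guillemotleft>q n\<guillemotright> \<otimes> \<guillemotleft>q n\<guillemotright>)) \<otimes> (inv \<guillemotleft>q n\<guillemotright> \<otimes> inv \<guillemotleft>q n\<guillemotright>)"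
      by (rule fraction_square_minus) (use qi in auto)
    also have "\<guillemotleft>p n\<guillemotright> \<otimes> \<guillemotleft>p n\<guillemotright> \<ominus> \<guillemotleft>int m\<guillemotright> \<otimes> (\<guillemotleft>q n\<guillemotright> \<otimes> \<guillemotleft>q n\<guillemotright>) = \<guillemotleft>p n * p n - int m * (q n * q n)\<guillemotright>"
      by (simp only: of_int_diff of_int_mult)
    finally have "a (z n \<otimes> z n \<ominus> \<guillemotleft>int m\<guillemotright>) = a \<guillemotleft>p n * p n - int m * (q n * q n)\<guillemotright> * (inverse (a \<guillemotleft>q n\<guillemotright>) * inverse (a \<guillemotleft>q n\<guillemotright>))"
      using q[of n] qi by (simp del: of_int_diff of_int_mult)
    also have "\<dots> = (\<bar>real_of_int (p n * p n - int m * (q n * q n))\<bar> / (\<bar>real_of_int (q n)\<bar> * \<bar>real_of_int (q n)\<bar>)) powr s"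
      unfolding int by (simp add: qr powr_divide powr_mult inverse_eq_divide del: of_nat_Suc)
    also have "\<bar>real_of_int (p n * p n - int m * (q n * q n))\<bar> / (\<bar>real_of_int (q n)\<bar> * \<bar>real_of_int (q n)\<bar>) = \<bar>r n * r n - m\<bar>"
    proof -
      have r': "r n = real_of_int (p n) / real_of_int (q n)" by (simp add: r_def q_def)
      have "real_of_int (q n) \<noteq> 0" by (simp add: q_def)
      then have "r n * r n - m = real_of_int (p n * p n - int m * (q n * q n)) / (real_of_int (q n) * real_of_int (q n))"
        unfolding r' by (simp add: diff_divide_distrib)
      then show ?thesis by (simp add: Fields.abs_divide Rings.abs_mult)
    qed
    finally show ?thesis .
  qed
  have small: "\<bar>x\<bar> powr s < e" if "\<bar>x\<bar> < e powr (1 / s)" "e > 0" for x e :: real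
  proof -
    have "\<bar>x\<bar> powr s < (e powr (1 / s)) powr s" using that s by (intro powr_less_mono2) auto
    then show ?thesis using s that by (simp add: powr_powr)
  qed
  have "cauchy z" unfolding cauchy_def
  proof (intro conjI allI impI)
    fix e :: real assume e: "e > 0"
    have "Cauchy r" using r by (intro LIMSEQ_imp_Cauchy)
    then obtain N where "\<forall>k\<ge>N. \<forall>n\<ge>N. dist (r k) (r n) < e powr (1 / s)" using e unfolding Cauchy_def
      by (metis powr_gt_zero order_less_irrefl)
    then show "\<exists>N. \<forall>m\<ge>N. \<forall>n\<ge>N. a (z m \<ominus> z n) < e" using small e unfolding cross dist_real_def by blast
  qed (use zc in auto)
  moreover have "null (\<lambda>n. z n \<otimes> z n \<ominus> \<guillemotleft>int m\<guillemotright>)"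
  proof (rule nullI)
    fix e :: real assume e: "e > 0"
    have "(\<lambda>n. r n * r n - m) \<longlonglongrightarrow> sqrt m * sqrt m - m" by (intro tendsto_intros r)
    then have "(\<lambda>n. r n * r n - m) \<longlonglongrightarrow> 0" by simp
    then obtain N where "\<forall>n\<ge>N. \<bar>r n * r n - m\<bar> < e powr (1 / s)"
      using LIMSEQ_D[of _ 0 "e powr (1 / s)"] e by fastforce
    then show "\<exists>N. \<forall>n\<ge>N. a (z n \<otimes> z n \<ominus> \<guillemotleft>int m\<guillemotright>) < e" using small e unfolding sq by blast
  qed (use zc in auto)
  ultimately show ?thesis unfolding approx_sqrt_def by blast
qed

end

locale nonarch_field = valued_field +
  assumes ultra: "x \<in> carrier K \<Longrightarrow> y \<in> carrier K \<Longrightarrow> a (x \<oplus> y) \<le> max (a x) (a y)"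
begin

lemma ultra_diff: "x \<in> carrier K \<Longrightarrow> y \<in> carrier K \<Longrightarrow> a (x \<ominus> y) \<le> max (a x) (a y)"
  using ultra[of x "\<ominus> y"] by (simp add: minus_eq)

lemma abs_of_int_le: "a \<guillemotleft>i\<guillemotright> \<le> 1"
proof -
  have nat: "a \<guillemotleft>int n\<guillemotright> \<le> 1" for n
  proof (induction n)
    case (Suc n)
    then show ?case using ultra[of \<one> "\<guillemotleft>int n\<guillemotright>"] by simp
  qed simp
  obtain n where "i = int n \<or> i = - int n" by (metis int_cases2)
  then show ?thesis using nat[of n] by auto
qed

lemma abs_eq_if_close:
  assumes "x \<in> carrier K" "y \<in> carrier K" "a (x \<ominus> y) < a y"
  shows "a x = a y"
proof -
  have "x = (x \<ominus> y) \<oplus> y" using assms by (simp add: minus_eq a_assoc l_neg)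
  then have "a x \<le> a y" using ultra[of "x \<ominus> y" y] assms by simp
  moreover have "y = x \<ominus> (x \<ominus> y)"
    by (rule ring_identity[where ls="[x, y]"], (rule reify)+, simp add: in_carrier_def assms, code_simp)
  then have "a y \<le> max (a x) (a (x \<ominus> y))" using ultra_diff[of x "x \<ominus> y"] assms by simp
  ultimately show ?thesis using assms(3) by linarith
qed

text \<open>A root of \<open>1 + 4 x\<close> is \<open>1 + 2 y\<close> with \<open>y + y^2 = x\<close>, and \<open>y\<close> is the limit of the contraction
  \<open>w \<mapsto> x - w^2\<close> started at \<open>0\<close>. This covers residue characteristic two as well.\<close>

lemma approx_sqrt_one_plus_four:
  assumes x: "x \<in> carrier K" "a x < 1"
  shows "approx_sqrt (\<one> \<oplus> \<guillemotleft>4\<guillemotright> \<otimes> x)"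
proof -
  define y where "y = rec_nat \<zero> (\<lambda>_ w. x \<ominus> w \<otimes> w)"
  have y0: "y 0 = \<zero>" and yS: "y (Suc n) = x \<ominus> y n \<otimes> y n" for n by (simp_all add: y_def)
  have yc: "y n \<in> carrier K" for n by (induction n) (use x in \<open>auto simp: y0 yS\<close>)
  have ya: "a (y n) \<le> a x" for n
  proof (induction n)
    case (Suc n)
    have "a (y (Suc n)) \<le> max (a x) (a (y n) * a (y n))" using ultra_diff[of x "y n \<otimes> y n"] yc x by (simp add: yS)
    moreover have "a (y n) * a (y n) \<le> a x * 1" using Suc x yc by (intro mult_mono) auto
    ultimately show ?case by simp
  qed (use x in \<open>simp add: y0\<close>)
  have step: "a (y (Suc n) \<ominus> y n) \<le> a x ^ Suc n" for n
  proof (induction n)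
    case (Suc n)
    have "y (Suc (Suc n)) \<ominus> y (Suc n) = (x \<ominus> y (Suc n) \<otimes> y (Suc n)) \<ominus> (x \<ominus> y n \<otimes> y n)" using yS by simp
    also have "\<dots> = \<ominus> ((y (Suc n) \<ominus> y n) \<otimes> (y (Suc n) \<oplus> y n))"
      by (rule ring_identity[where ls="[x, y (Suc n), y n]"], (rule reify)+, simp add: in_carrier_def x yc, code_simp)
    finally have "a (y (Suc (Suc n)) \<ominus> y (Suc n)) = a (y (Suc n) \<ominus> y n) * a (y (Suc n) \<oplus> y n)" using yc by simp
    also have "\<dots> \<le> a x ^ Suc n * a x"
      using Suc ultra[of "y (Suc n)" "y n"] ya[of n] ya[of "Suc n"] yc x by (intro mult_mono) auto
    finally show ?case by (simp add: mult.commute)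
  qed (use x in \<open>simp add: y0 yS minus_eq\<close>)
  have le: "a (y (n + k) \<ominus> y n) \<le> a x ^ Suc n" for n k
  proof (induction k)
    case (Suc k)
    have "y (n + Suc k) \<ominus> y n = (y (Suc (n + k)) \<ominus> y (n + k)) \<oplus> (y (n + k) \<ominus> y n)"
      by (simp only: add_Suc_right)
         (rule ring_identity[where ls="[y (Suc (n + k)), y (n + k), y n]"], (rule reify)+, simp add: in_carrier_def yc, code_simp)
    then have "a (y (n + Suc k) \<ominus> y n) \<le> max (a x ^ Suc (n + k)) (a x ^ Suc n)"
      using ultra[of "y (Suc (n + k)) \<ominus> y (n + k)" "y (n + k) \<ominus> y n"] yc step[of "n + k"] Suc by auto
    moreover have "a x ^ Suc (n + k) \<le> a x ^ Suc n" using x by (intro power_decreasing) auto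
    ultimately show ?case by simp
  qed (use x yc in \<open>simp add: minus_eq r_neg\<close>)
  have pow: "\<exists>N. a x ^ Suc N < e" if e: "e > 0" for e :: real
  proof -
    obtain N where "a x ^ N < e" using real_arch_pow_inv[OF e x(2)] by blast
    moreover have "a x ^ Suc N \<le> a x ^ N" using x by (intro power_decreasing) auto
    ultimately show ?thesis by (intro exI[of _ N]) simp
  qed
  have "cauchy y" unfolding cauchy_def
  proof (intro conjI allI impI)
    fix e :: real assume "e > 0"
    then obtain N where N: "a x ^ Suc N < e" using pow by blast
    have lt: "a (y m \<ominus> y n) < e" if "n \<ge> N" "n \<le> m" for m n
    proof -
      have "a (y m \<ominus> y n) \<le> a x ^ Suc n" using le[of n "m - n"] that by simp
      also have "\<dots> \<le> a x ^ Suc N" using x that by (intro power_decreasing) auto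
      finally show ?thesis using N by simp
    qed
    have "a (y m \<ominus> y n) < e" if "m \<ge> N" "n \<ge> N" for m n
      using lt[of n m] lt[of m n] abs_diff_commute[OF yc yc, of m n] that by (cases "n \<le> m") auto
    then show "\<exists>N. \<forall>m\<ge>N. \<forall>n\<ge>N. a (y m \<ominus> y n) < e" by blast
  qed (use yc in auto)
  then have "cauchy (\<lambda>n. \<one> \<oplus> \<guillemotleft>2\<guillemotright> \<otimes> y n)"
    by (intro cauchy_add cauchy_mult cauchy_const) auto
  moreover have "null (\<lambda>n. (\<one> \<oplus> \<guillemotleft>2\<guillemotright> \<otimes> y n) \<otimes> (\<one> \<oplus> \<guillemotleft>2\<guillemotright> \<otimes> y n) \<ominus> (\<one> \<oplus> \<guillemotleft>4\<guillemotright> \<otimes> x))"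
  proof (rule nullI)
    fix e :: real assume "e > 0"
    then obtain N where N: "a x ^ Suc N < e" using pow by blast
    have "a ((\<one> \<oplus> \<guillemotleft>2\<guillemotright> \<otimes> y n) \<otimes> (\<one> \<oplus> \<guillemotleft>2\<guillemotright> \<otimes> y n) \<ominus> (\<one> \<oplus> \<guillemotleft>4\<guillemotright> \<otimes> x)) < e" if "n \<ge> N" for n
    proof -
      have "(\<one> \<oplus> \<guillemotleft>2\<guillemotright> \<otimes> y n) \<otimes> (\<one> \<oplus> \<guillemotleft>2\<guillemotright> \<otimes> y n) \<ominus> (\<one> \<oplus> \<guillemotleft>4\<guillemotright> \<otimes> x) = (\<ominus> \<guillemotleft>4\<guillemotright>) \<otimes> ((x \<ominus> y n \<otimes> y n) \<ominus> y n)"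
        by (rule ring_identity[where ls="[x, y n]"], (rule reify)+, simp add: in_carrier_def x yc, code_simp)
      also have "a \<dots> = a \<guillemotleft>4\<guillemotright> * a (y (Suc n) \<ominus> y n)" using x yc by (simp add: yS)
      also have "\<dots> \<le> 1 * a x ^ Suc n" using abs_of_int_le[of 4] step[of n] yc by (intro mult_mono) auto
      also have "\<dots> \<le> a x ^ Suc N" unfolding mult_1 using x that by (intro power_decreasing) auto
      finally show ?thesis using N by simp
    qed
    then show "\<exists>N. \<forall>n\<ge>N. a ((\<one> \<oplus> \<guillemotleft>2\<guillemotright> \<otimes> y n) \<otimes> (\<one> \<oplus> \<guillemotleft>2\<guillemotright> \<otimes> y n) \<ominus> (\<one> \<oplus> \<guillemotleft>4\<guillemotright> \<otimes> x)) < e" by blast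
  qed (use x yc in auto)
  ultimately show ?thesis unfolding approx_sqrt_def by blast
qed

lemma approx_sqrt_one_plus:
  assumes "a \<guillemotleft>2\<guillemotright> = 1" "d \<in> carrier K" "a d < 1"
  shows "approx_sqrt (\<one> \<oplus> d)"
proof -
  have "\<guillemotleft>4\<guillemotright> = \<guillemotleft>2\<guillemotright> \<otimes> \<guillemotleft>2\<guillemotright>" using of_int_mult[of 2 2] by simp
  then have a4: "a \<guillemotleft>4\<guillemotright> = 1" using assms(1) by simp
  then have ne: "\<guillemotleft>4\<guillemotright> \<noteq> \<zero>" using abs_zero by fastforce
  then have "\<guillemotleft>4\<guillemotright> \<otimes> (inv \<guillemotleft>4\<guillemotright> \<otimes> d) = d" using assms(2) by (simp add: m_assoc[symmetric])
  then show ?thesis using approx_sqrt_one_plus_four[of "inv \<guillemotleft>4\<guillemotright> \<otimes> d"] assms a4 ne by simp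
qed

text \<open>Divide by \<open>w^2\<close> to reduce to \<open>1 + d\<close> with \<open>a d < 1\<close>.\<close>

lemma approx_sqrt_close_to_square:
  assumes "a \<guillemotleft>2\<guillemotright> = 1" "u \<in> carrier K" "a u = 1" "w \<in> carrier K" "a (u \<ominus> w \<otimes> w) < 1"
  shows "approx_sqrt u"
proof -
  have "a (w \<otimes> w \<ominus> u) < a u" using assms abs_diff_commute[of u "w \<otimes> w"] by simp
  then have "a (w \<otimes> w) = 1" using abs_eq_if_close[of "w \<otimes> w" u] assms by simp
  then have ww: "w \<otimes> w \<noteq> \<zero>" "a (w \<otimes> w) = 1" using abs_zero by fastforce+
  define d where "d = inv (w \<otimes> w) \<otimes> (u \<ominus> w \<otimes> w)"
  have d: "d \<in> carrier K" "a d < 1" using ww assms by (auto simp: d_def simp del: abs_mult) (subst abs_mult, auto)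
  have "w \<otimes> w \<otimes> (\<one> \<oplus> d) = w \<otimes> w \<oplus> (w \<otimes> w) \<otimes> inv (w \<otimes> w) \<otimes> (u \<ominus> w \<otimes> w)"
    using ww assms by (simp add: d_def r_distr m_assoc del: r_inv_ne)
  also have "\<dots> = u" using ww assms by (simp add: minus_eq a_ac r_neg a_lcomm[of "w \<otimes> w" u])
  finally show ?thesis using approx_sqrt_mult_square[OF approx_sqrt_one_plus[OF assms(1) d], of w] d assms by simp
qed

end

section \<open>Finite residue fields\<close>

context nonarch_field
begin

text \<open>For \<open>E\<close> the whole field this is finiteness of the residue field. Arbitrary subsets \<open>E\<close> are needed for the
  induction on the dimension below.\<close>

definition finite_residues :: "'a set \<Rightarrow> bool" where
  "finite_residues E \<longleftrightarrow> (\<exists>Y. finite Y \<and> Y \<subseteq> carrier K \<and> (\<forall>u\<in>E. a u \<le> 1 \<longrightarrow> (\<exists>x\<in>Y. a (u \<ominus> x) < 1)))"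

lemma abs_le_1_if_close: "x \<in> carrier K \<Longrightarrow> y \<in> carrier K \<Longrightarrow> a x \<le> 1 \<Longrightarrow> a (x \<ominus> y) < 1 \<Longrightarrow> a y \<le> 1"
  using ultra_diff[of x "x \<ominus> y"]
proof -
  assume h: "x \<in> carrier K" "y \<in> carrier K" "a x \<le> 1" "a (x \<ominus> y) < 1"
  have "y = x \<ominus> (x \<ominus> y)"
    by (rule ring_identity[where ls="[x, y]"], (rule reify)+, simp add: in_carrier_def h, code_simp)
  then show ?thesis using ultra_diff[of x "x \<ominus> y"] h by simp
qed

lemma close_trans:
  assumes "x \<in> carrier K" "y \<in> carrier K" "z \<in> carrier K" "a (x \<ominus> y) < 1" "a (y \<ominus> z) < 1"
  shows "a (x \<ominus> z) < 1"
proof -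
  have "x \<ominus> z = (x \<ominus> y) \<oplus> (y \<ominus> z)"
    by (rule ring_identity[where ls="[x, y, z]"], (rule reify)+, simp add: in_carrier_def assms, code_simp)
  then show ?thesis using ultra[of "x \<ominus> y" "y \<ominus> z"] assms by simp
qed

text \<open>Induction on the dimension. Passing from \<open>W\<close> to \<open>W + k e\<close> either adds no new residues, or there is
  a \<open>u0\<close> with \<open>a u0 \<le> 1\<close> that is not congruent to any element of \<open>W\<close>. In the latter case, in a
  representation \<open>u = c u0 + w\<close> of an integral element the coefficient \<open>c\<close> is integral as well,
  since otherwise \<open>u0\<close> would be congruent to \<open>- w / c\<close>. So the residues of \<open>u\<close> are determined by those of
  \<open>c\<close> and \<open>w\<close>.\<close>

lemma finite_residues_dimension:
  assumes k: "subfield k K" and fk: "finite_residues k" and dim: "dimension n k E"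
  shows "finite_residues E"
  using dim k fk
proof (induction n k E rule: dimension.induct)
  case (zero_dim k)
  then show ?case unfolding finite_residues_def by (intro exI[of _ "{\<zero>}"]) (auto simp: minus_eq)
next
  case (Suc_dim e W n k)
  note kc = subringE(1)[OF subfieldE(1)[OF Suc_dim.prems(1)]]
  note W = space_subgroup_props[OF Suc_dim.prems(1) Suc_dim.hyps(3)]
  have Wc: "w \<in> carrier K" if "w \<in> W" for w using W(1) that by blast
  obtain Y where Y: "finite Y" "Y \<subseteq> carrier K" "\<And>u. u \<in> W \<Longrightarrow> a u \<le> 1 \<Longrightarrow> \<exists>x\<in>Y. a (u \<ominus> x) < 1"
    using Suc_dim.IH[OF Suc_dim.prems] unfolding finite_residues_def by blast
  obtain S where S: "finite S" "S \<subseteq> carrier K" "\<And>u. u \<in> k \<Longrightarrow> a u \<le> 1 \<Longrightarrow> \<exists>x\<in>S. a (u \<ominus> x) < 1"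
    using Suc_dim.prems(2) unfolding finite_residues_def by blast
  let ?E = "line_extension k e W"
  have Emem: "u \<in> ?E \<longleftrightarrow> (\<exists>c\<in>k. \<exists>w\<in>W. u = c \<otimes> e \<oplus> w)" for u by (rule line_extension_mem_iff)
  have Ec: "u \<in> carrier K" if "u \<in> ?E" for u using that Emem kc Wc Suc_dim.hyps(1) by auto
  show ?case
  proof (cases "\<forall>u\<in>?E. a u \<le> 1 \<longrightarrow> (\<exists>w\<in>W. a (u \<ominus> w) < 1)")
    case True
    have "\<exists>x\<in>Y. a (u \<ominus> x) < 1" if u: "u \<in> ?E" "a u \<le> 1" for u
    proof -
      obtain w where w: "w \<in> W" "a (u \<ominus> w) < 1" using True u by blast
      then have "a w \<le> 1" using abs_le_1_if_close[OF Ec[OF u(1)] Wc[OF w(1)] u(2)] by blast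
      then obtain x where "x \<in> Y" "a (w \<ominus> x) < 1" using Y(3) w(1) by blast
      then show ?thesis using close_trans[OF Ec[OF u(1)] Wc[OF w(1)] _ w(2)] Y(2) by blast
    qed
    then show ?thesis unfolding finite_residues_def using Y by blast
  next
    case False
    then obtain u0 where u0: "u0 \<in> ?E" "a u0 \<le> 1" "\<And>w. w \<in> W \<Longrightarrow> \<not> a (u0 \<ominus> w) < 1" by blast
    obtain c0 w0 where cw: "c0 \<in> k" "w0 \<in> W" "u0 = c0 \<otimes> e \<oplus> w0" using u0(1) Emem by blast
    have u0c: "u0 \<in> carrier K" using Ec u0 by blast
    have c0: "c0 \<noteq> \<zero>"
    proof
      assume "c0 = \<zero>"
      then have "u0 \<ominus> w0 = \<zero>" using cw Wc Suc_dim.hyps(1) by (simp add: minus_eq r_neg)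
      then show False using u0(3)[OF cw(2)] by simp
    qed
    note cwc = subsetD[OF kc cw(1)] Wc[OF cw(2)] Suc_dim.hyps(1)
    have i0: "inv c0 \<in> k" "inv c0 \<otimes> c0 = \<one>"
      using subfield_m_inv[OF Suc_dim.prems(1), of c0] cw c0 by auto
    let ?Y = "(\<lambda>(x, s). x \<oplus> s \<otimes> u0) ` (Y \<times> S)"
    have "\<exists>x\<in>?Y. a (u \<ominus> x) < 1" if u: "u \<in> ?E" "a u \<le> 1" for u
    proof -
      obtain c1 w1 where c1: "c1 \<in> k" "w1 \<in> W" "u = c1 \<otimes> e \<oplus> w1" using u(1) Emem by blast
      note c1c = subsetD[OF kc c1(1)] Wc[OF c1(2)]
      define c where "c = c1 \<otimes> inv c0"
      define w where "w = w1 \<ominus> c \<otimes> w0"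
      have ck: "c \<in> k" using c1 i0 subringE(6)[OF subfieldE(1)[OF Suc_dim.prems(1)]] by (simp add: c_def)
      have cc: "c \<in> carrier K" using ck kc by blast
      have "\<ominus> c \<in> k" using ck subringE(5)[OF subfieldE(1)[OF Suc_dim.prems(1)]] by simp
      then have "(\<ominus> c) \<otimes> w0 \<in> W" using W(5) cw(2) by blast
      then have wW: "w \<in> W" using W(3)[OF c1(2)] cc cwc by (simp add: w_def minus_eq l_minus)
      have wc: "w \<in> carrier K" using Wc wW by blast
      have uc: "u = c \<otimes> u0 \<oplus> w"
      proof -
        have ic: "inv c0 \<in> carrier K" using i0 kc by blast
        have "c \<otimes> u0 \<oplus> w = c1 \<otimes> (inv c0 \<otimes> c0) \<otimes> e \<oplus> w1" unfolding w_def c_def cw(3)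
          by (rule ring_identity[where ls="[c1, inv c0, c0, e, w0, w1]"], (rule reify)+, simp add: in_carrier_def cwc c1c ic, code_simp)
        then show ?thesis using i0 c1 c1c by simp
      qed
      have ac: "a c \<le> 1"
      proof (rule ccontr)
        assume gt: "\<not> a c \<le> 1"
        then have cn: "c \<noteq> \<zero>" by auto
        have ic: "inv c \<in> k" "inv c \<in> carrier K" using subfield_m_inv[OF Suc_dim.prems(1), of c] ck cn kc by auto
        then have "\<ominus> (inv c) \<in> k" using subringE(5)[OF subfieldE(1)[OF Suc_dim.prems(1)]] by simp
        then have iw: "(\<ominus> (inv c)) \<otimes> w \<in> W" using W(5) wW by blast
        have "inv c \<otimes> u = (inv c \<otimes> c) \<otimes> u0 \<oplus> inv c \<otimes> w"
          unfolding uc by (rule ring_identity[where ls="[c, inv c, u0, w]"], (rule reify)+, simp add: in_carrier_def cc ic u0c wc, code_simp)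
        then have "u0 \<ominus> (\<ominus> (inv c)) \<otimes> w = inv c \<otimes> u"
          using cc cn ic u0c wc by (simp add: minus_eq l_minus)
        then have "a (u0 \<ominus> (\<ominus> (inv c)) \<otimes> w) = inverse (a c) * a u" using cc cn ic Ec u by simp
        also have "\<dots> \<le> inverse (a c) * 1" using u(2) gt by (intro mult_left_mono) auto
        also have "\<dots> < 1" using gt by (simp add: inverse_less_1_iff)
        finally show False using u0(3)[OF iw] by simp
      qed
      have wu: "w = u \<ominus> c \<otimes> u0"
        unfolding uc by (rule ring_identity[where ls="[c, u0, w]"], (rule reify)+, simp add: in_carrier_def cc u0c wc, code_simp)
      have cu: "a (c \<otimes> u0) \<le> 1" using mult_mono[of "a c" 1 "a u0" 1] ac u0 cc u0c by simp
      have "a w \<le> 1" unfolding wu using ultra_diff[of u "c \<otimes> u0"] Ec[OF u(1)] u(2) cu cc u0c by simp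
      then obtain x where x: "x \<in> Y" "a (w \<ominus> x) < 1" using Y(3) wW by blast
      obtain s where s: "s \<in> S" "a (c \<ominus> s) < 1" using S(3)[OF ck ac] by blast
      have xs: "x \<in> carrier K" "s \<in> carrier K" using x s Y S by auto
      have "u \<ominus> (x \<oplus> s \<otimes> u0) = (w \<ominus> x) \<oplus> (c \<ominus> s) \<otimes> u0"
        unfolding uc by (rule ring_identity[where ls="[c, u0, w, x, s]"], (rule reify)+, simp add: in_carrier_def cc u0c wc xs, code_simp)
      moreover have "a ((c \<ominus> s) \<otimes> u0) < 1"
        using mult_strict_mono'[of "a (c \<ominus> s)" 1 "a u0" 1] mult_left_le[of "a u0" "a (c \<ominus> s)"] s u0 cc xs u0c by simp
      ultimately have "a (u \<ominus> (x \<oplus> s \<otimes> u0)) < 1"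
        using ultra[of "w \<ominus> x" "(c \<ominus> s) \<otimes> u0"] x(2) cc u0c wc xs by simp
      then show ?thesis using x(1) s(1) by force
    qed
    moreover have "finite ?Y" using Y(1) S(1) by simp
    moreover have "?Y \<subseteq> carrier K" using Y(2) S(2) u0c by (auto simp: subset_iff)
    ultimately show ?thesis unfolding finite_residues_def by blast
  qed
qed

text \<open>If \<open>a \<le> 1\<close> on the subfield, then \<open>a\<close> is bounded on a finite-dimensional space over it, and the powers of an
  element with \<open>a x > 1\<close> contradict this.\<close>

lemma exists_abs_gt_1_in_subfield:
  assumes k: "subfield k K" and dim: "dimension n k (carrier K)"
  shows "\<exists>c\<in>k. 1 < a c"
proof (rule ccontr)
  assume no: "\<not> ?thesis"
  have bd: "\<exists>B. \<forall>x\<in>E. a x \<le> B" if "dimension n k' E" "k' = k" for n k' E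
    using that
  proof (induction n k' E rule: dimension.induct)
    case (Suc_dim e W n k')
    obtain B where B: "\<forall>x\<in>W. a x \<le> B" using Suc_dim.IH[OF Suc_dim.prems] by blast
    have kc: "k' \<subseteq> carrier K" using subringE(1)[OF subfieldE(1)[OF k]] unfolding Suc_dim.prems .
    have "dimension n k W" using Suc_dim.hyps(3) unfolding Suc_dim.prems .
    then have Wc: "W \<subseteq> carrier K" by (rule space_subgroup_props(1)[OF k])
    have "a u \<le> max (a e) B" if u: "u \<in> line_extension k' e W" for u
    proof -
      obtain c w where c: "c \<in> k'" "w \<in> W" "u = c \<otimes> e \<oplus> w" using u unfolding line_extension_mem_iff by blast
      have cc: "c \<in> carrier K" "w \<in> carrier K" using c kc Wc by auto
      have "a c \<le> 1" using no c Suc_dim.prems by (auto simp: not_less)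
      then have "a (c \<otimes> e) \<le> a e" using cc Suc_dim.hyps(1) mult_right_mono[of "a c" 1 "a e"] by simp
      moreover have "a w \<le> B" using B c by blast
      ultimately show ?thesis using ultra[of "c \<otimes> e" w] cc c Suc_dim.hyps(1) by auto
    qed
    then show ?case by blast
  qed (auto intro!: exI[of _ 0])
  obtain B where B: "\<forall>x\<in>carrier K. a x \<le> B" using bd[OF dim refl] by blast
  obtain x where x: "x \<in> carrier K" "1 < a x" using exists_abs_gt_1 by blast
  obtain j where "B < a x ^ j" using real_arch_pow[OF x(2)] by blast
  moreover have "a (x [^] j) \<le> B" using B x by blast
  ultimately show False using x by simp
qed

definition square_residue :: "'a \<Rightarrow> bool" where
  "square_residue x \<longleftrightarrow> (\<exists>z\<in>carrier K. a (x \<ominus> z \<otimes> z) < 1)"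

abbreviation valuation_ring where "valuation_ring \<equiv> K\<lparr>carrier := {x \<in> carrier K. a x \<le> 1}\<rparr>"

lemma domain_valuation_ring: "domain valuation_ring"
proof -
  have "subring {x \<in> carrier K. a x \<le> 1} K"
  proof (rule subringI)
    fix x y assume xy: "x \<in> {x \<in> carrier K. a x \<le> 1}" "y \<in> {x \<in> carrier K. a x \<le> 1}"
    then show "x \<otimes> y \<in> {x \<in> carrier K. a x \<le> 1}" using mult_mono[of "a x" 1 "a y" 1] by auto
    show "x \<oplus> y \<in> {x \<in> carrier K. a x \<le> 1}" using ultra[of x y] xy by auto
  qed auto
  then show ?thesis by (rule subring_is_domain)
qed

interpretation V: domain valuation_ring by (rule domain_valuation_ring)

lemma V_minus: "x \<in> carrier K \<Longrightarrow> a x \<le> 1 \<Longrightarrow> y \<in> carrier K \<Longrightarrow> a y \<le> 1 \<Longrightarrow> x \<ominus>\<^bsub>valuation_ring\<^esub> y = x \<ominus> y"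
proof -
  assume h: "x \<in> carrier K" "a x \<le> 1" "y \<in> carrier K" "a y \<le> 1"
  have "\<ominus>\<^bsub>valuation_ring\<^esub> y = \<ominus> y"
    by (rule V.minus_equality) (use h in \<open>auto simp: l_neg\<close>)
  then show ?thesis by (simp add: V.minus_eq minus_eq)
qed

lemma maximalideal_valuation_ring: "maximalideal {x \<in> carrier K. a x < 1} valuation_ring"
proof (rule maximalidealI)
  show "ideal {x \<in> carrier K. a x < 1} valuation_ring"
  proof (rule idealI)
    show "subgroup {x \<in> carrier K. a x < 1} (add_monoid valuation_ring)"
    proof (rule V.add.subgroupI)
      fix x assume x: "x \<in> {x \<in> carrier K. a x < 1}"
      have "\<ominus>\<^bsub>valuation_ring\<^esub> x = \<ominus> x" by (rule V.minus_equality) (use x in \<open>auto simp: l_neg\<close>)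
      then show "\<ominus>\<^bsub>valuation_ring\<^esub> x \<in> {x \<in> carrier K. a x < 1}" using x by simp
      fix y assume "y \<in> {x \<in> carrier K. a x < 1}"
      then show "x \<oplus>\<^bsub>valuation_ring\<^esub> y \<in> {x \<in> carrier K. a x < 1}" using x ultra[of x y] by auto
    qed (auto intro!: exI[of _ \<zero>])
    fix u x assume "u \<in> {x \<in> carrier K. a x < 1}" "x \<in> carrier valuation_ring"
    then have "a x * a u < 1" "x \<in> carrier K" "u \<in> carrier K"
      using mult_left_le_one_le[of "a u" "a x"] by (auto intro: le_less_trans)
    then show "x \<otimes>\<^bsub>valuation_ring\<^esub> u \<in> {x \<in> carrier K. a x < 1}" "u \<otimes>\<^bsub>valuation_ring\<^esub> x \<in> {x \<in> carrier K. a x < 1}"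
      by (auto simp: mult.commute)
  qed (rule V.ring_axioms)
  have "\<one> \<in> carrier valuation_ring" "\<one> \<notin> {x \<in> carrier K. a x < 1}" by auto
  then show "carrier valuation_ring \<noteq> {x \<in> carrier K. a x < 1}" by blast
  fix J assume J: "ideal J valuation_ring" "{x \<in> carrier K. a x < 1} \<subseteq> J" "J \<subseteq> carrier valuation_ring"
  show "J = {x \<in> carrier K. a x < 1} \<or> J = carrier valuation_ring"
  proof (rule disjCI)
    assume nJ: "J \<noteq> carrier valuation_ring"
    have "a x < 1" if x: "x \<in> J" for x
    proof (rule ccontr)
      assume "\<not> a x < 1"
      then have ax: "x \<in> carrier K" "a x = 1" using J(3) x by auto
      then have ne: "x \<noteq> \<zero>" by auto
      then have "inv x \<in> carrier valuation_ring" using ax by simp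
      then have "inv x \<otimes>\<^bsub>valuation_ring\<^esub> x \<in> J" using ideal.I_l_closed[OF J(1) x] by blast
      then have "\<one>\<^bsub>valuation_ring\<^esub> \<in> J" using ax ne by simp
      then show False using ideal.one_imp_carrier[OF J(1)] nJ by simp
    qed
    then show "J = {x \<in> carrier K. a x < 1}" using J(2,3) by auto
  qed
qed

text \<open>The multiplicative group of the finite residue field is cyclic; of two exponents and their sum, at least
  one is even.\<close>

lemma square_residue_mult:
  assumes fin: "finite_residues (carrier K)"
    and u: "u \<in> carrier K" "a u = 1" and w: "w \<in> carrier K" "a w = 1"
  shows "square_residue u \<or> square_residue w \<or> square_residue (u \<otimes> w)"
proof -
  let ?m = "{x \<in> carrier K. a x < 1}"
  let ?V = valuation_ring
  let ?Q = "?V Quot ?m"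
  note max = maximalideal_valuation_ring
  note id = maximalideal.axioms(1)[OF max]
  interpret Q: field ?Q by (rule maximalideal.quotient_is_field[OF max V.is_cring])
  note h = ideal.rcos_ring_hom[OF id]
  let ?c = "\<lambda>x. ?m +>\<^bsub>?V\<^esub> x"
  have ceq: "?c x = ?c y \<longleftrightarrow> a (x \<ominus> y) < 1" if "x \<in> carrier K" "a x \<le> 1" "y \<in> carrier K" "a y \<le> 1" for x y
    using V.quotient_eq_iff_same_a_r_cos[OF id, of x y] V_minus[OF that] that by auto
  have carQ: "\<exists>x\<in>carrier K. a x \<le> 1 \<and> q = ?c x" if "q \<in> carrier ?Q" for q
    using that unfolding FactRing_def A_RCOSETS_def' by auto
  obtain Y where Y: "finite Y" "Y \<subseteq> carrier K" "\<And>u. u \<in> carrier K \<Longrightarrow> a u \<le> 1 \<Longrightarrow> \<exists>x\<in>Y. a (u \<ominus> x) < 1"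
    using fin unfolding finite_residues_def by blast
  have "carrier ?Q \<subseteq> ?c ` Y"
  proof
    fix q assume "q \<in> carrier ?Q"
    then obtain y where y: "y \<in> carrier K" "a y \<le> 1" "q = ?c y" using carQ by blast
    then obtain x where x: "x \<in> Y" "a (y \<ominus> x) < 1" using Y by blast
    then have "x \<in> carrier K" "a x \<le> 1" using Y abs_le_1_if_close[of y x] y by auto
    then show "q \<in> ?c ` Y" using ceq[of y x] x y by auto
  qed
  then have finQ: "finite (carrier ?Q)" by (rule finite_subset) (use Y(1) in simp)
  then obtain g where g: "g \<in> carrier (Multiplicative_Group.mult_of ?Q)" "carrier (Multiplicative_Group.mult_of ?Q) = {g [^]\<^bsub>?Q\<^esub> i | i::nat. i \<in> UNIV}"
    using Q.finite_field_mult_group_has_gen[OF finQ] by (elim bexE) (rule that, assumption+)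
  have gc: "g \<in> carrier ?Q" using g(1) by (simp add: Multiplicative_Group.carrier_mult_of)
  have unit: "\<exists>i::nat. ?c x = g [^]\<^bsub>?Q\<^esub> i" if x: "x \<in> carrier K" "a x = 1" for x
  proof -
    have "?c x \<in> carrier ?Q" using ring_hom_closed[OF h, of x] x by simp
    moreover have "?c x \<noteq> \<zero>\<^bsub>?Q\<^esub>"
    proof
      assume "?c x = \<zero>\<^bsub>?Q\<^esub>"
      also have "\<zero>\<^bsub>?Q\<^esub> = ?c \<zero>" using ring_hom_zero[OF h V.ring_axioms Q.ring_axioms] by simp
      finally have "a (x \<ominus> \<zero>) < 1" using ceq[of x \<zero>] x by simp
      then show False using x by (simp add: minus_eq)
    qed
    ultimately have "?c x \<in> carrier (Multiplicative_Group.mult_of ?Q)" by (simp add: Multiplicative_Group.carrier_mult_of)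
    then show ?thesis unfolding g(2) by blast
  qed
  have even: "square_residue x" if x: "x \<in> carrier K" "a x = 1" "?c x = g [^]\<^bsub>?Q\<^esub> (2 * i)" for x and i :: nat
  proof -
    have "g [^]\<^bsub>?Q\<^esub> i \<in> carrier ?Q" using gc by simp
    then obtain z where z: "z \<in> carrier K" "a z \<le> 1" "g [^]\<^bsub>?Q\<^esub> i = ?c z" using carQ by blast
    have "?c x = g [^]\<^bsub>?Q\<^esub> i \<otimes>\<^bsub>?Q\<^esub> g [^]\<^bsub>?Q\<^esub> i" unfolding x(3) using gc by (simp add: Q.nat_pow_mult mult_2)
    also have "\<dots> = ?c (z \<otimes> z)" unfolding z(3) using ring_hom_mult[OF h, of z z] z by simp
    finally have "a (x \<ominus> z \<otimes> z) < 1" using ceq[of x "z \<otimes> z"] x z mult_mono[of "a z" 1 "a z" 1] by simp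
    then show ?thesis using z by (auto simp: square_residue_def)
  qed
  obtain i j :: nat where i: "?c u = g [^]\<^bsub>?Q\<^esub> i" and j: "?c w = g [^]\<^bsub>?Q\<^esub> j" using unit[OF u] unit[OF w] by blast
  have "?c (u \<otimes> w) = ?c u \<otimes>\<^bsub>?Q\<^esub> ?c w" using ring_hom_mult[OF h, of u w] u w by simp
  also have "\<dots> = g [^]\<^bsub>?Q\<^esub> (i + j)" using gc i j by (simp add: Q.nat_pow_mult)
  finally have uw: "?c (u \<otimes> w) = g [^]\<^bsub>?Q\<^esub> (i + j)" .
  consider "even i" | "even j" | "even (i + j)" by auto
  then show ?thesis
  proof cases
    case 1
    then show ?thesis using even[OF u] i by (auto elim!: evenE)
  next
    case 2
    then show ?thesis using even[OF w] j by (auto elim!: evenE)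
  next
    case 3
    then obtain l where "i + j = 2 * l" by (rule evenE)
    then show ?thesis using even[of "u \<otimes> w" l] uw u w by simp
  qed
qed

end

section \<open>Squares in principal ideal domains\<close>

context principal_domain
begin

lemma bezout_common_divisor:
  assumes x: "x \<in> carrier R" "y \<in> carrier R"
  shows "\<exists>g\<in>carrier R. \<exists>\<alpha>\<in>carrier R. \<exists>\<beta>\<in>carrier R. \<exists>x'\<in>carrier R. \<exists>y'\<in>carrier R.
     g = \<alpha> \<otimes> x \<oplus> \<beta> \<otimes> y \<and> x = x' \<otimes> g \<and> y = y' \<otimes> g"
proof -
  obtain g where g: "g \<in> carrier R" "PIdl x <+> PIdl y = PIdl g"
    using exists_gen[OF add_ideals[OF cgenideal_ideal[OF x(1)] cgenideal_ideal[OF x(2)]]] by blast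
  have "g \<in> PIdl x <+> PIdl y" unfolding g(2) using g(1) by (rule cgenideal_self)
  then obtain \<alpha> \<beta> where ab: "\<alpha> \<in> carrier R" "\<beta> \<in> carrier R" "g = \<alpha> \<otimes> x \<oplus> \<beta> \<otimes> y"
    unfolding set_add_def' cgenideal_def by blast
  have z: "\<zero> \<in> PIdl x" "\<zero> \<in> PIdl y" unfolding cgenideal_def using l_null[OF x(1)] l_null[OF x(2)] zero_closed by force+
  have "x \<oplus> \<zero> \<in> PIdl x <+> PIdl y" unfolding set_add_def' using cgenideal_self[OF x(1)] z by blast
  then have "x \<in> PIdl g" using x g(2) by simp
  then obtain x' where x': "x' \<in> carrier R" "x = x' \<otimes> g" unfolding cgenideal_def by blast
  have "\<zero> \<oplus> y \<in> PIdl x <+> PIdl y" unfolding set_add_def' using cgenideal_self[OF x(2)] z by blast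
  then have "y \<in> PIdl g" using x g(2) by simp
  then obtain y' where y': "y' \<in> carrier R" "y = y' \<otimes> g" unfolding cgenideal_def by blast
  show ?thesis using g(1) ab x' y' by blast
qed

end

definition (in monoid) unit_times_square :: "'a \<Rightarrow> bool" where
  "unit_times_square x \<longleftrightarrow> (\<exists>\<epsilon>\<in>Units G. \<exists>g\<in>carrier G. x = \<epsilon> \<otimes> (g \<otimes> g))"

definition (in ring) comaximal :: "'a \<Rightarrow> 'a \<Rightarrow> bool" where
  "comaximal x y \<longleftrightarrow> (\<exists>u\<in>carrier R. \<exists>v\<in>carrier R. u \<otimes> x \<oplus> v \<otimes> y = \<one>)"

lemma (in domain) Units_of_mult_eq_one: "x \<in> carrier R \<Longrightarrow> y \<in> carrier R \<Longrightarrow> x \<otimes> y = \<one> \<Longrightarrow> x \<in> Units R"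
  unfolding Units_def using m_comm[of x y] by auto

context principal_domain
begin

text \<open>Let \<open>g\<close> be a greatest common divisor of \<open>x\<close> and \<open>s\<close>. Then \<open>g^2\<close> generates the ideal
  \<open>(x^2, x s, s^2) = x (x, s, y) = (x)\<close>. Factorization into primes is avoided.\<close>

lemma comaximal_mult_square:
  assumes x: "x \<in> carrier R" "x \<noteq> \<zero>" and y: "y \<in> carrier R" and s: "s \<in> carrier R" and xy: "x \<otimes> y = s \<otimes> s" and co: "comaximal x y"
  shows "unit_times_square x"
proof -
  obtain u v where uv: "u \<in> carrier R" "v \<in> carrier R" "u \<otimes> x \<oplus> v \<otimes> y = \<one>" using co by (auto simp: comaximal_def)
  obtain g \<alpha> \<beta> x' s' where g: "g \<in> carrier R" "\<alpha> \<in> carrier R" "\<beta> \<in> carrier R" "x' \<in> carrier R" "s' \<in> carrier R"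
     "g = \<alpha> \<otimes> x \<oplus> \<beta> \<otimes> s" "x = x' \<otimes> g" "s = s' \<otimes> g" using bezout_common_divisor[OF x(1) s] by (elim bexE conjE) (rule that)
  \<comment> \<open>\<open>g^2 = (\<alpha> x + \<beta> s)^2 = x w\<close>, and \<open>x = u x^2 + v s^2 = g^2 z\<close>.\<close>
  define w where "w = \<alpha> \<otimes> \<alpha> \<otimes> x \<oplus> \<guillemotleft>2\<guillemotright> \<otimes> \<alpha> \<otimes> \<beta> \<otimes> s \<oplus> \<beta> \<otimes> \<beta> \<otimes> y"
  define z where "z = u \<otimes> (x' \<otimes> x') \<oplus> v \<otimes> (s' \<otimes> s')"
  have wz: "w \<in> carrier R" "z \<in> carrier R" using g(1-5) x y s uv(1,2) by (auto simp: w_def z_def)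
  have "g \<otimes> g = (\<alpha> \<otimes> x \<oplus> \<beta> \<otimes> s) \<otimes> (\<alpha> \<otimes> x \<oplus> \<beta> \<otimes> s)" by (simp only: g(6)[symmetric])
  also have "\<dots> = \<alpha> \<otimes> \<alpha> \<otimes> x \<otimes> x \<oplus> \<guillemotleft>2\<guillemotright> \<otimes> \<alpha> \<otimes> \<beta> \<otimes> s \<otimes> x \<oplus> \<beta> \<otimes> \<beta> \<otimes> (s \<otimes> s)"
    by (rule ring_identity[where ls="[\<alpha>, \<beta>, x, s]"], (rule reify)+, simp add: in_carrier_def x s g(1-5), code_simp)
  also have "\<dots> = x \<otimes> w" unfolding w_def xy[symmetric]
    by (rule ring_identity[where ls="[\<alpha>, \<beta>, x, s, y]"], (rule reify)+, simp add: in_carrier_def x s y g(1-5), code_simp)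
  finally have gg: "g \<otimes> g = x \<otimes> w" .
  have "x = x \<otimes> (u \<otimes> x \<oplus> v \<otimes> y)" using uv x by simp
  also have "\<dots> = u \<otimes> (x \<otimes> x) \<oplus> v \<otimes> (x \<otimes> y)"
    by (rule ring_identity[where ls="[u, v, x, y]"], (rule reify)+, simp add: in_carrier_def x y uv(1,2), code_simp)
  also have "\<dots> = u \<otimes> ((x' \<otimes> g) \<otimes> (x' \<otimes> g)) \<oplus> v \<otimes> ((s' \<otimes> g) \<otimes> (s' \<otimes> g))"
    unfolding xy by (simp only: g(7)[symmetric] g(8)[symmetric])
  also have "\<dots> = (g \<otimes> g) \<otimes> z" unfolding z_def
    by (rule ring_identity[where ls="[u, v, x', s', g]"], (rule reify)+, simp add: in_carrier_def g(1-5) uv(1,2), code_simp)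
  finally have xz: "x = (g \<otimes> g) \<otimes> z" .
  have "x \<otimes> (w \<otimes> z) = (g \<otimes> g) \<otimes> z" unfolding gg using x wz by (simp add: m_assoc)
  then have "x \<otimes> \<one> = x \<otimes> (w \<otimes> z)" unfolding xz[symmetric] using x by simp
  then have "\<one> = w \<otimes> z" using m_lcancel[OF x(2,1) one_closed m_closed[OF wz]] by blast
  then have "z \<in> Units R" using Units_of_mult_eq_one[OF wz(2,1)] m_comm[OF wz] by simp
  then show ?thesis unfolding unit_times_square_def using \<open>z \<in> Units R\<close> g(1) xz m_comm[of "g \<otimes> g" z] wz(2) m_closed[OF g(1) g(1)] by (metis (no_types))
qed

text \<open>In lowest terms \<open>p' / q'\<close>, the Bezout identity for \<open>p'\<close> and \<open>q'\<close> shows that \<open>q'\<close> is a unit.\<close>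

lemma comaximal_mult_fraction_square:
  assumes x: "x \<in> carrier R" "x \<noteq> \<zero>" and y: "y \<in> carrier R" and co: "comaximal x y"
    and p: "p \<in> carrier R" and q: "q \<in> carrier R" "q \<noteq> \<zero>" and eq: "x \<otimes> y \<otimes> (q \<otimes> q) = p \<otimes> p"
  shows "unit_times_square x"
proof -
  obtain g \<alpha> \<beta> p' q' where g: "g \<in> carrier R" "\<alpha> \<in> carrier R" "\<beta> \<in> carrier R" "p' \<in> carrier R" "q' \<in> carrier R"
     "g = \<alpha> \<otimes> p \<oplus> \<beta> \<otimes> q" "p = p' \<otimes> g" "q = q' \<otimes> g" using bezout_common_divisor[OF p q(1)] by (elim bexE conjE) (rule that)
  have g0: "g \<noteq> \<zero>"
  proof
    assume "g = \<zero>"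
    then have "q = \<zero>" using g(5) g(8) by simp
    then show False using q(2) by simp
  qed
  have gg0: "g \<otimes> g \<noteq> \<zero>" "g \<otimes> g \<in> carrier R" using g0 g(1) by (auto simp: integral_iff)
  have "g \<otimes> \<one> = g \<otimes> (\<alpha> \<otimes> p' \<oplus> \<beta> \<otimes> q')"
  proof -
    have "g \<otimes> (\<alpha> \<otimes> p' \<oplus> \<beta> \<otimes> q') = \<alpha> \<otimes> (p' \<otimes> g) \<oplus> \<beta> \<otimes> (q' \<otimes> g)"
      by (rule ring_identity[where ls="[\<alpha>, \<beta>, p', q', g]"], (rule reify)+, simp add: in_carrier_def g(1-5), code_simp)
    also have "\<dots> = g" by (simp only: g(7)[symmetric] g(8)[symmetric] g(6)[symmetric])
    finally have "g \<otimes> (\<alpha> \<otimes> p' \<oplus> \<beta> \<otimes> q') = g" .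
    then show ?thesis using r_one[OF g(1)] by (simp only:)
  qed
  then have one: "\<alpha> \<otimes> p' \<oplus> \<beta> \<otimes> q' = \<one>" using m_lcancel[OF g0 g(1) one_closed, of "\<alpha> \<otimes> p' \<oplus> \<beta> \<otimes> q'"] g(1-5) by simp
  have "(g \<otimes> g) \<otimes> (x \<otimes> y \<otimes> (q' \<otimes> q')) = x \<otimes> y \<otimes> ((q' \<otimes> g) \<otimes> (q' \<otimes> g))"
    by (rule ring_identity[where ls="[x, y, q', g]"], (rule reify)+, simp add: in_carrier_def x y g(1-5), code_simp)
  also have "\<dots> = (p' \<otimes> g) \<otimes> (p' \<otimes> g)" using eq by (simp only: g(7)[symmetric] g(8)[symmetric])
  also have "\<dots> = (g \<otimes> g) \<otimes> (p' \<otimes> p')"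
    by (rule ring_identity[where ls="[p', g]"], (rule reify)+, simp add: in_carrier_def g(1-5), code_simp)
  finally have pq: "x \<otimes> y \<otimes> (q' \<otimes> q') = p' \<otimes> p'" using m_lcancel[OF gg0(1,2)] x y g(1-5) by simp
  \<comment> \<open>The inverse of \<open>q'\<close>, from \<open>1 = (\<alpha> p' + \<beta> q')^2\<close> and \<open>q' dvd p'^2\<close>.\<close>
  define c where "c = \<alpha> \<otimes> \<alpha> \<otimes> (x \<otimes> y \<otimes> q') \<oplus> \<guillemotleft>2\<guillemotright> \<otimes> \<alpha> \<otimes> \<beta> \<otimes> p' \<oplus> \<beta> \<otimes> \<beta> \<otimes> q'"
  have c: "c \<in> carrier R" using g(1-5) x y by (simp add: c_def)
  have "q' \<otimes> c = \<alpha> \<otimes> \<alpha> \<otimes> (x \<otimes> y \<otimes> (q' \<otimes> q')) \<oplus> \<guillemotleft>2\<guillemotright> \<otimes> \<alpha> \<otimes> \<beta> \<otimes> p' \<otimes> q' \<oplus> \<beta> \<otimes> \<beta> \<otimes> q' \<otimes> q'" unfolding c_def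
    by (rule ring_identity[where ls="[\<alpha>, \<beta>, p', q', x, y]"], (rule reify)+, simp add: in_carrier_def x y g(1-5), code_simp)
  also have "\<dots> = (\<alpha> \<otimes> p' \<oplus> \<beta> \<otimes> q') \<otimes> (\<alpha> \<otimes> p' \<oplus> \<beta> \<otimes> q')" unfolding pq
    by (rule ring_identity[where ls="[\<alpha>, \<beta>, p', q']"], (rule reify)+, simp add: in_carrier_def x y g(1-5), code_simp)
  finally have qc: "q' \<otimes> c = \<one>" using one by simp
  have "x \<otimes> y = x \<otimes> y \<otimes> ((q' \<otimes> c) \<otimes> (q' \<otimes> c))" unfolding qc using x y by simp
  also have "\<dots> = x \<otimes> y \<otimes> (q' \<otimes> q') \<otimes> (c \<otimes> c)"
    by (rule ring_identity[where ls="[x, y, q', c]"], (rule reify)+, simp add: in_carrier_def x y c g(1-5), code_simp)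
  also have "\<dots> = (p' \<otimes> c) \<otimes> (p' \<otimes> c)" unfolding pq
    by (rule ring_identity[where ls="[p', c]"], (rule reify)+, simp add: in_carrier_def x y c g(1-5), code_simp)
  finally show ?thesis using comaximal_mult_square[OF x y _ _ co, of "p' \<otimes> c"] g(4) c by simp
qed

end

context field
begin

text \<open>For \<open>es = [e\<^sub>n, \<dots>, e\<^sub>1]\<close> this is \<open>k(e\<^sub>1, \<dots>, e\<^sub>n)\<close>, provided that all \<open>e\<^sub>i^2\<close> lie in \<open>k\<close>.\<close>

fun quadratic_tower :: "'a set \<Rightarrow> 'a list \<Rightarrow> 'a set" where
  "quadratic_tower k [] = k"
| "quadratic_tower k (e # es) = {x \<oplus> y \<otimes> e | x y. x \<in> quadratic_tower k es \<and> y \<in> quadratic_tower k es}"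

fun tower_list :: "'a set \<Rightarrow> 'a list \<Rightarrow> bool" where
  "tower_list k [] = True"
| "tower_list k (e # es) = (tower_list k es \<and> e \<in> carrier R \<and> e \<otimes> e \<in> k \<and> e \<notin> quadratic_tower k es)"

fun subproducts :: "'a list \<Rightarrow> 'a set" where
  "subproducts [] = {\<one>}"
| "subproducts (e # es) = subproducts es \<union> (\<lambda>p. p \<otimes> e) ` subproducts es"

lemma finite_subproducts: "finite (subproducts es)"
  by (induction es) auto

text \<open>The inverse of \<open>x + y e\<close> is its conjugate divided by the norm \<open>x^2 - y^2 e^2\<close>, which is nonzero because
  \<open>e\<close> is not in the smaller field.\<close>

lemma subfield_quadratic_tower:
  assumes k: "subfield k R"
  shows "tower_list k es \<Longrightarrow> subfield (quadratic_tower k es) R \<and> k \<subseteq> quadratic_tower k es"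
proof (induction es)
  case Nil
  then show ?case using k by simp
next
  case (Cons e es)
  let ?F = "quadratic_tower k es" and ?E = "quadratic_tower k (e # es)"
  have F: "subfield ?F R" "k \<subseteq> ?F" using Cons by auto
  have e: "e \<in> carrier R" "e \<otimes> e \<in> ?F" "e \<notin> ?F" using Cons.prems F by auto
  note sub = subfieldE(1)[OF F(1)]
  have Fc: "x \<in> carrier R" if "x \<in> ?F" for x using subringE(1)[OF sub] that by blast
  note cl = subringE(2,3,5,6,7)[OF sub]
  have mem: "x \<oplus> y \<otimes> e \<in> ?E" if "x \<in> ?F" "y \<in> ?F" for x y using that by auto
  have FE: "?F \<subseteq> ?E"
  proof
    fix x assume x: "x \<in> ?F"
    then have "x = x \<oplus> \<zero> \<otimes> e" using Fc e by simp
    then show "x \<in> ?E" using mem[OF x cl(1)] by simp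
  qed
  have dd: "d \<ominus> d' \<in> ?F" if "d \<in> ?F" "d' \<in> ?F" for d d' using that cl by (simp add: minus_eq)
  have "subfield ?E R"
  proof (rule subfieldI')
    show "subring ?E R"
    proof (rule subringI)
      show "?E \<subseteq> carrier R" using Fc e by auto
      show "\<one> \<in> ?E" using FE cl(2) by blast
      fix s assume "s \<in> ?E"
      then obtain x y where s: "x \<in> ?F" "y \<in> ?F" "s = x \<oplus> y \<otimes> e" by auto
      note sc = Fc[OF s(1)] Fc[OF s(2)]
      have "\<ominus> s = (\<ominus> x) \<oplus> (\<ominus> y) \<otimes> e" unfolding s(3)
        by (rule ring_identity[where ls="[x, y, e]"], (rule reify)+, simp add: in_carrier_def sc e, code_simp)
      then show "\<ominus> s \<in> ?E" using mem s cl by simp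
      fix t assume "t \<in> ?E"
      then obtain x' y' where t: "x' \<in> ?F" "y' \<in> ?F" "t = x' \<oplus> y' \<otimes> e" by auto
      note tc = Fc[OF t(1)] Fc[OF t(2)]
      have "s \<oplus> t = (x \<oplus> x') \<oplus> (y \<oplus> y') \<otimes> e" unfolding s(3) t(3)
        by (rule ring_identity[where ls="[x, y, x', y', e]"], (rule reify)+, simp add: in_carrier_def sc tc e, code_simp)
      then show "s \<oplus> t \<in> ?E" using mem s t cl by simp
      have "s \<otimes> t = (x \<otimes> x' \<oplus> y \<otimes> y' \<otimes> (e \<otimes> e)) \<oplus> (x \<otimes> y' \<oplus> y \<otimes> x') \<otimes> e" unfolding s(3) t(3)
        by (rule ring_identity[where ls="[x, y, x', y', e]"], (rule reify)+, simp add: in_carrier_def sc tc e, code_simp)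
      then show "s \<otimes> t \<in> ?E" using mem s t cl e by simp
    qed
    fix s assume s0: "s \<in> ?E - {\<zero>}"
    then obtain x y where s: "x \<in> ?F" "y \<in> ?F" "s = x \<oplus> y \<otimes> e" by auto
    note sc = Fc[OF s(1)] Fc[OF s(2)]
    have scl: "s \<in> carrier R" using s sc e by simp
    define N where "N = x \<otimes> x \<ominus> y \<otimes> y \<otimes> (e \<otimes> e)"
    have NF: "N \<in> ?F" using s cl e dd by (simp add: N_def)
    have N0: "N \<noteq> \<zero>"
    proof
      assume "N = \<zero>"
      then have xx: "x \<otimes> x = y \<otimes> y \<otimes> (e \<otimes> e)" using sc e by (simp add: N_def r_right_minus_eq)
      have "(x \<ominus> y \<otimes> e) \<otimes> (x \<oplus> y \<otimes> e) = x \<otimes> x \<ominus> y \<otimes> y \<otimes> (e \<otimes> e)"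
        by (rule ring_identity[where ls="[x, y, e]"], (rule reify)+, simp add: in_carrier_def sc e, code_simp)
      also have "\<dots> = \<zero>" using xx sc e by (simp add: r_right_minus_eq)
      finally have "x \<ominus> y \<otimes> e = \<zero>" using s0 s sc e integral[of "x \<ominus> y \<otimes> e" "x \<oplus> y \<otimes> e"] by auto
      then have xe: "x = y \<otimes> e" using sc e by (simp add: r_right_minus_eq)
      have "y \<noteq> \<zero>" using xe s0 s(3) sc e by auto
      then have iy: "inv y \<in> ?F" "inv y \<otimes> y = \<one>" using subfield_m_inv[OF F(1), of y] s by auto
      have "inv y \<otimes> x = e" unfolding xe using iy sc e Fc by (simp add: m_assoc[symmetric])
      then show False using e cl(4)[OF iy(1) s(1)] by simp
    qed
    have iN: "inv N \<in> ?F" "N \<otimes> inv N = \<one>" using subfield_m_inv[OF F(1), of N] NF N0 by auto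
    note iNc = Fc[OF iN(1)]
    have "s \<otimes> (x \<otimes> inv N \<oplus> (\<ominus> (y \<otimes> inv N)) \<otimes> e) = (x \<otimes> x \<ominus> y \<otimes> y \<otimes> (e \<otimes> e)) \<otimes> inv N" unfolding s(3)
      by (rule ring_identity[where ls="[x, y, e, inv N]"], (rule reify)+, simp add: in_carrier_def sc e iNc, code_simp)
    then have "s \<otimes> (x \<otimes> inv N \<oplus> (\<ominus> (y \<otimes> inv N)) \<otimes> e) = \<one>" using iN by (simp add: N_def)
    then have "inv s = x \<otimes> inv N \<oplus> (\<ominus> (y \<otimes> inv N)) \<otimes> e"
      using comm_inv_char[OF scl, of "x \<otimes> inv N \<oplus> (\<ominus> (y \<otimes> inv N)) \<otimes> e"] sc iNc e by simp
    then show "inv s \<in> ?E" using mem[of "x \<otimes> inv N" "\<ominus> (y \<otimes> inv N)"] s iN cl by simp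
  qed
  then show ?case using FE F(2) by blast
qed

lemma Span_subset_if_closed:
  assumes "set Us \<subseteq> F" "\<zero> \<in> F" "\<And>x y. x \<in> F \<Longrightarrow> y \<in> F \<Longrightarrow> x \<oplus> y \<in> F" "\<And>c x. c \<in> k \<Longrightarrow> x \<in> F \<Longrightarrow> c \<otimes> x \<in> F"
  shows "Span k Us \<subseteq> F"
  using assms(1)
proof (induction Us)
  case (Cons u Us)
  show ?case
  proof
    fix w assume "w \<in> Span k (u # Us)"
    moreover have "Span k (u # Us) = line_extension k u (Span k Us)" by simp
    ultimately obtain c v where cv: "c \<in> k" "v \<in> Span k Us" "w = c \<otimes> u \<oplus> v"
      using line_extension_mem_iff[of w k u "Span k Us"] by blast
    moreover have "v \<in> F" using Cons.IH Cons.prems cv(2) by auto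
    ultimately show "w \<in> F" using assms(3)[OF assms(4)[OF cv(1), of u]] Cons.prems by simp
  qed
qed (use assms(2) in simp)

text \<open>This bounds the length of a tower by the degree of the extension.\<close>

lemma independent_tower_list:
  assumes k: "subfield k R"
  shows "tower_list k es \<Longrightarrow> independent k (es @ [\<one>]) \<and> set (es @ [\<one>]) \<subseteq> quadratic_tower k es"
proof (induction es)
  case Nil
  have "independent k [\<one>]" by (rule li_Cons) auto
  then show ?case using subringE(3)[OF subfieldE(1)[OF k]] by simp
next
  case (Cons e es)
  let ?F = "quadratic_tower k es"
  have F: "subfield ?F R" "k \<subseteq> ?F" using subfield_quadratic_tower[OF k] Cons by auto
  note cl = subringE[OF subfieldE(1)[OF F(1)]]
  have "Span k (es @ [\<one>]) \<subseteq> ?F" by (rule Span_subset_if_closed) (use Cons F cl in auto)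
  then have "independent k (e # (es @ [\<one>]))" using Cons by (intro li_Cons) auto
  moreover have "?F \<subseteq> quadratic_tower k (e # es)" 
  proof
    fix x assume x: "x \<in> ?F"
    then have "x = x \<oplus> \<zero> \<otimes> e" using cl(1) Cons.prems by auto
    then show "x \<in> quadratic_tower k (e # es)" using x cl(2) by auto
  qed
  moreover have "e \<in> quadratic_tower k (e # es)"
  proof -
    have "e = \<zero> \<oplus> \<one> \<otimes> e" using Cons.prems by simp
    then show ?thesis using cl(2,3) by auto
  qed
  ultimately show ?case using Cons by auto
qed

lemma subproducts_props:
  assumes k: "subfield k R"
  shows "tower_list k es \<Longrightarrow> p \<in> subproducts es \<Longrightarrow> p \<in> carrier R \<and> p \<noteq> \<zero> \<and> p \<otimes> p \<in> k"
proof (induction es arbitrary: p)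
  case Nil
  then show ?case using subringE(3)[OF subfieldE(1)[OF k]] by simp
next
  case (Cons e es)
  have F: "subfield (quadratic_tower k es) R" using subfield_quadratic_tower[OF k] Cons by auto
  have e0: "e \<noteq> \<zero>" using Cons.prems(1) subringE(2)[OF subfieldE(1)[OF F]] by auto
  show ?case
  proof (cases "p \<in> subproducts es")
    case False
    then obtain p' where p': "p' \<in> subproducts es" "p = p' \<otimes> e" using Cons.prems by auto
    then have IH: "p' \<in> carrier R" "p' \<noteq> \<zero>" "p' \<otimes> p' \<in> k" using Cons by auto
    have e: "e \<in> carrier R" "e \<otimes> e \<in> k" using Cons.prems by auto
    have "p \<otimes> p = (p' \<otimes> p') \<otimes> (e \<otimes> e)" unfolding p'(2)
      by (rule ring_identity[where ls="[p', e]"], (rule reify)+, simp add: in_carrier_def IH e, code_simp)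
    then show ?thesis using IH e e0 p' subringE(6)[OF subfieldE(1)[OF k]] by (simp add: integral_iff)
  qed (use Cons in auto)
qed

text \<open>The easy half of Kummer theory. If \<open>g = x + y e\<close> has its square in \<open>k\<close>, then \<open>2 x y e\<close> lies in the smaller
  field, so \<open>x = 0\<close> or \<open>y = 0\<close>; after multiplying by \<open>e\<close> in the first case, \<open>g\<close> lies in the smaller
  field.\<close>

lemma square_root_in_tower:
  assumes k: "subfield k R" and two: "\<guillemotleft>2\<guillemotright> \<noteq> \<zero>"
  shows "tower_list k es \<Longrightarrow> g \<in> quadratic_tower k es \<Longrightarrow> g \<otimes> g \<in> k \<Longrightarrow> \<exists>p\<in>subproducts es. g \<otimes> p \<in> k"
proof (induction es arbitrary: g)
  case Nil
  then show ?case using subringE(1)[OF subfieldE(1)[OF k]] by auto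
next
  case (Cons e es)
  let ?F = "quadratic_tower k es"
  have F: "subfield ?F R" "k \<subseteq> ?F" using subfield_quadratic_tower[OF k] Cons by auto
  note cl = subringE(2,3,5,6,7)[OF subfieldE(1)[OF F(1)]]
  have Fc: "x \<in> carrier R" if "x \<in> ?F" for x using subringE(1)[OF subfieldE(1)[OF F(1)]] that by blast
  have e: "e \<in> carrier R" "e \<otimes> e \<in> k" "e \<notin> ?F" using Cons.prems by auto
  obtain x y where g: "x \<in> ?F" "y \<in> ?F" "g = x \<oplus> y \<otimes> e" using Cons.prems by auto
  note gc = Fc[OF g(1)] Fc[OF g(2)]
  consider "y = \<zero>" | "x = \<zero>" | "x \<noteq> \<zero>" "y \<noteq> \<zero>" by blast
  then show ?case
  proof cases
    case 1
    then have "g = x" using g gc e by simp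
    then show ?thesis using Cons.IH[of g] Cons.prems g by auto
  next
    case 2
    then have gy: "g = y \<otimes> e" using g gc e by simp
    have gcl: "g \<in> carrier R" using gy gc e by simp
    have ge: "g \<otimes> e = y \<otimes> (e \<otimes> e)" unfolding gy using gc e by (simp add: m_assoc)
    then have 1: "g \<otimes> e \<in> ?F" using cl(4)[OF g(2)] e F(2) by auto
    have "(g \<otimes> e) \<otimes> (g \<otimes> e) = (g \<otimes> g) \<otimes> (e \<otimes> e)"
      by (rule ring_identity[where ls="[g, e]"], (rule reify)+, simp add: in_carrier_def gcl e, code_simp)
    then have "(g \<otimes> e) \<otimes> (g \<otimes> e) \<in> k" using Cons.prems(3) e subringE(6)[OF subfieldE(1)[OF k]] by simp
    then obtain p where p: "p \<in> subproducts es" "g \<otimes> e \<otimes> p \<in> k" using Cons.IH[OF _ 1] Cons.prems by auto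
    have pc: "p \<in> carrier R" using subproducts_props[OF k _ p(1)] Cons.prems by auto
    have "g \<otimes> (p \<otimes> e) = g \<otimes> e \<otimes> p" using gcl e pc by (simp add: m_ac)
    moreover have "p \<otimes> e \<in> subproducts (e # es)" using p(1) by simp
    ultimately show ?thesis using p(2) by (intro bexI[of _ "p \<otimes> e"]) simp_all
  next
    case 3
    define c where "c = \<guillemotleft>2\<guillemotright> \<otimes> (x \<otimes> y)"
    have c2: "\<guillemotleft>2\<guillemotright> \<in> ?F" using cl(2) cl(5)[OF cl(2) cl(2)] by (simp add: of_int_2)
    have cF: "c \<in> ?F" using c2 cl(4) g by (simp add: c_def)
    have c0: "c \<noteq> \<zero>" using two 3 gc by (simp add: c_def integral_iff)
    have ic: "inv c \<in> ?F" "inv c \<otimes> c = \<one>" using subfield_m_inv[OF F(1), of c] cF c0 by auto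
    have "c \<otimes> e = g \<otimes> g \<ominus> (x \<otimes> x \<oplus> y \<otimes> y \<otimes> (e \<otimes> e))" unfolding c_def g(3)
      by (rule ring_identity[where ls="[x, y, e]"], (rule reify)+, simp add: in_carrier_def gc e, code_simp)
    moreover have "\<dots> \<in> ?F"
    proof -
      have 1: "g \<otimes> g \<in> ?F" "e \<otimes> e \<in> ?F" using F(2) Cons.prems(3) e(2) by blast+
      have 2: "x \<otimes> x \<oplus> y \<otimes> y \<otimes> (e \<otimes> e) \<in> ?F"
        by (intro cl(5) cl(4) g(1,2) 1(2))
      show ?thesis unfolding minus_eq by (intro cl(5) cl(3) 1(1) 2)
    qed
    ultimately have "c \<otimes> e \<in> ?F" by simp
    then have 1: "inv c \<otimes> (c \<otimes> e) \<in> ?F" by (rule cl(4)[OF ic(1)])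
    have 2: "inv c \<otimes> (c \<otimes> e) = e"
      unfolding m_assoc[OF Fc[OF ic(1)] Fc[OF cF] e(1), symmetric] ic(2) by (rule l_one[OF e(1)])
    have "e \<in> ?F" by (rule 1[unfolded 2])
    then show ?thesis using e(3) by blast
  qed
qed

text \<open>Take a tower of maximal length. By maximality it contains all \<open>e\<close> with \<open>e^2 \<in> k\<close>, and the
  squares of the finitely many subproducts are the representatives.\<close>

theorem finite_square_classes:
  assumes k: "subfield k R" and two: "\<guillemotleft>2\<guillemotright> \<noteq> \<zero>" and dim: "dimension n k (carrier R)"
  shows "\<exists>D. finite D \<and> D \<subseteq> k - {\<zero>} \<and> (\<forall>e\<in>carrier R. e \<otimes> e \<in> k \<longrightarrow> (\<exists>d\<in>D. \<exists>f\<in>k. e \<otimes> e \<otimes> d = f \<otimes> f))"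
proof -
  have bd: "length es \<le> n" if "tower_list k es" for es
  proof -
    have 1: "set (es @ [\<one>]) \<subseteq> carrier R"
      using independent_tower_list[OF k that] subringE(1)[OF subfieldE(1), of "quadratic_tower k es" R]
        subfield_quadratic_tower[OF k that] by blast
    show ?thesis
      using independent_length_le_dimension[OF k dim conjunct1[OF independent_tower_list[OF k that]] 1] by simp
  qed
  obtain es where es: "tower_list k es" "\<And>fs. tower_list k fs \<Longrightarrow> length fs \<le> length es"
    using ex_has_greatest_nat[of "tower_list k" "[]" length "Suc n"] bd by (auto simp: less_Suc_eq_le)
  have all: "e \<in> quadratic_tower k es" if "e \<in> carrier R" "e \<otimes> e \<in> k" for e
  proof (rule ccontr)
    assume "e \<notin> quadratic_tower k es"
    then have "tower_list k (e # es)" using es(1) that by simp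
    then show False using es(2)[of "e # es"] by simp
  qed
  let ?D = "(\<lambda>p. p \<otimes> p) ` subproducts es"
  have kc: "k \<subseteq> carrier R" using subringE(1)[OF subfieldE(1)[OF k]] .
  have sq: "\<exists>d\<in>?D. \<exists>f\<in>k. e \<otimes> e \<otimes> d = f \<otimes> f" if e: "e \<in> carrier R" "e \<otimes> e \<in> k" for e
  proof -
    obtain p where p: "p \<in> subproducts es" "e \<otimes> p \<in> k" using square_root_in_tower[OF k two es(1) all[OF e] e(2)] by blast
    have pc: "p \<in> carrier R" using subproducts_props[OF k es(1) p(1)] by blast
    have "e \<otimes> e \<otimes> (p \<otimes> p) = (e \<otimes> p) \<otimes> (e \<otimes> p)"
      by (rule ring_identity[where ls="[e, p]"], (rule reify)+, simp add: in_carrier_def e pc, code_simp)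
    then show ?thesis using p(2) imageI[OF p(1), of "\<lambda>p. p \<otimes> p"] by (intro bexI[of _ "p \<otimes> p"] bexI[of _ "e \<otimes> p"])
  qed
  have "?D \<subseteq> k - {\<zero>}"
  proof
    fix d assume "d \<in> ?D"
    then obtain p where p: "p \<in> subproducts es" "d = p \<otimes> p" by blast
    have "p \<in> carrier R" "p \<noteq> \<zero>" "p \<otimes> p \<in> k" using subproducts_props[OF k es(1) p(1)] by blast+
    then show "d \<in> k - {\<zero>}" unfolding p(2) using integral[of p p] by blast
  qed
  then show ?thesis using sq finite_imageI[OF finite_subproducts, of "\<lambda>p. p \<otimes> p" es]
    by (intro exI[of _ ?D] conjI ballI impI) blast+
qed

end

section \<open>Square classes of finite extensions of fraction fields\<close>

lemma (in cring) comaximal_divisor: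
  assumes "comaximal x m" "x \<in> carrier R" "y \<in> carrier R" "w \<in> carrier R" "m = y \<otimes> w"
  shows "comaximal x y"
proof -
  obtain u v where uv: "u \<in> carrier R" "v \<in> carrier R" "u \<otimes> x \<oplus> v \<otimes> m = \<one>" using assms(1) by (auto simp: comaximal_def)
  then have "u \<otimes> x \<oplus> (v \<otimes> w) \<otimes> y = \<one>" using assms by (simp add: m_ac)
  then show ?thesis unfolding comaximal_def using uv assms m_closed by blast
qed

lemma (in domain) finprod_ne_zero:
  assumes "finite D" "D \<subseteq> carrier R - {\<zero>}"
  shows "finprod R (\<lambda>r. r) D \<in> carrier R - {\<zero>}"
  using assms by (induction D rule: finite_induct) (auto simp: Pi_def subset_iff integral_iff)

lemma (in cring) finprod_divisible:
  assumes "finite D" "D \<subseteq> carrier R" "r \<in> D"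
  shows "\<exists>s\<in>carrier R. finprod R (\<lambda>r. r) D = r \<otimes> s"
proof -
  have "finprod R (\<lambda>r. r) (insert r (D - {r})) = r \<otimes> finprod R (\<lambda>r. r) (D - {r})"
    by (rule finprod_insert) (use assms in auto)
  moreover have "insert r (D - {r}) = D" using assms by blast
  moreover have "finprod R (\<lambda>r. r) (D - {r}) \<in> carrier R" by (rule finprod_closed) (use assms in auto)
  ultimately show ?thesis by auto
qed

text \<open>A finite extension \<open>K\<close> of the fraction field of a Euclidean domain \<open>R\<close>.\<close>

locale base_extension =
  field K + R: euclidean_domain R \<phi>
  for K :: "('a, 'm) ring_scheme" (structure) and R :: "('r, 'n) ring_scheme" and \<phi> :: "'r \<Rightarrow> nat" +
  fixes h :: "'r \<Rightarrow> 'a"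
  assumes hom: "h \<in> ring_hom R K" and inj: "inj_on h (carrier R)"
    and finite_dim: "finite_dimension {h a \<otimes> inv (h b) | a b. a \<in> carrier R \<and> b \<in> carrier R - {\<zero>\<^bsub>R\<^esub>}} (carrier K)"
begin

definition fractions :: "'a set" where
  "fractions = {h a \<otimes> inv (h b) | a b. a \<in> carrier R \<and> b \<in> carrier R - {\<zero>\<^bsub>R\<^esub>}}"

sublocale h: ring_hom_cring R K h
  using hom R.is_cring is_cring by (simp add: ring_hom_cring_def ring_hom_cring_axioms_def)

lemma h_eq_iff: "x \<in> carrier R \<Longrightarrow> y \<in> carrier R \<Longrightarrow> h x = h y \<longleftrightarrow> x = y"
  using inj by (auto dest: inj_onD)

lemma h_eq_zero_iff: "x \<in> carrier R \<Longrightarrow> h x = \<zero> \<longleftrightarrow> x = \<zero>\<^bsub>R\<^esub>"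
  using h_eq_iff[of x "\<zero>\<^bsub>R\<^esub>"] by simp

lemma inv_closed' [simp]: "x \<in> carrier K \<Longrightarrow> x \<noteq> \<zero> \<Longrightarrow> inv x \<in> carrier K"
  and r_inv' [simp]: "x \<in> carrier K \<Longrightarrow> x \<noteq> \<zero> \<Longrightarrow> x \<otimes> inv x = \<one>"
  and l_inv' [simp]: "x \<in> carrier K \<Longrightarrow> x \<noteq> \<zero> \<Longrightarrow> inv x \<otimes> x = \<one>"
  using field_Units by auto

lemma fractionsE:
  assumes "x \<in> fractions"
  obtains p q where "p \<in> carrier R" "q \<in> carrier R" "q \<noteq> \<zero>\<^bsub>R\<^esub>" "x = h p \<otimes> inv (h q)" "h q \<noteq> \<zero>" "x \<otimes> h q = h p"
proof -
  obtain p q where pq: "p \<in> carrier R" "q \<in> carrier R" "q \<noteq> \<zero>\<^bsub>R\<^esub>" "x = h p \<otimes> inv (h q)"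
    using assms unfolding fractions_def by blast
  have "h q \<noteq> \<zero>" using pq h_eq_zero_iff by simp
  moreover have "x \<otimes> h q = h p" using pq calculation by (simp add: m_assoc)
  ultimately show ?thesis using that pq by blast
qed

lemma fractionsI: "p \<in> carrier R \<Longrightarrow> q \<in> carrier R \<Longrightarrow> q \<noteq> \<zero>\<^bsub>R\<^esub> \<Longrightarrow> x \<in> carrier K \<Longrightarrow> x \<otimes> h q = h p \<Longrightarrow> x \<in> fractions"
proof -
  assume h: "p \<in> carrier R" "q \<in> carrier R" "q \<noteq> \<zero>\<^bsub>R\<^esub>" "x \<in> carrier K" "x \<otimes> h q = h p"
  have q: "h q \<noteq> \<zero>" using h h_eq_zero_iff by simp
  have "x = x \<otimes> h q \<otimes> inv (h q)" using h(1-4) q by (simp add: m_assoc)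
  then have "x = h p \<otimes> inv (h q)" unfolding h(5) .
  then show ?thesis unfolding fractions_def using h by blast
qed

lemma h_in_fractions: "x \<in> carrier R \<Longrightarrow> h x \<in> fractions"
  by (rule fractionsI[of x "\<one>\<^bsub>R\<^esub>"]) auto

lemma fractions_closed: "fractions \<subseteq> carrier K"
  using h_eq_zero_iff by (auto simp: fractions_def)

lemma subfield_fractions: "subfield fractions K"
proof (rule subfieldI')
  show "subring fractions K"
  proof (rule subringI)
    show "fractions \<subseteq> carrier K" by (rule fractions_closed)
    show "\<one> \<in> fractions" using h_in_fractions[of "\<one>\<^bsub>R\<^esub>"] by simp
    fix x assume x: "x \<in> fractions"
    then have xc: "x \<in> carrier K" using fractions_closed by blast
    obtain p q where pq: "p \<in> carrier R" "q \<in> carrier R" "q \<noteq> \<zero>\<^bsub>R\<^esub>" "x \<otimes> h q = h p" using x by (rule fractionsE)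
    show "\<ominus> x \<in> fractions" by (rule fractionsI[of "\<ominus>\<^bsub>R\<^esub> p" q]) (use pq xc in \<open>auto simp: l_minus\<close>)
    fix y assume y: "y \<in> fractions"
    then have yc: "y \<in> carrier K" using fractions_closed by blast
    obtain r s where rs: "r \<in> carrier R" "s \<in> carrier R" "s \<noteq> \<zero>\<^bsub>R\<^esub>" "y \<otimes> h s = h r" using y by (rule fractionsE)
    have qs: "q \<otimes>\<^bsub>R\<^esub> s \<in> carrier R" "q \<otimes>\<^bsub>R\<^esub> s \<noteq> \<zero>\<^bsub>R\<^esub>" using pq rs by (auto simp: R.integral_iff)
    note c = xc yc h.hom_closed[OF pq(2)] h.hom_closed[OF rs(2)]
    have "(x \<otimes> y) \<otimes> (h q \<otimes> h s) = (x \<otimes> h q) \<otimes> (y \<otimes> h s)"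
      by (rule ring_identity[where ls="[x, y, h q, h s]"], (rule reify)+, simp add: in_carrier_def c, code_simp)
    then have e: "(x \<otimes> y) \<otimes> h (q \<otimes>\<^bsub>R\<^esub> s) = h (p \<otimes>\<^bsub>R\<^esub> r)" unfolding pq(4) rs(4) using pq rs by simp
    show "x \<otimes> y \<in> fractions" by (rule fractionsI[OF _ qs _ e]) (use pq rs c in auto)
    have "(x \<oplus> y) \<otimes> (h q \<otimes> h s) = (x \<otimes> h q) \<otimes> h s \<oplus> (y \<otimes> h s) \<otimes> h q"
      by (rule ring_identity[where ls="[x, y, h q, h s]"], (rule reify)+, simp add: in_carrier_def c, code_simp)
    then have e: "(x \<oplus> y) \<otimes> h (q \<otimes>\<^bsub>R\<^esub> s) = h (p \<otimes>\<^bsub>R\<^esub> s \<oplus>\<^bsub>R\<^esub> r \<otimes>\<^bsub>R\<^esub> q)" unfolding pq(4) rs(4) using pq rs by simp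
    show "x \<oplus> y \<in> fractions" by (rule fractionsI[OF _ qs _ e]) (use pq rs c in auto)
  qed
  fix x assume x: "x \<in> fractions - {\<zero>}"
  then have xc: "x \<in> carrier K" "x \<noteq> \<zero>" using fractions_closed by auto
  obtain p q where pq: "p \<in> carrier R" "q \<in> carrier R" "q \<noteq> \<zero>\<^bsub>R\<^esub>" "x \<otimes> h q = h p" "h q \<noteq> \<zero>"
    using x by (elim DiffE) (rule fractionsE, auto)
  have "h p \<noteq> \<zero>" unfolding pq(4)[symmetric] using xc pq(1-3,5) by (simp add: integral_iff)
  then have p0: "p \<noteq> \<zero>\<^bsub>R\<^esub>" using pq h_eq_zero_iff by simp
  have e: "inv x \<otimes> h p = h q" unfolding pq(4)[symmetric] using xc pq(1-3,5) by (simp add: m_assoc[symmetric])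
  show "inv x \<in> fractions" by (rule fractionsI[OF pq(2,1) p0 _ e]) (use xc in simp)
qed

lemma exists_dimension: "\<exists>n. dimension n fractions (carrier K)"
  using finite_dim unfolding finite_dimension_def fractions_def .

text \<open>The hypothesis \<open>candidates\<close> supplies, for each \<open>N\<close>, a multiple \<open>M = N N'\<close> and a \<open>\<tau>\<close> prime to it such that neither
  \<open>\<tau>\<close> nor \<open>b = 1 + 16 t^2\<close> for \<open>t = \<tau> M^2\<close> is a unit times a square. It is used with \<open>N\<close> twice the product of the
  representatives \<open>r\<close> of the square classes that become trivial in \<open>K\<close>. Of the six elements, four are
  \<open>b\<close> times a factor of \<open>t\<close>, up to squares, and two are \<open>\<tau>\<close> times \<open>\<plusminus>2\<close>; in each
  case the other factor is prime to the first one, even after multiplication by \<open>r\<close>.\<close>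

theorem exists_parameter:
  assumes two: "\<guillemotleft>2\<guillemotright> \<noteq> \<zero>"
    and candidates: "\<And>N. N \<in> carrier R \<Longrightarrow> N \<noteq> \<zero>\<^bsub>R\<^esub> \<Longrightarrow> \<exists>N'\<in>carrier R. \<exists>\<tau>\<in>carrier R.
       N \<otimes>\<^bsub>R\<^esub> N' \<noteq> \<zero>\<^bsub>R\<^esub> \<and> \<tau> \<noteq> \<zero>\<^bsub>R\<^esub> \<and> R.comaximal \<tau> (N \<otimes>\<^bsub>R\<^esub> N') \<and> \<not> R.unit_times_square \<tau> \<and>
       (\<forall>t. t = \<tau> \<otimes>\<^bsub>R\<^esub> ((N \<otimes>\<^bsub>R\<^esub> N') \<otimes>\<^bsub>R\<^esub> (N \<otimes>\<^bsub>R\<^esub> N')) \<longrightarrow> \<not> R.unit_times_square (\<one>\<^bsub>R\<^esub> \<oplus>\<^bsub>R\<^esub> \<guillemotleft>16\<guillemotright>\<^bsub>R\<^esub> \<otimes>\<^bsub>R\<^esub> (t \<otimes>\<^bsub>R\<^esub> t)))"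
  shows "\<exists>t\<in>carrier R. \<forall>e\<in>carrier K. e \<otimes> e \<notin>
     {\<one> \<oplus> \<guillemotleft>16\<guillemotright> \<otimes> (h t \<otimes> h t), \<ominus> (\<one> \<oplus> \<guillemotleft>16\<guillemotright> \<otimes> (h t \<otimes> h t)), \<guillemotleft>2\<guillemotright> \<otimes> (\<one> \<oplus> \<guillemotleft>16\<guillemotright> \<otimes> (h t \<otimes> h t)),
      \<guillemotleft>2\<guillemotright> \<otimes> h t, \<ominus> (\<guillemotleft>2\<guillemotright> \<otimes> h t), (\<one> \<oplus> \<guillemotleft>16\<guillemotright> \<otimes> (h t \<otimes> h t)) \<otimes> h t}"
proof -
  obtain n where n: "dimension n fractions (carrier K)" using exists_dimension by blast
  obtain D where D: "finite D" "D \<subseteq> fractions - {\<zero>}"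
    "\<And>e. e \<in> carrier K \<Longrightarrow> e \<otimes> e \<in> fractions \<Longrightarrow> \<exists>d\<in>D. \<exists>f\<in>fractions. e \<otimes> e \<otimes> d = f \<otimes> f"
    using finite_square_classes[OF subfield_fractions two n] by blast
  have cl: "x \<in> carrier K" if "x \<in> fractions" for x using that fractions_closed by blast
  note sub = subringE[OF subfieldE(1)[OF subfield_fractions]]
  have "\<forall>d\<in>D. \<exists>r. r \<in> carrier R - {\<zero>\<^bsub>R\<^esub>} \<and> (\<exists>c\<in>fractions. h r = d \<otimes> (c \<otimes> c))"
  proof
    fix d assume d: "d \<in> D"
    then have df: "d \<in> fractions" "d \<noteq> \<zero>" using D(2) by auto
    obtain p q where pq: "p \<in> carrier R" "q \<in> carrier R" "q \<noteq> \<zero>\<^bsub>R\<^esub>" "d \<otimes> h q = h p" "h q \<noteq> \<zero>" using df(1) by (rule fractionsE)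
    have "h p \<noteq> \<zero>" unfolding pq(4)[symmetric] using df cl pq(1-3,5) by (simp add: integral_iff)
    then have "p \<noteq> \<zero>\<^bsub>R\<^esub>" using pq h_eq_zero_iff by simp
    then have "p \<otimes>\<^bsub>R\<^esub> q \<in> carrier R - {\<zero>\<^bsub>R\<^esub>}" using pq by (simp add: R.integral_iff)
    moreover have "h (p \<otimes>\<^bsub>R\<^esub> q) = d \<otimes> (h q \<otimes> h q)" using pq cl[OF df(1)] by (simp add: pq(4)[symmetric] m_assoc)
    ultimately show "\<exists>r. r \<in> carrier R - {\<zero>\<^bsub>R\<^esub>} \<and> (\<exists>c\<in>fractions. h r = d \<otimes> (c \<otimes> c))"
      using h_in_fractions[OF pq(2)] by blast
  qed
  from bchoice[OF this] obtain \<rho> where \<rho>: "\<forall>d\<in>D. \<rho> d \<in> carrier R - {\<zero>\<^bsub>R\<^esub>} \<and> (\<exists>c\<in>fractions. h (\<rho> d) = d \<otimes> (c \<otimes> c))" ..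
  define D' where "D' = \<rho> ` D"
  have D': "finite D'" "D' \<subseteq> carrier R - {\<zero>\<^bsub>R\<^esub>}" using D \<rho> by (auto simp: D'_def)
  have cls: "\<exists>r\<in>D'. \<exists>f\<in>fractions. e \<otimes> e \<otimes> h r = f \<otimes> f" if e: "e \<in> carrier K" "e \<otimes> e \<in> fractions" for e
  proof -
    obtain d f where d: "d \<in> D" "f \<in> fractions" "e \<otimes> e \<otimes> d = f \<otimes> f" using D(3)[OF e] by blast
    obtain c where c: "c \<in> fractions" "h (\<rho> d) = d \<otimes> (c \<otimes> c)" using \<rho> d(1) by blast
    have dc: "d \<in> carrier K" "c \<in> carrier K" "f \<in> carrier K" using d c D(2) cl by auto
    have "e \<otimes> e \<otimes> h (\<rho> d) = (e \<otimes> e \<otimes> d) \<otimes> (c \<otimes> c)" unfolding c(2) using e dc by (simp add: m_ac)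
    also have "\<dots> = (f \<otimes> c) \<otimes> (f \<otimes> c)" unfolding d(3) using dc by (simp add: m_ac)
    finally show ?thesis using d(1,2) c(1) sub(6) D'_def by blast
  qed
  \<comment> \<open>The factor \<open>2\<close> makes \<open>\<tau>\<close> prime to \<open>2 r\<close>.\<close>
  define N where "N = \<guillemotleft>2\<guillemotright>\<^bsub>R\<^esub> \<otimes>\<^bsub>R\<^esub> finprod R (\<lambda>r. r) D'"
  have two_R: "\<guillemotleft>2\<guillemotright>\<^bsub>R\<^esub> \<noteq> \<zero>\<^bsub>R\<^esub>"
  proof
    assume "\<guillemotleft>2\<guillemotright>\<^bsub>R\<^esub> = \<zero>\<^bsub>R\<^esub>"
    then have "\<one>\<^bsub>R\<^esub> \<oplus>\<^bsub>R\<^esub> \<one>\<^bsub>R\<^esub> = \<zero>\<^bsub>R\<^esub>" by (simp add: R.of_int_2)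
    then have "h (\<one>\<^bsub>R\<^esub> \<oplus>\<^bsub>R\<^esub> \<one>\<^bsub>R\<^esub>) = \<zero>" by simp
    then show False using two by (simp add: of_int_2)
  qed
  have P: "finprod R (\<lambda>r. r) D' \<in> carrier R - {\<zero>\<^bsub>R\<^esub>}" by (rule R.finprod_ne_zero[OF D'])
  have N: "N \<in> carrier R" "N \<noteq> \<zero>\<^bsub>R\<^esub>" using P two_R by (auto simp: N_def R.integral_iff)
  obtain N' \<tau> where s: "N' \<in> carrier R" "\<tau> \<in> carrier R" "N \<otimes>\<^bsub>R\<^esub> N' \<noteq> \<zero>\<^bsub>R\<^esub>" "\<tau> \<noteq> \<zero>\<^bsub>R\<^esub>" "R.comaximal \<tau> (N \<otimes>\<^bsub>R\<^esub> N')"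
     "\<not> R.unit_times_square \<tau>"
     "\<And>t. t = \<tau> \<otimes>\<^bsub>R\<^esub> ((N \<otimes>\<^bsub>R\<^esub> N') \<otimes>\<^bsub>R\<^esub> (N \<otimes>\<^bsub>R\<^esub> N')) \<Longrightarrow> \<not> R.unit_times_square (\<one>\<^bsub>R\<^esub> \<oplus>\<^bsub>R\<^esub> \<guillemotleft>16\<guillemotright>\<^bsub>R\<^esub> \<otimes>\<^bsub>R\<^esub> (t \<otimes>\<^bsub>R\<^esub> t))"
    using candidates[OF N] by blast
  define M where "M = N \<otimes>\<^bsub>R\<^esub> N'"
  define t where "t = \<tau> \<otimes>\<^bsub>R\<^esub> (M \<otimes>\<^bsub>R\<^esub> M)"
  define b where "b = \<one>\<^bsub>R\<^esub> \<oplus>\<^bsub>R\<^esub> \<guillemotleft>16\<guillemotright>\<^bsub>R\<^esub> \<otimes>\<^bsub>R\<^esub> (t \<otimes>\<^bsub>R\<^esub> t)"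
  have M: "M \<in> carrier R" "M \<noteq> \<zero>\<^bsub>R\<^esub>" using s N by (auto simp: M_def)
  have tc: "t \<in> carrier R" using s M by (simp add: t_def)
  have bc: "b \<in> carrier R" using tc by (simp add: b_def)
  have nb: "\<not> R.unit_times_square b" using s(7)[of t] by (simp add: b_def t_def M_def)
  have b0: "b \<noteq> \<zero>\<^bsub>R\<^esub>"
  proof
    assume "b = \<zero>\<^bsub>R\<^esub>"
    then have "b = \<one>\<^bsub>R\<^esub> \<otimes>\<^bsub>R\<^esub> (\<zero>\<^bsub>R\<^esub> \<otimes>\<^bsub>R\<^esub> \<zero>\<^bsub>R\<^esub>)" by simp
    then show False using nb unfolding R.unit_times_square_def by blast
  qed
  have dvd: "\<exists>w\<in>carrier R. M = \<guillemotleft>2\<guillemotright>\<^bsub>R\<^esub> \<otimes>\<^bsub>R\<^esub> r \<otimes>\<^bsub>R\<^esub> w" if r: "r \<in> D'" for r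
  proof -
    have rc: "r \<in> carrier R" using r D' by blast
    obtain w where w: "w \<in> carrier R" "finprod R (\<lambda>r. r) D' = r \<otimes>\<^bsub>R\<^esub> w" using R.finprod_divisible[OF D'(1) _ r] D'(2) by blast
    have "M = \<guillemotleft>2\<guillemotright>\<^bsub>R\<^esub> \<otimes>\<^bsub>R\<^esub> r \<otimes>\<^bsub>R\<^esub> (w \<otimes>\<^bsub>R\<^esub> N')" using w rc s by (simp add: M_def N_def R.m_assoc)
    then show ?thesis using w s by blast
  qed
  have nosq: "\<not> (e \<otimes> e = h (x \<otimes>\<^bsub>R\<^esub> y \<otimes>\<^bsub>R\<^esub> (m \<otimes>\<^bsub>R\<^esub> m)))"
    if e: "e \<in> carrier K" and x: "x \<in> carrier R" "x \<noteq> \<zero>\<^bsub>R\<^esub>" "\<not> R.unit_times_square x" and y: "y \<in> carrier R"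
      and m: "m \<in> carrier R" "m \<noteq> \<zero>\<^bsub>R\<^esub>" and co: "\<And>r. r \<in> D' \<Longrightarrow> R.comaximal x (y \<otimes>\<^bsub>R\<^esub> r)" for e x y m
  proof
    assume ee: "e \<otimes> e = h (x \<otimes>\<^bsub>R\<^esub> y \<otimes>\<^bsub>R\<^esub> (m \<otimes>\<^bsub>R\<^esub> m))"
    then have "e \<otimes> e \<in> fractions" using h_in_fractions[of "x \<otimes>\<^bsub>R\<^esub> y \<otimes>\<^bsub>R\<^esub> (m \<otimes>\<^bsub>R\<^esub> m)"] x y m by (metis R.m_closed)
    then obtain r f where r: "r \<in> D'" "f \<in> fractions" "e \<otimes> e \<otimes> h r = f \<otimes> f" using cls[OF e] by blast
    have rc: "r \<in> carrier R" using r D' by blast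
    obtain p q where pq: "p \<in> carrier R" "q \<in> carrier R" "q \<noteq> \<zero>\<^bsub>R\<^esub>" "f \<otimes> h q = h p" using r(2) by (rule fractionsE)
    have fc: "f \<in> carrier K" using cl r by blast
    have mq: "m \<otimes>\<^bsub>R\<^esub> q \<in> carrier R" "m \<otimes>\<^bsub>R\<^esub> q \<noteq> \<zero>\<^bsub>R\<^esub>" using m pq by (auto simp: R.integral_iff)
    have "h (x \<otimes>\<^bsub>R\<^esub> (y \<otimes>\<^bsub>R\<^esub> r) \<otimes>\<^bsub>R\<^esub> ((m \<otimes>\<^bsub>R\<^esub> q) \<otimes>\<^bsub>R\<^esub> (m \<otimes>\<^bsub>R\<^esub> q))) = h (x \<otimes>\<^bsub>R\<^esub> y \<otimes>\<^bsub>R\<^esub> (m \<otimes>\<^bsub>R\<^esub> m)) \<otimes> h r \<otimes> (h q \<otimes> h q)"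
      using x y m rc pq by (simp add: m_ac)
    also have "\<dots> = (f \<otimes> h q) \<otimes> (f \<otimes> h q)" unfolding ee[symmetric] r(3) using fc pq(1-3) by (simp add: m_ac)
    also have "\<dots> = h (p \<otimes>\<^bsub>R\<^esub> p)" unfolding pq(4) using pq(1-3) by simp
    finally have "x \<otimes>\<^bsub>R\<^esub> (y \<otimes>\<^bsub>R\<^esub> r) \<otimes>\<^bsub>R\<^esub> ((m \<otimes>\<^bsub>R\<^esub> q) \<otimes>\<^bsub>R\<^esub> (m \<otimes>\<^bsub>R\<^esub> q)) = p \<otimes>\<^bsub>R\<^esub> p"
      by (rule iffD1[OF h_eq_iff, rotated 2]) (use x y rc mq pq in auto)
    then have "R.unit_times_square x"
      using R.comaximal_mult_fraction_square[OF x(1,2) _ co[OF r(1)] pq(1) mq] y rc by blast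
    then show False using x(3) by simp
  qed
  have cot: "R.comaximal b t"
  proof -
    have "\<one>\<^bsub>R\<^esub> \<otimes>\<^bsub>R\<^esub> b \<oplus>\<^bsub>R\<^esub> (\<ominus>\<^bsub>R\<^esub> (\<guillemotleft>16\<guillemotright>\<^bsub>R\<^esub> \<otimes>\<^bsub>R\<^esub> t)) \<otimes>\<^bsub>R\<^esub> t = \<one>\<^bsub>R\<^esub>" unfolding b_def
      by (rule R.ring_identity[where ls="[t]"], (rule R.reify)+, simp add: R.in_carrier_def tc, code_simp)
    then show ?thesis unfolding R.comaximal_def using tc by (intro bexI[of _ "\<one>\<^bsub>R\<^esub>"] bexI[of _ "\<ominus>\<^bsub>R\<^esub> (\<guillemotleft>16\<guillemotright>\<^bsub>R\<^esub> \<otimes>\<^bsub>R\<^esub> t)"]) auto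
  qed
  have cM: "R.comaximal \<tau> M" using s(5) by (simp add: M_def)
  have co_b: "R.comaximal b (y \<otimes>\<^bsub>R\<^esub> r)" if r: "r \<in> D'" and y: "y \<in> {\<one>\<^bsub>R\<^esub>, \<ominus>\<^bsub>R\<^esub> \<one>\<^bsub>R\<^esub>, \<guillemotleft>2\<guillemotright>\<^bsub>R\<^esub>, \<tau>}" for y r
  proof -
    have rc: "r \<in> carrier R" using r D' by blast
    obtain w where w: "w \<in> carrier R" "M = \<guillemotleft>2\<guillemotright>\<^bsub>R\<^esub> \<otimes>\<^bsub>R\<^esub> r \<otimes>\<^bsub>R\<^esub> w" using dvd[OF r] by blast
    have "\<exists>z\<in>carrier R. t = (y \<otimes>\<^bsub>R\<^esub> r) \<otimes>\<^bsub>R\<^esub> z"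
      using y
    proof (elim insertE emptyE)
      assume "y = \<one>\<^bsub>R\<^esub>"
      moreover have "t = (\<one>\<^bsub>R\<^esub> \<otimes>\<^bsub>R\<^esub> r) \<otimes>\<^bsub>R\<^esub> (\<tau> \<otimes>\<^bsub>R\<^esub> M \<otimes>\<^bsub>R\<^esub> \<guillemotleft>2\<guillemotright>\<^bsub>R\<^esub> \<otimes>\<^bsub>R\<^esub> w)" unfolding t_def w(2)
        by (rule R.ring_identity[where ls="[r, w, \<tau>]"], (rule R.reify)+, simp add: R.in_carrier_def rc w s, code_simp)
      ultimately show ?thesis using s M w by (intro bexI[of _ "\<tau> \<otimes>\<^bsub>R\<^esub> M \<otimes>\<^bsub>R\<^esub> \<guillemotleft>2\<guillemotright>\<^bsub>R\<^esub> \<otimes>\<^bsub>R\<^esub> w"]) auto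
    next
      assume "y = \<ominus>\<^bsub>R\<^esub> \<one>\<^bsub>R\<^esub>"
      moreover have "t = ((\<ominus>\<^bsub>R\<^esub> \<one>\<^bsub>R\<^esub>) \<otimes>\<^bsub>R\<^esub> r) \<otimes>\<^bsub>R\<^esub> (\<ominus>\<^bsub>R\<^esub> (\<tau> \<otimes>\<^bsub>R\<^esub> M \<otimes>\<^bsub>R\<^esub> \<guillemotleft>2\<guillemotright>\<^bsub>R\<^esub> \<otimes>\<^bsub>R\<^esub> w))" unfolding t_def w(2)
        by (rule R.ring_identity[where ls="[r, w, \<tau>]"], (rule R.reify)+, simp add: R.in_carrier_def rc w s, code_simp)
      ultimately show ?thesis using s M w by (intro bexI[of _ "\<ominus>\<^bsub>R\<^esub> (\<tau> \<otimes>\<^bsub>R\<^esub> M \<otimes>\<^bsub>R\<^esub> \<guillemotleft>2\<guillemotright>\<^bsub>R\<^esub> \<otimes>\<^bsub>R\<^esub> w)"]) auto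
    next
      assume "y = \<guillemotleft>2\<guillemotright>\<^bsub>R\<^esub>"
      moreover have "t = (\<guillemotleft>2\<guillemotright>\<^bsub>R\<^esub> \<otimes>\<^bsub>R\<^esub> r) \<otimes>\<^bsub>R\<^esub> (\<tau> \<otimes>\<^bsub>R\<^esub> M \<otimes>\<^bsub>R\<^esub> w)" unfolding t_def w(2)
        by (rule R.ring_identity[where ls="[r, w, \<tau>]"], (rule R.reify)+, simp add: R.in_carrier_def rc w s, code_simp)
      ultimately show ?thesis using s M w by (intro bexI[of _ "\<tau> \<otimes>\<^bsub>R\<^esub> M \<otimes>\<^bsub>R\<^esub> w"]) auto
    next
      assume "y = \<tau>"
      moreover have "t = (\<tau> \<otimes>\<^bsub>R\<^esub> r) \<otimes>\<^bsub>R\<^esub> (M \<otimes>\<^bsub>R\<^esub> \<guillemotleft>2\<guillemotright>\<^bsub>R\<^esub> \<otimes>\<^bsub>R\<^esub> w)" unfolding t_def w(2)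
        by (rule R.ring_identity[where ls="[r, w, \<tau>]"], (rule R.reify)+, simp add: R.in_carrier_def rc w s, code_simp)
      ultimately show ?thesis using s M w by (intro bexI[of _ "M \<otimes>\<^bsub>R\<^esub> \<guillemotleft>2\<guillemotright>\<^bsub>R\<^esub> \<otimes>\<^bsub>R\<^esub> w"]) auto
    qed
    then obtain z where z: "z \<in> carrier R" "t = (y \<otimes>\<^bsub>R\<^esub> r) \<otimes>\<^bsub>R\<^esub> z" by blast
    have "y \<in> carrier R" using y s by auto
    then show ?thesis using R.comaximal_divisor[OF cot bc _ z] rc by simp
  qed
  have co_\<tau>: "R.comaximal \<tau> (y \<otimes>\<^bsub>R\<^esub> r)" if r: "r \<in> D'" and y: "y = \<guillemotleft>2\<guillemotright>\<^bsub>R\<^esub> \<or> y = \<ominus>\<^bsub>R\<^esub> \<guillemotleft>2\<guillemotright>\<^bsub>R\<^esub>" for y r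
  proof -
    have rc: "r \<in> carrier R" using r D' by blast
    obtain w where w: "w \<in> carrier R" "M = \<guillemotleft>2\<guillemotright>\<^bsub>R\<^esub> \<otimes>\<^bsub>R\<^esub> r \<otimes>\<^bsub>R\<^esub> w" using dvd[OF r] by blast
    have M': "M = (\<ominus>\<^bsub>R\<^esub> \<guillemotleft>2\<guillemotright>\<^bsub>R\<^esub>) \<otimes>\<^bsub>R\<^esub> r \<otimes>\<^bsub>R\<^esub> (\<ominus>\<^bsub>R\<^esub> w)" unfolding w(2)
      by (rule R.ring_identity[where ls="[r, w]"], (rule R.reify)+, simp add: R.in_carrier_def rc w(1), code_simp)
    have c2: "\<guillemotleft>2\<guillemotright>\<^bsub>R\<^esub> \<otimes>\<^bsub>R\<^esub> r \<in> carrier R" "(\<ominus>\<^bsub>R\<^esub> \<guillemotleft>2\<guillemotright>\<^bsub>R\<^esub>) \<otimes>\<^bsub>R\<^esub> r \<in> carrier R" "\<ominus>\<^bsub>R\<^esub> w \<in> carrier R" using rc w by auto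
    show ?thesis
      using y R.comaximal_divisor[OF cM s(2) c2(1) w(1,2)] R.comaximal_divisor[OF cM s(2) c2(2,3) M'] by blast
  qed
  have hb: "h b = \<one> \<oplus> \<guillemotleft>16\<guillemotright> \<otimes> (h t \<otimes> h t)" using tc by (simp add: b_def h.hom_of_int)
  show ?thesis
  proof (intro bexI[of _ t] ballI notI)
    fix e assume e: "e \<in> carrier K"
    assume "e \<otimes> e \<in> {\<one> \<oplus> \<guillemotleft>16\<guillemotright> \<otimes> (h t \<otimes> h t), \<ominus> (\<one> \<oplus> \<guillemotleft>16\<guillemotright> \<otimes> (h t \<otimes> h t)), \<guillemotleft>2\<guillemotright> \<otimes> (\<one> \<oplus> \<guillemotleft>16\<guillemotright> \<otimes> (h t \<otimes> h t)),
      \<guillemotleft>2\<guillemotright> \<otimes> h t, \<ominus> (\<guillemotleft>2\<guillemotright> \<otimes> h t), (\<one> \<oplus> \<guillemotleft>16\<guillemotright> \<otimes> (h t \<otimes> h t)) \<otimes> h t}"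
    then show False
      unfolding hb[symmetric]
    proof (elim insertE emptyE)
      assume "e \<otimes> e = h b"
      then show False using nosq[OF e bc b0 nb, of "\<one>\<^bsub>R\<^esub>" "\<one>\<^bsub>R\<^esub>"] co_b[of _ "\<one>\<^bsub>R\<^esub>"] bc by simp
    next
      assume "e \<otimes> e = \<ominus> h b"
      then show False using nosq[OF e bc b0 nb, of "\<ominus>\<^bsub>R\<^esub> \<one>\<^bsub>R\<^esub>" "\<one>\<^bsub>R\<^esub>"] co_b[of _ "\<ominus>\<^bsub>R\<^esub> \<one>\<^bsub>R\<^esub>"] bc by (simp add: r_minus)
    next
      assume "e \<otimes> e = \<guillemotleft>2\<guillemotright> \<otimes> h b"
      then show False using nosq[OF e bc b0 nb, of "\<guillemotleft>2\<guillemotright>\<^bsub>R\<^esub>" "\<one>\<^bsub>R\<^esub>"] co_b[of _ "\<guillemotleft>2\<guillemotright>\<^bsub>R\<^esub>"] bc by (simp add: h.hom_of_int m_comm)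
    next
      assume ee: "e \<otimes> e = \<guillemotleft>2\<guillemotright> \<otimes> h t"
      have "h (\<tau> \<otimes>\<^bsub>R\<^esub> \<guillemotleft>2\<guillemotright>\<^bsub>R\<^esub> \<otimes>\<^bsub>R\<^esub> (M \<otimes>\<^bsub>R\<^esub> M)) = \<guillemotleft>2\<guillemotright> \<otimes> h t" using s M by (simp add: t_def h.hom_of_int m_ac)
      then show False using ee nosq[OF e s(2,4,6), of "\<guillemotleft>2\<guillemotright>\<^bsub>R\<^esub>" M] co_\<tau>[of _ "\<guillemotleft>2\<guillemotright>\<^bsub>R\<^esub>"] M by simp
    next
      assume ee: "e \<otimes> e = \<ominus> (\<guillemotleft>2\<guillemotright> \<otimes> h t)"
      have "h (\<tau> \<otimes>\<^bsub>R\<^esub> (\<ominus>\<^bsub>R\<^esub> \<guillemotleft>2\<guillemotright>\<^bsub>R\<^esub>) \<otimes>\<^bsub>R\<^esub> (M \<otimes>\<^bsub>R\<^esub> M)) = \<ominus> (\<guillemotleft>2\<guillemotright> \<otimes> h t)" using s M by (simp add: t_def h.hom_of_int m_ac l_minus r_minus)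
      then show False using ee nosq[OF e s(2,4,6), of "\<ominus>\<^bsub>R\<^esub> \<guillemotleft>2\<guillemotright>\<^bsub>R\<^esub>" M] co_\<tau>[of _ "\<ominus>\<^bsub>R\<^esub> \<guillemotleft>2\<guillemotright>\<^bsub>R\<^esub>"] M by simp
    next
      assume ee: "e \<otimes> e = h b \<otimes> h t"
      have "h (b \<otimes>\<^bsub>R\<^esub> \<tau> \<otimes>\<^bsub>R\<^esub> (M \<otimes>\<^bsub>R\<^esub> M)) = h b \<otimes> h t" using s M bc by (simp add: t_def m_assoc)
      then show False using ee nosq[OF e bc b0 nb s(2) M] co_b[of _ \<tau>] by simp
    qed
  qed (rule tc)
qed

end

section \<open>Residues of fractions\<close>

context nonarch_field
begin

text \<open>If \<open>p\<close> and \<open>q\<close> have the leading terms \<open>c w\<close> and \<open>d w\<close>, then the residue of \<open>p / q\<close> is that of \<open>c / d\<close>.\<close>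

lemma residue_quotient:
  assumes cl: "u \<in> carrier K" "p \<in> carrier K" "q \<in> carrier K" "c \<in> carrier K" "d \<in> carrier K" "w \<in> carrier K"
    and u: "u \<otimes> q = p" "a u \<le> 1" and d: "a d = 1"
    and p: "a (p \<ominus> c \<otimes> w) < a w" and q: "a (q \<ominus> d \<otimes> w) < a w"
  shows "a (u \<ominus> c \<otimes> inv d) < 1"
proof -
  have d0: "d \<noteq> \<zero>" using d by auto
  have i: "inv d \<in> carrier K" "inv d \<otimes> d = \<one>" using d0 cl field_Units by auto
  have "0 \<le> a (q \<ominus> d \<otimes> w)" using cl by simp
  then have w0: "0 < a w" using q by linarith
  have "(u \<ominus> c \<otimes> inv d) \<otimes> (d \<otimes> w) = u \<otimes> (d \<otimes> w) \<ominus> c \<otimes> (inv d \<otimes> d) \<otimes> w"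
    by (rule ring_identity[where ls="[u, c, d, w, inv d]"], (rule reify)+, simp add: in_carrier_def cl i(1), code_simp)
  also have "\<dots> = u \<otimes> (d \<otimes> w) \<ominus> c \<otimes> w" using i cl by simp
  also have "\<dots> = (u \<otimes> q \<ominus> c \<otimes> w) \<ominus> u \<otimes> (q \<ominus> d \<otimes> w)"
    by (rule ring_identity[where ls="[u, c, d, w, q]"], (rule reify)+, simp add: in_carrier_def cl, code_simp)
  finally have e: "(u \<ominus> c \<otimes> inv d) \<otimes> (d \<otimes> w) = (p \<ominus> c \<otimes> w) \<ominus> u \<otimes> (q \<ominus> d \<otimes> w)" unfolding u(1) .
  have "a (u \<otimes> (q \<ominus> d \<otimes> w)) \<le> 1 * a (q \<ominus> d \<otimes> w)" using mult_right_mono[of "a u" 1 "a (q \<ominus> d \<otimes> w)"] u(2) cl by simp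
  then have "a ((p \<ominus> c \<otimes> w) \<ominus> u \<otimes> (q \<ominus> d \<otimes> w)) < a w"
    using ultra_diff[of "p \<ominus> c \<otimes> w" "u \<otimes> (q \<ominus> d \<otimes> w)"] p q cl by simp
  then have "a (u \<ominus> c \<otimes> inv d) * a w < 1 * a w" unfolding e[symmetric] using cl i d by simp
  then show ?thesis using w0 by simp
qed

end

locale nonarch_extension = nonarch_field K a + base_extension K R \<phi> h
  for K :: "('a, 'm) ring_scheme" (structure) and a and R :: "('r, 'n) ring_scheme" and \<phi> and h
begin

lemma exists_fraction_abs_gt_1: "\<exists>c\<in>fractions. 1 < a c"
  using exists_dimension exists_abs_gt_1_in_subfield[OF subfield_fractions] by blast

text \<open>Let \<open>\<pi>\<close> be of minimal Euclidean size among the nonzero elements with \<open>a \<pi> < 1\<close>. Division with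
  remainder shows that \<open>\<pi>\<close> divides every element with \<open>a r < 1\<close>, and that every residue of \<open>R\<close> is
  represented by an element smaller than \<open>\<pi>\<close>. After cancelling powers of \<open>\<pi>\<close>, a fraction of absolute
  value one has numerator and denominator of absolute value one.\<close>

theorem finite_residues_fractions_integral:
  assumes int: "\<And>r. r \<in> carrier R \<Longrightarrow> a (h r) \<le> 1" and fin: "\<And>n. finite {r \<in> carrier R. \<phi> r < n}"
  shows "finite_residues fractions"
proof -
  obtain c where c: "c \<in> fractions" "1 < a c" using exists_fraction_abs_gt_1 by blast
  obtain p0 q0 where pq0: "p0 \<in> carrier R" "q0 \<in> carrier R" "q0 \<noteq> \<zero>\<^bsub>R\<^esub>" "c \<otimes> h q0 = h p0" using c(1) by (rule fractionsE)
  let ?P = "\<lambda>r. r \<in> carrier R \<and> r \<noteq> \<zero>\<^bsub>R\<^esub> \<and> a (h r) < 1"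
  have "c \<in> carrier K" using c(1) fractions_closed by blast
  then have "a c * a (h q0) = a (h p0)" using pq0(2) by (simp add: pq0(4)[symmetric])
  then have "a c * a (h q0) \<le> 1" using int[OF pq0(1)] by simp
  then have "a (h q0) < 1" using c(2)
    by (metis abs_nonneg h.hom_closed pq0(2) less_le_trans mult_le_cancel_right2 not_less order.strict_trans1 zero_less_one)
  then have "?P q0" using pq0 by blast
  from ex_has_least_nat[of ?P, OF this, of \<phi>] obtain \<pi> where \<pi>: "?P \<pi>" "\<And>y. ?P y \<Longrightarrow> \<phi> \<pi> \<le> \<phi> y" by blast
  have pc: "\<pi> \<in> carrier R" "h \<pi> \<in> carrier K" "h \<pi> \<noteq> \<zero>" using \<pi>(1) h_eq_zero_iff by auto
  have dv: "\<exists>s\<in>carrier R. \<exists>\<rho>\<in>carrier R. r = \<pi> \<otimes>\<^bsub>R\<^esub> s \<oplus>\<^bsub>R\<^esub> \<rho> \<and> (\<rho> = \<zero>\<^bsub>R\<^esub> \<or> \<phi> \<rho> < \<phi> \<pi>)" if r: "r \<in> carrier R" for r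
  proof (cases "r = \<zero>\<^bsub>R\<^esub>")
    case True
    then show ?thesis using pc by (intro bexI[of _ "\<zero>\<^bsub>R\<^esub>"]) auto
  next
    case False
    then show ?thesis using R.euclidean_function[of r \<pi>] r \<pi>(1) by blast
  qed
  have hdiv: "h r \<ominus> h \<rho> = h \<pi> \<otimes> h s" if "r = \<pi> \<otimes>\<^bsub>R\<^esub> s \<oplus>\<^bsub>R\<^esub> \<rho>" "s \<in> carrier R" "\<rho> \<in> carrier R" for r s \<rho>
  proof -
    have "h r = h \<pi> \<otimes> h s \<oplus> h \<rho>" using that pc by simp
    moreover have "(h \<pi> \<otimes> h s \<oplus> h \<rho>) \<ominus> h \<rho> = h \<pi> \<otimes> h s"
      by (rule ring_identity[where ls="[h \<pi>, h s, h \<rho>]"], (rule reify)+, simp add: in_carrier_def that pc, code_simp)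
    ultimately show ?thesis by simp
  qed
  have small: "a (h \<pi> \<otimes> h s) < 1" if "s \<in> carrier R" for s
  proof -
    have "a (h \<pi> \<otimes> h s) = a (h \<pi>) * a (h s)" using that pc by simp
    also have "\<dots> \<le> a (h \<pi>)" by (rule mult_left_le[OF int[OF that]]) (use pc in simp)
    finally show ?thesis using \<pi>(1) by linarith
  qed
  have dv1: "\<exists>s\<in>carrier R. r = \<pi> \<otimes>\<^bsub>R\<^esub> s" if r: "r \<in> carrier R" "a (h r) < 1" for r
  proof -
    obtain s \<rho> where s: "s \<in> carrier R" "\<rho> \<in> carrier R" "r = \<pi> \<otimes>\<^bsub>R\<^esub> s \<oplus>\<^bsub>R\<^esub> \<rho>" "\<rho> = \<zero>\<^bsub>R\<^esub> \<or> \<phi> \<rho> < \<phi> \<pi>" using dv[OF r(1)] by blast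
    have hc: "h r \<in> carrier K" "h \<rho> \<in> carrier K" "h \<pi> \<otimes> h s \<in> carrier K" using s r pc by auto
    have "h \<rho> = h r \<ominus> (h r \<ominus> h \<rho>)"
      by (rule ring_identity[where ls="[h r, h \<rho>]"], (rule reify)+, simp add: in_carrier_def hc, code_simp)
    then have "h \<rho> = h r \<ominus> h \<pi> \<otimes> h s" unfolding hdiv[OF s(3,1,2)] .
    then have "a (h \<rho>) < 1" using ultra_diff[OF hc(1,3)] small[OF s(1)] r(2) by simp
    then have "\<rho> = \<zero>\<^bsub>R\<^esub>" using \<pi>(2)[of \<rho>] s(2,4) by force
    then have "r = \<pi> \<otimes>\<^bsub>R\<^esub> s" using s(1,3) pc by simp
    then show ?thesis using s(1) by blast
  qed
  have key: "p \<in> carrier R \<Longrightarrow> q \<in> carrier R \<Longrightarrow> a (h p) = a (h q) \<Longrightarrow> a (h \<pi>) ^ n < a (h p) \<Longrightarrow>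
      \<exists>p'\<in>carrier R. \<exists>q'\<in>carrier R. a (h p') = 1 \<and> a (h q') = 1 \<and> h p \<otimes> h q' = h p' \<otimes> h q" for p q n
  proof (induction n arbitrary: p q)
    case 0
    then show ?case using int[of p] by simp
  next
    case (Suc n)
    show ?case
    proof (cases "a (h p) < 1")
      case False
      then have "a (h p) = 1" using int[OF Suc.prems(1)] by simp
      then show ?thesis using Suc.prems(1-3) m_comm by (intro bexI[of _ p] bexI[of _ q]) auto
    next
      case True
      obtain p1 where p1: "p1 \<in> carrier R" "p = \<pi> \<otimes>\<^bsub>R\<^esub> p1" using dv1[OF Suc.prems(1) True] by blast
      obtain q1 where q1: "q1 \<in> carrier R" "q = \<pi> \<otimes>\<^bsub>R\<^esub> q1" using dv1[OF Suc.prems(2)] True Suc.prems(3) by auto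
      have pos: "0 < a (h \<pi>)" using pc by simp
      have "a (h p1) = a (h q1)" using Suc.prems(3) pc p1 q1 by simp
      moreover have "a (h \<pi>) ^ n < a (h p1)" using Suc.prems(4) p1 pc pos by simp
      ultimately obtain p' q' where r: "p' \<in> carrier R" "q' \<in> carrier R" "a (h p') = 1" "a (h q') = 1" "h p1 \<otimes> h q' = h p' \<otimes> h q1"
        using Suc.IH[OF p1(1) q1(1)] by blast
      have "h p \<otimes> h q' = h \<pi> \<otimes> (h p1 \<otimes> h q')" using p1 pc r(2) by (simp add: m_assoc)
      also have "\<dots> = h p' \<otimes> h q" unfolding r(5) using q1 pc r(1) by (simp add: m_ac)
      finally show ?thesis using r by blast
    qed
  qed
  define S where "S = insert \<zero>\<^bsub>R\<^esub> {r \<in> carrier R. \<phi> r < \<phi> \<pi>}"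
  have S: "finite S" "S \<subseteq> carrier R" using fin by (auto simp: S_def)
  have res: "\<exists>\<rho>\<in>S. a (h r \<ominus> h \<rho>) < 1" if r: "r \<in> carrier R" for r
  proof -
    obtain s \<rho> where s: "s \<in> carrier R" "\<rho> \<in> carrier R" "r = \<pi> \<otimes>\<^bsub>R\<^esub> s \<oplus>\<^bsub>R\<^esub> \<rho>" "\<rho> = \<zero>\<^bsub>R\<^esub> \<or> \<phi> \<rho> < \<phi> \<pi>" using dv[OF r] by blast
    have "\<rho> \<in> S" using s(2,4) by (auto simp: S_def)
    moreover have "a (h r \<ominus> h \<rho>) < 1" unfolding hdiv[OF s(3,1,2)] by (rule small[OF s(1)])
    ultimately show ?thesis by blast
  qed
  define Y where "Y = insert \<zero> ((\<lambda>(\<rho>, \<sigma>). h \<rho> \<otimes> inv (h \<sigma>)) ` (S \<times> (S - {\<zero>\<^bsub>R\<^esub>})))"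
  have "finite Y" "Y \<subseteq> carrier K" using S h_eq_zero_iff by (auto simp: Y_def subset_iff)
  moreover have "\<exists>y\<in>Y. a (u \<ominus> y) < 1" if u: "u \<in> fractions" "a u \<le> 1" for u
  proof (cases "a u = 1")
    case False
    have "u \<in> carrier K" using u fractions_closed by blast
    then have "a (u \<ominus> \<zero>) < 1" using False u(2) by (simp add: minus_eq)
    then show ?thesis by (auto simp: Y_def)
  next
    case True
    have uc: "u \<in> carrier K" using u fractions_closed by blast
    obtain p q where pq: "p \<in> carrier R" "q \<in> carrier R" "u \<otimes> h q = h p" "h q \<noteq> \<zero>" using u(1) by (rule fractionsE)
    have ae: "a (h p) = a (h q)" using True uc pq(2) by (simp add: pq(3)[symmetric])
    have "0 < a (h p)" unfolding ae using pq by simp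
    then obtain n where "a (h \<pi>) ^ n < a (h p)" using real_arch_pow_inv[of "a (h p)" "a (h \<pi>)"] \<pi>(1) by blast
    then obtain p' q' where r: "p' \<in> carrier R" "q' \<in> carrier R" "a (h p') = 1" "a (h q') = 1" "h p \<otimes> h q' = h p' \<otimes> h q"
      using key[OF pq(1,2) ae] by blast
    have "h q \<otimes> (u \<otimes> h q') = (u \<otimes> h q) \<otimes> h q'" using uc pq(2) r(2) by (simp add: m_ac)
    also have "\<dots> = h q \<otimes> h p'" unfolding pq(3) r(5) using r(1) pq(2) by (simp add: m_comm)
    finally have uq: "u \<otimes> h q' = h p'" using m_lcancel[of "h q" "u \<otimes> h q'" "h p'"] pq(2,4) uc r(1,2) by simp
    obtain \<rho> where \<rho>: "\<rho> \<in> S" "a (h p' \<ominus> h \<rho>) < 1" using res[OF r(1)] by blast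
    obtain \<sigma> where \<sigma>: "\<sigma> \<in> S" "a (h q' \<ominus> h \<sigma>) < 1" using res[OF r(2)] by blast
    have cs: "h \<rho> \<in> carrier K" "h \<sigma> \<in> carrier K" "h p' \<in> carrier K" "h q' \<in> carrier K" using \<rho> \<sigma> S r by auto
    have "a (h \<sigma>) = 1" using abs_eq_if_close[OF cs(2,4)] abs_diff_commute[OF cs(2,4)] \<sigma>(2) r(4) by simp
    moreover from this have "\<sigma> \<noteq> \<zero>\<^bsub>R\<^esub>" by auto
    moreover have "a (u \<ominus> h \<rho> \<otimes> inv (h \<sigma>)) < 1"
      using residue_quotient[OF uc cs(3,4,1,2) one_closed uq] \<rho>(2) \<sigma>(2) u(2) \<open>a (h \<sigma>) = 1\<close> cs by simp
    ultimately show ?thesis using \<rho>(1) \<sigma>(1) unfolding Y_def by (intro bexI[of _ "h \<rho> \<otimes> inv (h \<sigma>)"]) auto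
  qed
  ultimately show ?thesis unfolding finite_residues_def by blast
qed

text \<open>The case of an absolute value which is unbounded on \<open>R\<close>, such as the degree on polynomials: every
  element has a leading term with respect to a fixed \<open>w\<close>, with coefficients in a finite set.\<close>

theorem finite_residues_fractions_leading_terms:
  assumes w: "w \<in> carrier K" "1 < a w" and C: "finite C" "C \<subseteq> carrier K"
    and lead: "\<And>r. r \<in> carrier R \<Longrightarrow> r \<noteq> \<zero>\<^bsub>R\<^esub> \<Longrightarrow> \<exists>(n::nat). \<exists>c\<in>C. a c = 1 \<and> a (h r \<ominus> c \<otimes> w [^] n) < a w ^ n"
  shows "finite_residues fractions"
proof -
  define Y where "Y = insert \<zero> ((\<lambda>(c, d). c \<otimes> inv d) ` (C \<times> (C - {\<zero>})))"
  have "finite Y" "Y \<subseteq> carrier K" using C by (auto simp: Y_def subset_iff)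
  moreover have "\<exists>y\<in>Y. a (u \<ominus> y) < 1" if u: "u \<in> fractions" "a u \<le> 1" for u
  proof (cases "a u = 1")
    case False
    have "u \<in> carrier K" using u fractions_closed by blast
    then have "a (u \<ominus> \<zero>) < 1" using False u(2) by (simp add: minus_eq)
    then show ?thesis by (auto simp: Y_def)
  next
    case True
    have uc: "u \<in> carrier K" using u fractions_closed by blast
    obtain p q where pq: "p \<in> carrier R" "q \<in> carrier R" "q \<noteq> \<zero>\<^bsub>R\<^esub>" "u \<otimes> h q = h p" "h q \<noteq> \<zero>" using u(1) by (rule fractionsE)
    have ae: "a (h p) = a (h q)" using True uc pq(2) by (simp add: pq(4)[symmetric])
    have "a (h q) \<noteq> 0" using pq(2,5) by simp
    then have "a (h p) \<noteq> 0" unfolding ae .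
    then have "p \<noteq> \<zero>\<^bsub>R\<^esub>" by auto
    then obtain n :: nat and c where c: "c \<in> C" "a c = 1" "a (h p \<ominus> c \<otimes> w [^] n) < a w ^ n" using lead[OF pq(1)] by blast
    obtain m :: nat and d where d: "d \<in> C" "a d = 1" "a (h q \<ominus> d \<otimes> w [^] m) < a w ^ m" using lead[OF pq(2,3)] by blast
    have cl: "h p \<in> carrier K" "h q \<in> carrier K" "c \<in> carrier K" "d \<in> carrier K" using pq c d C by auto
    have "a (h p) = a w ^ n" using abs_eq_if_close[of "h p" "c \<otimes> w [^] n"] c cl w by simp
    moreover have "a (h q) = a w ^ m" using abs_eq_if_close[of "h q" "d \<otimes> w [^] m"] d cl w by simp
    ultimately have "a w ^ n = a w ^ m" using ae by simp
    then have nm: "n = m" using power_inject_exp[OF w(2)] by blast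
    have "a (u \<ominus> c \<otimes> inv d) < 1"
      using residue_quotient[OF uc cl nat_pow_closed[OF w(1), of m] pq(4) u(2) d(2)] c(3) d(3) w unfolding nm by simp
    moreover have "d \<noteq> \<zero>" using d(2) by auto
    ultimately show ?thesis using c(1) d(1) unfolding Y_def by (intro bexI[of _ "c \<otimes> inv d"]) auto
  qed
  ultimately show ?thesis unfolding finite_residues_def by blast
qed

end

section \<open>Number fields as extensions of the integers\<close>

lemma type_algebra_simps:
  "carrier (ring_of_type_algebra :: 'a::comm_ring_1 ring) = UNIV"
  "x \<otimes>\<^bsub>ring_of_type_algebra\<^esub> y = x * (y :: 'a)" "x \<oplus>\<^bsub>ring_of_type_algebra\<^esub> y = x + (y :: 'a)"
  "\<one>\<^bsub>ring_of_type_algebra\<^esub> = (1 :: 'a)" "\<zero>\<^bsub>ring_of_type_algebra\<^esub> = (0 :: 'a)"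
  by (simp_all add: ring_of_type_algebra_def)

lemma euclidean_domain_int: "euclidean_domain (ring_of_type_algebra :: int ring) (\<lambda>n. nat \<bar>n\<bar>)"
proof -
  interpret cring "ring_of_type_algebra :: int ring" by (rule cring_from_type_algebra)
  interpret domain "ring_of_type_algebra :: int ring"
    by unfold_locales (auto simp: type_algebra_simps)
  show ?thesis
  proof (rule euclidean_domainI)
    fix x y :: int
    assume "y \<in> carrier ring_of_type_algebra - {\<zero>\<^bsub>ring_of_type_algebra\<^esub>}"
    then have "y \<noteq> 0" by (simp add: type_algebra_simps)
    then have "nat \<bar>x mod y\<bar> < nat \<bar>y\<bar>" using abs_mod_less[of y x] by simp
    then show "\<exists>q r. q \<in> carrier ring_of_type_algebra \<and> r \<in> carrier ring_of_type_algebra \<and>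
        x = y \<otimes>\<^bsub>ring_of_type_algebra\<^esub> q \<oplus>\<^bsub>ring_of_type_algebra\<^esub> r \<and> (r = \<zero>\<^bsub>ring_of_type_algebra\<^esub> \<or> nat \<bar>r\<bar> < nat \<bar>y\<bar>)"
      by (intro exI[of _ "x div y"] exI[of _ "x mod y"]) (simp add: type_algebra_simps)
  qed
qed

lemma int_unit_times_square: "monoid.unit_times_square (ring_of_type_algebra :: int ring) x \<longleftrightarrow> (\<exists>g. x = g * g \<or> x = - (g * g))"
proof -
  interpret domain "ring_of_type_algebra :: int ring" using euclidean_domain_int by (simp add: euclidean_domain_def)
  have "Units (ring_of_type_algebra :: int ring) = {1, - 1}"
    using zmult_eq_1_iff by (auto simp: Units_def type_algebra_simps)
  then show ?thesis by (auto simp: unit_times_square_def type_algebra_simps)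
qed

lemma of_integer_type_algebra: "of_integer (ring_of_type_algebra :: 'a::comm_ring_1 ring) n = of_int n"
proof -
  interpret cring "ring_of_type_algebra :: 'a ring" by (rule cring_from_type_algebra)
  have minus: "\<ominus>\<^bsub>ring_of_type_algebra\<^esub> x = - x" for x :: 'a
    by (rule minus_equality) (simp_all add: type_algebra_simps)
  have nat: "of_integer (ring_of_type_algebra :: 'a ring) (int m) = of_nat m" for m
    by (induction m) (simp_all add: type_algebra_simps)
  obtain m where "n = int m \<or> n = - int m" by (metis int_cases2)
  then show ?thesis using nat[of m] minus by auto
qed

text \<open>Modulo \<open>4\<close> the number \<open>4 N^2 - 1\<close> is \<open>3\<close>, and \<open>1 + (4 t)^2\<close> lies strictly between two consecutive
  squares. The sign is decided by positivity.\<close>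

lemma int_candidates:
  fixes N t :: int
  assumes "N \<noteq> 0"
  shows "\<not> (\<exists>g::int. 4 * (N * N) - 1 = g * g \<or> 4 * (N * N) - 1 = - (g * g))"
    and "t \<noteq> 0 \<Longrightarrow> \<not> (\<exists>g::int. 1 + 16 * (t * t) = g * g \<or> 1 + 16 * (t * t) = - (g * g))"
proof -
  have N1: "1 \<le> N * N" using assms by (smt (verit) mult_eq_0_iff zero_le_square)
  have g4: "g * g mod 4 = 0 \<or> g * g mod 4 = 1" for g :: int
  proof -
    have "g mod 4 \<in> {0, 1, 2, 3}" by auto
    then show ?thesis using mod_mult_eq[of g 4 g, symmetric] by auto
  qed
  show "\<not> (\<exists>g. 4 * (N * N) - 1 = g * g \<or> 4 * (N * N) - 1 = - (g * g))"
  proof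
    assume "\<exists>g. 4 * (N * N) - 1 = g * g \<or> 4 * (N * N) - 1 = - (g * g)"
    then obtain g where g: "4 * (N * N) - 1 = g * g \<or> 4 * (N * N) - 1 = - (g * g)" ..
    have "0 \<le> g * g" by simp
    then have "4 * (N * N) - 1 = g * g" using g N1 by linarith
    then show False using g4[of g] by presburger
  qed
  assume t: "t \<noteq> 0"
  show "\<not> (\<exists>g. 1 + 16 * (t * t) = g * g \<or> 1 + 16 * (t * t) = - (g * g))"
  proof
    assume "\<exists>g. 1 + 16 * (t * t) = g * g \<or> 1 + 16 * (t * t) = - (g * g)"
    then obtain g where g: "1 + 16 * (t * t) = g * g \<or> 1 + 16 * (t * t) = - (g * g)" ..
    have "0 \<le> g * g" "0 \<le> t * t" by simp_all
    then have "1 + 16 * (t * t) = g * g" using g by linarith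
    then have "1 + (4 * \<bar>t\<bar>) * (4 * \<bar>t\<bar>) = \<bar>g\<bar> * \<bar>g\<bar>" by (simp add: Rings.abs_mult[symmetric] abs_mult_self_eq algebra_simps)
    moreover define u w where "u = 4 * \<bar>t\<bar>" and "w = \<bar>g\<bar>"
    ultimately have uw: "1 + u * u = w * w" "0 < u" "0 \<le> w" using t by simp_all
    have "u < w" using uw by (smt (verit) mult_mono)
    then have "(u + 1) * (u + 1) \<le> w * w" using uw by (intro mult_mono) auto
    then show False using uw by (simp add: algebra_simps)
  qed
qed

lemma number_field_base_extension:
  assumes "number_field K"
  shows "base_extension K (ring_of_type_algebra :: int ring) (\<lambda>n. nat \<bar>n\<bar>) (of_integer K)"
proof -
  obtain h where h: "field K" "h \<in> ring_hom (ring_of_type_algebra :: rat ring) K"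
      "ring.finite_dimension K (range h) (carrier K)"
    using assms unfolding number_field_def by blast
  interpret K: field K by (rule h(1))
  interpret h: ring_hom_cring "ring_of_type_algebra :: rat ring" K h
    using h(2) K.is_cring cring_from_type_algebra by (simp add: ring_hom_cring_def ring_hom_cring_axioms_def)
  have hz: "of_integer K z = h (of_int z)" for z
    using h.hom_of_int[of z] by (simp add: of_integer_type_algebra)
  have hm: "h (x * y) = h x \<otimes>\<^bsub>K\<^esub> h y" and hc: "h x \<in> carrier K" for x y
    using h.hom_mult[of x y] h.hom_closed[of x] by (simp_all add: type_algebra_simps)
  have h1: "h 1 = \<one>\<^bsub>K\<^esub>" using h.hom_one by (simp add: type_algebra_simps)
  have h0: "h x \<noteq> \<zero>\<^bsub>K\<^esub>" if "x \<noteq> 0" for x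
  proof
    assume "h x = \<zero>\<^bsub>K\<^esub>"
    then show False using hm[of x "1 / x"] that hc h1 by simp
  qed
  have hom: "of_integer K \<in> ring_hom (ring_of_type_algebra :: int ring) K"
    by (rule ring_hom_memI) (simp_all add: type_algebra_simps)
  have inj: "inj (of_integer K)"
  proof (rule injI)
    fix x y assume e: "of_integer K x = of_integer K y"
    have "of_integer K (x - y) = of_integer K x \<ominus>\<^bsub>K\<^esub> of_integer K y" by simp
    then have "of_integer K (x - y) = \<zero>\<^bsub>K\<^esub>" unfolding e by (simp add: K.r_right_minus_eq)
    then show "x = y" using h0[of "of_int (x - y)"] unfolding hz by auto
  qed
  have quot: "h (of_int p / of_int q) = of_integer K p \<otimes>\<^bsub>K\<^esub> inv\<^bsub>K\<^esub> (of_integer K q)" if "q \<noteq> 0" for p q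
  proof -
    have n: "h (of_int q) \<noteq> \<zero>\<^bsub>K\<^esub>" using h0 that by simp
    have "h (of_int p / of_int q) \<otimes>\<^bsub>K\<^esub> h (of_int q) = h (of_int p)" using that by (simp add: hm[symmetric])
    then have "h (of_int p) \<otimes>\<^bsub>K\<^esub> inv\<^bsub>K\<^esub> h (of_int q) = h (of_int p / of_int q) \<otimes>\<^bsub>K\<^esub> (h (of_int q) \<otimes>\<^bsub>K\<^esub> inv\<^bsub>K\<^esub> h (of_int q))"
      using hc n K.field_Units by (metis (no_types, lifting) DiffI K.Units_inv_closed K.m_assoc singletonD)
    then show ?thesis unfolding hz using hc n K.field_Units by simp
  qed
  have range: "{of_integer K a \<otimes>\<^bsub>K\<^esub> inv\<^bsub>K\<^esub> (of_integer K b) | a b. a \<in> carrier (ring_of_type_algebra :: int ring) \<and>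
      b \<in> carrier ring_of_type_algebra - {\<zero>\<^bsub>ring_of_type_algebra\<^esub>}} = range h"
  proof (intro equalityI subsetI)
    fix y assume "y \<in> range h"
    then obtain x where x: "y = h x" by blast
    obtain p q :: int where "x = of_int p / of_int q" "q > 0" by (metis Rat_cases of_int_rat[symmetric] Fract_of_int_quotient)
    then have "y = of_integer K p \<otimes>\<^bsub>K\<^esub> inv\<^bsub>K\<^esub> (of_integer K q)" "q \<noteq> 0" using x quot by simp_all
    then show "y \<in> {of_integer K a \<otimes>\<^bsub>K\<^esub> inv\<^bsub>K\<^esub> (of_integer K b) | a b. a \<in> carrier (ring_of_type_algebra :: int ring) \<and>
      b \<in> carrier ring_of_type_algebra - {\<zero>\<^bsub>ring_of_type_algebra\<^esub>}}" by (auto simp: type_algebra_simps)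
  next
    fix y assume "y \<in> {of_integer K a \<otimes>\<^bsub>K\<^esub> inv\<^bsub>K\<^esub> (of_integer K b) | a b. a \<in> carrier (ring_of_type_algebra :: int ring) \<and>
      b \<in> carrier ring_of_type_algebra - {\<zero>\<^bsub>ring_of_type_algebra\<^esub>}}"
    then obtain p q where "y = of_integer K p \<otimes>\<^bsub>K\<^esub> inv\<^bsub>K\<^esub> (of_integer K q)" "q \<noteq> 0" by (auto simp: type_algebra_simps)
    then show "y \<in> range h" using quot by (metis rangeI)
  qed
  show ?thesis
    unfolding base_extension_def base_extension_axioms_def range
    using h(1,3) euclidean_domain_int hom inj by (simp add: type_algebra_simps)
qed

lemma number_field_exists_parameter:
  assumes nf: "number_field K"
  shows "\<exists>t. \<forall>e\<in>carrier K. e \<otimes>\<^bsub>K\<^esub> e \<notin>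
     {\<one>\<^bsub>K\<^esub> \<oplus>\<^bsub>K\<^esub> \<guillemotleft>16\<guillemotright>\<^bsub>K\<^esub> \<otimes>\<^bsub>K\<^esub> (\<guillemotleft>t\<guillemotright>\<^bsub>K\<^esub> \<otimes>\<^bsub>K\<^esub> \<guillemotleft>t\<guillemotright>\<^bsub>K\<^esub>), \<ominus>\<^bsub>K\<^esub> (\<one>\<^bsub>K\<^esub> \<oplus>\<^bsub>K\<^esub> \<guillemotleft>16\<guillemotright>\<^bsub>K\<^esub> \<otimes>\<^bsub>K\<^esub> (\<guillemotleft>t\<guillemotright>\<^bsub>K\<^esub> \<otimes>\<^bsub>K\<^esub> \<guillemotleft>t\<guillemotright>\<^bsub>K\<^esub>)),
      \<guillemotleft>2\<guillemotright>\<^bsub>K\<^esub> \<otimes>\<^bsub>K\<^esub> (\<one>\<^bsub>K\<^esub> \<oplus>\<^bsub>K\<^esub> \<guillemotleft>16\<guillemotright>\<^bsub>K\<^esub> \<otimes>\<^bsub>K\<^esub> (\<guillemotleft>t\<guillemotright>\<^bsub>K\<^esub> \<otimes>\<^bsub>K\<^esub> \<guillemotleft>t\<guillemotright>\<^bsub>K\<^esub>)), \<guillemotleft>2\<guillemotright>\<^bsub>K\<^esub> \<otimes>\<^bsub>K\<^esub> \<guillemotleft>t\<guillemotright>\<^bsub>K\<^esub>,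
      \<ominus>\<^bsub>K\<^esub> (\<guillemotleft>2\<guillemotright>\<^bsub>K\<^esub> \<otimes>\<^bsub>K\<^esub> \<guillemotleft>t\<guillemotright>\<^bsub>K\<^esub>), (\<one>\<^bsub>K\<^esub> \<oplus>\<^bsub>K\<^esub> \<guillemotleft>16\<guillemotright>\<^bsub>K\<^esub> \<otimes>\<^bsub>K\<^esub> (\<guillemotleft>t\<guillemotright>\<^bsub>K\<^esub> \<otimes>\<^bsub>K\<^esub> \<guillemotleft>t\<guillemotright>\<^bsub>K\<^esub>)) \<otimes>\<^bsub>K\<^esub> \<guillemotleft>t\<guillemotright>\<^bsub>K\<^esub>}"
proof -
  let ?Z = "ring_of_type_algebra :: int ring"
  interpret E: base_extension K ?Z "\<lambda>n. nat \<bar>n\<bar>" "of_integer K" by (rule number_field_base_extension[OF nf])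
  have two: "\<guillemotleft>2\<guillemotright>\<^bsub>K\<^esub> \<noteq> \<zero>\<^bsub>K\<^esub>" using E.h_eq_zero_iff[of 2] by (simp add: type_algebra_simps)
  have "\<exists>t\<in>carrier ?Z. \<forall>e\<in>carrier K. e \<otimes>\<^bsub>K\<^esub> e \<notin>
     {\<one>\<^bsub>K\<^esub> \<oplus>\<^bsub>K\<^esub> \<guillemotleft>16\<guillemotright>\<^bsub>K\<^esub> \<otimes>\<^bsub>K\<^esub> (\<guillemotleft>t\<guillemotright>\<^bsub>K\<^esub> \<otimes>\<^bsub>K\<^esub> \<guillemotleft>t\<guillemotright>\<^bsub>K\<^esub>), \<ominus>\<^bsub>K\<^esub> (\<one>\<^bsub>K\<^esub> \<oplus>\<^bsub>K\<^esub> \<guillemotleft>16\<guillemotright>\<^bsub>K\<^esub> \<otimes>\<^bsub>K\<^esub> (\<guillemotleft>t\<guillemotright>\<^bsub>K\<^esub> \<otimes>\<^bsub>K\<^esub> \<guillemotleft>t\<guillemotright>\<^bsub>K\<^esub>)),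
      \<guillemotleft>2\<guillemotright>\<^bsub>K\<^esub> \<otimes>\<^bsub>K\<^esub> (\<one>\<^bsub>K\<^esub> \<oplus>\<^bsub>K\<^esub> \<guillemotleft>16\<guillemotright>\<^bsub>K\<^esub> \<otimes>\<^bsub>K\<^esub> (\<guillemotleft>t\<guillemotright>\<^bsub>K\<^esub> \<otimes>\<^bsub>K\<^esub> \<guillemotleft>t\<guillemotright>\<^bsub>K\<^esub>)), \<guillemotleft>2\<guillemotright>\<^bsub>K\<^esub> \<otimes>\<^bsub>K\<^esub> \<guillemotleft>t\<guillemotright>\<^bsub>K\<^esub>,
      \<ominus>\<^bsub>K\<^esub> (\<guillemotleft>2\<guillemotright>\<^bsub>K\<^esub> \<otimes>\<^bsub>K\<^esub> \<guillemotleft>t\<guillemotright>\<^bsub>K\<^esub>), (\<one>\<^bsub>K\<^esub> \<oplus>\<^bsub>K\<^esub> \<guillemotleft>16\<guillemotright>\<^bsub>K\<^esub> \<otimes>\<^bsub>K\<^esub> (\<guillemotleft>t\<guillemotright>\<^bsub>K\<^esub> \<otimes>\<^bsub>K\<^esub> \<guillemotleft>t\<guillemotright>\<^bsub>K\<^esub>)) \<otimes>\<^bsub>K\<^esub> \<guillemotleft>t\<guillemotright>\<^bsub>K\<^esub>}"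
  proof (rule E.exists_parameter[OF two])
    fix N assume "N \<noteq> \<zero>\<^bsub>?Z\<^esub>"
    then have N: "N \<noteq> 0" by (simp add: type_algebra_simps)
    let ?\<tau> = "4 * (N * N) - 1"
    have \<tau>0: "?\<tau> \<noteq> 0" by presburger
    have "(- 1) * ?\<tau> + (4 * N) * N = 1" by simp
    then have co: "\<exists>u v. u * ?\<tau> + v * N = 1" by blast
    have "1 + 16 * (t * t) \<noteq> g * g \<and> 1 + 16 * (t * t) \<noteq> - (g * g)" if "t = ?\<tau> * (N * N)" for t g
      using int_candidates(2)[OF N, of t] \<tau>0 N that by auto
    then show "\<exists>N'\<in>carrier ?Z. \<exists>\<tau>\<in>carrier ?Z. N \<otimes>\<^bsub>?Z\<^esub> N' \<noteq> \<zero>\<^bsub>?Z\<^esub> \<and> \<tau> \<noteq> \<zero>\<^bsub>?Z\<^esub> \<and> E.R.comaximal \<tau> (N \<otimes>\<^bsub>?Z\<^esub> N') \<and>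
        \<not> E.R.unit_times_square \<tau> \<and>
       (\<forall>t. t = \<tau> \<otimes>\<^bsub>?Z\<^esub> ((N \<otimes>\<^bsub>?Z\<^esub> N') \<otimes>\<^bsub>?Z\<^esub> (N \<otimes>\<^bsub>?Z\<^esub> N')) \<longrightarrow> \<not> E.R.unit_times_square (\<one>\<^bsub>?Z\<^esub> \<oplus>\<^bsub>?Z\<^esub> \<guillemotleft>16\<guillemotright>\<^bsub>?Z\<^esub> \<otimes>\<^bsub>?Z\<^esub> (t \<otimes>\<^bsub>?Z\<^esub> t)))"
      using \<tau>0 N int_candidates(1)[OF N] co
      by (intro bexI[of _ 1] bexI[of _ ?\<tau>])
        (simp_all add: type_algebra_simps int_unit_times_square E.R.comaximal_def of_integer_type_algebra)
  qed
  then show ?thesis by blast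
qed

lemma number_field_finite_residues:
  assumes nf: "number_field K" and a: "nonarch_field K a"
  shows "nonarch_field.finite_residues K a (carrier K)"
proof -
  let ?Z = "ring_of_type_algebra :: int ring"
  interpret B: base_extension K ?Z "\<lambda>n. nat \<bar>n\<bar>" "of_integer K" by (rule number_field_base_extension[OF nf])
  interpret A: nonarch_field K a by (rule a)
  interpret E: nonarch_extension K a ?Z "\<lambda>n. nat \<bar>n\<bar>" "of_integer K" by unfold_locales
  have fin: "finite {r \<in> carrier ?Z. nat \<bar>r\<bar> < n}" for n
    by (rule finite_subset[of _ "{- int n..int n}"]) (auto simp: type_algebra_simps)
  have "A.finite_residues B.fractions"
    by (rule E.finite_residues_fractions_integral[OF A.abs_of_int_le fin])
  then show ?thesis using B.exists_dimension A.finite_residues_dimension[OF B.subfield_fractions] by blast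
qed

section \<open>Polynomials over a field\<close>

context field
begin

lemma poly_ring_domain: "domain (poly_ring R)"
  by (rule univ_poly_is_domain[OF carrier_is_subring])

lemma degree_poly_mult:
  assumes "p \<in> carrier (poly_ring R)" "q \<in> carrier (poly_ring R)" "p \<noteq> []" "q \<noteq> []"
  shows "Polynomials.degree (p \<otimes>\<^bsub>poly_ring R\<^esub> q) = Polynomials.degree p + Polynomials.degree q"
  using poly_mult_degree_eq[OF carrier_is_subring, of p q] assms by (simp add: univ_poly_mult univ_poly_carrier)

lemma not_unit_times_square_if_odd_degree:
  assumes "p \<in> carrier (poly_ring R)" "odd (Polynomials.degree p)"
  shows "\<not> monoid.unit_times_square (poly_ring R) p"
proof
  interpret P: domain "poly_ring R" by (rule poly_ring_domain)
  assume "P.unit_times_square p"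
  then obtain e g where g: "e \<in> Units (poly_ring R)" "g \<in> carrier (poly_ring R)" "p = e \<otimes>\<^bsub>poly_ring R\<^esub> (g \<otimes>\<^bsub>poly_ring R\<^esub> g)"
    unfolding P.unit_times_square_def by blast
  have e: "e \<in> carrier (poly_ring R)" "e \<noteq> []" "Polynomials.degree e = 0"
    using g(1) univ_poly_units'[OF carrier_is_subfield] by auto
  show False
  proof (cases "g = []")
    case True
    then have "p = []" using g(3) e P.r_null by (metis P.zero_closed univ_poly_zero)
    then show False using assms(2) by simp
  next
    case False
    have "g \<otimes>\<^bsub>poly_ring R\<^esub> g \<noteq> []" using P.integral[of g g] g(2) False by (auto simp: univ_poly_zero)
    then have "Polynomials.degree p = Polynomials.degree g + Polynomials.degree g"
      unfolding g(3) using degree_poly_mult[OF e(1) _ e(2)] degree_poly_mult[OF g(2) g(2) False False] e(3) g(2) by simp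
    then show False using assms(2) by simp
  qed
qed

text \<open>Take \<open>Y\<close> to be \<open>1\<close> or the variable, according to the parity of the degree of \<open>M\<close>.\<close>

lemma odd_degree_one_plus_multiple:
  assumes M: "M \<in> carrier (poly_ring R)" "0 < Polynomials.degree M"
  shows "\<exists>Y\<in>carrier (poly_ring R). odd (Polynomials.degree (\<one>\<^bsub>poly_ring R\<^esub> \<oplus>\<^bsub>poly_ring R\<^esub> M \<otimes>\<^bsub>poly_ring R\<^esub> Y))"
proof -
  interpret P: domain "poly_ring R" by (rule poly_ring_domain)
  have M0: "M \<noteq> []" using M by auto
  define Y where "Y = (if odd (Polynomials.degree M) then \<one>\<^bsub>poly_ring R\<^esub> else X)"
  have Y: "Y \<in> carrier (poly_ring R)" "Y \<noteq> []"
    using var_closed(1)[OF carrier_is_subring] P.one_closed by (simp add: Y_def) (simp add: Y_def univ_poly_one var_def)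
  have dY: "Polynomials.degree Y = (if odd (Polynomials.degree M) then 0 else 1)" by (simp add: Y_def univ_poly_one var_def)
  have MY: "M \<otimes>\<^bsub>poly_ring R\<^esub> Y \<in> carrier (poly_ring R)" "Polynomials.degree (M \<otimes>\<^bsub>poly_ring R\<^esub> Y) = Polynomials.degree M + Polynomials.degree Y"
    using M Y degree_poly_mult[OF M(1) Y(1) M0 Y(2)] by auto
  have "Polynomials.degree (\<one>\<^bsub>poly_ring R\<^esub> \<oplus>\<^bsub>poly_ring R\<^esub> M \<otimes>\<^bsub>poly_ring R\<^esub> Y) = max 0 (Polynomials.degree M + Polynomials.degree Y)"
    using poly_add_degree_eq[OF carrier_is_subring, of "\<one>\<^bsub>poly_ring R\<^esub>" "M \<otimes>\<^bsub>poly_ring R\<^esub> Y"] MY P.one_closed M(2)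
    by (simp add: univ_poly_add univ_poly_carrier univ_poly_one)
  moreover have "odd (m + e)" if "e = (if odd m then 0 else 1)" for m e :: nat
    using that by (cases "odd m") auto
  from this[OF dY] have "odd (Polynomials.degree M + Polynomials.degree Y)" .
  ultimately have "odd (Polynomials.degree (\<one>\<^bsub>poly_ring R\<^esub> \<oplus>\<^bsub>poly_ring R\<^esub> M \<otimes>\<^bsub>poly_ring R\<^esub> Y))" by (simp only: max_0L not_False_eq_True)
  then show ?thesis using Y by blast
qed

text \<open>Suppose \<open>1 + 16 t^2 = e g^2\<close>. Comparing constant terms, the constant \<open>e\<close> is a square, so
  \<open>1 + 16 t^2 = G^2\<close> and \<open>(G - 4 t) (G + 4 t) = 1\<close>. Both factors are units, hence constants, and so is
  their difference \<open>8 t\<close>; but \<open>t\<close> has constant term zero.\<close>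

lemma not_unit_times_square_one_plus_16_square:
  assumes two: "\<guillemotleft>2\<guillemotright>\<^bsub>poly_ring R\<^esub> \<noteq> \<zero>\<^bsub>poly_ring R\<^esub>"
    and t: "t \<in> carrier (poly_ring R)" "t \<noteq> \<zero>\<^bsub>poly_ring R\<^esub>" "const_term t = \<zero>"
  shows "\<not> monoid.unit_times_square (poly_ring R) (\<one>\<^bsub>poly_ring R\<^esub> \<oplus>\<^bsub>poly_ring R\<^esub> \<guillemotleft>16\<guillemotright>\<^bsub>poly_ring R\<^esub> \<otimes>\<^bsub>poly_ring R\<^esub> (t \<otimes>\<^bsub>poly_ring R\<^esub> t))"
proof
  let ?P = "poly_ring R"
  interpret P: domain ?P by (rule poly_ring_domain)
  assume "P.unit_times_square (\<one>\<^bsub>?P\<^esub> \<oplus>\<^bsub>?P\<^esub> \<guillemotleft>16\<guillemotright>\<^bsub>?P\<^esub> \<otimes>\<^bsub>?P\<^esub> (t \<otimes>\<^bsub>?P\<^esub> t))"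
  then obtain e g where g: "e \<in> Units ?P" "g \<in> carrier ?P" "\<one>\<^bsub>?P\<^esub> \<oplus>\<^bsub>?P\<^esub> \<guillemotleft>16\<guillemotright>\<^bsub>?P\<^esub> \<otimes>\<^bsub>?P\<^esub> (t \<otimes>\<^bsub>?P\<^esub> t) = e \<otimes>\<^bsub>?P\<^esub> (g \<otimes>\<^bsub>?P\<^esub> g)"
    unfolding P.unit_times_square_def by blast
  note ct = const_term_simprules_shell[OF carrier_is_subring]
  have unit: "\<exists>k\<in>carrier R - {\<zero>}. u = poly_of_const k \<and> const_term u = k" if "u \<in> Units ?P" for u
    using that unfolding univ_poly_units[OF carrier_is_subfield] by (auto simp: poly_of_const_def const_term_def)
  obtain k where k: "k \<in> carrier R" "k \<noteq> \<zero>" "e = poly_of_const k" "const_term e = k" using unit[OF g(1)] by blast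
  have ec: "e \<in> carrier ?P" using g(1) by blast
  have one: "const_term \<one>\<^bsub>?P\<^esub> = \<one>" by (simp add: const_term_def univ_poly_one)
  define c where "c = const_term g"
  have cc: "c \<in> carrier R" using ct(1) g(2) by (simp add: c_def)
  have "const_term (\<one>\<^bsub>?P\<^esub> \<oplus>\<^bsub>?P\<^esub> \<guillemotleft>16\<guillemotright>\<^bsub>?P\<^esub> \<otimes>\<^bsub>?P\<^esub> (t \<otimes>\<^bsub>?P\<^esub> t)) = \<one>"
    using t ct one by simp
  then have kc: "k \<otimes> (c \<otimes> c) = \<one>" unfolding g(3) using ct(2) ec g(2) k(4) by (simp add: c_def)
  interpret C: ring_hom_cring R ?P poly_of_const by (rule poly_of_const_ring_hom_cring)
  define c' where "c' = inv c"
  have c0: "c \<noteq> \<zero>" using kc k(1) by auto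
  then have c': "c' \<in> carrier R" "c \<otimes> c' = \<one>" using cc field_Units by (auto simp: c'_def)
  have "k \<otimes> (c \<otimes> c) \<otimes> (c' \<otimes> c') = k \<otimes> ((c \<otimes> c') \<otimes> (c \<otimes> c'))"
    by (rule ring_identity[where ls="[k, c, c']"], (rule reify)+, simp add: in_carrier_def k cc c', code_simp)
  then have "k = c' \<otimes> c'" unfolding kc c'(2) using k c' by simp
  then have eC: "e = poly_of_const c' \<otimes>\<^bsub>?P\<^esub> poly_of_const c'" unfolding k(3) using c' by simp
  define G where "G = poly_of_const c' \<otimes>\<^bsub>?P\<^esub> g"
  have Cc: "poly_of_const c' \<in> carrier ?P" using c' by simp
  have G: "G \<in> carrier ?P" using Cc g(2) by (simp add: G_def)
  let ?m = "G \<ominus>\<^bsub>?P\<^esub> \<guillemotleft>4\<guillemotright>\<^bsub>?P\<^esub> \<otimes>\<^bsub>?P\<^esub> t" and ?p = "G \<oplus>\<^bsub>?P\<^esub> \<guillemotleft>4\<guillemotright>\<^bsub>?P\<^esub> \<otimes>\<^bsub>?P\<^esub> t"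
  have mp: "?m \<in> carrier ?P" "?p \<in> carrier ?P" using G t by simp_all
  have GG: "G \<otimes>\<^bsub>?P\<^esub> G = e \<otimes>\<^bsub>?P\<^esub> (g \<otimes>\<^bsub>?P\<^esub> g)" unfolding G_def eC
    by (rule P.ring_identity[where ls="[poly_of_const c', g]"], (rule P.reify)+, simp add: P.in_carrier_def Cc g, code_simp)
  have "?m \<otimes>\<^bsub>?P\<^esub> ?p = G \<otimes>\<^bsub>?P\<^esub> G \<ominus>\<^bsub>?P\<^esub> \<guillemotleft>16\<guillemotright>\<^bsub>?P\<^esub> \<otimes>\<^bsub>?P\<^esub> (t \<otimes>\<^bsub>?P\<^esub> t)"
    by (rule P.ring_identity[where ls="[G, t]"], (rule P.reify)+, simp add: P.in_carrier_def G t, code_simp)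
  also have "\<dots> = (\<one>\<^bsub>?P\<^esub> \<oplus>\<^bsub>?P\<^esub> \<guillemotleft>16\<guillemotright>\<^bsub>?P\<^esub> \<otimes>\<^bsub>?P\<^esub> (t \<otimes>\<^bsub>?P\<^esub> t)) \<ominus>\<^bsub>?P\<^esub> \<guillemotleft>16\<guillemotright>\<^bsub>?P\<^esub> \<otimes>\<^bsub>?P\<^esub> (t \<otimes>\<^bsub>?P\<^esub> t)" unfolding GG g(3) ..
  also have "\<dots> = \<one>\<^bsub>?P\<^esub>"
    by (rule P.ring_identity[where ls="[t]"], (rule P.reify)+, simp add: P.in_carrier_def t, code_simp)
  finally have mp1: "?m \<otimes>\<^bsub>?P\<^esub> ?p = \<one>\<^bsub>?P\<^esub>" .
  have "?m \<in> Units ?P" by (rule P.Units_of_mult_eq_one[OF mp mp1])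
  moreover have "?p \<in> Units ?P" by (rule P.Units_of_mult_eq_one[OF mp(2,1)]) (use mp1 mp P.m_comm in auto)
  ultimately obtain x y where xy: "x \<in> carrier R" "y \<in> carrier R" "?m = poly_of_const x" "?p = poly_of_const y" using unit by blast
  have t8: "?p \<ominus>\<^bsub>?P\<^esub> ?m = \<guillemotleft>8\<guillemotright>\<^bsub>?P\<^esub> \<otimes>\<^bsub>?P\<^esub> t"
    by (rule P.ring_identity[where ls="[G, t]"], (rule P.reify)+, simp add: P.in_carrier_def G t, code_simp)
  have "?p \<ominus>\<^bsub>?P\<^esub> ?m = poly_of_const (y \<ominus> x)" unfolding xy(3,4) using xy(1,2) by simp
  then have t8': "\<guillemotleft>8\<guillemotright>\<^bsub>?P\<^esub> \<otimes>\<^bsub>?P\<^esub> t = poly_of_const (y \<ominus> x)" unfolding t8 .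
  have ct0: "const_term (\<guillemotleft>8\<guillemotright>\<^bsub>?P\<^esub> \<otimes>\<^bsub>?P\<^esub> t) = \<zero>" using ct t by simp
  have "const_term (poly_of_const z) = z" if "z \<in> carrier R" for z
    using that by (auto simp: const_term_def poly_of_const_def)
  then have "const_term (poly_of_const (y \<ominus> x)) = y \<ominus> x" using xy(1,2) minus_closed by blast
  then have yx: "y \<ominus> x = \<zero>" using ct0 unfolding t8' by metis
  have "\<guillemotleft>8\<guillemotright>\<^bsub>?P\<^esub> \<otimes>\<^bsub>?P\<^esub> t = \<zero>\<^bsub>?P\<^esub>" unfolding t8' yx by simp
  moreover have "\<guillemotleft>8\<guillemotright>\<^bsub>?P\<^esub> = \<guillemotleft>2\<guillemotright>\<^bsub>?P\<^esub> \<otimes>\<^bsub>?P\<^esub> (\<guillemotleft>2\<guillemotright>\<^bsub>?P\<^esub> \<otimes>\<^bsub>?P\<^esub> \<guillemotleft>2\<guillemotright>\<^bsub>?P\<^esub>)"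
    using P.of_int_mult[of 2 4] P.of_int_mult[of 2 2] by simp
  ultimately show False using two t by (simp add: P.integral_iff)
qed

text \<open>\<open>N' = X\<close> makes \<open>t\<close> a polynomial without constant term.\<close>

lemma poly_ring_candidates:
  assumes two: "\<guillemotleft>2\<guillemotright>\<^bsub>poly_ring R\<^esub> \<noteq> \<zero>\<^bsub>poly_ring R\<^esub>"
    and N: "N \<in> carrier (poly_ring R)" "N \<noteq> \<zero>\<^bsub>poly_ring R\<^esub>"
  shows "\<exists>N'\<in>carrier (poly_ring R). \<exists>\<tau>\<in>carrier (poly_ring R).
       N \<otimes>\<^bsub>poly_ring R\<^esub> N' \<noteq> \<zero>\<^bsub>poly_ring R\<^esub> \<and> \<tau> \<noteq> \<zero>\<^bsub>poly_ring R\<^esub> \<and> ring.comaximal (poly_ring R) \<tau> (N \<otimes>\<^bsub>poly_ring R\<^esub> N') \<and>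
       \<not> monoid.unit_times_square (poly_ring R) \<tau> \<and>
       (\<forall>t. t = \<tau> \<otimes>\<^bsub>poly_ring R\<^esub> ((N \<otimes>\<^bsub>poly_ring R\<^esub> N') \<otimes>\<^bsub>poly_ring R\<^esub> (N \<otimes>\<^bsub>poly_ring R\<^esub> N')) \<longrightarrow>
         \<not> monoid.unit_times_square (poly_ring R) (\<one>\<^bsub>poly_ring R\<^esub> \<oplus>\<^bsub>poly_ring R\<^esub> \<guillemotleft>16\<guillemotright>\<^bsub>poly_ring R\<^esub> \<otimes>\<^bsub>poly_ring R\<^esub> (t \<otimes>\<^bsub>poly_ring R\<^esub> t)))"
proof -
  let ?P = "poly_ring R"
  interpret P: domain ?P by (rule poly_ring_domain)
  note ct = const_term_simprules_shell[OF carrier_is_subring]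
  have x: "X \<in> carrier ?P" "X \<noteq> []" by (rule var_closed(1)[OF carrier_is_subring]) (simp add: var_def)
  define M where "M = N \<otimes>\<^bsub>?P\<^esub> X"
  have x0: "X \<noteq> \<zero>\<^bsub>?P\<^esub>" using x(2) by (simp add: univ_poly_zero)
  have M: "M \<in> carrier ?P" "M \<noteq> \<zero>\<^bsub>?P\<^esub>"
    unfolding M_def using P.integral[OF _ N(1) x(1)] N x(1) x0 by blast+
  have "Polynomials.degree M = Polynomials.degree N + 1"
    unfolding M_def using degree_poly_mult[OF N(1) x(1) _ x(2)] N(2) by (simp add: univ_poly_zero var_def)
  then obtain Y where Y: "Y \<in> carrier ?P" "odd (Polynomials.degree (\<one>\<^bsub>?P\<^esub> \<oplus>\<^bsub>?P\<^esub> M \<otimes>\<^bsub>?P\<^esub> Y))"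
    using odd_degree_one_plus_multiple[OF M(1)] by auto
  define \<tau> where "\<tau> = \<one>\<^bsub>?P\<^esub> \<oplus>\<^bsub>?P\<^esub> M \<otimes>\<^bsub>?P\<^esub> Y"
  have \<tau>: "\<tau> \<in> carrier ?P" "\<tau> \<noteq> \<zero>\<^bsub>?P\<^esub>" "\<not> P.unit_times_square \<tau>"
    using Y M not_unit_times_square_if_odd_degree[of \<tau>] by (auto simp: \<tau>_def univ_poly_zero)
  have "\<one>\<^bsub>?P\<^esub> \<otimes>\<^bsub>?P\<^esub> \<tau> \<oplus>\<^bsub>?P\<^esub> (\<ominus>\<^bsub>?P\<^esub> Y) \<otimes>\<^bsub>?P\<^esub> M = \<one>\<^bsub>?P\<^esub>" unfolding \<tau>_def
    by (rule P.ring_identity[where ls="[Y, M]"], (rule P.reify)+, simp add: P.in_carrier_def Y M, code_simp)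
  then have co: "P.comaximal \<tau> M" unfolding P.comaximal_def using Y(1) P.one_closed P.a_inv_closed by blast
  have ctX: "const_term X = \<zero>" by (simp add: const_term_def var_def)
  have "const_term M = \<zero>" unfolding M_def using ct N(1) x(1) ctX by simp
  then have "const_term (\<tau> \<otimes>\<^bsub>?P\<^esub> (M \<otimes>\<^bsub>?P\<^esub> M)) = \<zero>" using ct \<tau>(1) M(1) by simp
  then have "\<not> P.unit_times_square (\<one>\<^bsub>?P\<^esub> \<oplus>\<^bsub>?P\<^esub> \<guillemotleft>16\<guillemotright>\<^bsub>?P\<^esub> \<otimes>\<^bsub>?P\<^esub> (t \<otimes>\<^bsub>?P\<^esub> t))" if "t = \<tau> \<otimes>\<^bsub>?P\<^esub> (M \<otimes>\<^bsub>?P\<^esub> M)" for t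
    using not_unit_times_square_one_plus_16_square[OF two, of t] that \<tau> M by (simp add: P.integral_iff)
  then show ?thesis using \<tau> M co x(1) unfolding M_def by blast
qed

end

section \<open>Squares from bitangents and bitangents from squares\<close>

definition quartic_coeffs :: "('a, 'm) ring_scheme \<Rightarrow> 'a \<Rightarrow> 'a \<Rightarrow> nat \<Rightarrow> 'a" where
  "quartic_coeffs R b c i =
     (if i = 0 then \<one>\<^bsub>R\<^esub> else if i = 1 then \<ominus>\<^bsub>R\<^esub> (b \<otimes>\<^bsub>R\<^esub> b) else \<ominus>\<^bsub>R\<^esub> (c \<otimes>\<^bsub>R\<^esub> c))"

context field
begin

lemma quartic_coeffs_simps [simp]:
  "quartic_coeffs R b c 0 = \<one>" "quartic_coeffs R b c 1 = \<ominus> (b \<otimes> b)" "quartic_coeffs R b c (Suc 0) = \<ominus> (b \<otimes> b)"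
  "quartic_coeffs R b c 2 = \<ominus> (c \<otimes> c)"
  by (simp_all add: quartic_coeffs_def)

lemma minus_ne_zero: "x \<in> carrier R \<Longrightarrow> x \<noteq> \<zero> \<Longrightarrow> \<ominus> x \<noteq> \<zero>"
  using add.inv_eq_1_iff by simp

lemma quartic_coeffs_nonzero:
  assumes "b \<in> carrier R" "b \<noteq> \<zero>" "c \<in> carrier R" "c \<noteq> \<zero>"
  shows "quartic_coeffs R b c i \<in> carrier R" "quartic_coeffs R b c i \<noteq> \<zero>"
  using assms by (simp_all add: quartic_coeffs_def integral_iff minus_ne_zero)

lemma three_indices: "{0, 1, 2} = {..<3::nat}" "{0, 2, 1} = {..<3::nat}" "{1, 2, 0} = {..<3::nat}"
  by auto

lemma has_bitangent_if_square_fourth_power: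
  assumes bc: "b \<in> carrier R" "b \<noteq> \<zero>" "c \<in> carrier R" "c \<noteq> \<zero>" and w: "w \<in> carrier R"
    and sq: "w \<otimes> w \<in> {b, \<ominus> b, c, \<ominus> c}"
  shows "has_bitangent R (diag_form R 4 (quartic_coeffs R b c))"
proof -
  have four: "w [^] (4::nat) = (w \<otimes> w) \<otimes> (w \<otimes> w)"
    by (rule ring_identity[where ls="[w]"], (rule reify)+, simp add: in_carrier_def w, code_simp)
  have "w [^] (4::nat) = b \<otimes> b \<or> w [^] (4::nat) = c \<otimes> c"
    unfolding four using sq bc by (auto simp: l_minus r_minus)
  then show ?thesis
  proof
    assume "w [^] (4::nat) = b \<otimes> b"
    then show ?thesis
      by (intro has_bitangent_diag_hyperflex[OF three_indices(1) quartic_coeffs_nonzero[OF bc] w]) (use bc in \<open>simp add: l_neg\<close>)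
  next
    assume "w [^] (4::nat) = c \<otimes> c"
    then show ?thesis
      by (intro has_bitangent_diag_hyperflex[OF three_indices(2) quartic_coeffs_nonzero[OF bc] w]) (use bc in \<open>simp add: l_neg\<close>)
  qed
qed

text \<open>With \<open>e = s / ((1 + i) b)\<close> and \<open>(1 + i)^4 = -4\<close>, one has \<open>b^2 e^4 = - c^2\<close>, which is the condition for a
  hyperflex line through the vertex \<open>(1 : 0 : 0)\<close>.\<close>

lemma has_bitangent_if_twice_product_square:
  assumes two: "\<guillemotleft>2\<guillemotright> \<noteq> \<zero>" and bc: "b \<in> carrier R" "b \<noteq> \<zero>" "c \<in> carrier R" "c \<noteq> \<zero>"
    and i: "i \<in> carrier R" "i \<otimes> i = \<ominus> \<one>" and s: "s \<in> carrier R" "s \<otimes> s = \<guillemotleft>2\<guillemotright> \<otimes> (b \<otimes> c)"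
  shows "has_bitangent R (diag_form R 4 (quartic_coeffs R b c))"
proof -
  define d where "d = (\<one> \<oplus> i) \<otimes> b"
  have dc: "d \<in> carrier R" using i bc by (simp add: d_def)
  have "d [^] (4::nat) = (\<one> \<oplus> \<guillemotleft>2\<guillemotright> \<otimes> i \<oplus> i \<otimes> i) \<otimes> (\<one> \<oplus> \<guillemotleft>2\<guillemotright> \<otimes> i \<oplus> i \<otimes> i) \<otimes> (b \<otimes> b \<otimes> b \<otimes> b)" unfolding d_def
    by (rule ring_identity[where ls="[i, b]"], (rule reify)+, simp add: in_carrier_def bc i, code_simp)
  also have "\<dots> = \<guillemotleft>4\<guillemotright> \<otimes> (i \<otimes> i) \<otimes> (b \<otimes> b \<otimes> b \<otimes> b)" unfolding i(2)
    by (subst i(2)[symmetric], rule ring_identity[where ls="[i, b]"], (rule reify)+, simp add: in_carrier_def bc i, code_simp)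
  also have "\<dots> = \<ominus> (\<guillemotleft>4\<guillemotright> \<otimes> (b \<otimes> b \<otimes> b \<otimes> b))" unfolding i(2)
    by (rule ring_identity[where ls="[b]"], (rule reify)+, simp add: in_carrier_def bc, code_simp)
  finally have d4: "d [^] (4::nat) = \<ominus> (\<guillemotleft>4\<guillemotright> \<otimes> (b \<otimes> b \<otimes> b \<otimes> b))" .
  have four0: "\<guillemotleft>4\<guillemotright> \<noteq> \<zero>" using of_int_mult[of 2 2] two by (simp add: integral_iff)
  have d4n: "d [^] (4::nat) \<noteq> \<zero>" unfolding d4 using bc four0 by (intro minus_ne_zero) (simp_all add: integral_iff)
  then have d0: "d \<noteq> \<zero>" by (auto simp: numeral_eq_Suc)
  then have id: "inv d \<in> carrier R" "d \<otimes> inv d = \<one>" using dc field_Units by auto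
  define e where "e = s \<otimes> inv d"
  have ec: "e \<in> carrier R" using s id by (simp add: e_def)
  have "(\<ominus> (c \<otimes> c) \<oplus> \<ominus> (b \<otimes> b) \<otimes> e [^] (4::nat)) \<otimes> d [^] (4::nat)
      = \<ominus> (c \<otimes> c) \<otimes> d [^] (4::nat) \<oplus> \<ominus> (b \<otimes> b) \<otimes> (s \<otimes> s) \<otimes> (s \<otimes> s) \<otimes> (d \<otimes> inv d) [^] (4::nat)"
    unfolding e_def
    by (rule ring_identity[where ls="[b, c, s, d, inv d]"], (rule reify)+, simp add: in_carrier_def bc s dc id(1), code_simp)
  also have "\<dots> = \<zero>" unfolding id(2) s(2) d4
    by (rule ring_identity[where ls="[b, c]"], (rule reify)+, simp add: in_carrier_def bc, code_simp)
  finally have "\<ominus> (c \<otimes> c) \<oplus> \<ominus> (b \<otimes> b) \<otimes> e [^] (4::nat) = \<zero>"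
    using d4n bc ec dc by (simp add: integral_iff)
  then show ?thesis
    by (intro has_bitangent_diag_hyperflex[OF three_indices(3) quartic_coeffs_nonzero[OF bc] ec]) simp
qed

text \<open>\<open>\<alpha> = (1 + i) s / 2\<close>, again by \<open>(1 + i)^4 = -4\<close>.\<close>

lemma minus_square_fourth_power:
  assumes two: "\<guillemotleft>2\<guillemotright> \<noteq> \<zero>" and b: "b \<in> carrier R"
    and i: "i \<in> carrier R" "i \<otimes> i = \<ominus> \<one>" and s: "s \<in> carrier R" "s \<otimes> s = \<guillemotleft>2\<guillemotright> \<otimes> b"
  shows "\<exists>\<alpha>\<in>carrier R. \<ominus> (b \<otimes> b) = \<alpha> [^] (4::nat)"
proof -
  have h: "inv \<guillemotleft>2\<guillemotright> \<in> carrier R" "inv \<guillemotleft>2\<guillemotright> \<otimes> \<guillemotleft>2\<guillemotright> = \<one>" using two field_Units by auto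
  define k where "k = inv \<guillemotleft>2\<guillemotright>"
  have k: "k \<in> carrier R" "k \<otimes> \<guillemotleft>2\<guillemotright> = \<one>" using h by (simp_all add: k_def)
  have "((\<one> \<oplus> i) \<otimes> s \<otimes> k) [^] (4::nat) = (\<one> \<oplus> \<guillemotleft>2\<guillemotright> \<otimes> i \<oplus> i \<otimes> i) \<otimes> (\<one> \<oplus> \<guillemotleft>2\<guillemotright> \<otimes> i \<oplus> i \<otimes> i) \<otimes> (s \<otimes> s) \<otimes> (s \<otimes> s) \<otimes> k [^] (4::nat)"
    by (rule ring_identity[where ls="[i, s, k]"], (rule reify)+, simp add: in_carrier_def s i k, code_simp)
  also have "\<dots> = (i \<otimes> i) \<otimes> (b \<otimes> b) \<otimes> (k \<otimes> \<guillemotleft>2\<guillemotright>) [^] (4::nat)" unfolding s(2) i(2)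
    by (subst i(2)[symmetric], rule ring_identity[where ls="[i, b, k]"], (rule reify)+, simp add: in_carrier_def b i k, code_simp)
  also have "\<dots> = \<ominus> (b \<otimes> b)" unfolding k(2) i(2)
    by (rule ring_identity[where ls="[b]"], (rule reify)+, simp add: in_carrier_def b, code_simp)
  finally show ?thesis using s i k by (intro bexI[of _ "(\<one> \<oplus> i) \<otimes> s \<otimes> k"]) auto
qed

lemma has_bitangent_if_doubles_square:
  assumes two: "\<guillemotleft>2\<guillemotright> \<noteq> \<zero>" and three: "\<guillemotleft>3\<guillemotright> \<noteq> \<zero>" and bc: "b \<in> carrier R" "b \<noteq> \<zero>" "c \<in> carrier R" "c \<noteq> \<zero>"
    and i: "i \<in> carrier R" "i \<otimes> i = \<ominus> \<one>" and s: "s \<in> carrier R" "s \<otimes> s = \<guillemotleft>2\<guillemotright> \<otimes> b" and r: "r \<in> carrier R" "r \<otimes> r = \<guillemotleft>2\<guillemotright> \<otimes> c"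
  shows "has_bitangent R (diag_form R 4 (quartic_coeffs R b c))"
proof -
  obtain \<alpha> \<beta> where al: "\<alpha> \<in> carrier R" "\<ominus> (b \<otimes> b) = \<alpha> [^] (4::nat)" "\<beta> \<in> carrier R" "\<ominus> (c \<otimes> c) = \<beta> [^] (4::nat)"
    using minus_square_fourth_power[OF two bc(1) i s] minus_square_fourth_power[OF two bc(3) i r] by blast
  show ?thesis
    by (intro has_bitangent_diag_two_contacts[OF two three three_indices(3) quartic_coeffs_nonzero[OF bc] al(1,3)]) (use al in simp_all)
qed

lemma eq_mult_quotient_pow4:
  assumes "x \<in> carrier R" "y \<in> carrier R" "y \<noteq> \<zero>" "p \<in> carrier R" "q \<in> carrier R" and eq: "p \<otimes> y [^] (4::nat) = q \<otimes> x [^] (4::nat)"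
  shows "p = q \<otimes> (x \<otimes> inv y) [^] (4::nat)"
proof -
  have i: "inv y \<in> carrier R" "y \<otimes> inv y = \<one>" using assms field_Units by auto
  have "p = p \<otimes> (y \<otimes> inv y) [^] (4::nat)" unfolding i(2) using assms by simp
  also have "\<dots> = (p \<otimes> y [^] (4::nat)) \<otimes> inv y [^] (4::nat)"
    by (rule ring_identity[where ls="[p, y, inv y]"], (rule reify)+, simp add: in_carrier_def assms i(1), code_simp)
  also have "\<dots> = q \<otimes> (x \<otimes> inv y) [^] (4::nat)" unfolding eq
    by (rule ring_identity[where ls="[q, x, inv y]"], (rule reify)+, simp add: in_carrier_def assms i(1), code_simp)
  finally show ?thesis .
qed

lemma square_eq_fourth_power_cases:
  assumes "u \<in> carrier R" "e \<in> carrier R" "u \<otimes> u = e [^] (4::nat)"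
  shows "e \<otimes> e = u \<or> e \<otimes> e = \<ominus> u"
proof -
  have "(e \<otimes> e \<ominus> u) \<otimes> (e \<otimes> e \<ominus> (\<ominus> u)) = e [^] (4::nat) \<ominus> u \<otimes> u"
    by (rule ring_identity[where ls="[e, u]"], (rule reify)+, simp add: in_carrier_def assms, code_simp)
  also have "\<dots> = \<zero>" unfolding assms(3) using assms by (simp add: r_right_minus_eq)
  finally have "e \<otimes> e \<ominus> u = \<zero> \<or> e \<otimes> e \<ominus> (\<ominus> u) = \<zero>" using assms by (simp add: integral_iff)
  then show ?thesis using assms by (simp add: r_right_minus_eq)
qed

text \<open>\<open>i = \<alpha>^2 / b\<close> is a square root of \<open>-1\<close>, and \<open>(\<alpha> (1 - i))^2 = - 2 i \<alpha>^2 = 2 b\<close>.\<close>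

lemma double_square_if_minus_square_fourth_power:
  assumes b: "b \<in> carrier R" "b \<noteq> \<zero>" and \<alpha>: "\<alpha> \<in> carrier R" "\<ominus> (b \<otimes> b) = \<alpha> [^] (4::nat)"
  shows "\<exists>e\<in>carrier R. e \<otimes> e = \<guillemotleft>2\<guillemotright> \<otimes> b"
proof -
  have k: "inv b \<in> carrier R" "b \<otimes> inv b = \<one>" using b field_Units by auto
  define k where "k = inv b"
  have kk: "k \<in> carrier R" "b \<otimes> k = \<one>" using k by (simp_all add: k_def)
  define i where "i = \<alpha> \<otimes> \<alpha> \<otimes> k"
  have ic: "i \<in> carrier R" using kk \<alpha> by (simp add: i_def)
  have "i \<otimes> i = \<alpha> [^] (4::nat) \<otimes> (k \<otimes> k)" unfolding i_def
    by (rule ring_identity[where ls="[\<alpha>, k]"], (rule reify)+, simp add: in_carrier_def \<alpha> kk, code_simp)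
  also have "\<dots> = \<ominus> ((b \<otimes> k) \<otimes> (b \<otimes> k))" unfolding \<alpha>(2)[symmetric]
    by (rule ring_identity[where ls="[b, k]"], (rule reify)+, simp add: in_carrier_def b kk, code_simp)
  finally have ii: "i \<otimes> i = \<ominus> \<one>" unfolding kk(2) by simp
  have ib: "i \<otimes> b = \<alpha> \<otimes> \<alpha>"
  proof -
    have "i \<otimes> b = \<alpha> \<otimes> \<alpha> \<otimes> (b \<otimes> k)" unfolding i_def
      by (rule ring_identity[where ls="[\<alpha>, b, k]"], (rule reify)+, simp add: in_carrier_def \<alpha> b kk, code_simp)
    then show ?thesis unfolding kk(2) using \<alpha> by simp
  qed
  have "(\<alpha> \<otimes> (\<one> \<ominus> i)) \<otimes> (\<alpha> \<otimes> (\<one> \<ominus> i)) = (\<alpha> \<otimes> \<alpha>) \<otimes> (\<one> \<oplus> i \<otimes> i \<ominus> \<guillemotleft>2\<guillemotright> \<otimes> i)"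
    by (rule ring_identity[where ls="[\<alpha>, i]"], (rule reify)+, simp add: in_carrier_def \<alpha> ic, code_simp)
  also have "\<dots> = (i \<otimes> b) \<otimes> (\<one> \<oplus> \<ominus> \<one> \<ominus> \<guillemotleft>2\<guillemotright> \<otimes> i)" unfolding ii ib ..
  also have "\<dots> = \<ominus> (i \<otimes> i) \<otimes> (\<guillemotleft>2\<guillemotright> \<otimes> b)"
    by (rule ring_identity[where ls="[i, b]"], (rule reify)+, simp add: in_carrier_def b ic, code_simp)
  also have "\<dots> = \<guillemotleft>2\<guillemotright> \<otimes> b" unfolding ii using b by simp
  finally show ?thesis using \<alpha> ic by (intro bexI[of _ "\<alpha> \<otimes> (\<one> \<ominus> i)"]) auto
qed

text \<open>\<open>i = 2 t f^2 / b\<close> is a square root of \<open>-1\<close>, and \<open>((1 + i) b / (2 f))^2 = 2 i b^2 / (4 f^2) = b t\<close>.\<close>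

lemma product_square_if_sum_of_squares_zero:
  assumes two: "\<guillemotleft>2\<guillemotright> \<noteq> \<zero>" and bt: "b \<in> carrier R" "b \<noteq> \<zero>" "t \<in> carrier R" and f: "f \<in> carrier R" "f \<noteq> \<zero>"
    and eq: "b \<otimes> b \<oplus> (\<guillemotleft>2\<guillemotright> \<otimes> t) \<otimes> (\<guillemotleft>2\<guillemotright> \<otimes> t) \<otimes> f [^] (4::nat) = \<zero>"
  shows "\<exists>e\<in>carrier R. e \<otimes> e = b \<otimes> t"
proof -
  define k where "k = inv b"
  define g where "g = inv f"
  define h where "h = inv \<guillemotleft>2\<guillemotright>"
  have kgh: "k \<in> carrier R" "b \<otimes> k = \<one>" "g \<in> carrier R" "f \<otimes> g = \<one>" "h \<in> carrier R" "h \<otimes> \<guillemotleft>2\<guillemotright> = \<one>"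
    using field_Units bt f two by (auto simp: k_def g_def h_def)
  define i where "i = \<guillemotleft>2\<guillemotright> \<otimes> t \<otimes> (f \<otimes> f) \<otimes> k"
  have ic: "i \<in> carrier R" using kgh bt f by (simp add: i_def)
  have "i \<otimes> i = (b \<otimes> b \<oplus> (\<guillemotleft>2\<guillemotright> \<otimes> t) \<otimes> (\<guillemotleft>2\<guillemotright> \<otimes> t) \<otimes> f [^] (4::nat)) \<otimes> (k \<otimes> k) \<ominus> (b \<otimes> k) \<otimes> (b \<otimes> k)" unfolding i_def
    by (rule ring_identity[where ls="[b, t, f, k]"], (rule reify)+, simp add: in_carrier_def bt f kgh, code_simp)
  then have ii: "i \<otimes> i = \<ominus> \<one>" unfolding eq kgh(2) using kgh by (simp add: minus_eq)
  let ?e = "(\<one> \<oplus> i) \<otimes> b \<otimes> g \<otimes> h"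
  have "?e \<otimes> ?e = (\<one> \<oplus> i \<otimes> i \<oplus> \<guillemotleft>2\<guillemotright> \<otimes> i) \<otimes> (b \<otimes> b) \<otimes> (g \<otimes> g) \<otimes> (h \<otimes> h)"
    by (rule ring_identity[where ls="[i, b, g, h]"], (rule reify)+, simp add: in_carrier_def ic bt kgh, code_simp)
  also have "\<dots> = (b \<otimes> t) \<otimes> (b \<otimes> k) \<otimes> (f \<otimes> g) \<otimes> (f \<otimes> g) \<otimes> (h \<otimes> \<guillemotleft>2\<guillemotright>) \<otimes> (h \<otimes> \<guillemotleft>2\<guillemotright>)" unfolding ii unfolding i_def
    by (rule ring_identity[where ls="[t, b, f, k, g, h]"], (rule reify)+, simp add: in_carrier_def f bt kgh, code_simp)
  also have "\<dots> = b \<otimes> t" unfolding kgh using bt by simp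
  finally show ?thesis using ic bt kgh by (intro bexI[of _ ?e]) auto
qed

text \<open>Ratios between the coefficient \<open>1\<close> and another one give \<open>b^2\<close> or \<open>4 t^2\<close> as a fourth power. The ratio of the
  other two is the case of \<open>product_square_if_sum_of_squares_zero\<close>. The lines with two points of contact
  always make \<open>- b^2\<close> a fourth power, whichever coefficient is the common denominator.\<close>

theorem square_if_has_bitangent:
  assumes two: "\<guillemotleft>2\<guillemotright> \<noteq> \<zero>" and bt: "b \<in> carrier R" "b \<noteq> \<zero>" "t \<in> carrier R" "t \<noteq> \<zero>"
    and bit: "has_bitangent R (diag_form R 4 (quartic_coeffs R b (\<guillemotleft>2\<guillemotright> \<otimes> t)))"
  shows "\<exists>e\<in>carrier R. e \<otimes> e \<in> {b, \<ominus> b, \<guillemotleft>2\<guillemotright> \<otimes> b, \<guillemotleft>2\<guillemotright> \<otimes> t, \<ominus> (\<guillemotleft>2\<guillemotright> \<otimes> t), b \<otimes> t}"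
proof -
  let ?c = "quartic_coeffs R b (\<guillemotleft>2\<guillemotright> \<otimes> t)"
  have c: "\<guillemotleft>2\<guillemotright> \<otimes> t \<in> carrier R" "\<guillemotleft>2\<guillemotright> \<otimes> t \<noteq> \<zero>" using bt two by (auto simp: integral_iff)
  note cf = quartic_coeffs_nonzero[OF bt(1,2) c]
  have perm: "i = 0 \<and> j = 1 \<and> k = 2 \<or> i = 0 \<and> j = 2 \<and> k = 1 \<or> i = 1 \<and> j = 0 \<and> k = 2 \<or> i = 1 \<and> j = 2 \<and> k = 0
      \<or> i = 2 \<and> j = 0 \<and> k = 1 \<or> i = 2 \<and> j = 1 \<and> k = 0" if "{i, j, k} = {..<3::nat}" for i j k
  proof -
    have "0 \<in> {i, j, k}" "1 \<in> {i, j, k}" "2 \<in> {i, j, k}" unfolding that by auto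
    then show ?thesis by auto
  qed
  have 1: ?thesis if u: "u \<in> {b, \<guillemotleft>2\<guillemotright> \<otimes> t}" "e \<in> carrier R" "u \<otimes> u = e [^] (4::nat)" for u e
    using square_eq_fourth_power_cases[OF _ u(2,3)] u bt c by (intro bexI[OF _ u(2)]) auto
  have 2: ?thesis if "\<alpha> \<in> carrier R" "\<ominus> (b \<otimes> b) = \<alpha> [^] (4::nat)" for \<alpha>
    using double_square_if_minus_square_fourth_power[OF bt(1,2) that] by blast
  have neg: "p = q" if "p \<oplus> \<ominus> q = \<zero>" "p \<in> carrier R" "q \<in> carrier R" for p q
    using that by (metis minus_eq r_right_minus_eq)
  have nz: "x [^] (4::nat) = \<zero> \<Longrightarrow> x = \<zero>" if "x \<in> carrier R" for x
    using that by (simp add: numeral_eq_Suc integral_iff)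
  have pow_nz: "y [^] (4::nat) \<noteq> \<zero>" if "y \<in> carrier R" "y \<noteq> \<zero>" for y using nz that by blast
  from two cf(1) cf(2) bit show ?thesis
  proof (rule has_bitangent_diagD)
    fix i j k x y assume ijk: "{i, j, k} = {..<3::nat}" and xy: "x \<in> carrier R" "y \<in> carrier R" "y \<noteq> \<zero>"
      and eq: "?c i \<otimes> y [^] (4::nat) \<oplus> ?c j \<otimes> x [^] (4::nat) = \<zero>"
    define f where "f = x \<otimes> inv y"
    have fc: "f \<in> carrier R" using xy field_Units by (auto simp: f_def)
    have "?c i \<otimes> y [^] (4::nat) = \<ominus> (?c j) \<otimes> x [^] (4::nat)"
      using eq xy cf by (simp add: l_minus minus_equality)
    then have e: "?c i = \<ominus> (?c j) \<otimes> f [^] (4::nat)" unfolding f_def using xy cf by (intro eq_mult_quotient_pow4) auto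
    have f0: "f \<noteq> \<zero>"
    proof
      assume "f = \<zero>"
      then have "?c i = \<zero>" using e cf by (simp add: numeral_eq_Suc)
      then show False using cf by simp
    qed
    define g where "g = inv f"
    have g: "g \<in> carrier R" "f \<otimes> g = \<one>" "g \<noteq> \<zero>" using fc f0 field_Units by (auto simp: g_def)
    have inv_eq: "q = p \<otimes> g [^] (4::nat)" if "p = q \<otimes> f [^] (4::nat)" "q \<in> carrier R" for p q
    proof -
      have "p \<otimes> g [^] (4::nat) = q \<otimes> (f \<otimes> g) [^] (4::nat)" unfolding that(1)
        by (rule ring_identity[where ls="[q, f, g]"], (rule reify)+, simp add: in_carrier_def that fc g, code_simp)
      then show ?thesis unfolding g(2) using that by simp
    qed
    have mixed: ?thesis if "w \<in> carrier R" "w \<noteq> \<zero>" "\<ominus> (b \<otimes> b) = \<ominus> (\<ominus> ((\<guillemotleft>2\<guillemotright> \<otimes> t) \<otimes> (\<guillemotleft>2\<guillemotright> \<otimes> t))) \<otimes> w [^] (4::nat)" for w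
    proof -
      have "\<ominus> (b \<otimes> b) = (\<guillemotleft>2\<guillemotright> \<otimes> t) \<otimes> (\<guillemotleft>2\<guillemotright> \<otimes> t) \<otimes> w [^] (4::nat)" using that c by simp
      then have "b \<otimes> b \<oplus> (\<guillemotleft>2\<guillemotright> \<otimes> t) \<otimes> (\<guillemotleft>2\<guillemotright> \<otimes> t) \<otimes> w [^] (4::nat) = \<zero>"
        using bt r_neg[of "b \<otimes> b"] by (metis m_closed)
      then show ?thesis using product_square_if_sum_of_squares_zero[OF two bt(1-3) that(1,2)] by blast
    qed
    from perm[OF ijk] show ?thesis
    proof (elim disjE conjE)
      assume "i = 0" "j = 1"
      then have "b \<otimes> b = \<one> \<otimes> g [^] (4::nat)" using e bt by (intro inv_eq) simp_all
      then have "b \<otimes> b = g [^] (4::nat)" using g(1) by simp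
      then show ?thesis using 1[of b g] g by blast
    next
      assume "i = 0" "j = 2"
      then have "(\<guillemotleft>2\<guillemotright> \<otimes> t) \<otimes> (\<guillemotleft>2\<guillemotright> \<otimes> t) = \<one> \<otimes> g [^] (4::nat)" using e c by (intro inv_eq) simp_all
      then have "(\<guillemotleft>2\<guillemotright> \<otimes> t) \<otimes> (\<guillemotleft>2\<guillemotright> \<otimes> t) = g [^] (4::nat)" using g(1) by simp
      then show ?thesis using 1[of "\<guillemotleft>2\<guillemotright> \<otimes> t" g] g by blast
    next
      assume "i = 1" "j = 0"
      then have "\<ominus> (b \<otimes> b) = \<ominus> (f [^] (4::nat))" using e fc by (simp add: l_minus)
      then have "b \<otimes> b = f [^] (4::nat)" using bt fc by (metis minus_minus m_closed nat_pow_closed)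
      then show ?thesis using 1[of b f] fc by blast
    next
      assume "i = 2" "j = 0"
      then have "\<ominus> ((\<guillemotleft>2\<guillemotright> \<otimes> t) \<otimes> (\<guillemotleft>2\<guillemotright> \<otimes> t)) = \<ominus> (f [^] (4::nat))" using e fc by (simp add: l_minus)
      then have "(\<guillemotleft>2\<guillemotright> \<otimes> t) \<otimes> (\<guillemotleft>2\<guillemotright> \<otimes> t) = f [^] (4::nat)" using c fc by (metis minus_minus m_closed nat_pow_closed)
      then show ?thesis using 1[of "\<guillemotleft>2\<guillemotright> \<otimes> t" f] fc by blast
    next
      assume "i = 1" "j = 2"
      then show ?thesis using mixed[OF fc f0] e by simp
    next
      assume ij: "i = 2" "j = 1"
      have "\<ominus> (\<ominus> (b \<otimes> b)) = \<ominus> ((\<guillemotleft>2\<guillemotright> \<otimes> t) \<otimes> (\<guillemotleft>2\<guillemotright> \<otimes> t)) \<otimes> g [^] (4::nat)"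
        by (rule inv_eq) (use e ij bt in simp_all)
      then have "\<ominus> (b \<otimes> b) = \<ominus> (\<ominus> ((\<guillemotleft>2\<guillemotright> \<otimes> t) \<otimes> (\<guillemotleft>2\<guillemotright> \<otimes> t)) \<otimes> g [^] (4::nat))" using bt by simp
      then show ?thesis using mixed[OF g(1,3)] c g by (simp add: l_minus)
    qed
  next
    fix i j k x y z assume ijk: "{i, j, k} = {..<3::nat}" and xyz: "x \<in> carrier R" "y \<in> carrier R" "z \<in> carrier R" "z \<noteq> \<zero>"
      and eq: "?c i \<otimes> z [^] (4::nat) = ?c k \<otimes> x [^] (4::nat)" "?c j \<otimes> z [^] (4::nat) = ?c k \<otimes> y [^] (4::nat)"
    have nonzero: "w \<noteq> \<zero>" if "?c m \<otimes> z [^] (4::nat) = ?c k \<otimes> w [^] (4::nat)" for m w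
    proof
      assume "w = \<zero>"
      then have "?c m \<otimes> z [^] (4::nat) = \<zero>" using that cf(1) by (simp add: numeral_eq_Suc)
      then show False using cf pow_nz[OF xyz(3,4)] xyz by (simp add: integral_iff)
    qed
    note x0 = nonzero[OF eq(1)] and y0 = nonzero[OF eq(2)]
    have c1: "?c 1 \<in> carrier R" by (rule cf)
    have quot: ?thesis if "p \<in> carrier R" "q \<in> carrier R" "q \<noteq> \<zero>" "?c 1 \<otimes> q [^] (4::nat) = \<one> \<otimes> p [^] (4::nat)" for p q
    proof -
      have "?c 1 = \<one> \<otimes> (p \<otimes> inv q) [^] (4::nat)" by (rule eq_mult_quotient_pow4) (use that c1 in auto)
      moreover have iq: "p \<otimes> inv q \<in> carrier R" using that field_Units by auto
      ultimately show ?thesis using 2[OF iq] by simp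
    qed
    have swap: "(u \<otimes> p [^] (4::nat)) \<otimes> q [^] (4::nat) = (u \<otimes> q [^] (4::nat)) \<otimes> p [^] (4::nat)"
      if h: "u \<in> carrier R" "p \<in> carrier R" "q \<in> carrier R" for u p q
      by (rule ring_identity[where ls="[u, p, q]"], (rule reify)+, simp add: in_carrier_def h, code_simp)
    have two_steps: ?thesis if h: "p \<in> carrier R" "q \<in> carrier R" "p \<noteq> \<zero>" "\<one> \<otimes> z [^] (4::nat) = ?c k \<otimes> p [^] (4::nat)"
        "?c 1 \<otimes> z [^] (4::nat) = ?c k \<otimes> q [^] (4::nat)" for p q
    proof (rule quot[OF h(2,1,3)])
      have "(?c 1 \<otimes> p [^] (4::nat)) \<otimes> z [^] (4::nat) = (?c 1 \<otimes> z [^] (4::nat)) \<otimes> p [^] (4::nat)"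
        by (rule swap[OF c1 h(1) xyz(3)])
      also have "\<dots> = q [^] (4::nat) \<otimes> (?c k \<otimes> p [^] (4::nat))" unfolding h(5) using h(1,2) xyz cf(1)[of k] by (simp add: m_ac del: quartic_coeffs_simps)
      also have "\<dots> = (\<one> \<otimes> q [^] (4::nat)) \<otimes> z [^] (4::nat)" unfolding h(4)[symmetric] using h(1,2) xyz by simp
      finally show "?c 1 \<otimes> p [^] (4::nat) = \<one> \<otimes> q [^] (4::nat)"
        using m_rcancel[OF pow_nz[OF xyz(3,4)]] h xyz c1 by (metis m_closed nat_pow_closed one_closed)
    qed
    from perm[OF ijk] show ?thesis
    proof (elim disjE conjE)
      assume "i = 0" "j = 1" then show ?thesis using two_steps[OF xyz(1,2) x0] eq by simp
    next
      assume "i = 1" "j = 0" then show ?thesis using two_steps[OF xyz(2,1) y0] eq by simp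
    next
      assume "i = 0" "k = 1" then show ?thesis using quot[OF xyz(3,1) x0] eq by simp
    next
      assume "j = 0" "k = 1" then show ?thesis using quot[OF xyz(3,2) y0] eq by simp
    next
      assume "i = 1" "k = 0" then show ?thesis using quot[OF xyz(1,3,4)] eq by simp
    next
      assume "j = 1" "k = 0" then show ?thesis using quot[OF xyz(2,3,4)] eq by simp
    qed
  qed
qed

end

section \<open>Bitangents over completions\<close>

text \<open>The elements in the hypothesis become squares in the completion; the curve over the completion has the
  images of \<open>b\<close> and \<open>c\<close> in its coefficients.\<close>

lemma (in valued_place) completion_has_bitangent:
  assumes two: "\<guillemotleft>2\<guillemotright> \<noteq> \<zero>" and bc: "b \<in> carrier K" "b \<noteq> \<zero>" "c \<in> carrier K" "c \<noteq> \<zero>"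
    and local: "approx_sqrt b \<or> approx_sqrt (\<ominus> b) \<or> approx_sqrt c \<or>
      approx_sqrt (\<ominus> \<one>) \<and> (approx_sqrt (\<guillemotleft>2\<guillemotright> \<otimes> (b \<otimes> c)) \<or>
        approx_sqrt (\<guillemotleft>2\<guillemotright> \<otimes> b) \<and> approx_sqrt (\<guillemotleft>2\<guillemotright> \<otimes> c) \<and> \<guillemotleft>3\<guillemotright> \<noteq> \<zero>)"
  shows "has_bitangent (completion K v) (to_completion K v \<circ> diag_form K 4 (quartic_coeffs K b c))"
proof -
  let ?L = "completion K v" and ?T = "to_completion K v"
  interpret L: field ?L by (rule field_completion)
  interpret T: ring_hom_cring K ?L ?T
    using to_completion_hom is_cring L.is_cring by (simp add: ring_hom_cring_def ring_hom_cring_axioms_def)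
  have T0: "?T x \<noteq> \<zero>\<^bsub>?L\<^esub>" if "x \<in> carrier K" "x \<noteq> \<zero>" for x
  proof
    assume "?T x = \<zero>\<^bsub>?L\<^esub>"
    moreover have "inv x \<in> carrier K" "x \<otimes> inv x = \<one>" using that field_Units by auto
    ultimately show False using T.hom_mult[of x "inv x"] that(1) by simp
  qed
  have coeffs: "?T \<circ> quartic_coeffs K b c = quartic_coeffs ?L (?T b) (?T c)"
    using bc by (auto simp: quartic_coeffs_def fun_eq_iff)
  have form: "?T \<circ> diag_form K 4 (quartic_coeffs K b c) = diag_form ?L 4 (quartic_coeffs ?L (?T b) (?T c))"
    unfolding coeffs[symmetric] by (rule diag_form_comp) simp
  note Tbc = T.hom_closed[OF bc(1)] T0[OF bc(1,2)] T.hom_closed[OF bc(3)] T0[OF bc(3,4)]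
  have two': "\<guillemotleft>2\<guillemotright>\<^bsub>?L\<^esub> \<noteq> \<zero>\<^bsub>?L\<^esub>" using T0[of "\<guillemotleft>2\<guillemotright>"] two by (simp add: T.hom_of_int)
  have three': "\<guillemotleft>3\<guillemotright>\<^bsub>?L\<^esub> \<noteq> \<zero>\<^bsub>?L\<^esub>" if "\<guillemotleft>3\<guillemotright> \<noteq> \<zero>" using T0[of "\<guillemotleft>3\<guillemotright>"] that by (simp add: T.hom_of_int)
  have root: "\<exists>w\<in>carrier ?L. w \<otimes>\<^bsub>?L\<^esub> w = ?T x" if "approx_sqrt x" "x \<in> carrier K" for x
    using completion_square that .
  consider x where "x \<in> {b, \<ominus> b, c}" "approx_sqrt x"
    | "approx_sqrt (\<ominus> \<one>)" "approx_sqrt (\<guillemotleft>2\<guillemotright> \<otimes> (b \<otimes> c))"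
    | "approx_sqrt (\<ominus> \<one>)" "approx_sqrt (\<guillemotleft>2\<guillemotright> \<otimes> b)" "approx_sqrt (\<guillemotleft>2\<guillemotright> \<otimes> c)" "\<guillemotleft>3\<guillemotright> \<noteq> \<zero>"
    using local by blast
  then show ?thesis
    unfolding form
  proof cases
    case 1
    have xc: "x \<in> carrier K" using 1 bc by auto
    obtain w where w: "w \<in> carrier ?L" "w \<otimes>\<^bsub>?L\<^esub> w = ?T x" using root[OF 1(2) xc] by blast
    have "?T x \<in> {?T b, \<ominus>\<^bsub>?L\<^esub> ?T b, ?T c, \<ominus>\<^bsub>?L\<^esub> ?T c}" using 1(1) bc by auto
    then show "has_bitangent ?L (diag_form ?L 4 (quartic_coeffs ?L (?T b) (?T c)))"
      using L.has_bitangent_if_square_fourth_power[OF Tbc w(1)] w(2) by simp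
  next
    case 2
    obtain i where i: "i \<in> carrier ?L" "i \<otimes>\<^bsub>?L\<^esub> i = \<ominus>\<^bsub>?L\<^esub> \<one>\<^bsub>?L\<^esub>" using root[OF 2(1)] by auto
    obtain s where s: "s \<in> carrier ?L" "s \<otimes>\<^bsub>?L\<^esub> s = \<guillemotleft>2\<guillemotright>\<^bsub>?L\<^esub> \<otimes>\<^bsub>?L\<^esub> (?T b \<otimes>\<^bsub>?L\<^esub> ?T c)"
      using root[OF 2(2)] bc by (auto simp: T.hom_of_int)
    show "has_bitangent ?L (diag_form ?L 4 (quartic_coeffs ?L (?T b) (?T c)))"
      by (rule L.has_bitangent_if_twice_product_square[OF two' Tbc i s])
  next
    case 3
    obtain i where i: "i \<in> carrier ?L" "i \<otimes>\<^bsub>?L\<^esub> i = \<ominus>\<^bsub>?L\<^esub> \<one>\<^bsub>?L\<^esub>" using root[OF 3(1)] by auto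
    obtain s where s: "s \<in> carrier ?L" "s \<otimes>\<^bsub>?L\<^esub> s = \<guillemotleft>2\<guillemotright>\<^bsub>?L\<^esub> \<otimes>\<^bsub>?L\<^esub> ?T b"
      using root[OF 3(2)] bc by (auto simp: T.hom_of_int)
    obtain r where r: "r \<in> carrier ?L" "r \<otimes>\<^bsub>?L\<^esub> r = \<guillemotleft>2\<guillemotright>\<^bsub>?L\<^esub> \<otimes>\<^bsub>?L\<^esub> ?T c"
      using root[OF 3(3)] bc by (auto simp: T.hom_of_int)
    show "has_bitangent ?L (diag_form ?L 4 (quartic_coeffs ?L (?T b) (?T c)))"
      by (rule L.has_bitangent_if_doubles_square[OF two' three'[OF 3(4)] Tbc i s r])
  qed
qed

context nonarch_field
begin

lemma approx_sqrt_if_square_residue: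
  assumes "a \<guillemotleft>2\<guillemotright> = 1" "u \<in> carrier K" "a u = 1" "square_residue u"
  shows "approx_sqrt u"
  using assms approx_sqrt_close_to_square unfolding square_residue_def by blast

lemma square_residue_product:
  assumes u: "u \<in> carrier K" "a u = 1" "square_residue u" and w: "w \<in> carrier K" "a w = 1" "square_residue w"
  shows "square_residue (u \<otimes> w)"
proof -
  obtain y where y: "y \<in> carrier K" "a (u \<ominus> y \<otimes> y) < 1" using u(3) by (auto simp: square_residue_def)
  obtain z where z: "z \<in> carrier K" "a (w \<ominus> z \<otimes> z) < 1" using w(3) by (auto simp: square_residue_def)
  have zz: "a (z \<otimes> z) \<le> 1" by (rule abs_le_1_if_close[OF w(1) _ _ z(2)]) (use z w in auto)
  have "u \<otimes> w \<ominus> (y \<otimes> z) \<otimes> (y \<otimes> z) = u \<otimes> (w \<ominus> z \<otimes> z) \<oplus> (u \<ominus> y \<otimes> y) \<otimes> (z \<otimes> z)"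
    by (rule ring_identity[where ls="[u, w, y, z]"], (rule reify)+, simp add: in_carrier_def u w y z, code_simp)
  moreover have "a (u \<otimes> (w \<ominus> z \<otimes> z)) < 1" using u w z by simp
  moreover have "a ((u \<ominus> y \<otimes> y) \<otimes> (z \<otimes> z)) < 1"
  proof -
    have "a ((u \<ominus> y \<otimes> y) \<otimes> (z \<otimes> z)) = a (u \<ominus> y \<otimes> y) * a (z \<otimes> z)" using u y z by (intro abs_mult) auto
    also have "\<dots> \<le> a (u \<ominus> y \<otimes> y)" by (rule mult_left_le[OF zz]) (use u y in auto)
    finally show ?thesis using y by simp
  qed
  ultimately have "a (u \<otimes> w \<ominus> (y \<otimes> z) \<otimes> (y \<otimes> z)) < 1"
    using ultra[of "u \<otimes> (w \<ominus> z \<otimes> z)" "(u \<ominus> y \<otimes> y) \<otimes> (z \<otimes> z)"] u w y z by simp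
  then show ?thesis unfolding square_residue_def using y z by blast
qed

text \<open>Everything follows from the fact that among two units and their product there is a square modulo the
  maximal ideal, applied to \<open>-1\<close> and \<open>b\<close>, to \<open>b\<close> and \<open>c\<close>, and to \<open>2\<close> and \<open>b\<close> or \<open>c\<close>.\<close>

lemma approx_sqrt_unit_cases:
  assumes fin: "finite_residues (carrier K)" and two: "a \<guillemotleft>2\<guillemotright> = 1"
    and b: "b \<in> carrier K" "a b = 1" and c: "c \<in> carrier K" "a c = 1"
  shows "approx_sqrt b \<or> approx_sqrt (\<ominus> b) \<or> approx_sqrt c \<or>
      approx_sqrt (\<ominus> \<one>) \<and> (approx_sqrt (\<guillemotleft>2\<guillemotright> \<otimes> (b \<otimes> c)) \<or>
        approx_sqrt (\<guillemotleft>2\<guillemotright> \<otimes> b) \<and> approx_sqrt (\<guillemotleft>2\<guillemotright> \<otimes> c) \<and> \<guillemotleft>3\<guillemotright> \<noteq> \<zero>)"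
proof (rule ccontr)
  assume no: "\<not> ?thesis"
  note lift = approx_sqrt_if_square_residue[OF two]
  have m: "\<ominus> \<one> \<in> carrier K" "a (\<ominus> \<one>) = 1" and t: "\<guillemotleft>2\<guillemotright> \<in> carrier K" by simp_all
  have mb: "(\<ominus> \<one>) \<otimes> b = \<ominus> b" using b by (simp add: l_minus)
  have nb: "\<not> square_residue b" "\<not> square_residue (\<ominus> b)" and nc: "\<not> square_residue c"
    using no lift[of b] lift[of "\<ominus> b"] lift[of c] b c by auto
  have sm: "square_residue (\<ominus> \<one>)" using square_residue_mult[OF fin m b] nb unfolding mb by blast
  have im: "approx_sqrt (\<ominus> \<one>)" using lift[OF m sm] .
  have bc: "b \<otimes> c \<in> carrier K" "a (b \<otimes> c) = 1" "square_residue (b \<otimes> c)"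
    using square_residue_mult[OF fin b c] nb nc b c by auto
  have n2: "\<not> square_residue \<guillemotleft>2\<guillemotright>"
  proof
    assume "square_residue \<guillemotleft>2\<guillemotright>"
    then have "square_residue (\<guillemotleft>2\<guillemotright> \<otimes> (b \<otimes> c))" using square_residue_product[OF t two _ bc] by blast
    moreover have "a (\<guillemotleft>2\<guillemotright> \<otimes> (b \<otimes> c)) = 1" using bc two t by simp
    ultimately show False using no im lift[of "\<guillemotleft>2\<guillemotright> \<otimes> (b \<otimes> c)"] bc(1) t by blast
  qed
  have "square_residue (\<guillemotleft>2\<guillemotright> \<otimes> b)" "square_residue (\<guillemotleft>2\<guillemotright> \<otimes> c)"
    using square_residue_mult[OF fin t two b] square_residue_mult[OF fin t two c] n2 nb nc by blast+
  moreover have "a (\<guillemotleft>2\<guillemotright> \<otimes> b) = 1" "a (\<guillemotleft>2\<guillemotright> \<otimes> c) = 1" using two b c t by simp_all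
  ultimately have "approx_sqrt (\<guillemotleft>2\<guillemotright> \<otimes> b)" "approx_sqrt (\<guillemotleft>2\<guillemotright> \<otimes> c)"
    using lift[of "\<guillemotleft>2\<guillemotright> \<otimes> b"] lift[of "\<guillemotleft>2\<guillemotright> \<otimes> c"] b c t by blast+
  moreover have "\<guillemotleft>3\<guillemotright> \<noteq> \<zero>"
  proof
    assume three: "\<guillemotleft>3\<guillemotright> = \<zero>"
    have "\<guillemotleft>2\<guillemotright> = \<guillemotleft>3\<guillemotright> \<oplus> \<ominus> \<one>"
      by (rule ring_identity[where ls="[\<one>]"], (rule reify)+, simp add: in_carrier_def, code_simp)
    then have "\<guillemotleft>2\<guillemotright> = \<ominus> \<one>" unfolding three by simp
    then show False using n2 sm by simp
  qed
  ultimately show False using no im by blast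
qed

text \<open>The hypothesis on \<open>t\<close> excludes a pole of \<open>t\<close> at places above \<open>2\<close>. It holds for integral \<open>t\<close>, and for arbitrary
  \<open>t\<close> in characteristic \<open>p \<noteq> 2\<close>.\<close>

theorem approx_sqrt_cases:
  assumes fin: "finite_residues (carrier K)" and two: "\<guillemotleft>2\<guillemotright> \<noteq> \<zero>"
    and t: "t \<in> carrier K" "a t \<le> 1 \<or> a \<guillemotleft>2\<guillemotright> = 1"
    and b: "b = \<one> \<oplus> \<guillemotleft>16\<guillemotright> \<otimes> (t \<otimes> t)" and c: "c = \<guillemotleft>2\<guillemotright> \<otimes> t"
  shows "approx_sqrt b \<or> approx_sqrt (\<ominus> b) \<or> approx_sqrt c \<or>
      approx_sqrt (\<ominus> \<one>) \<and> (approx_sqrt (\<guillemotleft>2\<guillemotright> \<otimes> (b \<otimes> c)) \<or>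
        approx_sqrt (\<guillemotleft>2\<guillemotright> \<otimes> b) \<and> approx_sqrt (\<guillemotleft>2\<guillemotright> \<otimes> c) \<and> \<guillemotleft>3\<guillemotright> \<noteq> \<zero>)"
proof (cases "a \<guillemotleft>2\<guillemotright> = 1")
  case False
  then have a2: "a \<guillemotleft>2\<guillemotright> < 1" "a t \<le> 1" using abs_of_int_le[of 2] t by auto
  have "b = \<one> \<oplus> \<guillemotleft>4\<guillemotright> \<otimes> ((\<guillemotleft>2\<guillemotright> \<otimes> t) \<otimes> (\<guillemotleft>2\<guillemotright> \<otimes> t))" unfolding b
    by (rule ring_identity[where ls="[t]"], (rule reify)+, simp add: in_carrier_def t, code_simp)
  moreover have "a \<guillemotleft>2\<guillemotright> * a t < 1"
    using mult_left_le[OF a2(2), of "a \<guillemotleft>2\<guillemotright>"] a2(1) by simp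
  then have "a ((\<guillemotleft>2\<guillemotright> \<otimes> t) \<otimes> (\<guillemotleft>2\<guillemotright> \<otimes> t)) < 1"
    using mult_strict_mono'[of "a \<guillemotleft>2\<guillemotright> * a t" 1 "a \<guillemotleft>2\<guillemotright> * a t" 1] t by simp
  ultimately have "approx_sqrt b" using approx_sqrt_one_plus_four t by simp
  then show ?thesis ..
next
  case a2: True
  have "\<guillemotleft>4\<guillemotright> = \<guillemotleft>2\<guillemotright> \<otimes> \<guillemotleft>2\<guillemotright>" "\<guillemotleft>8\<guillemotright> = \<guillemotleft>4\<guillemotright> \<otimes> \<guillemotleft>2\<guillemotright>" "\<guillemotleft>16\<guillemotright> = \<guillemotleft>4\<guillemotright> \<otimes> \<guillemotleft>4\<guillemotright>"
    using of_int_mult[of 2 2] of_int_mult[of 4 2] of_int_mult[of 4 4] by simp_all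
  then have a4: "a \<guillemotleft>4\<guillemotright> = 1" "a \<guillemotleft>8\<guillemotright> = 1" "a \<guillemotleft>16\<guillemotright> = 1" using a2 by simp_all
  have bc: "b \<in> carrier K" "c \<in> carrier K" using t b c by simp_all
  consider "a t < 1" | "1 < a t" | "a t = 1" by linarith
  then show ?thesis
  proof cases
    case 1
    then have "a (\<guillemotleft>16\<guillemotright> \<otimes> (t \<otimes> t)) < 1" using t a4 mult_strict_mono'[of "a t" 1 "a t" 1] by simp
    then show ?thesis using approx_sqrt_one_plus[OF a2, of "\<guillemotleft>16\<guillemotright> \<otimes> (t \<otimes> t)"] t unfolding b by simp
  next
    case 2
    \<comment> \<open>\<open>b = (4 t)^2 (1 + 1 / (4 t)^2)\<close>\<close>
    define w where "w = \<guillemotleft>4\<guillemotright> \<otimes> t"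
    have w: "w \<in> carrier K" "1 < a w" using 2 t a4 by (simp_all add: w_def)
    then have w0: "w \<noteq> \<zero>" by auto
    have i: "inv w \<in> carrier K" "w \<otimes> inv w = \<one>" "a (inv w) < 1" using w w0 by (auto simp: inverse_less_1_iff)
    have "b = \<one> \<oplus> w \<otimes> w" unfolding b w_def
      by (rule ring_identity[where ls="[t]"], (rule reify)+, simp add: in_carrier_def t, code_simp)
    also have "\<dots> = w \<otimes> w \<oplus> (w \<otimes> inv w) \<otimes> (w \<otimes> inv w)" unfolding i(2) using w by (simp add: a_comm)
    also have "\<dots> = w \<otimes> w \<otimes> (\<one> \<oplus> inv w \<otimes> inv w)"
      by (rule ring_identity[where ls="[w, inv w]"], (rule reify)+, simp add: in_carrier_def w i(1), code_simp)
    finally have bw: "b = w \<otimes> w \<otimes> (\<one> \<oplus> inv w \<otimes> inv w)" .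
    have "a (inv w \<otimes> inv w) = a (inv w) * a (inv w)" by (rule abs_mult[OF i(1) i(1)])
    also have "\<dots> < 1" using mult_strict_mono'[of "a (inv w)" 1 "a (inv w)" 1] i(1,3) by (simp del: abs_inv)
    finally have "approx_sqrt (\<one> \<oplus> inv w \<otimes> inv w)" using approx_sqrt_one_plus[OF a2] i(1) by blast
    then have "approx_sqrt b" unfolding bw using approx_sqrt_mult_square[of "\<one> \<oplus> inv w \<otimes> inv w" w] w i(1) by simp
    then show ?thesis ..
  next
    case 3
    have c1: "a c = 1" using t a2 3 by (simp add: c)
    have "a b \<le> 1" unfolding b using ultra[of "\<one>" "\<guillemotleft>16\<guillemotright> \<otimes> (t \<otimes> t)"] t a4 3 by simp
    then consider "a b < 1" | "a b = 1" by linarith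
    then show ?thesis
    proof cases
      case 1
      have "\<guillemotleft>8\<guillemotright> \<otimes> t \<ominus> (\<one> \<oplus> \<guillemotleft>4\<guillemotright> \<otimes> t) \<otimes> (\<one> \<oplus> \<guillemotleft>4\<guillemotright> \<otimes> t) = \<ominus> b" unfolding b
        by (rule ring_identity[where ls="[t]"], (rule reify)+, simp add: in_carrier_def t, code_simp)
      then have "a (\<guillemotleft>8\<guillemotright> \<otimes> t \<ominus> (\<one> \<oplus> \<guillemotleft>4\<guillemotright> \<otimes> t) \<otimes> (\<one> \<oplus> \<guillemotleft>4\<guillemotright> \<otimes> t)) < 1" using 1 bc by simp
      then have s8: "approx_sqrt (\<guillemotleft>8\<guillemotright> \<otimes> t)" 
        using t a4 3 by (intro approx_sqrt_close_to_square[OF a2, of _ "\<one> \<oplus> \<guillemotleft>4\<guillemotright> \<otimes> t"]) simp_all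
      define k where "k = inv \<guillemotleft>2\<guillemotright>"
      have k: "k \<in> carrier K" "k \<otimes> \<guillemotleft>2\<guillemotright> = \<one>" using two field_Units by (auto simp: k_def)
      have "k \<otimes> k \<otimes> (\<guillemotleft>8\<guillemotright> \<otimes> t) = (k \<otimes> \<guillemotleft>2\<guillemotright>) \<otimes> (k \<otimes> \<guillemotleft>2\<guillemotright>) \<otimes> (\<guillemotleft>2\<guillemotright> \<otimes> t)"
        by (rule ring_identity[where ls="[k, t]"], (rule reify)+, simp add: in_carrier_def t k(1), code_simp)
      then have "k \<otimes> k \<otimes> (\<guillemotleft>8\<guillemotright> \<otimes> t) = c" unfolding k(2) c using t by simp
      then have "approx_sqrt c" using approx_sqrt_mult_square[OF s8 _ k(1)] t by simp
      then show ?thesis by blast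
    next
      case 2
      then show ?thesis using approx_sqrt_unit_cases[OF fin a2 bc(1) _ bc(2) c1] by blast
    qed
  qed
qed

end

section \<open>The local-global argument\<close>

theorem (in field) bitangent_local_global_counterexample:
  assumes two: "\<guillemotleft>2\<guillemotright> \<noteq> \<zero>" and t: "t \<in> carrier R"
    and nosq: "\<forall>e\<in>carrier R. e \<otimes> e \<notin>
     {\<one> \<oplus> \<guillemotleft>16\<guillemotright> \<otimes> (t \<otimes> t), \<ominus> (\<one> \<oplus> \<guillemotleft>16\<guillemotright> \<otimes> (t \<otimes> t)), \<guillemotleft>2\<guillemotright> \<otimes> (\<one> \<oplus> \<guillemotleft>16\<guillemotright> \<otimes> (t \<otimes> t)),
      \<guillemotleft>2\<guillemotright> \<otimes> t, \<ominus> (\<guillemotleft>2\<guillemotright> \<otimes> t), (\<one> \<oplus> \<guillemotleft>16\<guillemotright> \<otimes> (t \<otimes> t)) \<otimes> t}"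
    and nonarch: "\<And>a. nonarch_field R a \<Longrightarrow>
      nonarch_field.finite_residues R a (carrier R) \<and> (a t \<le> 1 \<or> a \<guillemotleft>2\<guillemotright> = 1)"
    and arch: "\<And>a s. valued_field R a \<Longrightarrow> 0 < s \<Longrightarrow> \<forall>n\<ge>1. a \<guillemotleft>int n\<guillemotright> = real n powr s \<Longrightarrow>
      \<exists>m. \<one> \<oplus> \<guillemotleft>16\<guillemotright> \<otimes> (t \<otimes> t) = \<guillemotleft>int m\<guillemotright>"
  shows "\<exists>f. smooth_plane_quartic R f \<and>
           (\<forall>v \<in> places R. has_bitangent (completion R v) (to_completion R v \<circ> f)) \<and>
           \<not> has_bitangent R f"
proof -
  define b where "b = \<one> \<oplus> \<guillemotleft>16\<guillemotright> \<otimes> (t \<otimes> t)"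
  define c where "c = \<guillemotleft>2\<guillemotright> \<otimes> t"
  let ?f = "diag_form R 4 (quartic_coeffs R b c)"
  have bc: "b \<in> carrier R" "c \<in> carrier R" using t by (simp_all add: b_def c_def)
  have nosq': "e \<otimes> e \<notin> {b, \<ominus> b, \<guillemotleft>2\<guillemotright> \<otimes> b, c, \<ominus> c, b \<otimes> t}" if "e \<in> carrier R" for e
    using nosq that unfolding b_def c_def by blast
  have b0: "b \<noteq> \<zero>" and c0: "c \<noteq> \<zero>" using nosq'[of \<zero>] by auto
  then have t0: "t \<noteq> \<zero>" by (auto simp: c_def)
  have "smooth_plane_quartic R ?f"
    by (rule smooth_diag[OF two quartic_coeffs_nonzero[OF bc(1) b0 bc(2) c0]])
  moreover have "\<not> has_bitangent R ?f"
    using square_if_has_bitangent[OF two bc(1) b0 t t0] nosq' unfolding c_def by blast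
  moreover have "has_bitangent (completion R v) (to_completion R v \<circ> ?f)" if v: "v \<in> places R" for v
  proof -
    obtain a where "valued_place R a v" using places_cases[OF field_axioms v] .
    then interpret V: valued_place R a v .
    from V.abs_of_int_cases show ?thesis
    proof
      assume bd: "\<forall>n. a \<guillemotleft>int n\<guillemotright> \<le> 1"
      interpret N: nonarch_field R a by unfold_locales (rule V.ultrametric_if_bounded_on_nat[OF bd])
      have "N.finite_residues (carrier R)" "a t \<le> 1 \<or> a \<guillemotleft>2\<guillemotright> = 1" using nonarch[OF N.nonarch_field_axioms] by auto
      from V.completion_has_bitangent[OF two bc(1) b0 bc(2) c0 N.approx_sqrt_cases[OF this(1) two t this(2) b_def c_def]]
      show ?thesis .
    next
      assume "\<exists>s>0. \<forall>n\<ge>1. a \<guillemotleft>int n\<guillemotright> = real n powr s"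
      then obtain s where s: "0 < s" "\<forall>n\<ge>1. a \<guillemotleft>int n\<guillemotright> = real n powr s" by blast
      obtain m where "b = \<guillemotleft>int m\<guillemotright>" using arch[OF V.valued_field_axioms s] unfolding b_def by blast
      then have "V.approx_sqrt b" using V.approx_sqrt_archimedean[OF s(1)] s(2) by simp
      then show ?thesis using V.completion_has_bitangent[OF two bc(1) b0 bc(2) c0] by blast
    qed
  qed
  ultimately show ?thesis by blast
qed

section \<open>Function fields\<close>

context nonarch_field
begin

lemma abs_eval_le_1:
  "a x \<le> 1 \<Longrightarrow> x \<in> carrier K \<Longrightarrow> set cs \<subseteq> {c \<in> carrier K. a c \<le> 1} \<Longrightarrow> a (eval cs x) \<le> 1"
proof (induction cs)
  case (Cons c cs)
  have cl: "c \<in> carrier K" "a c \<le> 1" "eval cs x \<in> carrier K" using Cons.prems by (auto intro!: eval_in_carrier)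
  have "a (c \<otimes> x [^] length cs) \<le> 1"
    using mult_mono[of "a c" 1 "a x ^ length cs" 1] power_le_one[of "a x"] cl Cons.prems by simp
  then show ?case using ultra[of "c \<otimes> x [^] length cs" "eval cs x"] Cons cl by simp
qed simp

text \<open>At a pole of the variable, the leading term of a polynomial dominates.\<close>

lemma abs_eval_less:
  "1 < a x \<Longrightarrow> x \<in> carrier K \<Longrightarrow> set cs \<subseteq> {c \<in> carrier K. a c \<le> 1} \<Longrightarrow> a (eval cs x) < a x ^ length cs"
proof (induction cs)
  case (Cons c cs)
  have cl: "c \<in> carrier K" "a c \<le> 1" "eval cs x \<in> carrier K" using Cons.prems by (auto intro!: eval_in_carrier)
  have pos: "0 < a x ^ length cs" using Cons.prems(1) by simp
  have lt: "a x ^ length cs < a x ^ length (c # cs)" using Cons.prems(1) pos by simp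
  have "a (c \<otimes> x [^] length cs) \<le> 1 * a x ^ length cs"
    using mult_right_mono[OF cl(2), of "a x ^ length cs"] pos cl Cons.prems by simp
  then have "a (c \<otimes> x [^] length cs) < a x ^ length (c # cs)" using lt by linarith
  moreover have "a (eval cs x) < a x ^ length (c # cs)" using Cons lt by auto
  ultimately show ?case using ultra[of "c \<otimes> x [^] length cs" "eval cs x"] cl Cons.prems by simp
qed simp

end

lemma (in valued_field) abs_le_1_if_finitely_many_powers:
  assumes S: "finite S" and x: "x \<in> carrier K" and pow: "\<And>j::nat. x [^] j \<in> S"
  shows "a x \<le> 1"
proof (rule ccontr)
  assume "\<not> a x \<le> 1"
  then obtain j where j: "Max (a ` S) < a x ^ j" using real_arch_pow[of "a x" "Max (a ` S)"] by auto
  have "a (x [^] j) \<le> Max (a ` S)" using S pow by (intro Max_ge) auto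
  then show False using j x by simp
qed

text \<open>A finite extension of the field of rational functions over a finite field \<open>F\<close>.\<close>

locale function_field_extension =
  base_extension K "poly_ring F" Polynomials.degree h + F: field F
  for K :: "('a, 'm) ring_scheme" (structure) and F :: "('c, 'k) ring_scheme" and h +
  assumes finite_constants: "finite (carrier F)"
begin

sublocale C: ring_hom_cring F "poly_ring F" F.poly_of_const
  by (rule F.poly_of_const_ring_hom_cring)

abbreviation const :: "'c \<Rightarrow> 'a" where "const c \<equiv> h (F.poly_of_const c)"

lemma of_int_const: "\<guillemotleft>n\<guillemotright> = const \<guillemotleft>n\<guillemotright>\<^bsub>F\<^esub>"
  by (simp add: C.hom_of_int h.hom_of_int)

text \<open>A nonzero constant and its inverse have only finitely many powers.\<close>

lemma abs_const:
  assumes a: "valued_field K a" and c: "c \<in> carrier F" "c \<noteq> \<zero>\<^bsub>F\<^esub>"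
  shows "a (const c) = 1"
proof -
  interpret A: valued_field K a by (rule a)
  have le: "a (const d) \<le> 1" if d: "d \<in> carrier F" for d
  proof (rule A.abs_le_1_if_finitely_many_powers[of "const ` carrier F"])
    show "const d [^] j \<in> const ` carrier F" for j :: nat
    proof -
      have "const d [^] j = const (d [^]\<^bsub>F\<^esub> j)" using d by (simp add: C.hom_nat_power h.hom_nat_power)
      then show ?thesis using d by blast
    qed
  qed (use d finite_constants in auto)
  have i: "inv\<^bsub>F\<^esub> c \<in> carrier F" "c \<otimes>\<^bsub>F\<^esub> inv\<^bsub>F\<^esub> c = \<one>\<^bsub>F\<^esub>" using c F.field_Units by auto
  have "const c \<otimes> const (inv\<^bsub>F\<^esub> c) = const (c \<otimes>\<^bsub>F\<^esub> inv\<^bsub>F\<^esub> c)"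
    by (simp only: C.hom_mult[OF c(1) i(1)] h.hom_mult[OF C.hom_closed[OF c(1)] C.hom_closed[OF i(1)]])
  also have "\<dots> = \<one>" unfolding i(2) by simp
  finally have "a (const c \<otimes> const (inv\<^bsub>F\<^esub> c)) = 1" by simp
  then have "a (const c) * a (const (inv\<^bsub>F\<^esub> c)) = 1" using c i(1) by simp
  moreover have "a (const c) * a (const (inv\<^bsub>F\<^esub> c)) \<le> a (const c)"
    by (rule mult_left_le[OF le[OF i(1)]]) (use c in simp)
  ultimately show ?thesis using le[OF c(1)] by linarith
qed

lemma abs_of_int_eq_1:
  assumes a: "valued_field K a" and n: "\<guillemotleft>n\<guillemotright> \<noteq> \<zero>"
  shows "a \<guillemotleft>n\<guillemotright> = 1"
proof -
  have "\<guillemotleft>n\<guillemotright>\<^bsub>F\<^esub> \<noteq> \<zero>\<^bsub>F\<^esub>" using n unfolding of_int_const by auto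
  then show ?thesis unfolding of_int_const by (intro abs_const[OF a]) simp_all
qed

text \<open>The homomorphism is determined by the images of the constants and of the variable.\<close>

lemma hom_eq_eval:
  assumes p: "p \<in> carrier (poly_ring F)"
  shows "h p = eval (map const p) (h X\<^bsub>F\<^esub>)"
proof -
  have x: "X\<^bsub>F\<^esub> \<in> carrier (poly_ring F)" by (rule F.var_closed(1)[OF F.carrier_is_subring])
  have *: "set l \<subseteq> carrier F \<Longrightarrow> h (R.eval (map F.poly_of_const l) X\<^bsub>F\<^esub>) = eval (map const l) (h X\<^bsub>F\<^esub>)" for l
  proof (induction l)
    case (Cons c l)
    have "R.eval (map F.poly_of_const l) X\<^bsub>F\<^esub> \<in> carrier (poly_ring F)"
      by (rule R.eval_in_carrier) (use Cons.prems x in auto)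
    then show ?case using Cons x by (simp add: h.hom_nat_power)
  qed simp
  have "set p \<subseteq> carrier F" using F.polynomial_in_carrier[OF F.carrier_is_subring] p by (simp add: univ_poly_carrier)
  then show ?thesis using *[of p] F.eval_rewrite[OF F.carrier_is_subring p] by simp
qed

text \<open>Either the absolute value is at most one on all polynomials, or the variable has a pole. The two cases
  are the finite places and the place at infinity.\<close>

lemma finite_residues_function_field:
  assumes a: "nonarch_field K a"
  shows "nonarch_field.finite_residues K a (carrier K)"
proof -
  interpret A: nonarch_field K a by (rule a)
  interpret E: nonarch_extension K a "poly_ring F" Polynomials.degree h by unfold_locales
  have x: "h X\<^bsub>F\<^esub> \<in> carrier K" using F.var_closed(1)[OF F.carrier_is_subring] by simp
  have coeffs: "set p \<subseteq> carrier F" if "p \<in> carrier (poly_ring F)" for p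
    using F.polynomial_in_carrier[OF F.carrier_is_subring] that by (simp add: univ_poly_carrier)
  have const_le: "a (const c) \<le> 1" if "c \<in> carrier F" for c
    using abs_const[OF A.valued_field_axioms that] by (cases "c = \<zero>\<^bsub>F\<^esub>") auto
  have cs: "set (map const l) \<subseteq> {c \<in> carrier K. a c \<le> 1}" if "set l \<subseteq> carrier F" for l
    using that const_le by auto
  have "A.finite_residues fractions"
  proof (cases "a (h X\<^bsub>F\<^esub>) \<le> 1")
    case True
    show ?thesis
    proof (rule E.finite_residues_fractions_integral)
      show "a (h p) \<le> 1" if "p \<in> carrier (poly_ring F)" for p
        unfolding hom_eq_eval[OF that] by (rule A.abs_eval_le_1[OF True x cs[OF coeffs[OF that]]])
      show "finite {p \<in> carrier (poly_ring F). Polynomials.degree p < n}" for n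
        by (rule finite_subset[OF _ finite_lists_length_le[OF finite_constants, of n]]) (use coeffs in auto)
    qed
  next
    case False
    show ?thesis
    proof (rule E.finite_residues_fractions_leading_terms[OF x])
      show "1 < a (h X\<^bsub>F\<^esub>)" using False by simp
      show "finite (const ` carrier F)" "const ` carrier F \<subseteq> carrier K" using finite_constants by auto
      fix p assume p: "p \<in> carrier (poly_ring F)" "p \<noteq> \<zero>\<^bsub>poly_ring F\<^esub>"
      then obtain c l where cl: "p = c # l" by (cases p) (auto simp: univ_poly_zero)
      have c: "c \<in> carrier F" "c \<noteq> \<zero>\<^bsub>F\<^esub>" "set l \<subseteq> carrier F"
        using p(1) coeffs[OF p(1)] F.lead_coeff_in_carrier[OF F.carrier_is_subring, of c l] unfolding cl by (auto simp: univ_poly_carrier)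
      let ?r = "eval (map const l) (h X\<^bsub>F\<^esub>)"
      have rc: "?r \<in> carrier K" by (rule eval_in_carrier) (use c x in auto)
      have wc: "const c \<otimes> h X\<^bsub>F\<^esub> [^] length l \<in> carrier K" using c x by simp
      have dif: "(u \<oplus> r) \<ominus> u = r" if ur: "u \<in> carrier K" "r \<in> carrier K" for u r
        by (rule ring_identity[where ls="[u, r]"], (rule reify)+, simp add: in_carrier_def ur, code_simp)
      have "h p = const c \<otimes> h X\<^bsub>F\<^esub> [^] length l \<oplus> ?r" using hom_eq_eval[OF p(1)] unfolding cl by simp
      then have "h p \<ominus> const c \<otimes> h X\<^bsub>F\<^esub> [^] length l = ?r" using dif[OF wc rc] by simp
      moreover have "a ?r < a (h X\<^bsub>F\<^esub>) ^ length l"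
        using A.abs_eval_less[OF _ x cs[OF c(3)]] False by simp
      ultimately show "\<exists>n. \<exists>d\<in>const ` carrier F. a d = 1 \<and> a (h p \<ominus> d \<otimes> h X\<^bsub>F\<^esub> [^] n) < a (h X\<^bsub>F\<^esub>) ^ n"
        using abs_const[OF A.valued_field_axioms c(1,2)] c(1)
        by (intro exI[of _ "length l"] bexI[of _ "const c"]) auto
    qed
  qed
  then show ?thesis using exists_dimension A.finite_residues_dimension[OF subfield_fractions] by blast
qed

text \<open>There are no archimedean places: \<open>a 2 = 1\<close> because \<open>2\<close> is a constant.\<close>

theorem function_field_counterexample:
  assumes two: "\<guillemotleft>2\<guillemotright> \<noteq> \<zero>"
  shows "\<exists>f. smooth_plane_quartic K f \<and>
           (\<forall>v \<in> places K. has_bitangent (completion K v) (to_completion K v \<circ> f)) \<and>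
           \<not> has_bitangent K f"
proof -
  have two_R: "\<guillemotleft>2\<guillemotright>\<^bsub>poly_ring F\<^esub> \<noteq> \<zero>\<^bsub>poly_ring F\<^esub>" using two h.hom_of_int[of 2] by auto
  obtain t where t: "t \<in> carrier (poly_ring F)" and nosq: "\<forall>e\<in>carrier K. e \<otimes> e \<notin>
     {\<one> \<oplus> \<guillemotleft>16\<guillemotright> \<otimes> (h t \<otimes> h t), \<ominus> (\<one> \<oplus> \<guillemotleft>16\<guillemotright> \<otimes> (h t \<otimes> h t)), \<guillemotleft>2\<guillemotright> \<otimes> (\<one> \<oplus> \<guillemotleft>16\<guillemotright> \<otimes> (h t \<otimes> h t)),
      \<guillemotleft>2\<guillemotright> \<otimes> h t, \<ominus> (\<guillemotleft>2\<guillemotright> \<otimes> h t), (\<one> \<oplus> \<guillemotleft>16\<guillemotright> \<otimes> (h t \<otimes> h t)) \<otimes> h t}"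
    using exists_parameter[OF two F.poly_ring_candidates[OF two_R]] by blast
  show ?thesis
  proof (rule bitangent_local_global_counterexample[OF two _ nosq])
    show "h t \<in> carrier K" using t by simp
    show "nonarch_field.finite_residues K a (carrier K) \<and> (a (h t) \<le> 1 \<or> a \<guillemotleft>2\<guillemotright> = 1)" if "nonarch_field K a" for a
      using finite_residues_function_field[OF that] abs_of_int_eq_1[OF _ two, of a] that
      by (simp add: nonarch_field_def)
    show "\<exists>m. \<one> \<oplus> \<guillemotleft>16\<guillemotright> \<otimes> (h t \<otimes> h t) = \<guillemotleft>int m\<guillemotright>"
      if a: "valued_field K a" "0 < s" "\<forall>n\<ge>1. a \<guillemotleft>int n\<guillemotright> = real n powr s" for a s
    proof -
      have "a \<guillemotleft>int 2\<guillemotright> = real 2 powr s" using a(3) by (metis one_le_numeral)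
      moreover have "a \<guillemotleft>int 2\<guillemotright> = 1" using abs_of_int_eq_1[OF a(1) two] by simp
      ultimately show ?thesis using a(2) by simp
    qed
  qed
qed

end

section \<open>Global fields\<close>

text \<open>At a nonarchimedean place every integer \<open>t\<close> has \<open>a t \<le> 1\<close>; at an archimedean place \<open>1 + 16 t^2\<close> is a
  positive integer.\<close>

theorem number_field_counterexample:
  assumes nf: "number_field K"
  shows "\<exists>f. smooth_plane_quartic K f \<and>
           (\<forall>v \<in> places K. has_bitangent (completion K v) (to_completion K v \<circ> f)) \<and>
           \<not> has_bitangent K f"
proof -
  interpret E: base_extension K "ring_of_type_algebra :: int ring" "\<lambda>n. nat \<bar>n\<bar>" "of_integer K"
    by (rule number_field_base_extension[OF nf])
  have two: "\<guillemotleft>2\<guillemotright>\<^bsub>K\<^esub> \<noteq> \<zero>\<^bsub>K\<^esub>" using E.h_eq_zero_iff[of 2] by (simp add: type_algebra_simps)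
  obtain t where nosq: "\<forall>e\<in>carrier K. e \<otimes>\<^bsub>K\<^esub> e \<notin>
     {\<one>\<^bsub>K\<^esub> \<oplus>\<^bsub>K\<^esub> \<guillemotleft>16\<guillemotright>\<^bsub>K\<^esub> \<otimes>\<^bsub>K\<^esub> (\<guillemotleft>t\<guillemotright>\<^bsub>K\<^esub> \<otimes>\<^bsub>K\<^esub> \<guillemotleft>t\<guillemotright>\<^bsub>K\<^esub>), \<ominus>\<^bsub>K\<^esub> (\<one>\<^bsub>K\<^esub> \<oplus>\<^bsub>K\<^esub> \<guillemotleft>16\<guillemotright>\<^bsub>K\<^esub> \<otimes>\<^bsub>K\<^esub> (\<guillemotleft>t\<guillemotright>\<^bsub>K\<^esub> \<otimes>\<^bsub>K\<^esub> \<guillemotleft>t\<guillemotright>\<^bsub>K\<^esub>)),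
      \<guillemotleft>2\<guillemotright>\<^bsub>K\<^esub> \<otimes>\<^bsub>K\<^esub> (\<one>\<^bsub>K\<^esub> \<oplus>\<^bsub>K\<^esub> \<guillemotleft>16\<guillemotright>\<^bsub>K\<^esub> \<otimes>\<^bsub>K\<^esub> (\<guillemotleft>t\<guillemotright>\<^bsub>K\<^esub> \<otimes>\<^bsub>K\<^esub> \<guillemotleft>t\<guillemotright>\<^bsub>K\<^esub>)), \<guillemotleft>2\<guillemotright>\<^bsub>K\<^esub> \<otimes>\<^bsub>K\<^esub> \<guillemotleft>t\<guillemotright>\<^bsub>K\<^esub>,
      \<ominus>\<^bsub>K\<^esub> (\<guillemotleft>2\<guillemotright>\<^bsub>K\<^esub> \<otimes>\<^bsub>K\<^esub> \<guillemotleft>t\<guillemotright>\<^bsub>K\<^esub>), (\<one>\<^bsub>K\<^esub> \<oplus>\<^bsub>K\<^esub> \<guillemotleft>16\<guillemotright>\<^bsub>K\<^esub> \<otimes>\<^bsub>K\<^esub> (\<guillemotleft>t\<guillemotright>\<^bsub>K\<^esub> \<otimes>\<^bsub>K\<^esub> \<guillemotleft>t\<guillemotright>\<^bsub>K\<^esub>)) \<otimes>\<^bsub>K\<^esub> \<guillemotleft>t\<guillemotright>\<^bsub>K\<^esub>}"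
    using number_field_exists_parameter[OF nf] by blast
  show ?thesis
  proof (rule E.bitangent_local_global_counterexample[OF two _ nosq])
    show "\<guillemotleft>t\<guillemotright>\<^bsub>K\<^esub> \<in> carrier K" by simp
    show "nonarch_field.finite_residues K a (carrier K) \<and> (a \<guillemotleft>t\<guillemotright>\<^bsub>K\<^esub> \<le> 1 \<or> a \<guillemotleft>2\<guillemotright>\<^bsub>K\<^esub> = 1)" if "nonarch_field K a" for a
      using number_field_finite_residues[OF nf that] nonarch_field.abs_of_int_le[OF that] by simp
    have "0 \<le> t * t" by simp
    then have "int (nat (1 + 16 * (t * t))) = 1 + 16 * (t * t)" by simp
    moreover have "\<guillemotleft>1 + 16 * (t * t)\<guillemotright>\<^bsub>K\<^esub> = \<one>\<^bsub>K\<^esub> \<oplus>\<^bsub>K\<^esub> \<guillemotleft>16\<guillemotright>\<^bsub>K\<^esub> \<otimes>\<^bsub>K\<^esub> (\<guillemotleft>t\<guillemotright>\<^bsub>K\<^esub> \<otimes>\<^bsub>K\<^esub> \<guillemotleft>t\<guillemotright>\<^bsub>K\<^esub>)"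
      by simp
    ultimately have "\<one>\<^bsub>K\<^esub> \<oplus>\<^bsub>K\<^esub> \<guillemotleft>16\<guillemotright>\<^bsub>K\<^esub> \<otimes>\<^bsub>K\<^esub> (\<guillemotleft>t\<guillemotright>\<^bsub>K\<^esub> \<otimes>\<^bsub>K\<^esub> \<guillemotleft>t\<guillemotright>\<^bsub>K\<^esub>) = \<guillemotleft>int (nat (1 + 16 * (t * t)))\<guillemotright>\<^bsub>K\<^esub>" by metis
    then show "\<exists>m. \<one>\<^bsub>K\<^esub> \<oplus>\<^bsub>K\<^esub> \<guillemotleft>16\<guillemotright>\<^bsub>K\<^esub> \<otimes>\<^bsub>K\<^esub> (\<guillemotleft>t\<guillemotright>\<^bsub>K\<^esub> \<otimes>\<^bsub>K\<^esub> \<guillemotleft>t\<guillemotright>\<^bsub>K\<^esub>) = \<guillemotleft>int m\<guillemotright>\<^bsub>K\<^esub>" ..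
  qed
qed

theorem theorem1p1:
  fixes K :: "('a, 'm) ring_scheme"
  assumes "global_field K"
    and "\<one>\<^bsub>K\<^esub> \<oplus>\<^bsub>K\<^esub> \<one>\<^bsub>K\<^esub> \<noteq> \<zero>\<^bsub>K\<^esub>"
  shows "\<exists>f. smooth_plane_quartic K f \<and>
           (\<forall>v \<in> places K. has_bitangent (completion K v) (to_completion K v \<circ> f)) \<and>
           \<not> has_bitangent K f"
proof (cases "number_field K")
  case True
  then show ?thesis by (rule number_field_counterexample)
next
  case False
  then obtain p where p: "Factorial_Ring.prime p" "global_function_field p K" using assms(1) unfolding global_field_def by blast
  let ?F = "residue_ring (int p)"
  interpret F: residues_prime p ?F using p(1) by unfold_locales
  obtain h where h: "field K" "h \<in> ring_hom (poly_ring ?F) K" "inj_on h (carrier (poly_ring ?F))"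
    "ring.finite_dimension K {h a \<otimes>\<^bsub>K\<^esub> inv\<^bsub>K\<^esub> (h b) | a b. a \<in> carrier (poly_ring ?F) \<and>
       b \<in> carrier (poly_ring ?F) - {\<zero>\<^bsub>poly_ring ?F\<^esub>}} (carrier K)"
    using p(2) unfolding global_function_field_def by blast
  have "function_field_extension K ?F h"
    unfolding function_field_extension_def function_field_extension_axioms_def base_extension_def base_extension_axioms_def
    using h domain.univ_poly_is_euclidean[OF field.axioms(1)[OF F.is_field] field.carrier_is_subfield[OF F.is_field]] F.is_field F.finite by simp
  then interpret E: function_field_extension K ?F h .
  have "\<guillemotleft>2\<guillemotright>\<^bsub>K\<^esub> \<noteq> \<zero>\<^bsub>K\<^esub>" using assms(2) by (simp add: E.of_int_2)
  then show ?thesis by (rule E.function_field_counterexample)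
qed

end
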